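(* Let $n\in\mathbb N$, $p_1,p_2\in(1,\infty)$ and $q,s>0$ satisfy $$\frac1q=\frac1{p_1}+\frac1{p_2}-\frac sn.$$ (a) If $s\in(0,2n)$, $0\le\delta<1$ and $\sigma\in BS^{-s}_{1,\delta}(\mathbb R^n)\cup\dot{BS}{}^{-s}_{1,\delta}(\mathbb R^n)$, then $T_\sigma$ is bounded from $L^{p_1}\times L^{p_2}$ into $L^q$. (b) If $s\in(0,n)$, $\theta\in(0,\pi)\setminus\{\pi/2,3\pi/4\}$, $0\le\delta<1$, and $\sigma\in BS^{-s}_{1,\delta;\theta}(\mathbb R^n)\cup\dot{BS}{}^{-s}_{1,\delta;\theta}(\mathbb R^n)$ is of the form $\sigma(x,\xi,\eta)=\sigma_0(x,\xi-\tan(\theta)\,\eta)$ with $\sigma_0\in S^{-s}_{1,\delta}(\mathbb R^n)$ or $\sigma_0\in\dot S^{-s}_{1,\delta}(\mathbb R^n)$ respectively, then $T_\sigma$ is bounded from $L^{p_1}\times L^{p_2}$ into $L^q$.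
   Context: For a symbol $\sigma(x,\xi,\eta)$, $x,\xi,\eta\in\mathbb R^n$, and Schwartz functions $f,g\in\mathcal S(\mathbb R^n)$, $$T_\sigma(f,g)(x)=\int_{\mathbb R^{2n}}e^{ix\cdot(\xi+\eta)}\sigma(x,\xi,\eta)\hat f(\xi)\hat g(\eta)\,d\xi\,d\eta$$ ($\hat{\ }$ is the Fourier transform; normalization immaterial). "Bounded from $L^{p_1}\times L^{p_2}$ into $L^q$" means that there is $C$ with $\|T_\sigma(f,g)\|_{L^q}\le C\|f\|_{L^{p_1}}\|g\|_{L^{p_2}}$ for all $f,g\in\mathcal S(\mathbb R^n)$; here $\|h\|_{L^q}=(\int|h|^q)^{1/q}$ also for $0<q<1$. Symbol classes ($\mu\in\mathbb R$, $0\le\delta\le1$, $\theta\in(0,\pi)$, $\theta\ne\pi/2$): - $BS^\mu_{1,\delta}(\mathbb R^n)$: $\sigma\in C^\infty(\mathbb R^{3n})$ such that for all multi-indices $\alpha,\beta,\gamma$ there is $C_{\alpha,\beta,\gamma}$ with $|\partial_x^\alpha\partial_\xi^\beta\partial_\eta^\gamma\sigma(x,\xi,\eta)|\le C_{\alpha,\beta,\gamma}(1+|\xi|+|\eta|)^{\mu-(|\beta|+|\gamma|)+\delta|\alpha|}$ for all $x,\xi,\eta$. - $BS^\mu_{1,\delta;\theta}(\mathbb R^n)$: same with $1+|\xi|+|\eta|$ replaced by $1+|\xi-\tan(\theta)\eta|$. - $S^\mu_{1,\delta}(\mathbb R^n)$: $\sigma_0\in C^\infty(\mathbb R^{2n})$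 with $|\partial_x^\alpha\partial_\xi^\beta\sigma_0(x,\xi)|\le C_{\alpha,\beta}(1+|\xi|)^{\mu-|\beta|+\delta|\alpha|}$ for all $x,\xi$ and all multi-indices. - The homogeneous classes $\dot{BS}{}^\mu_{1,\delta}$, $\dot{BS}{}^\mu_{1,\delta;\theta}$, $\dot S^\mu_{1,\delta}$ are defined in the same way with $1+|\xi|+|\eta|$, $1+|\xi-\tan(\theta)\eta|$, $1+|\xi|$ replaced by $|\xi|+|\eta|$, $|\xi-\tan(\theta)\eta|$, $|\xi|$ respectively, smoothness and estimates being required at the points where the latter quantity is nonzero. *)

theory Defs
  imports "HOL-Analysis.Analysis"
begin

section \<open>Partial derivatives and smooth functions\<close>

definition dir_deriv :: "'a::real_normed_vector \<Rightarrow> ('a \<Rightarrow> complex) \<Rightarrow> 'a \<Rightarrow> complex"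
  where "dir_deriv v f x = vector_derivative (\<lambda>t. f (x + t *\<^sub>R v)) (at 0)"

text \<open>\<open>C\<^sup>\<infinity>\<close> on an open set \<open>S\<close>: all iterated partial derivatives along the standard
  basis exist and are continuous on \<open>S\<close>.\<close>

definition smooth_on :: "'a::euclidean_space set \<Rightarrow> ('a \<Rightarrow> complex) \<Rightarrow> bool"
  where "smooth_on S f \<longleftrightarrow>
    (\<forall>bs \<in> lists Basis.
      continuous_on S (foldr dir_deriv bs f) \<and>
      (\<forall>x\<in>S. \<forall>b\<in>Basis.
        (\<lambda>t::real. foldr dir_deriv bs f (x + t *\<^sub>R b)) differentiable (at 0)))"

text \<open>A multi-index is a function \<open>\<alpha> :: 'n \<Rightarrow> nat\<close>. The index type carries no order, so some
  enumeration of the coordinates is fixed to order the derivatives; for smooth functions the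
  choice is immaterial.\<close>

definition mi_size :: "('n::finite \<Rightarrow> nat) \<Rightarrow> nat"
  where "mi_size \<alpha> = (\<Sum>i\<in>UNIV. \<alpha> i)"

definition coord_list :: "'n::finite list"
  where "coord_list = (SOME is. distinct is \<and> set is = UNIV)"

lemma coord_list: "distinct (coord_list :: 'n::finite list)" "set (coord_list :: 'n list) = UNIV"
proof -
  have "\<exists>is :: 'n list. distinct is \<and> set is = UNIV"
    using finite_distinct_list[of "UNIV :: 'n set"] by auto
  then have "distinct (coord_list :: 'n list) \<and> set (coord_list :: 'n list) = UNIV"
    unfolding coord_list_def by (rule someI_ex)
  then show "distinct (coord_list :: 'n list)" "set (coord_list :: 'n list) = UNIV" by auto
qed

text \<open>The derivative of multi-index \<open>\<alpha>\<close> where the \<open>i\<close>-th partial derivative is taken in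
  direction \<open>e i\<close>; the family \<open>e\<close> selects the block of variables that is differentiated.\<close>

definition mi_deriv ::
  "('n::finite \<Rightarrow> 'a::real_normed_vector) \<Rightarrow> ('n \<Rightarrow> nat) \<Rightarrow> ('a \<Rightarrow> complex) \<Rightarrow> 'a \<Rightarrow> complex"
  where "mi_deriv e \<alpha> f = foldr (\<lambda>i. dir_deriv (e i) ^^ \<alpha> i) coord_list f"

section \<open>Schwartz functions, Fourier transform, \<open>L\<^sup>q\<close>\<close>

definition schwartz :: "((real^'n) \<Rightarrow> complex) set"
  where "schwartz = {f. smooth_on UNIV f \<and>
    (\<forall>\<alpha> \<beta> :: 'n \<Rightarrow> nat.
      bounded (range (\<lambda>x. (\<Prod>i\<in>UNIV. (x $ i) ^ \<alpha> i) *\<^sub>R mi_deriv (\<lambda>i. axis i 1) \<beta> f x)))}"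

text \<open>Normalized so that \<open>f x = \<integral> e\<^bsup>ix\<cdot>\<xi>\<^esup> fourier f \<xi> d\<xi>\<close> for Schwartz \<open>f\<close>.\<close>

definition fourier :: "((real^'n) \<Rightarrow> complex) \<Rightarrow> (real^'n) \<Rightarrow> complex"
  where "fourier f \<xi> =
    of_real (1 / (2 * pi) ^ CARD('n)) * (\<integral>x. cis (- (x \<bullet> \<xi>)) * f x \<partial>lebesgue)"

definition in_Lq :: "real \<Rightarrow> ((real^'n) \<Rightarrow> complex) \<Rightarrow> bool"
  where "in_Lq q h \<longleftrightarrow>
    h \<in> borel_measurable lebesgue \<and> integrable lebesgue (\<lambda>x. norm (h x) powr q)"

definition Lq_norm :: "real \<Rightarrow> ((real^'n) \<Rightarrow> complex) \<Rightarrow> real"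
  where "Lq_norm q h = (\<integral>x. norm (h x) powr q \<partial>lebesgue) powr (1 / q)"

section \<open>Symbol classes\<close>

text \<open>Estimates and smoothness are imposed where the weight \<open>w\<close> is nonzero. The inhomogeneous
  weights never vanish. For the homogeneous ones, the values of the symbol on the zero set of
  the weight are unconstrained: the symbol is a function on the complement of that set.\<close>

definition lin_symbols ::
  "((real^'n) \<Rightarrow> real) \<Rightarrow> real \<Rightarrow> real \<Rightarrow> (((real^'n) \<times> (real^'n)) \<Rightarrow> complex) set"
  where "lin_symbols w \<mu> \<delta> = {\<sigma>. smooth_on {(x, \<xi>). w \<xi> \<noteq> 0} \<sigma> \<and>
    (\<forall>\<alpha> \<beta> :: 'n \<Rightarrow> nat. \<exists>C. \<forall>x \<xi>. w \<xi> \<noteq> 0 \<longrightarrow>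
      norm (mi_deriv (\<lambda>i. (axis i 1, 0)) \<alpha> (mi_deriv (\<lambda>i. (0, axis i 1)) \<beta> \<sigma>) (x, \<xi>))
        \<le> C * w \<xi> powr (\<mu> - real (mi_size \<beta>) + \<delta> * real (mi_size \<alpha>)))}"

definition bil_symbols ::
  "((real^'n) \<Rightarrow> (real^'n) \<Rightarrow> real) \<Rightarrow> real \<Rightarrow> real
    \<Rightarrow> (((real^'n) \<times> (real^'n) \<times> (real^'n)) \<Rightarrow> complex) set"
  where "bil_symbols w \<mu> \<delta> = {\<sigma>. smooth_on {(x, \<xi>, \<eta>). w \<xi> \<eta> \<noteq> 0} \<sigma> \<and>
    (\<forall>\<alpha> \<beta> \<gamma> :: 'n \<Rightarrow> nat. \<exists>C. \<forall>x \<xi> \<eta>. w \<xi> \<eta> \<noteq> 0 \<longrightarrow>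
      norm (mi_deriv (\<lambda>i. (axis i 1, 0, 0)) \<alpha>
             (mi_deriv (\<lambda>i. (0, axis i 1, 0)) \<beta>
               (mi_deriv (\<lambda>i. (0, 0, axis i 1)) \<gamma> \<sigma>)) (x, \<xi>, \<eta>))
        \<le> C * w \<xi> \<eta> powr (\<mu> - real (mi_size \<beta> + mi_size \<gamma>) + \<delta> * real (mi_size \<alpha>)))}"

definition S_class :: "real \<Rightarrow> real \<Rightarrow> (((real^'n) \<times> (real^'n)) \<Rightarrow> complex) set"
  where "S_class = lin_symbols (\<lambda>\<xi>. 1 + norm \<xi>)"

definition S_hom_class :: "real \<Rightarrow> real \<Rightarrow> (((real^'n) \<times> (real^'n)) \<Rightarrow> complex) set"
  where "S_hom_class = lin_symbols (\<lambda>\<xi>. norm \<xi>)"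

definition BS_class ::
  "real \<Rightarrow> real \<Rightarrow> (((real^'n) \<times> (real^'n) \<times> (real^'n)) \<Rightarrow> complex) set"
  where "BS_class = bil_symbols (\<lambda>\<xi> \<eta>. 1 + norm \<xi> + norm \<eta>)"

definition BS_hom_class ::
  "real \<Rightarrow> real \<Rightarrow> (((real^'n) \<times> (real^'n) \<times> (real^'n)) \<Rightarrow> complex) set"
  where "BS_hom_class = bil_symbols (\<lambda>\<xi> \<eta>. norm \<xi> + norm \<eta>)"

definition BS_theta_class ::
  "real \<Rightarrow> real \<Rightarrow> real \<Rightarrow> (((real^'n) \<times> (real^'n) \<times> (real^'n)) \<Rightarrow> complex) set"
  where "BS_theta_class \<theta> = bil_symbols (\<lambda>\<xi> \<eta>. 1 + norm (\<xi> - tan \<theta> *\<^sub>R \<eta>))"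

definition BS_theta_hom_class ::
  "real \<Rightarrow> real \<Rightarrow> real \<Rightarrow> (((real^'n) \<times> (real^'n) \<times> (real^'n)) \<Rightarrow> complex) set"
  where "BS_theta_hom_class \<theta> = bil_symbols (\<lambda>\<xi> \<eta>. norm (\<xi> - tan \<theta> *\<^sub>R \<eta>))"

section \<open>Bilinear pseudodifferential operators\<close>

definition bil_integrand ::
  "(((real^'n) \<times> (real^'n) \<times> (real^'n)) \<Rightarrow> complex)
    \<Rightarrow> ((real^'n) \<Rightarrow> complex) \<Rightarrow> ((real^'n) \<Rightarrow> complex)
    \<Rightarrow> (real^'n) \<Rightarrow> (real^'n) \<times> (real^'n) \<Rightarrow> complex"
  where "bil_integrand \<sigma> f g x =
    (\<lambda>(\<xi>, \<eta>). cis (x \<bullet> (\<xi> + \<eta>)) * \<sigma> (x, \<xi>, \<eta>) * fourier f \<xi> * fourier g \<eta>)"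

text \<open>Integration is over the completed measure, so that the arbitrary values of a homogeneous
  symbol on a null set cannot affect measurability.\<close>

definition bil_op ::
  "(((real^'n) \<times> (real^'n) \<times> (real^'n)) \<Rightarrow> complex)
    \<Rightarrow> ((real^'n) \<Rightarrow> complex) \<Rightarrow> ((real^'n) \<Rightarrow> complex) \<Rightarrow> (real^'n) \<Rightarrow> complex"
  where "bil_op \<sigma> f g x = (\<integral>z. bil_integrand \<sigma> f g x z \<partial>lebesgue)"

text \<open>Convergence of the defining integral and membership in \<open>L\<^sup>q\<close> are stated explicitly: the
  Bochner integral of a non-integrable function is \<open>0\<close>, so the norm inequality alone could
  hold vacuously.\<close>

definition bil_bounded ::
  "(((real^'n) \<times> (real^'n) \<times> (real^'n)) \<Rightarrow> complex) \<Rightarrow> real \<Rightarrow> real \<Rightarrow> real \<Rightarrow> bool"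
  where "bil_bounded \<sigma> p\<^sub>1 p\<^sub>2 q \<longleftrightarrow>
    (\<exists>C. \<forall>f \<in> schwartz. \<forall>g \<in> schwartz.
      (\<forall>x. integrable lebesgue (bil_integrand \<sigma> f g x)) \<and>
      in_Lq q (bil_op \<sigma> f g) \<and>
      Lq_norm q (bil_op \<sigma> f g) \<le> C * Lq_norm p\<^sub>1 f * Lq_norm p\<^sub>2 g)"

end

theory Submission
  imports Defs "HOL-Probability.Characteristic_Functions" "HOL-Library.Nat_Bijection"
begin

text \<open>
  Only the estimates with no \<open>x\<close>-derivatives matter: \<open>\<sigma>(x, \<cdot>)\<close> is, uniformly in \<open>x\<close>, a multiplier of
  order \<open>-s\<close>. Since \<open>s > 0\<close>, its inverse Fourier transform is a function dominated by \<open>|y|\<^bsup>s-N\<^esup>\<close>, with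
  \<open>N = 2n\<close> in the first part and, after the substitution \<open>\<xi> = \<zeta> + tan \<theta> \<eta>\<close> and Fourier inversion
  in \<open>\<eta>\<close>, \<open>N = n\<close> in the second. Hence \<open>T\<^sub>\<sigma>(f, g)\<close> is dominated pointwise by
  \<open>\<integral> |(y, z)|\<^bsup>s-2n\<^esup> |f(x - y) g(x - z)| d(y, z)\<close>, respectively
  \<open>\<integral> |y|\<^bsup>s-n\<^esup> |f(x - y) g(x + tan \<theta> y)| dy\<close>.

  The former is at most a product of two Riesz potentials because
  \<open>|(y, z)|\<^bsup>-a-b\<^esup> \<le> |y|\<^bsup>-a\<^esup> |z|\<^bsup>-b\<^esup>\<close>, so the Hardy-Littlewood-Sobolev inequality applies. The
  latter is the bilinear fractional integral of Grafakos and Kenig-Stein. For \<open>q \<le> 1\<close> it is estimated by splitting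
  the kernel into dyadic shells and localizing to balls of the same scale, for \<open>1/p\<^sub>1 + 1/p\<^sub>2 < 1\<close> by
  Hoelder's inequality and Hardy-Littlewood-Sobolev, and in between by interpolation; the condition
  \<open>tan \<theta> \<noteq> -1\<close> makes \<open>(x, y) \<mapsto> (x - y, x + tan \<theta> y)\<close> invertible.
\<close>

subsection \<open>Integrals over Euclidean space\<close>

text \<open>The Fourier integral of a symbol of order -s does not converge absolutely, so the kernel
  of the symbol itself is never constructed. The symbol is multiplied by a cutoff depending on
  \<epsilon>, its pairing with the transform of an integrable function is estimated with constants
  free of \<epsilon>, and dominated convergence removes the cutoff. Integration by parts is replaced
  by finite differences, which need derivatives along one coordinate direction only: for each y a
  coordinate of size at least |y| over the dimension serves. Hence \<open>dir_symbol\<close> tracks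
  a single direction.

  The obstacle in the second part is q < 1, where the triangle inequality and duality are lost. At a
  single dyadic scale the bilinear integral is local, so an L^1 bound on balls becomes an L^q bound
  by Hoelder, and the scales are added by subadditivity of t^q. At each scale the averages obey two
  bounds, by the maximal function and by the norm, with opposite growth in the scale, so the sum
  over scales costs no more than its value at the crossing point. The same device gives the linear
  Hardy-Littlewood-Sobolev inequality.\<close>

text \<open>Dividing by the bounds \<open>a\<close> and \<open>b\<close> reduces the claim to the
  weighted arithmetic-geometric inequality, whose integral is at most \<open>l + (1 - l)\<close>.
  Upper bounds in place of the integrals keep \<open>a\<close> and \<open>b\<close> finite; the
  endpoints \<open>l = 0\<close> and \<open>l = 1\<close> are included.\<close>

lemma nn_integral_Holder:
  fixes f g :: "'a \<Rightarrow> real"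
  assumes [measurable]: "f \<in> borel_measurable M" "g \<in> borel_measurable M"
    and f: "\<And>x. 0 \<le> f x" and g: "\<And>x. 0 \<le> g x" and l: "0 \<le> l" "l \<le> 1"
    and a: "(\<integral>\<^sup>+x. f x \<partial>M) \<le> ennreal a" "0 \<le> a"
    and b: "(\<integral>\<^sup>+x. g x \<partial>M) \<le> ennreal b" "0 \<le> b"
  shows "(\<integral>\<^sup>+x. f x powr l * g x powr (1 - l) \<partial>M) \<le> ennreal (a powr l * b powr (1 - l))"
proof (cases "a = 0 \<or> b = 0")
  case True
  then have "AE x in M. f x = 0 \<or> g x = 0"
  proof
    assume "a = 0"
    then have "(\<integral>\<^sup>+x. f x \<partial>M) = 0" using a by simp
    then have "AE x in M. ennreal (f x) = 0" by (subst (asm) nn_integral_0_iff_AE) auto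
    then show ?thesis using f by (auto elim!: eventually_mono simp: order.antisym)
  next
    assume "b = 0"
    then have "(\<integral>\<^sup>+x. g x \<partial>M) = 0" using b by simp
    then have "AE x in M. ennreal (g x) = 0" by (subst (asm) nn_integral_0_iff_AE) auto
    then show ?thesis using g by (auto elim!: eventually_mono simp: order.antisym)
  qed
  \<comment> \<open>\<open>0 powr l\<close> is 0 also for \<open>l = 0\<close>, so the product
    vanishes wherever one factor does.\<close>
  then have "(\<integral>\<^sup>+x. f x powr l * g x powr (1 - l) \<partial>M) = (\<integral>\<^sup>+x. 0 \<partial>M)"
    by (intro nn_integral_cong_AE) (auto elim!: eventually_mono)
  then show ?thesis by simp
next
  case False
  then have ab: "0 < a" "0 < b" using a b by auto
  have *: "f x powr l * g x powr (1 - l)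
      \<le> a powr l * b powr (1 - l) * (l / a * f x + (1 - l) / b * g x)" for x
  proof -
    have "(f x / a) powr l * (g x / b) powr (1 - l) \<le> l * (f x / a) + (1 - l) * (g x / b)"
    proof (cases "f x = 0 \<or> g x = 0")
      case True
      then show ?thesis using l ab f[of x] g[of x] by auto
    next
      case False
      then have "0 < f x" "0 < g x" using f[of x] g[of x] by auto
      then show ?thesis using Youngs_inequality_0[of l "1 - l" "f x / a" "g x / b"] l ab by auto
    qed
    also have "(f x / a) powr l * (g x / b) powr (1 - l)
        = f x powr l * g x powr (1 - l) / (a powr l * b powr (1 - l))"
      using f[of x] g[of x] ab by (simp add: powr_divide)
    finally show ?thesis using ab by (simp add: field_simps)
  qed
  have "(\<integral>\<^sup>+x. f x powr l * g x powr (1 - l) \<partial>M)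
     \<le> (\<integral>\<^sup>+x. ennreal (a powr l * b powr (1 - l)) *
          (ennreal (l / a) * ennreal (f x) + ennreal ((1 - l) / b) * ennreal (g x)) \<partial>M)"
    using * f g l ab
    by (intro nn_integral_mono) (simp add: ennreal_mult[symmetric] ennreal_plus[symmetric] del: ennreal_plus)
  also have "\<dots> = ennreal (a powr l * b powr (1 - l)) *
      (ennreal (l / a) * (\<integral>\<^sup>+x. f x \<partial>M) + ennreal ((1 - l) / b) * (\<integral>\<^sup>+x. g x \<partial>M))"
    by (simp add: nn_integral_cmult nn_integral_add)
  also have "\<dots> \<le> ennreal (a powr l * b powr (1 - l)) *
      (ennreal (l / a) * ennreal a + ennreal ((1 - l) / b) * ennreal b)"
    using a b by (intro mult_left_mono add_mono) auto
  also have "\<dots> = ennreal (a powr l * b powr (1 - l))"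
    using ab l by (simp add: ennreal_mult[symmetric] ennreal_plus[symmetric] del: ennreal_plus)
  finally show ?thesis .
qed

section \<open>Volumes of balls and integrals of power weights\<close>

lemma unit_vol_pos: "0 < measure lborel (ball (0::'a::euclidean_space) 1)"
  using content_ball_pos[of 1 "0::'a"] by simp

lemma emeasure_lborel_ball:
  fixes x :: "'a::euclidean_space"
  assumes "0 \<le> r"
  shows "emeasure lborel (ball x r) = ennreal (r ^ DIM('a) * measure lborel (ball (0::'a) 1))"
proof -
  have "emeasure lborel (ball x r) = ennreal (measure lborel (ball x r))"
    using emeasure_lborel_ball_finite[of x r] by (simp add: emeasure_eq_ennreal_measure top.not_eq_extremum)
  then show ?thesis using content_ball_conv_unit_ball[OF assms, of x] by simp
qed

lemma suminf_ennreal_le: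
  fixes f :: "nat \<Rightarrow> real"
  assumes "\<And>n. 0 \<le> f n" "\<And>I. finite I \<Longrightarrow> sum f I \<le> C"
  shows "(\<Sum>n. ennreal (f n)) \<le> ennreal C"
  by (rule suminf_le_const) (use assms in \<open>auto simp: ennreal_leI\<close>)

lemma suminf_geometric_ennreal:
  fixes r :: real assumes "0 \<le> r" "r < 1"
  shows "(\<Sum>n. ennreal (r ^ n)) = ennreal (1 / (1 - r))"
  using assms by (subst suminf_ennreal2) (auto simp: suminf_geometric summable_geometric)

lemma powr_le_two_powr_abs:
  fixes u c :: real
  assumes "1 / 2 \<le> u" "u \<le> 1"
  shows "u powr c \<le> 2 powr \<bar>c\<bar>"
proof (cases "0 \<le> c")
  case True
  then have "u powr c \<le> 1 powr c" using assms by (intro powr_mono2) auto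
  also have "\<dots> \<le> 2 powr \<bar>c\<bar>" by (simp add: ge_one_powr_ge_zero)
  finally show ?thesis .
next
  case False
  have "u powr c = (1 / u) powr (- c)" using assms by (simp add: powr_minus powr_divide)
  also have "\<dots> \<le> 2 powr (- c)" using assms False by (intro powr_mono2) (auto simp: field_simps)
  finally show ?thesis using False by simp
qed

text \<open>On a dyadic shell the weight is comparable to its value at the outer radius;
  \<open>\<bar>c\<bar>\<close> covers both signs of the exponent.\<close>

lemma powr_le_dyadic:
  fixes r \<rho> c :: real
  assumes "\<rho> / 2 \<le> r" "r \<le> \<rho>" "0 < \<rho>"
  shows "r powr c \<le> 2 powr \<bar>c\<bar> * \<rho> powr c"
proof -
  have "r powr c = (r / \<rho>) powr c * \<rho> powr c" using assms by (simp add: powr_divide)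
  also have "\<dots> \<le> 2 powr \<bar>c\<bar> * \<rho> powr c"
    using assms by (intro mult_right_mono powr_le_two_powr_abs) (auto simp: field_simps)
  finally show ?thesis .
qed

lemma term_le_suminf_ennreal: "f j \<le> suminf (f :: nat \<Rightarrow> ennreal)"
proof -
  have "sum f {j} \<le> suminf f" by (rule sum_le_suminf) auto
  then show ?thesis by simp
qed

text \<open>On the shell of outer radius \<open>\<rho> j\<close> the weight is at most a constant
  times \<open>\<rho> j powr c\<close>, and the shell is replaced by the whole ball, whose volume is
  explicit; polar coordinates are avoided. The radii stay abstract because they shrink for integrals
  near the origin and grow for tails.\<close>

lemma nn_integral_norm_powr_shells:
  fixes S :: "'a::euclidean_space set" and \<rho> :: "nat \<Rightarrow> real"
  assumes \<rho>: "\<And>j. 0 < \<rho> j" and S: "\<And>y. y \<in> S \<Longrightarrow> y \<noteq> 0 \<Longrightarrow> \<exists>j. \<rho> j / 2 \<le> norm y \<and> norm y < \<rho> j"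
  shows "(\<integral>\<^sup>+y. ennreal (norm y powr c) * indicator S y \<partial>lborel)
    \<le> (\<Sum>j. ennreal (2 powr \<bar>c\<bar> * measure lborel (ball (0::'a) 1) * \<rho> j powr (c + real DIM('a))))"
proof -
  define h where "h j y = ennreal (2 powr \<bar>c\<bar> * \<rho> j powr c) * indicator (ball (0::'a) (\<rho> j)) y" for j y
  have meas: "(\<lambda>y. h j y) \<in> borel_measurable lborel" for j
    unfolding h_def by (intro borel_measurable_times_ennreal borel_measurable_indicator measurable_const) auto
  have *: "ennreal (norm y powr c) * indicator S y \<le> (\<Sum>j. h j y)" for y
  proof (cases "y \<in> S \<and> y \<noteq> 0")
    case True
    then obtain j where j: "\<rho> j / 2 \<le> norm y" "norm y < \<rho> j" using S[of y] True by blast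
    then have "norm y powr c \<le> 2 powr \<bar>c\<bar> * \<rho> j powr c"
      using \<rho>[of j] by (intro powr_le_dyadic) auto
    then have "ennreal (norm y powr c) * indicator S y \<le> h j y"
      using True j by (simp add: h_def ennreal_leI)
    also have "h j y \<le> (\<Sum>j. h j y)"
      by (rule term_le_suminf_ennreal[of "\<lambda>j. h j y"])
    finally show ?thesis .
  next
    \<comment> \<open>At \<open>y = 0\<close> the weight is \<open>0 powr c = 0\<close> for every
      \<open>c\<close>, so the singular point costs nothing.\<close>
    case False
    then show ?thesis by (auto simp: indicator_def)
  qed
  have "(\<integral>\<^sup>+y. ennreal (norm y powr c) * indicator S y \<partial>lborel) \<le> (\<integral>\<^sup>+y. (\<Sum>j. h j y) \<partial>lborel)"
    by (rule nn_integral_mono) (rule *)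
  also have "\<dots> = (\<Sum>j. \<integral>\<^sup>+y. h j y \<partial>lborel)"
    by (rule nn_integral_suminf) (rule meas)
  also have "(\<lambda>j. \<integral>\<^sup>+y. h j y \<partial>lborel)
    = (\<lambda>j. ennreal (2 powr \<bar>c\<bar> * measure lborel (ball (0::'a) 1) * \<rho> j powr (c + real DIM('a))))"
  proof
    fix j
    have "(\<integral>\<^sup>+y. h j y \<partial>lborel) = ennreal (2 powr \<bar>c\<bar> * \<rho> j powr c) * emeasure lborel (ball (0::'a) (\<rho> j))"
      unfolding h_def by (subst nn_integral_cmult_indicator) auto
    also have "emeasure lborel (ball (0::'a) (\<rho> j))
        = ennreal (\<rho> j powr real DIM('a) * measure lborel (ball (0::'a) 1))"
      using \<rho>[of j] by (simp add: emeasure_lborel_ball powr_realpow)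
    also have "ennreal (2 powr \<bar>c\<bar> * \<rho> j powr c) * \<dots>
        = ennreal (2 powr \<bar>c\<bar> * \<rho> j powr c * (\<rho> j powr real DIM('a) * measure lborel (ball (0::'a) 1)))"
      by (simp add: ennreal_mult)
    also have "2 powr \<bar>c\<bar> * \<rho> j powr c * (\<rho> j powr real DIM('a) * measure lborel (ball (0::'a) 1))
       = 2 powr \<bar>c\<bar> * measure lborel (ball (0::'a) 1) * \<rho> j powr (c + real DIM('a))"
      by (simp add: powr_add)
    finally show "(\<integral>\<^sup>+y. h j y \<partial>lborel)
       = ennreal (2 powr \<bar>c\<bar> * measure lborel (ball (0::'a) 1) * \<rho> j powr (c + real DIM('a)))" .
  qed
  finally show ?thesis .
qed

lemma suminf_geometric_powr:
  fixes K d :: real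
  assumes "0 < d" "0 \<le> K"
  shows "(\<Sum>j. ennreal (K * 2 powr (- (d * real j)))) = ennreal (K / (1 - 2 powr (- d)))"
proof -
  define r :: real where "r = 2 powr (- d)"
  have r: "0 \<le> r" "r < 1" using assms by (auto simp: r_def powr_less_one)
  have eq: "ennreal (K * 2 powr (- (d * real j))) = ennreal K * ennreal (r ^ j)" for j
  proof -
    have "r ^ j = 2 powr (- (d * real j))"
      by (simp add: r_def powr_powr powr_realpow[symmetric])
    then show ?thesis using assms r by (simp add: ennreal_mult)
  qed
  show ?thesis
    unfolding eq ennreal_suminf_cmult suminf_geometric_ennreal[OF r]
    using assms r by (simp add: ennreal_mult[symmetric] r_def)
qed

text \<open>Radii halving inwards from \<open>R\<close> and doubling outwards from \<open>R\<close>;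
  both give a geometric series of ratio \<open>2 powr (- d)\<close>.\<close>

lemma suminf_dyadic_powr:
  fixes R d K :: real
  assumes "0 < R" "0 < d" "0 \<le> K"
  shows "(\<Sum>j. ennreal (K * (R * 2 powr (- real j)) powr d)) = ennreal (K * R powr d / (1 - 2 powr (- d)))"
    and "(\<Sum>j. ennreal (K * (R * 2 powr (real j + 1)) powr (- d)))
        = ennreal (K * 2 powr (- d) * R powr (- d) / (1 - 2 powr (- d)))"
proof -
  have 1: "K * (R * 2 powr (- real j)) powr d = (K * R powr d) * 2 powr (- (d * real j))" for j
    using assms by (simp add: powr_mult powr_powr mult_ac)
  have 2: "K * (R * 2 powr (real j + 1)) powr (- d)
      = (K * 2 powr (- d) * R powr (- d)) * 2 powr (- (d * real j))" for j
    using assms by (simp add: powr_mult powr_powr powr_add[symmetric] algebra_simps)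
  show "(\<Sum>j. ennreal (K * (R * 2 powr (- real j)) powr d)) = ennreal (K * R powr d / (1 - 2 powr (- d)))"
    unfolding 1 by (rule suminf_geometric_powr) (use assms in auto)
  show "(\<Sum>j. ennreal (K * (R * 2 powr (real j + 1)) powr (- d)))
        = ennreal (K * 2 powr (- d) * R powr (- d) / (1 - 2 powr (- d)))"
    unfolding 2 by (rule suminf_geometric_powr) (use assms in auto)
qed

lemma nn_integral_norm_powr_ball:
  assumes "- real DIM('a::euclidean_space) < c"
  shows "\<exists>C\<ge>0. \<forall>R>0. (\<integral>\<^sup>+y. ennreal (norm (y::'a) powr c) * indicator (ball 0 R) y \<partial>lborel)
           \<le> ennreal (C * R powr (c + real DIM('a)))"
proof -
  define K where "K = 2 powr \<bar>c\<bar> * measure lborel (ball (0::'a) 1)"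
  define d where "d = c + real DIM('a)"
  have d: "0 < d" "0 \<le> K" using assms unit_vol_pos[where 'a='a] by (auto simp: d_def K_def)
  have r: "0 \<le> 2 powr (- d)" "2 powr (- d) < 1" using d by (auto simp: powr_less_one)
  have "(\<integral>\<^sup>+y. ennreal (norm (y::'a) powr c) * indicator (ball 0 R) y \<partial>lborel)
           \<le> ennreal (K / (1 - 2 powr (- d)) * R powr d)" if R: "0 < R" for R
  proof -
    have "(\<integral>\<^sup>+y. ennreal (norm (y::'a) powr c) * indicator (ball 0 R) y \<partial>lborel)
      \<le> (\<Sum>j. ennreal (K * (R * 2 powr (- real j)) powr d))"
      unfolding K_def d_def
    proof (rule nn_integral_norm_powr_shells)
      fix y :: 'a assume y: "y \<in> ball 0 R" "y \<noteq> 0"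
      \<comment> \<open>The ceiling minus one puts \<open>y\<close> into the shell that is closed
        inside and open outside; \<open>norm y < R\<close> makes the logarithm positive, so
        \<open>nat\<close> loses nothing.\<close>
      define j where "j = nat (\<lceil>log 2 (R / norm y)\<rceil> - 1)"
      have lg: "0 < log 2 (R / norm y)" using y R by simp
      then have j1: "real j < log 2 (R / norm y)" "log 2 (R / norm y) \<le> real j + 1"
        unfolding j_def by linarith+
      have j2: "2 powr real j < R / norm y" "R / norm y \<le> 2 powr (real j + 1)"
        using j1 y R by (auto simp: less_log_iff log_le_iff)
      have "R * 2 powr (- real j) / 2 \<le> norm y"
        using j2(2) y by (simp add: powr_minus powr_add field_simps)
      moreover have "norm y < R * 2 powr (- real j)"
        using j2(1) y by (simp add: powr_minus field_simps)
      ultimately show "\<exists>j. R * 2 powr (- real j) / 2 \<le> norm y \<and> norm y < R * 2 powr (- real j)" by blast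
    qed (use R in auto)
    then show ?thesis using suminf_dyadic_powr(1)[OF R d] by simp
  qed
  then show ?thesis using d r unfolding d_def[symmetric] by (intro exI[of _ "K / (1 - 2 powr (- d))"]) auto
qed

lemma nn_integral_norm_powr_tail:
  assumes "c < - real DIM('a::euclidean_space)"
  shows "\<exists>C\<ge>0. \<forall>R>0. (\<integral>\<^sup>+y. ennreal (norm (y::'a) powr c) * indicator (- ball 0 R) y \<partial>lborel)
           \<le> ennreal (C * R powr (c + real DIM('a)))"
proof -
  define K where "K = 2 powr \<bar>c\<bar> * measure lborel (ball (0::'a) 1)"
  define d where "d = - (c + real DIM('a))"
  have d: "0 < d" "0 \<le> K" using assms unit_vol_pos[where 'a='a] by (auto simp: d_def K_def)
  have r: "0 \<le> 2 powr (- d)" "2 powr (- d) < 1" using d by (auto simp: powr_less_one)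
  have "(\<integral>\<^sup>+y. ennreal (norm (y::'a) powr c) * indicator (- ball 0 R) y \<partial>lborel)
           \<le> ennreal (K * 2 powr (- d) / (1 - 2 powr (- d)) * R powr (- d))" if R: "0 < R" for R
  proof -
    have "(\<integral>\<^sup>+y. ennreal (norm (y::'a) powr c) * indicator (- ball 0 R) y \<partial>lborel)
      \<le> (\<Sum>j. ennreal (K * (R * 2 powr (real j + 1)) powr (- d)))"
      unfolding K_def d_def minus_minus
    proof (rule nn_integral_norm_powr_shells)
      fix y :: 'a assume y: "y \<in> - ball 0 R" "y \<noteq> 0"
      \<comment> \<open>The floor gives the shell of outer radius \<open>R * 2 powr (j + 1)\<close>;
        its inner boundary belongs to it, in accordance with the closed exterior of the
        ball.\<close>
      define j where "j = nat (\<lfloor>log 2 (norm y / R)\<rfloor>)"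
      have lg: "0 \<le> log 2 (norm y / R)" using y R by (simp add: zero_le_log_cancel_iff)
      then have j1: "real j \<le> log 2 (norm y / R)" "log 2 (norm y / R) < real j + 1"
        unfolding j_def by linarith+
      have j2: "2 powr real j \<le> norm y / R" "norm y / R < 2 powr (real j + 1)"
        using j1 y R by (auto simp: le_log_iff log_less_iff)
      have "R * 2 powr (real j + 1) / 2 \<le> norm y"
        using j2(1) R by (simp add: powr_add field_simps)
      moreover have "norm y < R * 2 powr (real j + 1)"
        using j2(2) R by (simp add: field_simps)
      ultimately show "\<exists>j. R * 2 powr (real j + 1) / 2 \<le> norm y \<and> norm y < R * 2 powr (real j + 1)" by blast
    qed (use R in auto)
    then show ?thesis using suminf_dyadic_powr(2)[OF R d] by simp
  qed
  moreover have "c + real DIM('a) = - d" by (simp add: d_def)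
  ultimately show ?thesis using d r by (intro exI[of _ "K * 2 powr (- d) / (1 - 2 powr (- d))"]) auto
qed

section \<open>Affine substitutions\<close>

lemma nn_integral_lborel_affine:
  fixes f :: "'a::euclidean_space \<Rightarrow> ennreal"
  assumes [measurable]: "f \<in> borel_measurable borel" and "c \<noteq> 0"
  shows "(\<integral>\<^sup>+x. f x \<partial>lborel) = ennreal (\<bar>c\<bar> ^ DIM('a)) * (\<integral>\<^sup>+x. f (t + c *\<^sub>R x) \<partial>lborel)"
  by (subst lborel_affine[OF assms(2), of t])
     (simp add: nn_integral_density nn_integral_distr nn_integral_cmult)

lemma nn_integral_lborel_minus:
  fixes f :: "'a::euclidean_space \<Rightarrow> ennreal"
  assumes [measurable]: "f \<in> borel_measurable borel"
  shows "(\<integral>\<^sup>+x. f (t - x) \<partial>lborel) = (\<integral>\<^sup>+x. f x \<partial>lborel)"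
  using nn_integral_lborel_affine[of f "-1" t] by simp

lemma nn_integral_lborel_shift:
  fixes f :: "'a::euclidean_space \<Rightarrow> ennreal"
  assumes [measurable]: "f \<in> borel_measurable borel"
  shows "(\<integral>\<^sup>+x. f (t + x) \<partial>lborel) = (\<integral>\<^sup>+x. f x \<partial>lborel)"
  using nn_integral_lborel_affine[of f 1 t] by simp

lemma integral_lborel_affine:
  fixes f :: "'a::euclidean_space \<Rightarrow> complex"
  assumes [measurable]: "f \<in> borel_measurable borel" and "c \<noteq> 0"
  shows "(\<integral>x. f x \<partial>lborel) = (\<bar>c\<bar> ^ DIM('a)) *\<^sub>R (\<integral>x. f (t + c *\<^sub>R x) \<partial>lborel)"
  by (subst lborel_affine[OF assms(2), of t])
     (simp add: integral_density integral_distr)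

lemma integrable_lborel_affine:
  fixes f :: "'a::euclidean_space \<Rightarrow> complex"
  assumes "integrable lborel f" and "c \<noteq> 0"
  shows "integrable lborel (\<lambda>x. f (t + c *\<^sub>R x))"
  using assms assms(1)[THEN borel_measurable_integrable] unfolding integrable_iff_bounded
  by (subst (asm) nn_integral_lborel_affine[where c=c and t=t]) (auto simp: ennreal_mult_less_top)

lemma measurable_indicator_ball [measurable (raw)]:
  assumes "f \<in> M \<rightarrow>\<^sub>M borel"
  shows "(\<lambda>x. indicator (ball (0::'a::euclidean_space) r) (f x) :: ennreal) \<in> borel_measurable M"
  by (rule measurable_compose[OF assms borel_measurable_indicator]) simp

subsection \<open>The maximal function\<close>

text \<open>Radii are powers of 2, so the supremum over scales is countable and measurable. The
  normalization is by a power of the radius and not by the volume: a constant \<open>c\<close> has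
  average \<open>c\<close> times the volume of the unit ball, which accounts for the
  \<open>w\<close> in later constants.\<close>

definition ball_avg :: "int \<Rightarrow> ('a::euclidean_space \<Rightarrow> real) \<Rightarrow> 'a \<Rightarrow> ennreal"
  where "ball_avg k u x = ennreal (2 powr (- (real_of_int k * real DIM('a)))) *
    (\<integral>\<^sup>+y. ennreal (u y) * indicator (ball 0 (2 powr real_of_int k)) (x - y) \<partial>lborel)"

definition maximal :: "('a::euclidean_space \<Rightarrow> real) \<Rightarrow> 'a \<Rightarrow> ennreal"
  where "maximal u x = (SUP k. ball_avg k u x)"

text \<open>Boundedness makes the maximal function finite everywhere, so that passing to reals with
  \<open>enn2real\<close> is faithful.\<close>

definition bdd_borel :: "('a::euclidean_space \<Rightarrow> real) \<Rightarrow> bool"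
  where "bdd_borel u \<longleftrightarrow> u \<in> borel_measurable borel \<and> (\<forall>x. 0 \<le> u x) \<and> (\<exists>B. \<forall>x. u x \<le> B)"

lemma ball_avg_le_maximal: "ball_avg k u x \<le> maximal u x"
  unfolding maximal_def by (rule SUP_upper) simp

lemma ball_avg_measurable [measurable]:
  assumes [measurable]: "u \<in> borel_measurable borel"
  shows "ball_avg k u \<in> borel_measurable borel"
proof -
  have "(\<lambda>x. ball_avg k u x) \<in> borel_measurable borel"
    unfolding ball_avg_def by measurable
  then show ?thesis by simp
qed

lemma maximal_measurable [measurable]:
  assumes [measurable]: "u \<in> borel_measurable borel"
  shows "maximal u \<in> borel_measurable borel"
proof -
  have "(\<lambda>x. maximal u x) \<in> borel_measurable borel"
    unfolding maximal_def by (intro borel_measurable_SUP) auto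
  then show ?thesis by simp
qed

lemma nn_integral_indicator_ball_minus:
  "(\<integral>\<^sup>+y. indicator (ball (0::'a::euclidean_space) r) (x - y) \<partial>lborel) = emeasure lborel (ball (0::'a) r)"
proof -
  have "(\<integral>\<^sup>+y. indicator (ball (0::'a) r) (x - y) \<partial>lborel) = (\<integral>\<^sup>+y. indicator (ball (0::'a) r) y \<partial>lborel)"
    by (rule nn_integral_lborel_minus) (rule borel_measurable_indicator, simp)
  then show ?thesis by simp
qed

lemma ball_avg_const:
  "ball_avg k (\<lambda>_. c) (x::'a::euclidean_space) = ennreal c * ennreal (measure lborel (ball (0::'a) 1))"
proof -
  have "(2 powr real_of_int k) ^ DIM('a) = 2 powr (real_of_int k * real DIM('a))"
    by (simp add: powr_powr powr_realpow[symmetric])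
  then have "ball_avg k (\<lambda>_. c) x = ennreal (2 powr (- (real_of_int k * real DIM('a)))) *
     (ennreal c * ennreal (2 powr (real_of_int k * real DIM('a)) * measure lborel (ball (0::'a) 1)))"
    unfolding ball_avg_def
    by (subst nn_integral_cmult) (auto simp: nn_integral_indicator_ball_minus emeasure_lborel_ball)
  also have "\<dots> = ennreal c * (ennreal (2 powr (- (real_of_int k * real DIM('a)))) *
       ennreal (2 powr (real_of_int k * real DIM('a)) * measure lborel (ball (0::'a) 1)))"
    by (simp add: mult_ac)
  also have "ennreal (2 powr (- (real_of_int k * real DIM('a)))) *
       ennreal (2 powr (real_of_int k * real DIM('a)) * measure lborel (ball (0::'a) 1))
     = ennreal (measure lborel (ball (0::'a) 1))"
    by (subst ennreal_mult[symmetric]) (auto simp: powr_minus)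
  finally show ?thesis .
qed

lemma ball_avg_mono: "(\<And>x. u x \<le> v x) \<Longrightarrow> ball_avg k u x \<le> ball_avg k v x"
  unfolding ball_avg_def by (intro mult_left_mono nn_integral_mono mult_right_mono ennreal_leI) auto

lemma ball_avg_add:
  assumes [measurable]: "u \<in> borel_measurable borel" "v \<in> borel_measurable borel"
    and "\<And>x. 0 \<le> u x" "\<And>x. 0 \<le> v x"
  shows "ball_avg k (\<lambda>x. u x + v x) x = ball_avg k u x + ball_avg k v x"
proof -
  have "ball_avg k (\<lambda>x. u x + v x) x = ennreal (2 powr (- (real_of_int k * real DIM('a)))) *
    (\<integral>\<^sup>+y. ennreal (u y) * indicator (ball 0 (2 powr real_of_int k)) (x - y)
      + ennreal (v y) * indicator (ball 0 (2 powr real_of_int k)) (x - y) \<partial>lborel)"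
    unfolding ball_avg_def using assms(3,4) by (simp add: distrib_right)
  then show ?thesis
    unfolding ball_avg_def by (subst (asm) nn_integral_add) (auto simp: distrib_left)
qed

lemma maximal_finite:
  fixes u :: "'a::euclidean_space \<Rightarrow> real"
  assumes "bdd_borel u"
  shows "maximal u x < \<infinity>"
proof -
  obtain B where B: "\<And>x. u x \<le> B" using assms by (auto simp: bdd_borel_def)
  have "maximal u x \<le> ennreal B * ennreal (measure lborel (ball (0::'a) 1))"
    unfolding maximal_def
    by (intro SUP_least order_trans[OF ball_avg_mono[of u "\<lambda>_. B", OF B]]) (simp add: ball_avg_const)
  also have "\<dots> < \<infinity>" by (simp add: ennreal_mult_less_top)
  finally show ?thesis .
qed

section \<open>The weak type (1, 1) estimate\<close>

text \<open>The covering lemma asks for bounded radii, which is why the scales are capped at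
  \<open>K\<close>. Each point of the set is the centre of a ball in which \<open>u\<close> has mass
  at least \<open>l\<close> times the radius to the power of the dimension; a disjoint subfamily
  carries at most the total mass, and its fivefold enlargements cover the set.\<close>

lemma maximal_weak_type_aux:
  fixes u :: "'a::euclidean_space \<Rightarrow> real" and K :: nat
  assumes [measurable]: "u \<in> borel_measurable borel" and l: "0 < l"
  shows "emeasure lborel {x. \<exists>k\<le>int K. ennreal l < ball_avg k u x}
    \<le> ennreal (5 ^ DIM('a) * measure lborel (ball (0::'a) 1) / l) * (\<integral>\<^sup>+x. ennreal (u x) \<partial>lborel)"
proof -
  define w where "w = measure lborel (ball (0::'a) 1)"
  have w: "0 < w" using unit_vol_pos by (simp add: w_def)
  define E where "E = {x. \<exists>k\<le>int K. ennreal l < ball_avg k u x}"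
  \<comment> \<open>A scale witnessing membership; its dependence on x need not be measurable,
    because only countably many of the balls are used.\<close>
  define k where "k x = (SOME k. k \<le> int K \<and> ennreal l < ball_avg k u x)" for x
  define r :: "'a \<Rightarrow> real" where "r x = 2 powr real_of_int (k x)" for x
  have k: "k x \<le> int K" "ennreal l < ball_avg (k x) u x" if "x \<in> E" for x
    using someI_ex[of "\<lambda>k. k \<le> int K \<and> ennreal l < ball_avg k u x"] that
    by (auto simp: E_def k_def)
  have r: "0 < r x \<and> r x \<le> 2 powr real K" if "x \<in> E" for x
    using k(1)[OF that] by (auto simp: r_def)
  have "E \<subseteq> (\<Union>i\<in>E. ball i (r i))" using r by fastforce
  then obtain C where C: "countable C" "C \<subseteq> E"
     "pairwise (\<lambda>i j. disjnt (ball i (r i)) (ball j (r j))) C"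
     "E \<subseteq> (\<Union>i\<in>C. ball i (5 * r i))"
    using Vitali_covering_lemma_balls[where a = "\<lambda>x. x" and S = E and K = E and r = r and B = "2 powr real K"] r
    by (metis (mono_tags, lifting))
  have ball_bound: "emeasure lborel (ball i (5 * r i))
      \<le> ennreal (5 ^ DIM('a) * w / l) * (\<integral>\<^sup>+y. ennreal (u y) * indicator (ball i (r i)) y \<partial>lborel)"
    if "i \<in> C" for i
  proof -
    have iE: "i \<in> E" using C that by auto
    define J where "J = (\<integral>\<^sup>+y. ennreal (u y) * indicator (ball i (r i)) y \<partial>lborel)"
    have rn: "r i ^ DIM('a) = 2 powr (real_of_int (k i) * real DIM('a))"
      by (simp add: r_def powr_powr powr_realpow[symmetric])
    have "indicator (ball i (r i)) y = (indicator (ball 0 (r i)) (i - y) :: ennreal)" for y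
      by (auto simp: indicator_def dist_norm norm_minus_commute)
    then have "ennreal l \<le> ennreal (2 powr (- (real_of_int (k i) * real DIM('a)))) * J"
      using k(2)[OF iE] by (simp add: ball_avg_def J_def r_def less_imp_le)
    then have "ennreal (r i ^ DIM('a)) * ennreal l
        \<le> ennreal (r i ^ DIM('a)) * (ennreal (2 powr (- (real_of_int (k i) * real DIM('a)))) * J)"
      by (rule mult_left_mono) simp
    also have "\<dots> = (ennreal (r i ^ DIM('a)) * ennreal (2 powr (- (real_of_int (k i) * real DIM('a))))) * J"
      by (simp add: mult.assoc)
    also have "ennreal (r i ^ DIM('a)) * ennreal (2 powr (- (real_of_int (k i) * real DIM('a)))) = 1"
      unfolding rn by (subst ennreal_mult[symmetric]) (auto simp: powr_minus)
    finally have *: "ennreal (r i ^ DIM('a)) * ennreal l \<le> J" by simp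
    have ri: "0 < r i" using r iE by auto
    have "emeasure lborel (ball i (5 * r i)) = ennreal ((5 * r i) ^ DIM('a) * w)"
      using ri by (subst emeasure_lborel_ball) (auto simp: w_def)
    also have "(5 * r i) ^ DIM('a) * w = (5 ^ DIM('a) * w / l) * (r i ^ DIM('a) * l)"
      using l by (simp add: power_mult_distrib)
    also have "ennreal \<dots> = ennreal (5 ^ DIM('a) * w / l) * (ennreal (r i ^ DIM('a)) * ennreal l)"
      using l w ri by (simp add: ennreal_mult[symmetric])
    also have "\<dots> \<le> ennreal (5 ^ DIM('a) * w / l) * J"
      by (rule mult_left_mono[OF *]) simp
    finally show ?thesis unfolding J_def .
  qed
  \<comment> \<open>Disjointness enters as a bound on the number of chosen balls through
    \<open>y\<close>; summation over the family is integration over \<open>count_space C\<close>, so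
    sum and integral are exchanged by Tonelli.\<close>
  have disj: "(\<integral>\<^sup>+i. indicator (ball i (r i)) y \<partial>count_space C) \<le> 1" for y
  proof (cases "\<exists>i\<in>C. y \<in> ball i (r i)")
    case True
    then obtain i where i: "i \<in> C" "y \<in> ball i (r i)" by auto
    have "j = i" if "j \<in> C" "y \<in> ball j (r j)" for j
      using C(3) i that unfolding pairwise_def disjnt_def by blast
    then have "indicator (ball j (r j)) y \<le> (indicator {i} j :: ennreal)" if "j \<in> C" for j
      using that by (auto simp: indicator_def)
    then have "(\<integral>\<^sup>+i. indicator (ball i (r i)) y \<partial>count_space C) \<le> (\<integral>\<^sup>+j. indicator {i} j \<partial>count_space C)"
      by (intro nn_integral_mono) simp
    also have "\<dots> = 1" using i by (subst nn_integral_indicator) auto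
    finally show ?thesis .
  next
    case False
    then have "(\<integral>\<^sup>+i. indicator (ball i (r i)) y \<partial>count_space C) = (\<integral>\<^sup>+i. 0 \<partial>count_space C)"
      by (intro nn_integral_cong) auto
    then show ?thesis by simp
  qed
  have E_meas: "E \<in> sets lborel"
  proof -
    have "E = (\<Union>k\<in>{..int K}. {x\<in>space borel. ennreal l < ball_avg k u x})" by (auto simp: E_def)
    moreover have "{x\<in>space borel. ennreal l < ball_avg k u x} \<in> sets borel" for k by measurable
    ultimately show ?thesis by auto
  qed
  have ball_sets: "ball i s \<in> sets lborel" for i :: 'a and s by simp
  have "emeasure lborel E = (\<integral>\<^sup>+y. indicator E y \<partial>lborel)" using E_meas by simp
  also have "\<dots> \<le> (\<integral>\<^sup>+y. \<integral>\<^sup>+i. indicator (ball i (5 * r i)) y \<partial>count_space C \<partial>lborel)"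
  proof (rule nn_integral_mono)
    fix y
    show "indicator E y \<le> (\<integral>\<^sup>+i. indicator (ball i (5 * r i)) y \<partial>count_space C)"
    proof (cases "y \<in> E")
      case True
      then obtain i where i: "i \<in> C" "y \<in> ball i (5 * r i)" using C(4) by auto
      have "1 = (\<integral>\<^sup>+j. indicator {i} j \<partial>count_space C)" using i by (subst nn_integral_indicator) auto
      also have "\<dots> \<le> (\<integral>\<^sup>+j. indicator (ball j (5 * r j)) y \<partial>count_space C)"
        using i by (intro nn_integral_mono) (auto simp: indicator_def)
      finally show ?thesis using True by simp
    qed simp
  qed
  also have "\<dots> = (\<integral>\<^sup>+i. \<integral>\<^sup>+y. indicator (ball i (5 * r i)) y \<partial>lborel \<partial>count_space C)"
    by (rule nn_integral_count_space_nn_integral[OF C(1)]) (rule borel_measurable_indicator[OF ball_sets])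
  also have "\<dots> = (\<integral>\<^sup>+i. emeasure lborel (ball i (5 * r i)) \<partial>count_space C)"
    by (intro nn_integral_cong nn_integral_indicator ball_sets)
  also have "\<dots> \<le> (\<integral>\<^sup>+i. ennreal (5 ^ DIM('a) * w / l) * (\<integral>\<^sup>+y. ennreal (u y) * indicator (ball i (r i)) y \<partial>lborel) \<partial>count_space C)"
    using ball_bound by (intro nn_integral_mono) simp
  also have "\<dots> = ennreal (5 ^ DIM('a) * w / l) * (\<integral>\<^sup>+i. (\<integral>\<^sup>+y. ennreal (u y) * indicator (ball i (r i)) y \<partial>lborel) \<partial>count_space C)"
    by (rule nn_integral_cmult) simp
  also have "(\<integral>\<^sup>+i. (\<integral>\<^sup>+y. ennreal (u y) * indicator (ball i (r i)) y \<partial>lborel) \<partial>count_space C)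
     = (\<integral>\<^sup>+y. \<integral>\<^sup>+i. ennreal (u y) * indicator (ball i (r i)) y \<partial>count_space C \<partial>lborel)"
    by (rule nn_integral_count_space_nn_integral[OF C(1), symmetric])
       (intro borel_measurable_times_ennreal borel_measurable_indicator ball_sets, measurable)
  also have "\<dots> = (\<integral>\<^sup>+y. ennreal (u y) * (\<integral>\<^sup>+i. indicator (ball i (r i)) y \<partial>count_space C) \<partial>lborel)"
    by (intro nn_integral_cong nn_integral_cmult) simp
  also have "\<dots> \<le> (\<integral>\<^sup>+y. ennreal (u y) * 1 \<partial>lborel)"
    by (intro nn_integral_mono mult_left_mono disj) simp
  finally show ?thesis unfolding E_def w_def by (simp add: mult_left_mono)
qed

text \<open>The constant does not depend on the cap \<open>K\<close>, and the capped level sets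
  increase to the full one.\<close>

lemma maximal_weak_type:
  fixes u :: "'a::euclidean_space \<Rightarrow> real"
  assumes [measurable]: "u \<in> borel_measurable borel" and l: "0 < l"
  shows "emeasure lborel {x. ennreal l < maximal u x}
    \<le> ennreal (5 ^ DIM('a) * measure lborel (ball (0::'a) 1) / l) * (\<integral>\<^sup>+x. ennreal (u x) \<partial>lborel)"
proof -
  define E where "E K = {x. \<exists>k\<le>int K. ennreal l < ball_avg k u x}" for K :: nat
  have "{x. ennreal l < maximal u x} = (\<Union>K. E K)"
  proof -
    have "\<exists>K. k \<le> int K" for k :: int by (rule exI[of _ "nat k"]) simp
    then show ?thesis by (auto simp: E_def maximal_def less_SUP_iff) blast
  qed
  moreover have "range E \<subseteq> sets lborel"
  proof -
    have "E K = (\<Union>k\<in>{..int K}. {x\<in>space borel. ennreal l < ball_avg k u x})" for K by (auto simp: E_def)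
    moreover have "{x\<in>space borel. ennreal l < ball_avg k u x} \<in> sets borel" for k by measurable
    ultimately show ?thesis by auto
  qed
  moreover have "incseq E" by (auto simp: incseq_def E_def) (meson order_trans of_nat_mono)
  ultimately have "emeasure lborel {x. ennreal l < maximal u x} = (SUP K. emeasure lborel (E K))"
    using SUP_emeasure_incseq[of E lborel] by simp
  also have "\<dots> \<le> ennreal (5 ^ DIM('a) * measure lborel (ball (0::'a) 1) / l) * (\<integral>\<^sup>+x. ennreal (u x) \<partial>lborel)"
    unfolding E_def by (intro SUP_least maximal_weak_type_aux l) measurable
  finally show ?thesis .
qed

text \<open>Splitting \<open>u\<close> at height proportional to \<open>l\<close> upgrades the weak bound to the form
  that can be integrated against \<open>l\<^bsup>p-1\<^esup>\<close>.\<close>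

lemma maximal_weak_type_truncated:
  fixes u :: "'a::euclidean_space \<Rightarrow> real"
  defines "w \<equiv> measure lborel (ball (0::'a) 1)"
  assumes u: "bdd_borel u" and l: "0 < l"
  shows "emeasure lborel {x. ennreal l < maximal u x}
    \<le> ennreal (2 * 5 ^ DIM('a) * w / l) * (\<integral>\<^sup>+x. ennreal (u x) * indicator {0<..<2 * w * u x} l \<partial>lborel)"
proof -
  have w: "0 < w" using unit_vol_pos by (simp add: w_def)
  have [measurable]: "u \<in> borel_measurable borel" and u0: "\<And>x. 0 \<le> u x" using u by (auto simp: bdd_borel_def)
  \<comment> \<open>A constant \<open>c\<close> has average \<open>c * w\<close>, so the discarded
    part of \<open>u\<close>, at most \<open>l / (2 * w)\<close>, contributes at most
    \<open>l / 2\<close> to every average; the other half of \<open>l\<close> is left for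
    \<open>v\<close>.\<close>
  define v where "v x = u x * indicator {x. l / (2 * w) < u x} x" for x
  have [measurable]: "v \<in> borel_measurable borel" unfolding v_def by measurable
  have v0: "0 \<le> v x" for x using u0 by (simp add: v_def)
  have "ball_avg k u x \<le> ball_avg k v x + ennreal (l / 2)" for k x
  proof -
    have "ball_avg k u x \<le> ball_avg k (\<lambda>x. v x + l / (2 * w)) x"
      using l w by (intro ball_avg_mono) (auto simp: v_def indicator_def)
    also have "\<dots> = ball_avg k v x + ennreal (l / (2 * w)) * ennreal w"
      using l w v0 by (subst ball_avg_add) (auto simp: ball_avg_const w_def)
    also have "ennreal (l / (2 * w)) * ennreal w = ennreal (l / 2)"
      using l w by (simp add: ennreal_mult[symmetric])
    finally show ?thesis .
  qed
  then have "maximal u x \<le> maximal v x + ennreal (l / 2)" for x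
    unfolding maximal_def[of u]
    by (intro SUP_least) (meson add_right_mono ball_avg_le_maximal order_trans)
  then have "ennreal (l / 2) < maximal v x" if "ennreal l < maximal u x" for x
  proof -
    have "ennreal (l / 2) + ennreal (l / 2) < maximal v x + ennreal (l / 2)"
      using that \<open>maximal u x \<le> maximal v x + ennreal (l / 2)\<close> l
      by (simp add: ennreal_plus[symmetric] del: ennreal_plus)
    then show ?thesis by (meson add_right_mono not_le)
  qed
  then have "emeasure lborel {x. ennreal l < maximal u x} \<le> emeasure lborel {x. ennreal (l / 2) < maximal v x}"
  proof (intro emeasure_mono)
    have "{x\<in>space borel. ennreal (l / 2) < maximal v x} \<in> sets borel" by measurable
    then show "{x. ennreal (l / 2) < maximal v x} \<in> sets lborel" by simp
  qed auto
  also have "\<dots> \<le> ennreal (5 ^ DIM('a) * w / (l / 2)) * (\<integral>\<^sup>+x. ennreal (v x) \<partial>lborel)"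
    unfolding w_def using l by (intro maximal_weak_type) auto
  \<comment> \<open>Written as an interval in \<open>l\<close>, the truncation can later be
    integrated in \<open>l\<close> first.\<close>
  also have "(\<integral>\<^sup>+x. ennreal (v x) \<partial>lborel) = (\<integral>\<^sup>+x. ennreal (u x) * indicator {0<..<2 * w * u x} l \<partial>lborel)"
    using l w by (intro nn_integral_cong) (auto simp: v_def indicator_def field_simps)
  finally show ?thesis by (simp add: mult_ac)
qed

section \<open>The strong type estimate\<close>

lemma nn_integral_powr_interval:
  fixes v r :: real
  assumes "0 < r" "0 \<le> v"
  shows "(\<integral>\<^sup>+l. ennreal (l powr (r - 1)) * indicator {0<..<v} l \<partial>lborel) = ennreal (v powr r / r)"
proof -
  have "(\<integral>\<^sup>+l. ennreal (l powr (r - 1)) * indicator {0<..<v} l \<partial>lborel)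
    = (\<integral>\<^sup>+l. ennreal (l powr (r - 1)) * indicator {0..v} l \<partial>lborel)"
  proof (rule nn_integral_cong_AE)
    show "AE l in lborel. ennreal (l powr (r - 1)) * indicator {0<..<v} l = ennreal (l powr (r - 1)) * indicator {0..v} l"
      using AE_lborel_singleton[of "0::real"] AE_lborel_singleton[of v]
      by eventually_elim (auto simp: indicator_def)
  qed
  also have "\<dots> = ennreal (v powr r / r)"
    using has_integral_powr_from_0[of "r - 1" v] assms
    by (intro nn_integral_has_integral_lebesgue') auto
  finally show ?thesis .
qed

text \<open>The layer-cake formula writes the p-th power of the maximal function as an integral over
  its level sets. After the truncated weak bound and an exchange of integrals, the inner integral is
  that of \<open>l powr (p - 2)\<close> up to \<open>2 * w * u x\<close>, which converges at 0
  because \<open>p > 1\<close>.\<close>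

theorem maximal_strong_type:
  assumes p: "1 < p"
  shows "\<exists>C\<ge>0. \<forall>u::'a::euclidean_space \<Rightarrow> real. bdd_borel u \<longrightarrow>
    (\<integral>\<^sup>+x. ennreal (enn2real (maximal u x) powr p) \<partial>lborel) \<le> ennreal C * (\<integral>\<^sup>+x. ennreal (u x powr p) \<partial>lborel)"
proof -
  define w where "w = measure lborel (ball (0::'a) 1)"
  have w: "0 < w" using unit_vol_pos by (simp add: w_def)
  \<comment> \<open>\<open>p\<close> comes from the layer-cake formula, the next factor is the
    weak-type constant, and the last one is left by the inner integral.\<close>
  define C where "C = p * (2 * 5 ^ DIM('a) * w) * ((2 * w) powr (p - 1) / (p - 1))"
  have "(\<integral>\<^sup>+x. ennreal (enn2real (maximal u x) powr p) \<partial>lborel) \<le> ennreal C * (\<integral>\<^sup>+x. ennreal (u x powr p) \<partial>lborel)"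
    if u: "bdd_borel u" for u :: "'a \<Rightarrow> real"
  proof -
    have [measurable]: "u \<in> borel_measurable borel" and u0: "\<And>x. 0 \<le> u x" using u by (auto simp: bdd_borel_def)
    define m where "m x = enn2real (maximal u x)" for x
    have [measurable]: "m \<in> borel_measurable borel" unfolding m_def by measurable
    have m: "maximal u x = ennreal (m x)" "0 \<le> m x" for x
      using maximal_finite[OF u, of x] by (auto simp: m_def)
    have "(\<integral>\<^sup>+x. ennreal (m x powr p) \<partial>lborel)
      = (\<integral>\<^sup>+x. (\<integral>\<^sup>+l. ennreal (p * l powr (p - 1)) * indicator {0<..<m x} l \<partial>lborel) \<partial>lborel)"
    proof (intro nn_integral_cong)
      fix x
      have "(\<integral>\<^sup>+l. ennreal (p * l powr (p - 1)) * indicator {0<..<m x} l \<partial>lborel)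
         = ennreal p * (\<integral>\<^sup>+l. ennreal (l powr (p - 1)) * indicator {0<..<m x} l \<partial>lborel)"
        using p by (subst nn_integral_cmult[symmetric]) (auto simp: ennreal_mult mult.assoc)
      also have "\<dots> = ennreal (m x powr p)"
        using p m by (subst nn_integral_powr_interval) (auto simp: ennreal_mult[symmetric])
      finally show "ennreal (m x powr p) = (\<integral>\<^sup>+l. ennreal (p * l powr (p - 1)) * indicator {0<..<m x} l \<partial>lborel)" ..
    qed
    also have "\<dots> = (\<integral>\<^sup>+l. (\<integral>\<^sup>+x. ennreal (p * l powr (p - 1)) * indicator {0<..<m x} l \<partial>lborel) \<partial>lborel)"
      by (rule lborel_pair.Fubini') (simp add: indicator_def, measurable)
    also have "\<dots> \<le> (\<integral>\<^sup>+l. (\<integral>\<^sup>+x. ennreal (p * (2 * 5 ^ DIM('a) * w) * l powr (p - 2)) *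
         (ennreal (u x) * indicator {0<..<2 * w * u x} l) \<partial>lborel) \<partial>lborel)"
    proof (rule nn_integral_mono)
      fix l :: real
      show "(\<integral>\<^sup>+x. ennreal (p * l powr (p - 1)) * indicator {0<..<m x} l \<partial>lborel)
        \<le> (\<integral>\<^sup>+x. ennreal (p * (2 * 5 ^ DIM('a) * w) * l powr (p - 2)) *
         (ennreal (u x) * indicator {0<..<2 * w * u x} l) \<partial>lborel)"
      proof (cases "0 < l")
        case True
        have ms: "{x. ennreal l < maximal u x} \<in> sets lborel"
        proof -
          have "{x\<in>space borel. ennreal l < maximal u x} \<in> sets borel" by measurable
          then show ?thesis by simp
        qed
        have "(\<integral>\<^sup>+x. ennreal (p * l powr (p - 1)) * indicator {0<..<m x} l \<partial>lborel)
          = (\<integral>\<^sup>+x. ennreal (p * l powr (p - 1)) * indicator {x. ennreal l < maximal u x} x \<partial>lborel)"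
          using True m by (intro nn_integral_cong) (auto simp: indicator_def ennreal_less_iff)
        also have "\<dots> = ennreal (p * l powr (p - 1)) * emeasure lborel {x. ennreal l < maximal u x}"
          by (rule nn_integral_cmult_indicator[OF ms])
        also have "\<dots> \<le> ennreal (p * l powr (p - 1)) * (ennreal (2 * 5 ^ DIM('a) * w / l) *
            (\<integral>\<^sup>+x. ennreal (u x) * indicator {0<..<2 * w * u x} l \<partial>lborel))"
          unfolding w_def by (intro mult_left_mono maximal_weak_type_truncated[OF u True]) simp
        also have "\<dots> = ennreal (p * l powr (p - 1)) * ennreal (2 * 5 ^ DIM('a) * w / l) *
            (\<integral>\<^sup>+x. ennreal (u x) * indicator {0<..<2 * w * u x} l \<partial>lborel)"
          by (simp add: mult.assoc)
        also have "ennreal (p * l powr (p - 1)) * ennreal (2 * 5 ^ DIM('a) * w / l)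
            = ennreal (p * (2 * 5 ^ DIM('a) * w) * l powr (p - 2))"
        proof -
          have "l powr (p - 2) = l powr (p - 1) / l" using True by (simp add: powr_diff powr_numeral field_simps power2_eq_square)
          then show ?thesis using p w True by (subst ennreal_mult[symmetric]) (auto simp: field_simps)
        qed
        also have "\<dots> * (\<integral>\<^sup>+x. ennreal (u x) * indicator {0<..<2 * w * u x} l \<partial>lborel)
          = (\<integral>\<^sup>+x. ennreal (p * (2 * 5 ^ DIM('a) * w) * l powr (p - 2)) *
         (ennreal (u x) * indicator {0<..<2 * w * u x} l) \<partial>lborel)"
          by (subst nn_integral_cmult) (simp_all add: indicator_def)
        finally show ?thesis .
      qed (simp add: indicator_def)
    qed
    also have "\<dots> = (\<integral>\<^sup>+x. (\<integral>\<^sup>+l. ennreal (p * (2 * 5 ^ DIM('a) * w) * l powr (p - 2)) *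
         (ennreal (u x) * indicator {0<..<2 * w * u x} l) \<partial>lborel) \<partial>lborel)"
      by (rule lborel_pair.Fubini'[symmetric]) (simp add: indicator_def, measurable)
    also have "\<dots> = (\<integral>\<^sup>+x. ennreal C * ennreal (u x powr p) \<partial>lborel)"
    proof (intro nn_integral_cong)
      fix x
      have "(\<integral>\<^sup>+l. ennreal (p * (2 * 5 ^ DIM('a) * w) * l powr (p - 2)) * (ennreal (u x) * indicator {0<..<2 * w * u x} l) \<partial>lborel)
        = (\<integral>\<^sup>+l. ennreal (p * (2 * 5 ^ DIM('a) * w) * u x) * (ennreal (l powr ((p - 1) - 1)) * indicator {0<..<2 * w * u x} l) \<partial>lborel)"
        using p w u0[of x] by (intro nn_integral_cong) (auto simp: ennreal_mult[symmetric] indicator_def mult_ac)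
      also have "\<dots> = ennreal (p * (2 * 5 ^ DIM('a) * w) * u x) * ennreal ((2 * w * u x) powr (p - 1) / (p - 1))"
        using p w u0[of x] by (subst nn_integral_cmult, simp, subst nn_integral_powr_interval) auto
      also have "\<dots> = ennreal (p * (2 * 5 ^ DIM('a) * w) * u x * ((2 * w * u x) powr (p - 1) / (p - 1)))"
        using p w u0[of x] by (intro ennreal_mult[symmetric]) auto
      also have "p * (2 * 5 ^ DIM('a) * w) * u x * ((2 * w * u x) powr (p - 1) / (p - 1)) = C * u x powr p"
      proof (cases "u x = 0")
        case False
        then have "u x powr p = u x * u x powr (p - 1)" using u0[of x] by (simp add: powr_diff)
        moreover have "(2 * w * u x) powr (p - 1) = (2 * w) powr (p - 1) * u x powr (p - 1)"
          by (rule powr_mult)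
        ultimately show ?thesis by (simp add: C_def)
      qed auto
      also have "ennreal (C * u x powr p) = ennreal C * ennreal (u x powr p)"
        using p w by (intro ennreal_mult) (auto simp: C_def)
      finally show "(\<integral>\<^sup>+l. ennreal (p * (2 * 5 ^ DIM('a) * w) * l powr (p - 2)) * (ennreal (u x) * indicator {0<..<2 * w * u x} l) \<partial>lborel)
        = ennreal C * ennreal (u x powr p)" .
    qed
    also have "\<dots> = ennreal C * (\<integral>\<^sup>+x. ennreal (u x powr p) \<partial>lborel)"
      by (rule nn_integral_cmult) simp
    finally show ?thesis by (simp add: m_def)
  qed
  moreover have "0 \<le> C" using p w by (simp add: C_def)
  ultimately show ?thesis by blast
qed

subsection \<open>Hardy-Littlewood-Sobolev inequality\<close>

text \<open>One geometric series on each side of \<open>k0\<close>, whence the factor 2.\<close>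

lemma sum_dyadic_decay_le:
  fixes c :: real and I :: "int set"
  assumes c: "0 < c" and I: "finite I"
  shows "(\<Sum>k\<in>I. 2 powr (- (c * real_of_int \<bar>k - k0\<bar>))) \<le> 2 / (1 - 2 powr (- c))"
proof -
  define r :: real where "r = 2 powr (- c)"
  have r: "0 \<le> r" "r < 1" using c by (auto simp: r_def powr_less_one)
  have geo: "(\<Sum>k\<in>I'. 2 powr (- (c * real_of_int \<bar>k - k0\<bar>))) \<le> 1 / (1 - r)"
    if inj: "inj_on (\<lambda>k. nat \<bar>k - k0\<bar>) I'" and fin: "finite I'" for I'
  proof -
    have "(\<Sum>k\<in>I'. 2 powr (- (c * real_of_int \<bar>k - k0\<bar>))) = (\<Sum>k\<in>I'. r ^ nat \<bar>k - k0\<bar>)"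
      by (intro sum.cong) (auto simp: r_def powr_powr powr_realpow[symmetric])
    also have "\<dots> = (\<Sum>i\<in>(\<lambda>k. nat \<bar>k - k0\<bar>) ` I'. r ^ i)"
      using inj by (simp add: sum.reindex)
    also have "\<dots> \<le> (\<Sum>i. r ^ i)"
      using r fin by (intro sum_le_suminf) (auto simp: summable_geometric)
    also have "\<dots> = 1 / (1 - r)" using r by (simp add: suminf_geometric)
    finally show ?thesis .
  qed
  have "I = (I \<inter> {k0..}) \<union> (I \<inter> {..<k0})" by auto
  then have "(\<Sum>k\<in>I. 2 powr (- (c * real_of_int \<bar>k - k0\<bar>)))
     = (\<Sum>k\<in>I \<inter> {k0..}. 2 powr (- (c * real_of_int \<bar>k - k0\<bar>))) + (\<Sum>k\<in>I \<inter> {..<k0}. 2 powr (- (c * real_of_int \<bar>k - k0\<bar>)))"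
    using I by (metis (no_types, lifting) sum.union_disjoint finite_Int disjoint_iff Int_iff atLeast_iff lessThan_iff not_le)
  also have "\<dots> \<le> 1 / (1 - r) + 1 / (1 - r)"
    using I by (intro add_mono geo) (auto simp: inj_on_def)
  finally show ?thesis by (simp add: r_def)
qed

text \<open>The two bounds cross where \<open>2\<^bsup>k(a+b)\<^esup>\<close> is about \<open>1/M\<close>, and the sum is comparable
  to their common value there.\<close>

lemma suminf_dyadic_crossing:
  fixes a b D :: real
  assumes a: "0 < a" and b: "0 < b" and D: "0 \<le> D"
  shows "\<exists>C\<ge>0. \<forall>M\<ge>0. \<forall>e::int \<Rightarrow> real.
    (\<forall>k. 0 \<le> e k \<and> e k \<le> D * M * 2 powr (real_of_int k * a) \<and> e k \<le> D * 2 powr (- (real_of_int k * b)))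
    \<longrightarrow> (\<Sum>j. ennreal (e (int_decode j))) \<le> ennreal (C * M powr (b / (a + b)))"
proof -
  define c where "c = min a b"
  \<comment> \<open>\<open>2 powr b\<close> pays for rounding the crossing point down to an
    integer.\<close>
  define K where "K = D * 2 powr b"
  define C where "C = K * (2 / (1 - 2 powr (- c)))"
  have c: "0 < c" using a b by (simp add: c_def)
  have K: "0 \<le> K" "D \<le> K" using D b by (auto simp: K_def mult_le_cancel_left1 ge_one_powr_ge_zero)
  have C: "0 \<le> C" using K c by (simp add: C_def powr_le_one_le powr_mono less_imp_le powr_less_one)
  have "(\<Sum>j. ennreal (e (int_decode j))) \<le> ennreal (C * M powr (b / (a + b)))"
    if M: "0 \<le> M" and e: "\<And>k. 0 \<le> e k" "\<And>k. e k \<le> D * M * 2 powr (real_of_int k * a)"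
      "\<And>k. e k \<le> D * 2 powr (- (real_of_int k * b))" for M and e :: "int \<Rightarrow> real"
  proof (cases "M = 0")
    case True
    then have "e k = 0" for k using e(1,2)[of k] by simp
    then show ?thesis by simp
  next
    case False
    with M have M0: "0 < M" by simp
    \<comment> \<open>The real scale at which \<open>M * 2 powr (x * a)\<close> equals
      \<open>2 powr (- (x * b))\<close>.\<close>
    define x where "x = - log 2 M / (a + b)"
    define k0 where "k0 = \<lfloor>x\<rfloor>"
    have k0: "real_of_int k0 \<le> x" "x < real_of_int k0 + 1" by (auto simp: k0_def; linarith)+
    have Mx: "M = 2 powr (- (x * (a + b)))" using M0 a b by (simp add: x_def)
    have Mth: "M powr (b / (a + b)) = 2 powr (- (x * b))"
      using a b by (subst Mx) (simp add: powr_powr)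
    have bound: "e k \<le> K * M powr (b / (a + b)) * 2 powr (- (c * real_of_int \<bar>k - k0\<bar>))" for k
    proof (cases "k \<le> k0")
      case True
      have "M * 2 powr (real_of_int k * a) = 2 powr (- (x * (a + b)) + real_of_int k * a)"
        by (subst Mx) (simp add: powr_add[symmetric])
      also have "\<dots> \<le> 2 powr (- (x * b) + - (c * real_of_int \<bar>k - k0\<bar>))"
      proof -
        have "real_of_int k * a \<le> x * a - a * (real_of_int k0 - real_of_int k)"
          using k0(1) a by (simp add: algebra_simps)
        moreover have "c * (real_of_int k0 - real_of_int k) \<le> a * (real_of_int k0 - real_of_int k)"
          using True by (intro mult_right_mono) (auto simp: c_def)
        ultimately have "- (x * (a + b)) + real_of_int k * a \<le> - (x * b) + - (c * (real_of_int k0 - real_of_int k))"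
          by (simp add: algebra_simps)
        then show ?thesis using True by (simp add: powr_mono)
      qed
      also have "\<dots> = M powr (b / (a + b)) * 2 powr (- (c * real_of_int \<bar>k - k0\<bar>))"
        by (simp only: powr_add Mth)
      finally have "D * (M * 2 powr (real_of_int k * a)) \<le> K * (M powr (b / (a + b)) * 2 powr (- (c * real_of_int \<bar>k - k0\<bar>)))"
        using K D M0 by (intro mult_mono[OF K(2)]) auto
      then show ?thesis using e(2)[of k] by (simp add: mult_ac)
    next
      case False
      have "2 powr (- (real_of_int k * b)) \<le> 2 powr (b + - (x * b) + - (c * real_of_int \<bar>k - k0\<bar>))"
      proof -
        have "(x - 1) * b \<le> real_of_int k0 * b" using k0 b by (intro mult_right_mono) auto
        moreover have "c * (real_of_int k - real_of_int k0) \<le> b * (real_of_int k - real_of_int k0)"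
          using False by (intro mult_right_mono) (auto simp: c_def)
        ultimately have "- (real_of_int k * b) \<le> b + - (x * b) + - (c * (real_of_int k - real_of_int k0))"
          by (simp add: algebra_simps)
        then show ?thesis using False by (simp add: powr_mono)
      qed
      also have "\<dots> = 2 powr b * (M powr (b / (a + b)) * 2 powr (- (c * real_of_int \<bar>k - k0\<bar>)))"
        by (simp only: powr_add Mth mult.assoc)
      finally have "D * 2 powr (- (real_of_int k * b)) \<le> K * (M powr (b / (a + b)) * 2 powr (- (c * real_of_int \<bar>k - k0\<bar>)))"
        using D by (simp add: K_def mult.assoc mult_left_mono)
      then show ?thesis using e(3)[of k] by (simp add: mult_ac)
    qed
    show ?thesis
    proof (rule suminf_ennreal_le)
      fix J :: "nat set" assume J: "finite J"
      have "sum (\<lambda>j. e (int_decode j)) J = (\<Sum>k\<in>int_decode ` J. e k)"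
        by (simp add: sum.reindex inj_int_decode)
      also have "\<dots> \<le> (\<Sum>k\<in>int_decode ` J. K * M powr (b / (a + b)) * 2 powr (- (c * real_of_int \<bar>k - k0\<bar>)))"
        by (intro sum_mono bound)
      also have "\<dots> = K * M powr (b / (a + b)) * (\<Sum>k\<in>int_decode ` J. 2 powr (- (c * real_of_int \<bar>k - k0\<bar>)))"
        by (simp add: sum_distrib_left)
      also have "\<dots> \<le> K * M powr (b / (a + b)) * (2 / (1 - 2 powr (- c)))"
        using K J c by (intro mult_left_mono sum_dyadic_decay_le) auto
      finally show "sum (\<lambda>j. e (int_decode j)) J \<le> C * M powr (b / (a + b))" by (simp add: C_def mult_ac)
    qed (use e in auto)
  qed
  with C show ?thesis by blast
qed

section \<open>Dyadic decomposition of the kernel\<close>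

text \<open>Series over the naturals reach all scales, large and small, through
  \<open>int_decode\<close>. Only an upper bound is wanted, so the shell containing \<open>y\<close>
  is replaced by its full ball, on which averages can be formed.\<close>

lemma dyadic_kernel_le:
  assumes "y \<noteq> 0"
  shows "ennreal (norm y powr c) \<le> (\<Sum>j. ennreal (2 powr \<bar>c\<bar> * 2 powr (real_of_int (int_decode j) * c)) *
    indicator (ball (0::'a::euclidean_space) (2 powr real_of_int (int_decode j))) y)"
proof -
  define k where "k = \<lfloor>log 2 (norm y)\<rfloor> + 1"
  have k: "real_of_int k - 1 \<le> log 2 (norm y)" "log 2 (norm y) < real_of_int k"
    unfolding k_def by linarith+
  have y: "0 < norm y" using assms by simp
  have k2: "2 powr (real_of_int k - 1) \<le> norm y" "norm y < 2 powr real_of_int k"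
    using k y by (auto simp: le_log_iff log_less_iff)
  have "norm y powr c \<le> 2 powr \<bar>c\<bar> * (2 powr real_of_int k) powr c"
    using k2 by (intro powr_le_dyadic) (auto simp: powr_diff)
  then have "ennreal (norm y powr c) \<le> ennreal (2 powr \<bar>c\<bar> * 2 powr (real_of_int k * c)) *
    indicator (ball 0 (2 powr real_of_int k)) y"
    using k2 by (simp add: powr_powr ennreal_leI)
  also have "\<dots> = ennreal (2 powr \<bar>c\<bar> * 2 powr (real_of_int (int_decode (int_encode k)) * c)) *
    indicator (ball 0 (2 powr real_of_int (int_decode (int_encode k)))) y" by simp
  also have "\<dots> \<le> (\<Sum>j. ennreal (2 powr \<bar>c\<bar> * 2 powr (real_of_int (int_decode j) * c)) *
    indicator (ball (0::'a) (2 powr real_of_int (int_decode j))) y)"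
    by (rule term_le_suminf_ennreal[of "\<lambda>j. ennreal (2 powr \<bar>c\<bar> * 2 powr (real_of_int (int_decode j) * c)) *
    indicator (ball (0::'a) (2 powr real_of_int (int_decode j))) y"])
  finally show ?thesis .
qed

lemma nn_integral_dyadic_kernel_le:
  fixes h :: "'a::euclidean_space \<Rightarrow> ennreal"
  assumes [measurable]: "h \<in> borel_measurable borel"
  shows "(\<integral>\<^sup>+y. ennreal (norm y powr c) * h y \<partial>lborel)
    \<le> (\<Sum>j. ennreal (2 powr \<bar>c\<bar> * 2 powr (real_of_int (int_decode j) * c)) *
        (\<integral>\<^sup>+y. h y * indicator (ball 0 (2 powr real_of_int (int_decode j))) y \<partial>lborel))"
proof -
  have ind: "(\<lambda>y. indicator (ball (0::'a) r) y :: ennreal) \<in> borel_measurable lborel" for r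
    by (rule borel_measurable_indicator) simp
  have "(\<integral>\<^sup>+y. ennreal (norm y powr c) * h y \<partial>lborel)
   \<le> (\<integral>\<^sup>+y. (\<Sum>j. ennreal (2 powr \<bar>c\<bar> * 2 powr (real_of_int (int_decode j) * c)) *
        (h y * indicator (ball 0 (2 powr real_of_int (int_decode j))) y)) \<partial>lborel)"
  proof (rule nn_integral_mono_AE)
    show "AE y in lborel. ennreal (norm y powr c) * h y \<le> (\<Sum>j. ennreal (2 powr \<bar>c\<bar> * 2 powr (real_of_int (int_decode j) * c)) *
        (h y * indicator (ball 0 (2 powr real_of_int (int_decode j))) y))"
      using AE_lborel_singleton[of "0::'a"]
    proof eventually_elim
      case (elim y)
      have "ennreal (norm y powr c) * h y \<le> (\<Sum>j. ennreal (2 powr \<bar>c\<bar> * 2 powr (real_of_int (int_decode j) * c)) *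
          indicator (ball 0 (2 powr real_of_int (int_decode j))) y) * h y"
        by (intro mult_right_mono dyadic_kernel_le elim) simp
      also have "\<dots> = (\<Sum>j. h y * (ennreal (2 powr \<bar>c\<bar> * 2 powr (real_of_int (int_decode j) * c)) *
          indicator (ball 0 (2 powr real_of_int (int_decode j))) y))"
        by (simp only: ennreal_suminf_cmult mult.commute)
      finally show ?case by (simp only: mult_ac)
    qed
  qed
  also have "\<dots> = (\<Sum>j. \<integral>\<^sup>+y. ennreal (2 powr \<bar>c\<bar> * 2 powr (real_of_int (int_decode j) * c)) *
        (h y * indicator (ball 0 (2 powr real_of_int (int_decode j))) y) \<partial>lborel)"
    by (rule nn_integral_suminf) (intro borel_measurable_times_ennreal ind measurable_const, auto)
  also have "\<dots> = (\<Sum>j. ennreal (2 powr \<bar>c\<bar> * 2 powr (real_of_int (int_decode j) * c)) *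
        (\<integral>\<^sup>+y. h y * indicator (ball 0 (2 powr real_of_int (int_decode j))) y \<partial>lborel))"
    by (intro suminf_cong nn_integral_cmult borel_measurable_times_ennreal ind) auto
  finally show ?thesis .
qed

section \<open>Tame functions and their averages\<close>

text \<open>Integrability of all positive powers makes the class stable under
  \<open>F \<mapsto> (F / A) powr p\<close>, the renormalization that passes between a function and
  a density of mass at most 1. Absolute values of Schwartz functions are tame.\<close>

definition tame :: "('a::euclidean_space \<Rightarrow> real) \<Rightarrow> bool"
  where "tame F \<longleftrightarrow> bdd_borel F \<and> (\<forall>a>0. (\<integral>\<^sup>+x. ennreal (F x powr a) \<partial>lborel) < \<infinity>)"

lemma tame_measurable [measurable_dest]: "tame F \<Longrightarrow> F \<in> borel_measurable borel"
  and tame_nonneg: "tame F \<Longrightarrow> 0 \<le> F x"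
  by (auto simp: tame_def bdd_borel_def)

lemma tame_powr_bounded:
  assumes "tame F" "0 \<le> a"
  obtains B where "0 \<le> B" "\<And>x. F x powr a \<le> B"
proof -
  obtain B where B: "\<And>x. F x \<le> B" using assms by (auto simp: tame_def bdd_borel_def)
  have "F x powr a \<le> B powr a" for x using B[of x] tame_nonneg[OF assms(1), of x] assms(2) by (intro powr_mono2) auto
  then show thesis by (intro that[of "B powr a"]) auto
qed

lemma tame_powr_bdd_borel:
  assumes "tame F" "0 < a"
  shows "bdd_borel (\<lambda>x. F x powr a)"
proof -
  obtain B where "\<And>x. F x powr a \<le> B" using tame_powr_bounded[of F a] assms by auto
  moreover have "(\<lambda>x. F x powr a) \<in> borel_measurable borel" using assms(1) by measurable
  ultimately show ?thesis by (auto simp: bdd_borel_def)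
qed

definition avg :: "int \<Rightarrow> ('a::euclidean_space \<Rightarrow> real) \<Rightarrow> 'a \<Rightarrow> real"
  where "avg k u x = enn2real (ball_avg k u x)"

definition mx :: "('a::euclidean_space \<Rightarrow> real) \<Rightarrow> 'a \<Rightarrow> real"
  where "mx u x = enn2real (maximal u x)"

lemma mx_measurable [measurable]: "u \<in> borel_measurable borel \<Longrightarrow> mx u \<in> borel_measurable borel"
  unfolding mx_def[abs_def] by measurable

lemma avg_measurable [measurable]: "u \<in> borel_measurable borel \<Longrightarrow> avg k u \<in> borel_measurable borel"
  unfolding avg_def[abs_def] by measurable

lemma avg_nonneg: "0 \<le> avg k u x" and mx_nonneg: "0 \<le> mx u x"
  by (simp_all add: avg_def mx_def)

lemma ball_avg_eq:
  assumes "bdd_borel u"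
  shows "ball_avg k u x = ennreal (avg k u x)"
  using order.strict_trans1[OF ball_avg_le_maximal maximal_finite[OF assms]] by (simp add: avg_def)

lemma avg_le_mx:
  assumes "bdd_borel u"
  shows "avg k u x \<le> mx u x"
  unfolding avg_def mx_def using maximal_finite[OF assms] by (intro enn2real_mono ball_avg_le_maximal) auto

text \<open>The bound that is effective at large scales: Hoelder between \<open>F\<close> and the
  indicator of the ball leaves the power \<open>a\<close> of the normalizing factor. At small scales
  the same average is controlled by the maximal function.\<close>

lemma avg_powr_le:
  fixes F :: "'a::euclidean_space \<Rightarrow> real"
  assumes F: "tame F" and F1: "(\<integral>\<^sup>+x. ennreal (F x) \<partial>lborel) \<le> 1" and a: "0 < a" "a \<le> 1"
  shows "avg k (\<lambda>x. F x powr a) x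
    \<le> measure lborel (ball (0::'a) 1) powr (1 - a) * 2 powr (- (real_of_int k * (real DIM('a) * a)))"
proof -
  define w where "w = measure lborel (ball (0::'a) 1)"
  have w: "0 < w" using unit_vol_pos by (simp add: w_def)
  define K where "K = real_of_int k * real DIM('a)"
  define g where "g y = (indicator (ball 0 (2 powr real_of_int k)) (x - y) :: real)" for y
  have eg: "ennreal (g y) = indicator (ball 0 (2 powr real_of_int k)) (x - y)" for y
    by (auto simp: g_def indicator_def)
  have [measurable]: "F \<in> borel_measurable borel" using F by measurable
  have g[measurable]: "g \<in> borel_measurable lborel"
  proof -
    have "(\<lambda>y. indicator (ball 0 (2 powr real_of_int k)) (x - y) :: real) \<in> borel_measurable borel"
      by (rule measurable_compose[of "\<lambda>y. x - y" borel borel, OF _ borel_measurable_indicator]) auto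
    then show ?thesis by (simp add: g_def[abs_def])
  qed
  have "2 powr K = (2 powr real_of_int k) ^ DIM('a)"
    by (simp add: K_def powr_powr powr_realpow[symmetric])
  then have gI: "(\<integral>\<^sup>+y. ennreal (g y) \<partial>lborel) = ennreal (2 powr K * w)"
    by (simp add: eg nn_integral_indicator_ball_minus emeasure_lborel_ball w_def)
  \<comment> \<open>An indicator equals every power of itself, even with exponent 0, since
    \<open>0 powr 0 = 0\<close>.\<close>
  have "(\<integral>\<^sup>+y. ennreal (F y powr a) * indicator (ball 0 (2 powr real_of_int k)) (x - y) \<partial>lborel)
      = (\<integral>\<^sup>+y. ennreal (F y powr a * g y powr (1 - a)) \<partial>lborel)"
    by (intro nn_integral_cong) (auto simp: g_def indicator_def)
  also have "\<dots> \<le> ennreal (1 powr a * (2 powr K * w) powr (1 - a))"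
  proof (rule nn_integral_Holder)
    show "(\<integral>\<^sup>+x. ennreal (F x) \<partial>lborel) \<le> ennreal 1" using F1 by simp
    show "0 \<le> g y" for y by (simp add: g_def)
  qed (use F a w gI in \<open>auto simp: tame_nonneg\<close>)
  finally have "ball_avg k (\<lambda>x. F x powr a) x \<le> ennreal (2 powr (- K)) * ennreal ((2 powr K * w) powr (1 - a))"
    unfolding ball_avg_def K_def by (intro mult_left_mono) auto
  also have "\<dots> = ennreal (2 powr (- K) * (2 powr K * w) powr (1 - a))"
    by (simp add: ennreal_mult)
  also have "2 powr (- K) * (2 powr K * w) powr (1 - a) = w powr (1 - a) * 2 powr (- (K * a))"
  proof -
    have "2 powr (- K) * (2 powr K * w) powr (1 - a) = w powr (1 - a) * (2 powr (- K) * 2 powr (K * (1 - a)))"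
      by (simp only: powr_mult powr_powr mult_ac)
    also have "2 powr (- K) * 2 powr (K * (1 - a)) = 2 powr (- (K * a))"
      unfolding powr_add[symmetric] by (simp add: algebra_simps)
    finally show ?thesis .
  qed
  finally have "avg k (\<lambda>x. F x powr a) x \<le> w powr (1 - a) * 2 powr (- (K * a))"
    unfolding ball_avg_eq[OF tame_powr_bdd_borel[OF F a(1)]] by (subst (asm) ennreal_le_iff) auto
  then show ?thesis by (simp add: w_def K_def mult.assoc)
qed

text \<open>\<open>F powr a\<close> has norm at most 1 in L^(1/a), and 1/a > 1 is in the range of
  the maximal theorem.\<close>

lemma mx_powr_integral:
  assumes a: "0 < a" "a < 1"
  shows "\<exists>C\<ge>0. \<forall>F::'a::euclidean_space \<Rightarrow> real. tame F \<and> (\<integral>\<^sup>+x. ennreal (F x) \<partial>lborel) \<le> 1 \<longrightarrow>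
    (\<integral>\<^sup>+x. ennreal (mx (\<lambda>x. F x powr a) x powr (1 / a)) \<partial>lborel) \<le> ennreal C"
proof -
  obtain C where C: "0 \<le> C" "\<And>u::'a \<Rightarrow> real. bdd_borel u \<Longrightarrow>
    (\<integral>\<^sup>+x. ennreal (mx u x powr (1 / a)) \<partial>lborel) \<le> ennreal C * (\<integral>\<^sup>+x. ennreal (u x powr (1 / a)) \<partial>lborel)"
    using maximal_strong_type[of "1 / a", where 'a = 'a] a by (auto simp: mx_def)
  have "(\<integral>\<^sup>+x. ennreal (mx (\<lambda>x. F x powr a) x powr (1 / a)) \<partial>lborel) \<le> ennreal C"
    if F: "tame F" "(\<integral>\<^sup>+x. ennreal (F x) \<partial>lborel) \<le> 1" for F :: "'a \<Rightarrow> real"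
  proof -
    have "(\<integral>\<^sup>+x. ennreal (mx (\<lambda>x. F x powr a) x powr (1 / a)) \<partial>lborel)
      \<le> ennreal C * (\<integral>\<^sup>+x. ennreal ((F x powr a) powr (1 / a)) \<partial>lborel)"
      by (rule C(2)[OF tame_powr_bdd_borel[OF F(1) a(1)]])
    also have "\<dots> = ennreal C * (\<integral>\<^sup>+x. ennreal (F x) \<partial>lborel)"
      using a tame_nonneg[OF F(1)] by (simp add: powr_powr)
    also have "\<dots> \<le> ennreal C * 1" using F by (intro mult_left_mono) auto
    finally show ?thesis by simp
  qed
  with C(1) show ?thesis by blast
qed

section \<open>Hedberg's pointwise bound\<close>

text \<open>At scale k the kernel contributes \<open>2 powr (k * (n * \<tau>))\<close> times an
  average. The average is at most the maximal function and also decays like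
  \<open>2 powr (- (k * (n * a)))\<close>, so the contributions grow at rate
  \<open>n * \<tau>\<close> up to a crossing scale and fall at rate \<open>n * (a - \<tau>)\<close>
  beyond it.\<close>

lemma riesz_pointwise:
  assumes t: "0 < \<tau>" "\<tau> < a" "a < 1"
  shows "\<exists>C\<ge>0. \<forall>F::'a::euclidean_space \<Rightarrow> real. tame F \<and> (\<integral>\<^sup>+x. ennreal (F x) \<partial>lborel) \<le> 1 \<longrightarrow>
    (\<forall>x. (\<integral>\<^sup>+y. ennreal (norm y powr (real DIM('a) * (\<tau> - 1))) * ennreal (F (x - y) powr a) \<partial>lborel)
      \<le> ennreal (C * mx (\<lambda>x. F x powr a) x powr ((a - \<tau>) / a)))"
proof -
  define n where "n = real DIM('a)"
  have n: "0 < n" by (simp add: n_def)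
  \<comment> \<open>One constant must serve both bounds; the \<open>1\<close> is for the bound by
    the maximal function.\<close>
  define D where "D = max 1 (measure lborel (ball (0::'a) 1) powr (1 - a))"
  have "0 < n * \<tau>" "0 < n * (a - \<tau>)" "0 \<le> D" using n t by (auto simp: D_def)
  from suminf_dyadic_crossing[OF this] obtain C where C: "0 \<le> C" "\<And>M e. 0 \<le> M \<Longrightarrow>
    (\<And>k. 0 \<le> e k \<and> e k \<le> D * M * 2 powr (real_of_int k * (n * \<tau>)) \<and> e k \<le> D * 2 powr (- (real_of_int k * (n * (a - \<tau>)))))
    \<Longrightarrow> (\<Sum>j. ennreal (e (int_decode j))) \<le> ennreal (C * M powr (n * (a - \<tau>) / (n * \<tau> + n * (a - \<tau>))))"
    by blast
  define c where "c = n * (\<tau> - 1)"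
  have th: "n * (a - \<tau>) / (n * \<tau> + n * (a - \<tau>)) = (a - \<tau>) / a"
    using n t by (simp add: distrib_left[symmetric])
  have "(\<integral>\<^sup>+y. ennreal (norm y powr c) * ennreal (F (x - y) powr a) \<partial>lborel)
      \<le> ennreal (2 powr \<bar>c\<bar> * C * mx (\<lambda>x. F x powr a) x powr ((a - \<tau>) / a))"
    if F: "tame F" "(\<integral>\<^sup>+x. ennreal (F x) \<partial>lborel) \<le> 1" for F :: "'a \<Rightarrow> real" and x
  proof -
    define u where "u x = F x powr a" for x
    have bu: "bdd_borel u" unfolding u_def by (rule tame_powr_bdd_borel) (use F t in auto)
    then have [measurable]: "u \<in> borel_measurable borel" by (simp add: bdd_borel_def)
    \<comment> \<open>The kernel exponent \<open>c\<close> and the volume exponent \<open>n\<close>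
      add up to \<open>n * \<tau>\<close>.\<close>
    define e where "e k = 2 powr (real_of_int k * (n * \<tau>)) * avg k u x" for k
    have e: "0 \<le> e k \<and> e k \<le> D * mx u x * 2 powr (real_of_int k * (n * \<tau>)) \<and> e k \<le> D * 2 powr (- (real_of_int k * (n * (a - \<tau>))))" for k
    proof (intro conjI)
      have "avg k u x \<le> D * mx u x"
        using avg_le_mx[OF bu, of k x] mult_right_mono[of 1 D "mx u x"] mx_nonneg[of u x] by (simp add: D_def)
      then have "2 powr (real_of_int k * (n * \<tau>)) * avg k u x \<le> 2 powr (real_of_int k * (n * \<tau>)) * (D * mx u x)"
        by (rule mult_left_mono) simp
      then show "e k \<le> D * mx u x * 2 powr (real_of_int k * (n * \<tau>))" by (simp add: e_def mult_ac)
      have "avg k u x \<le> measure lborel (ball (0::'a) 1) powr (1 - a) * 2 powr (- (real_of_int k * (n * a)))"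
        unfolding u_def n_def by (rule avg_powr_le) (use F t in auto)
      also have "\<dots> \<le> D * 2 powr (- (real_of_int k * (n * a)))" by (intro mult_right_mono) (auto simp: D_def)
      finally have "e k \<le> 2 powr (real_of_int k * (n * \<tau>)) * (D * 2 powr (- (real_of_int k * (n * a))))"
        unfolding e_def by (rule mult_left_mono) simp
      also have "\<dots> = D * (2 powr (real_of_int k * (n * \<tau>)) * 2 powr (- (real_of_int k * (n * a))))" by simp
      also have "\<dots> = D * 2 powr (- (real_of_int k * (n * (a - \<tau>))))"
        unfolding powr_add[symmetric] by (simp add: algebra_simps)
      finally show "e k \<le> D * 2 powr (- (real_of_int k * (n * (a - \<tau>))))" .
    qed (simp add: e_def avg_nonneg)
    have dyad: "ennreal (2 powr \<bar>c\<bar> * 2 powr (real_of_int k * c)) *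
        (\<integral>\<^sup>+y. ennreal (u (x - y)) * indicator (ball 0 (2 powr real_of_int k)) y \<partial>lborel)
      = ennreal (2 powr \<bar>c\<bar>) * ennreal (e k)" for k
    proof -
      define J where "J = (\<integral>\<^sup>+y. ennreal (u y) * indicator (ball 0 (2 powr real_of_int k)) (x - y) \<partial>lborel)"
      have "(\<integral>\<^sup>+y. ennreal (u (x - y)) * indicator (ball 0 (2 powr real_of_int k)) (x - (x - y)) \<partial>lborel) = J"
        unfolding J_def by (rule nn_integral_lborel_minus) measurable
      then have 1: "(\<integral>\<^sup>+y. ennreal (u (x - y)) * indicator (ball 0 (2 powr real_of_int k)) y \<partial>lborel) = J" by simp
      have "ennreal (e k) = ennreal (2 powr (real_of_int k * (n * \<tau>))) * ball_avg k u x"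
        unfolding e_def ball_avg_eq[OF bu] by (simp add: ennreal_mult avg_nonneg)
      also have "\<dots> = (ennreal (2 powr (real_of_int k * (n * \<tau>))) * ennreal (2 powr (- (real_of_int k * n)))) * J"
        by (simp add: ball_avg_def J_def n_def mult.assoc)
      also have "ennreal (2 powr (real_of_int k * (n * \<tau>))) * ennreal (2 powr (- (real_of_int k * n))) = ennreal (2 powr (real_of_int k * c))"
        by (simp add: ennreal_mult[symmetric] powr_add[symmetric] c_def algebra_simps)
      finally show ?thesis unfolding 1 by (simp add: ennreal_mult mult_ac)
    qed
    have "(\<integral>\<^sup>+y. ennreal (norm y powr c) * ennreal (u (x - y)) \<partial>lborel)
      \<le> (\<Sum>j. ennreal (2 powr \<bar>c\<bar> * 2 powr (real_of_int (int_decode j) * c)) *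
        (\<integral>\<^sup>+y. ennreal (u (x - y)) * indicator (ball 0 (2 powr real_of_int (int_decode j))) y \<partial>lborel))"
      by (rule nn_integral_dyadic_kernel_le) measurable
    also have "\<dots> = ennreal (2 powr \<bar>c\<bar>) * (\<Sum>j. ennreal (e (int_decode j)))"
      unfolding dyad by simp
    also have "\<dots> \<le> ennreal (2 powr \<bar>c\<bar>) * ennreal (C * mx u x powr ((a - \<tau>) / a))"
    proof (rule mult_left_mono)
      have "(\<Sum>j. ennreal (e (int_decode j))) \<le> ennreal (C * mx u x powr (n * (a - \<tau>) / (n * \<tau> + n * (a - \<tau>))))"
        by (rule C(2)) (rule mx_nonneg, rule e)
      then show "(\<Sum>j. ennreal (e (int_decode j))) \<le> ennreal (C * mx u x powr ((a - \<tau>) / a))"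
        unfolding th .
    qed simp
    also have "\<dots> = ennreal (2 powr \<bar>c\<bar> * C * mx u x powr ((a - \<tau>) / a))"
      using C(1) by (simp add: ennreal_mult[symmetric] mult.assoc)
    finally show ?thesis by (simp add: u_def[abs_def])
  qed
  with C(1) show ?thesis by (intro exI[of _ "2 powr \<bar>c\<bar> * C"]) (auto simp: c_def n_def)
qed

text \<open>With \<open>a = 1/p\<close> and \<open>\<tau> = s/n\<close> the target exponent is
  \<open>1 / (a - \<tau>)\<close>, and the pointwise bound raised to it is a multiple of the power
  \<open>1 / a\<close> of the maximal function, which is integrable.\<close>

theorem Hardy_Littlewood_Sobolev:
  assumes t: "0 < \<tau>" "\<tau> < a" "a < 1"
  shows "\<exists>C\<ge>0. \<forall>F::'a::euclidean_space \<Rightarrow> real. tame F \<and> (\<integral>\<^sup>+x. ennreal (F x) \<partial>lborel) \<le> 1 \<longrightarrow>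
    (\<forall>x. (\<integral>\<^sup>+y. ennreal (norm y powr (real DIM('a) * (\<tau> - 1))) * ennreal (F (x - y) powr a) \<partial>lborel) < \<infinity>) \<and>
    (\<integral>\<^sup>+x. ennreal (enn2real (\<integral>\<^sup>+y. ennreal (norm y powr (real DIM('a) * (\<tau> - 1))) * ennreal (F (x - y) powr a) \<partial>lborel)
        powr (1 / (a - \<tau>))) \<partial>lborel) \<le> ennreal C"
proof -
  obtain C1 where C1: "0 \<le> C1" "\<And>F x. tame F \<Longrightarrow> (\<integral>\<^sup>+x. ennreal (F x) \<partial>lborel) \<le> 1 \<Longrightarrow>
    (\<integral>\<^sup>+y. ennreal (norm y powr (real DIM('a) * (\<tau> - 1))) * ennreal (F ((x::'a) - y) powr a) \<partial>lborel)
      \<le> ennreal (C1 * mx (\<lambda>x. F x powr a) x powr ((a - \<tau>) / a))"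
    using riesz_pointwise[OF t, where 'a = 'a] by blast
  obtain C2 where C2: "0 \<le> C2" "\<And>F::'a \<Rightarrow> real. tame F \<Longrightarrow> (\<integral>\<^sup>+x. ennreal (F x) \<partial>lborel) \<le> 1 \<Longrightarrow>
    (\<integral>\<^sup>+x. ennreal (mx (\<lambda>x. F x powr a) x powr (1 / a)) \<partial>lborel) \<le> ennreal C2"
    using mx_powr_integral[of a, where 'a = 'a] t by auto
  define q where "q = 1 / (a - \<tau>)"
  have q: "0 < q" using t by (simp add: q_def)
  show ?thesis
  proof (rule exI[of _ "C1 powr q * C2"], intro conjI allI impI; (elim conjE)?)
    show "0 \<le> C1 powr q * C2" using C2(1) by simp
    fix F :: "'a \<Rightarrow> real"
    assume F: "tame F" "(\<integral>\<^sup>+x. ennreal (F x) \<partial>lborel) \<le> 1"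
    show "(\<integral>\<^sup>+y. ennreal (norm y powr (real DIM('a) * (\<tau> - 1))) * ennreal (F (x - y) powr a) \<partial>lborel) < \<infinity>" for x
      using C1(2)[OF F, of x] by (rule order.strict_trans1) simp
    have [measurable]: "F \<in> borel_measurable borel" by (rule tame_measurable[OF F(1)])
    define I where "I x = enn2real (\<integral>\<^sup>+y. ennreal (norm y powr (real DIM('a) * (\<tau> - 1))) * ennreal (F (x - y) powr a) \<partial>lborel)" for x
    have "I x \<le> C1 * mx (\<lambda>x. F x powr a) x powr ((a - \<tau>) / a)" for x
      unfolding I_def using C1(2)[OF F, of x] C1(1) by (intro enn2real_leI) auto
    then have "I x powr q \<le> (C1 * mx (\<lambda>x. F x powr a) x powr ((a - \<tau>) / a)) powr q" for x
      using q by (intro powr_mono2) (auto simp: I_def)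
    also have "(C1 * mx (\<lambda>x. F x powr a) x powr ((a - \<tau>) / a)) powr q = C1 powr q * mx (\<lambda>x. F x powr a) x powr (1 / a)" for x
      using t by (simp add: powr_mult powr_powr q_def)
    finally have "(\<integral>\<^sup>+x. ennreal (I x powr q) \<partial>lborel) \<le> (\<integral>\<^sup>+x. ennreal (C1 powr q) * ennreal (mx (\<lambda>x. F x powr a) x powr (1 / a)) \<partial>lborel)"
      by (intro nn_integral_mono) (auto simp: ennreal_mult[symmetric] intro!: ennreal_leI)
    also have "\<dots> = ennreal (C1 powr q) * (\<integral>\<^sup>+x. ennreal (mx (\<lambda>x. F x powr a) x powr (1 / a)) \<partial>lborel)"
      by (rule nn_integral_cmult) measurable
    also have "\<dots> \<le> ennreal (C1 powr q) * ennreal C2"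
      by (intro mult_left_mono C2(2) F) simp
    also have "\<dots> = ennreal (C1 powr q * C2)" using C2(1) by (simp add: ennreal_mult)
    finally show "(\<integral>\<^sup>+x. ennreal (enn2real (\<integral>\<^sup>+y. ennreal (norm y powr (real DIM('a) * (\<tau> - 1))) * ennreal (F (x - y) powr a) \<partial>lborel)
        powr (1 / (a - \<tau>))) \<partial>lborel) \<le> ennreal (C1 powr q * C2)"
      by (simp add: I_def q_def)
  qed
qed

subsection \<open>Bilinear fractional integrals\<close>

text \<open>The maps \<open>\<pi>1\<close>, \<open>\<pi>2\<close> let one definition cover both
  kernels: \<open>fst\<close> and \<open>snd\<close> on the product space, \<open>y\<close> and
  \<open>c *\<^sub>R y\<close> on a single copy. The value is an \<open>ennreal\<close>, so no
  integrability is presupposed.\<close>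

definition bop :: "('b::euclidean_space \<Rightarrow> real) \<Rightarrow> ('b \<Rightarrow> 'a::euclidean_space) \<Rightarrow> ('b \<Rightarrow> 'a) \<Rightarrow>
    ('a \<Rightarrow> real) \<Rightarrow> ('a \<Rightarrow> real) \<Rightarrow> 'a \<Rightarrow> ennreal"
  where "bop K \<pi>1 \<pi>2 u v x = (\<integral>\<^sup>+z. ennreal (K z) * ennreal (u (x - \<pi>1 z) * v (x - \<pi>2 z)) \<partial>lborel)"

text \<open>With \<open>F = f\<^bsup>p\<^sub>1\<^esup>\<close>, \<open>\<alpha> = 1/p\<^sub>1\<close> and \<open>r = 1/q\<close> this is the bound \<open>L\<^bsup>p\<^sub>1\<^esup> \<times> L\<^bsup>p\<^sub>2\<^esup> \<rightarrow> L\<^sup>q\<close> on the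
  unit balls. In this parametrization interpolation is just Hoelder's inequality.\<close>

definition bop_bounded :: "('b::euclidean_space \<Rightarrow> real) \<Rightarrow> ('b \<Rightarrow> 'a::euclidean_space) \<Rightarrow> ('b \<Rightarrow> 'a) \<Rightarrow>
    real \<Rightarrow> real \<Rightarrow> real \<Rightarrow> bool"
  where "bop_bounded K \<pi>1 \<pi>2 \<alpha> \<beta> r \<longleftrightarrow> (\<exists>C\<ge>0. \<forall>F G. tame F \<and> tame G \<and>
    (\<integral>\<^sup>+x. ennreal (F x) \<partial>lborel) \<le> 1 \<and> (\<integral>\<^sup>+x. ennreal (G x) \<partial>lborel) \<le> 1 \<longrightarrow>
    (\<forall>x. bop K \<pi>1 \<pi>2 (\<lambda>x. F x powr \<alpha>) (\<lambda>x. G x powr \<beta>) x < \<infinity>) \<and>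
    (\<integral>\<^sup>+x. ennreal (enn2real (bop K \<pi>1 \<pi>2 (\<lambda>x. F x powr \<alpha>) (\<lambda>x. G x powr \<beta>) x) powr (1 / r)) \<partial>lborel) \<le> ennreal C)"

lemma bop_boundedI:
  assumes "0 \<le> C" "\<And>F G x. tame F \<Longrightarrow> tame G \<Longrightarrow> (\<integral>\<^sup>+x. ennreal (F x) \<partial>lborel) \<le> 1 \<Longrightarrow>
      (\<integral>\<^sup>+x. ennreal (G x) \<partial>lborel) \<le> 1 \<Longrightarrow> bop K \<pi>1 \<pi>2 (\<lambda>x. F x powr \<alpha>) (\<lambda>x. G x powr \<beta>) x < \<infinity>"
    "\<And>F G. tame F \<Longrightarrow> tame G \<Longrightarrow> (\<integral>\<^sup>+x. ennreal (F x) \<partial>lborel) \<le> 1 \<Longrightarrow> (\<integral>\<^sup>+x. ennreal (G x) \<partial>lborel) \<le> 1 \<Longrightarrow>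
      (\<integral>\<^sup>+x. ennreal (enn2real (bop K \<pi>1 \<pi>2 (\<lambda>x. F x powr \<alpha>) (\<lambda>x. G x powr \<beta>) x) powr (1 / r)) \<partial>lborel) \<le> ennreal C"
  shows "bop_bounded K \<pi>1 \<pi>2 \<alpha> \<beta> r"
  unfolding bop_bounded_def using assms by blast

lemma bop_boundedE:
  assumes "bop_bounded K \<pi>1 \<pi>2 \<alpha> \<beta> r"
  obtains C where "0 \<le> C" "\<And>F G x. tame F \<Longrightarrow> tame G \<Longrightarrow> (\<integral>\<^sup>+x. ennreal (F x) \<partial>lborel) \<le> 1 \<Longrightarrow>
      (\<integral>\<^sup>+x. ennreal (G x) \<partial>lborel) \<le> 1 \<Longrightarrow> bop K \<pi>1 \<pi>2 (\<lambda>x. F x powr \<alpha>) (\<lambda>x. G x powr \<beta>) x < \<infinity>"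
    "\<And>F G. tame F \<Longrightarrow> tame G \<Longrightarrow> (\<integral>\<^sup>+x. ennreal (F x) \<partial>lborel) \<le> 1 \<Longrightarrow> (\<integral>\<^sup>+x. ennreal (G x) \<partial>lborel) \<le> 1 \<Longrightarrow>
      (\<integral>\<^sup>+x. ennreal (enn2real (bop K \<pi>1 \<pi>2 (\<lambda>x. F x powr \<alpha>) (\<lambda>x. G x powr \<beta>) x) powr (1 / r)) \<partial>lborel) \<le> ennreal C"
  using assms unfolding bop_bounded_def by blast

lemma bop_measurable:
  assumes [measurable]: "K \<in> borel_measurable borel" "\<pi>1 \<in> borel_measurable borel" "\<pi>2 \<in> borel_measurable borel"
    "u \<in> borel_measurable borel" "v \<in> borel_measurable borel"
  shows "bop K \<pi>1 \<pi>2 u v \<in> borel_measurable borel"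
proof -
  have "(\<lambda>x. bop K \<pi>1 \<pi>2 u v x) \<in> borel_measurable borel" unfolding bop_def by measurable
  then show ?thesis by simp
qed

text \<open>Both operators are positive and act on powers of the same \<open>F\<close> and
  \<open>G\<close>, so the integrand for \<open>K\<close> is pointwise a geometric mean of the two
  given ones. Hoelder in z bounds the operator by a geometric mean of operators, and Hoelder in x
  then bounds its norm.\<close>

lemma bop_bounded_interpolate:
  fixes K :: "'b::euclidean_space \<Rightarrow> real" and \<pi>1 \<pi>2 :: "'b \<Rightarrow> 'a::euclidean_space"
  assumes 1: "bop_bounded K1 \<pi>1 \<pi>2 \<alpha>1 \<beta>1 r1" and 2: "bop_bounded K2 \<pi>1 \<pi>2 \<alpha>2 \<beta>2 r2"
    and [measurable]: "K1 \<in> borel_measurable borel" "K2 \<in> borel_measurable borel"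
      "\<pi>1 \<in> borel_measurable borel" "\<pi>2 \<in> borel_measurable borel"
    and K0: "\<And>z. 0 \<le> K1 z" "\<And>z. 0 \<le> K2 z"
    and l: "0 < l" "l < 1" and r: "0 < r1" "0 < r2"
    and K: "\<And>z. K z = K1 z powr l * K2 z powr (1 - l)"
    and \<alpha>: "\<alpha> = l * \<alpha>1 + (1 - l) * \<alpha>2" and \<beta>: "\<beta> = l * \<beta>1 + (1 - l) * \<beta>2" and r': "r = l * r1 + (1 - l) * r2"
  shows "bop_bounded K \<pi>1 \<pi>2 \<alpha> \<beta> r"
proof -
  obtain C1 where C1: "0 \<le> C1" "\<And>F G x. tame F \<Longrightarrow> tame G \<Longrightarrow> (\<integral>\<^sup>+x. ennreal (F x) \<partial>lborel) \<le> 1 \<Longrightarrow>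
      (\<integral>\<^sup>+x. ennreal (G x) \<partial>lborel) \<le> 1 \<Longrightarrow> bop K1 \<pi>1 \<pi>2 (\<lambda>x. F x powr \<alpha>1) (\<lambda>x. G x powr \<beta>1) x < \<infinity>"
    "\<And>F G. tame F \<Longrightarrow> tame G \<Longrightarrow> (\<integral>\<^sup>+x. ennreal (F x) \<partial>lborel) \<le> 1 \<Longrightarrow> (\<integral>\<^sup>+x. ennreal (G x) \<partial>lborel) \<le> 1 \<Longrightarrow>
      (\<integral>\<^sup>+x. ennreal (enn2real (bop K1 \<pi>1 \<pi>2 (\<lambda>x. F x powr \<alpha>1) (\<lambda>x. G x powr \<beta>1) x) powr (1 / r1)) \<partial>lborel) \<le> ennreal C1"
    using bop_boundedE[OF 1] by blast
  obtain C2 where C2: "0 \<le> C2" "\<And>F G x. tame F \<Longrightarrow> tame G \<Longrightarrow> (\<integral>\<^sup>+x. ennreal (F x) \<partial>lborel) \<le> 1 \<Longrightarrow>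
      (\<integral>\<^sup>+x. ennreal (G x) \<partial>lborel) \<le> 1 \<Longrightarrow> bop K2 \<pi>1 \<pi>2 (\<lambda>x. F x powr \<alpha>2) (\<lambda>x. G x powr \<beta>2) x < \<infinity>"
    "\<And>F G. tame F \<Longrightarrow> tame G \<Longrightarrow> (\<integral>\<^sup>+x. ennreal (F x) \<partial>lborel) \<le> 1 \<Longrightarrow> (\<integral>\<^sup>+x. ennreal (G x) \<partial>lborel) \<le> 1 \<Longrightarrow>
      (\<integral>\<^sup>+x. ennreal (enn2real (bop K2 \<pi>1 \<pi>2 (\<lambda>x. F x powr \<alpha>2) (\<lambda>x. G x powr \<beta>2) x) powr (1 / r2)) \<partial>lborel) \<le> ennreal C2"
    using bop_boundedE[OF 2] by blast
  have r0: "0 < r" using l r unfolding r' by (intro add_pos_pos mult_pos_pos) auto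
  \<comment> \<open>Determined by \<open>l / r = m / r1\<close> and
    \<open>(1 - l) / r = (1 - m) / r2\<close>, which turns \<open>b1 powr (l / r)\<close> into a
    power of \<open>b1 powr (1 / r1)\<close>.\<close>
  define m where "m = l * r1 / r"
  have m: "0 \<le> m" "m \<le> 1" "1 - m = (1 - l) * r2 / r"
    using r0 l r by (auto simp: m_def r' field_simps)
  have main: "bop K \<pi>1 \<pi>2 (\<lambda>x. F x powr \<alpha>) (\<lambda>x. G x powr \<beta>) x
     \<le> ennreal (enn2real (bop K1 \<pi>1 \<pi>2 (\<lambda>x. F x powr \<alpha>1) (\<lambda>x. G x powr \<beta>1) x) powr l *
         enn2real (bop K2 \<pi>1 \<pi>2 (\<lambda>x. F x powr \<alpha>2) (\<lambda>x. G x powr \<beta>2) x) powr (1 - l))"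
    if F: "tame F" "(\<integral>\<^sup>+x. ennreal (F x) \<partial>lborel) \<le> 1" and G: "tame G" "(\<integral>\<^sup>+x. ennreal (G x) \<partial>lborel) \<le> 1" for F G x
  proof -
    have [measurable]: "F \<in> borel_measurable borel" "G \<in> borel_measurable borel" using F G by (auto dest: tame_measurable)
    define h1 where "h1 z = K1 z * (F (x - \<pi>1 z) powr \<alpha>1 * G (x - \<pi>2 z) powr \<beta>1)" for z
    define h2 where "h2 z = K2 z * (F (x - \<pi>1 z) powr \<alpha>2 * G (x - \<pi>2 z) powr \<beta>2)" for z
    have "h1 z powr l * h2 z powr (1 - l) = K z * (F (x - \<pi>1 z) powr \<alpha> * G (x - \<pi>2 z) powr \<beta>)" for z
    proof -
      have "h1 z powr l * h2 z powr (1 - l) = (K1 z powr l * K2 z powr (1 - l)) *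
        ((F (x - \<pi>1 z) powr (\<alpha>1 * l) * F (x - \<pi>1 z) powr (\<alpha>2 * (1 - l))) *
        (G (x - \<pi>2 z) powr (\<beta>1 * l) * G (x - \<pi>2 z) powr (\<beta>2 * (1 - l))))"
        unfolding h1_def h2_def by (simp only: powr_mult powr_powr mult_ac)
      then show ?thesis unfolding K \<alpha> \<beta> powr_add[symmetric] by (simp only: mult.commute)
    qed
    then have "bop K \<pi>1 \<pi>2 (\<lambda>x. F x powr \<alpha>) (\<lambda>x. G x powr \<beta>) x = (\<integral>\<^sup>+z. ennreal (h1 z powr l * h2 z powr (1 - l)) \<partial>lborel)"
      unfolding bop_def by (intro nn_integral_cong) (simp add: ennreal_mult K K0)
    also have "\<dots> \<le> ennreal (enn2real (bop K1 \<pi>1 \<pi>2 (\<lambda>x. F x powr \<alpha>1) (\<lambda>x. G x powr \<beta>1) x) powr l *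
         enn2real (bop K2 \<pi>1 \<pi>2 (\<lambda>x. F x powr \<alpha>2) (\<lambda>x. G x powr \<beta>2) x) powr (1 - l))"
    proof (rule nn_integral_Holder)
      show "h1 \<in> borel_measurable lborel" "h2 \<in> borel_measurable lborel" unfolding h1_def[abs_def] h2_def[abs_def] by measurable
      have "(\<integral>\<^sup>+z. ennreal (h1 z) \<partial>lborel) = bop K1 \<pi>1 \<pi>2 (\<lambda>x. F x powr \<alpha>1) (\<lambda>x. G x powr \<beta>1) x"
        unfolding bop_def h1_def by (intro nn_integral_cong) (simp add: ennreal_mult K0)
      also have "\<dots> = ennreal (enn2real (bop K1 \<pi>1 \<pi>2 (\<lambda>x. F x powr \<alpha>1) (\<lambda>x. G x powr \<beta>1) x))"
        using C1(2)[OF F(1) G(1) F(2) G(2), of x] by simp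
      finally show "(\<integral>\<^sup>+z. ennreal (h1 z) \<partial>lborel) \<le> ennreal (enn2real (bop K1 \<pi>1 \<pi>2 (\<lambda>x. F x powr \<alpha>1) (\<lambda>x. G x powr \<beta>1) x))" by simp
      have "(\<integral>\<^sup>+z. ennreal (h2 z) \<partial>lborel) = bop K2 \<pi>1 \<pi>2 (\<lambda>x. F x powr \<alpha>2) (\<lambda>x. G x powr \<beta>2) x"
        unfolding bop_def h2_def by (intro nn_integral_cong) (simp add: ennreal_mult K0)
      also have "\<dots> = ennreal (enn2real (bop K2 \<pi>1 \<pi>2 (\<lambda>x. F x powr \<alpha>2) (\<lambda>x. G x powr \<beta>2) x))"
        using C2(2)[OF F(1) G(1) F(2) G(2), of x] by simp
      finally show "(\<integral>\<^sup>+z. ennreal (h2 z) \<partial>lborel) \<le> ennreal (enn2real (bop K2 \<pi>1 \<pi>2 (\<lambda>x. F x powr \<alpha>2) (\<lambda>x. G x powr \<beta>2) x))" by simp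
    qed (use l K0 in \<open>auto simp: h1_def h2_def\<close>)
    finally show ?thesis .
  qed
  show ?thesis
  proof (rule bop_boundedI)
    show "0 \<le> C1 powr m * C2 powr (1 - m)" by simp
    fix F G :: "'a \<Rightarrow> real"
    assume F: "tame F" and G: "tame G" and F1: "(\<integral>\<^sup>+x. ennreal (F x) \<partial>lborel) \<le> 1" and G1: "(\<integral>\<^sup>+x. ennreal (G x) \<partial>lborel) \<le> 1"
    show "bop K \<pi>1 \<pi>2 (\<lambda>x. F x powr \<alpha>) (\<lambda>x. G x powr \<beta>) x < \<infinity>" for x
      using main[OF F F1 G G1, of x] by (rule order.strict_trans1) simp
    have [measurable]: "F \<in> borel_measurable borel" "G \<in> borel_measurable borel" using F G by (auto dest: tame_measurable)
    define b1 where "b1 x = enn2real (bop K1 \<pi>1 \<pi>2 (\<lambda>x. F x powr \<alpha>1) (\<lambda>x. G x powr \<beta>1) x)" for x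
    define b2 where "b2 x = enn2real (bop K2 \<pi>1 \<pi>2 (\<lambda>x. F x powr \<alpha>2) (\<lambda>x. G x powr \<beta>2) x)" for x
    have b: "0 \<le> b1 x" "0 \<le> b2 x" for x by (auto simp: b1_def b2_def)
    have bm[measurable]: "b1 \<in> borel_measurable borel" "b2 \<in> borel_measurable borel"
      unfolding b1_def[abs_def] b2_def[abs_def] by (intro measurable_compose[OF bop_measurable borel_measurable_enn2real]; measurable)+
    have "enn2real (bop K \<pi>1 \<pi>2 (\<lambda>x. F x powr \<alpha>) (\<lambda>x. G x powr \<beta>) x) powr (1 / r)
        \<le> (b1 x powr (1 / r1)) powr m * (b2 x powr (1 / r2)) powr (1 - m)" for x
    proof -
      have "enn2real (bop K \<pi>1 \<pi>2 (\<lambda>x. F x powr \<alpha>) (\<lambda>x. G x powr \<beta>) x) \<le> b1 x powr l * b2 x powr (1 - l)"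
        using main[OF F F1 G G1, of x] by (intro enn2real_leI) (auto simp: b1_def b2_def)
      then have "enn2real (bop K \<pi>1 \<pi>2 (\<lambda>x. F x powr \<alpha>) (\<lambda>x. G x powr \<beta>) x) powr (1 / r)
         \<le> (b1 x powr l * b2 x powr (1 - l)) powr (1 / r)"
        using r0 by (intro powr_mono2) auto
      also have "\<dots> = (b1 x powr (1 / r1)) powr m * (b2 x powr (1 / r2)) powr (1 - m)"
        unfolding m(3) using r by (simp add: powr_mult powr_powr m_def)
      finally show ?thesis .
    qed
    then have "(\<integral>\<^sup>+x. ennreal (enn2real (bop K \<pi>1 \<pi>2 (\<lambda>x. F x powr \<alpha>) (\<lambda>x. G x powr \<beta>) x) powr (1 / r)) \<partial>lborel)
       \<le> (\<integral>\<^sup>+x. ennreal ((b1 x powr (1 / r1)) powr m * (b2 x powr (1 / r2)) powr (1 - m)) \<partial>lborel)"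
      by (intro nn_integral_mono ennreal_leI)
    also have "\<dots> \<le> ennreal (C1 powr m * C2 powr (1 - m))"
    proof (rule nn_integral_Holder)
      show "(\<lambda>x. b1 x powr (1 / r1)) \<in> borel_measurable lborel" "(\<lambda>x. b2 x powr (1 / r2)) \<in> borel_measurable lborel" by measurable
      show "(\<integral>\<^sup>+x. ennreal (b1 x powr (1 / r1)) \<partial>lborel) \<le> ennreal C1"
        unfolding b1_def by (rule C1(3)[OF F G F1 G1])
      show "(\<integral>\<^sup>+x. ennreal (b2 x powr (1 / r2)) \<partial>lborel) \<le> ennreal C2"
        unfolding b2_def by (rule C2(3)[OF F G F1 G1])
    qed (use m C1 C2 in auto)
    finally show "(\<integral>\<^sup>+x. ennreal (enn2real (bop K \<pi>1 \<pi>2 (\<lambda>x. F x powr \<alpha>) (\<lambda>x. G x powr \<beta>) x) powr (1 / r)) \<partial>lborel)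
       \<le> ennreal (C1 powr m * C2 powr (1 - m))" .
  qed
qed

section \<open>The Riesz kernel: endpoints with one bounded factor\<close>

text \<open>For \<open>\<tau> = s/n\<close> this is |y|^(s-n). The exponent is affine in
  \<open>\<tau>\<close>, so geometric means of such kernels are again of this form.\<close>

definition riesz :: "real \<Rightarrow> 'a::euclidean_space \<Rightarrow> real"
  where "riesz \<tau> y = norm y powr (real DIM('a) * (\<tau> - 1))"

lemma riesz_measurable [measurable]: "riesz \<tau> \<in> borel_measurable borel"
  unfolding riesz_def[abs_def] by measurable

lemma riesz_nonneg: "0 \<le> riesz \<tau> y" by (simp add: riesz_def)

text \<open>The endpoint with the second function in L^\<infinity>: \<open>G x powr 0\<close> is at
  most 1 (and 0 where \<open>G\<close> vanishes), and what remains is a linear Riesz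
  potential.\<close>

lemma bop_bounded_left:
  assumes t: "0 < \<tau>" "\<tau> < a" "a < 1"
  shows "bop_bounded (riesz \<tau>) (\<lambda>y. y :: 'a::euclidean_space) (\<lambda>y. c *\<^sub>R y) a 0 (a - \<tau>)"
proof -
  obtain C where C: "0 \<le> C" "\<And>F x. tame F \<Longrightarrow> (\<integral>\<^sup>+x. ennreal (F x) \<partial>lborel) \<le> 1 \<Longrightarrow>
      (\<integral>\<^sup>+y. ennreal (norm y powr (real DIM('a) * (\<tau> - 1))) * ennreal (F ((x::'a) - y) powr a) \<partial>lborel) < \<infinity>"
    "\<And>F. tame F \<Longrightarrow> (\<integral>\<^sup>+x. ennreal (F x) \<partial>lborel) \<le> 1 \<Longrightarrow>
    (\<integral>\<^sup>+x. ennreal (enn2real (\<integral>\<^sup>+y. ennreal (norm y powr (real DIM('a) * (\<tau> - 1))) * ennreal (F ((x::'a) - y) powr a) \<partial>lborel)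
        powr (1 / (a - \<tau>))) \<partial>lborel) \<le> ennreal C"
    using Hardy_Littlewood_Sobolev[OF t, where 'a = 'a] by blast
  have le: "bop (riesz \<tau>) (\<lambda>y. y) (\<lambda>y. c *\<^sub>R y) (\<lambda>x. F x powr a) (\<lambda>x. G x powr 0) x
     \<le> (\<integral>\<^sup>+y. ennreal (norm y powr (real DIM('a) * (\<tau> - 1))) * ennreal (F ((x::'a) - y) powr a) \<partial>lborel)" for F G x
    unfolding bop_def riesz_def by (intro nn_integral_mono mult_left_mono ennreal_leI) auto
  show ?thesis
  proof (rule bop_boundedI[OF C(1)])
    fix F G :: "'a \<Rightarrow> real"
    assume F: "tame F" "(\<integral>\<^sup>+x. ennreal (F x) \<partial>lborel) \<le> 1"
    show "bop (riesz \<tau>) (\<lambda>y. y) (\<lambda>y. c *\<^sub>R y) (\<lambda>x. F x powr a) (\<lambda>x. G x powr 0) x < \<infinity>" for x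
      using le C(2)[OF F] by (rule order.strict_trans1)
    have "enn2real (bop (riesz \<tau>) (\<lambda>y. y) (\<lambda>y. c *\<^sub>R y) (\<lambda>x. F x powr a) (\<lambda>x. G x powr 0) x) powr (1 / (a - \<tau>))
       \<le> enn2real (\<integral>\<^sup>+y. ennreal (norm y powr (real DIM('a) * (\<tau> - 1))) * ennreal (F ((x::'a) - y) powr a) \<partial>lborel) powr (1 / (a - \<tau>))" for x
      using le[of F G x] C(2)[OF F, of x] t by (intro powr_mono2 enn2real_mono) auto
    then have "(\<integral>\<^sup>+x. ennreal (enn2real (bop (riesz \<tau>) (\<lambda>y. y) (\<lambda>y. c *\<^sub>R y) (\<lambda>x. F x powr a) (\<lambda>x. G x powr 0) x) powr (1 / (a - \<tau>))) \<partial>lborel)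
      \<le> (\<integral>\<^sup>+x. ennreal (enn2real (\<integral>\<^sup>+y. ennreal (norm y powr (real DIM('a) * (\<tau> - 1))) * ennreal (F ((x::'a) - y) powr a) \<partial>lborel)
        powr (1 / (a - \<tau>))) \<partial>lborel)"
      by (intro nn_integral_mono ennreal_leI)
    also have "\<dots> \<le> ennreal C" by (rule C(3)[OF F])
    finally show "(\<integral>\<^sup>+x. ennreal (enn2real (bop (riesz \<tau>) (\<lambda>y. y) (\<lambda>y. c *\<^sub>R y) (\<lambda>x. F x powr a) (\<lambda>x. G x powr 0) x) powr (1 / (a - \<tau>))) \<partial>lborel) \<le> ennreal C" .
  qed
qed

text \<open>The mirror image of the endpoint with a bounded second function;
  \<open>c \<noteq> 0\<close> permits the substitution that turns \<open>c *\<^sub>R y\<close> into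
  the variable of the potential.\<close>

lemma bop_bounded_right:
  assumes t: "0 < \<tau>" "\<tau> < b" "b < 1" and c: "c \<noteq> 0"
  shows "bop_bounded (riesz \<tau>) (\<lambda>y. y :: 'a::euclidean_space) (\<lambda>y. c *\<^sub>R y) 0 b (b - \<tau>)"
proof -
  define J where "J G x = (\<integral>\<^sup>+y. ennreal (norm y powr (real DIM('a) * (\<tau> - 1))) * ennreal (G ((x::'a) - y) powr b) \<partial>lborel)" for G x
  obtain C where C: "0 \<le> C" "\<And>G x. tame G \<Longrightarrow> (\<integral>\<^sup>+x. ennreal (G x) \<partial>lborel) \<le> 1 \<Longrightarrow> J G x < \<infinity>"
    "\<And>G. tame G \<Longrightarrow> (\<integral>\<^sup>+x. ennreal (G x) \<partial>lborel) \<le> 1 \<Longrightarrow>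
    (\<integral>\<^sup>+x. ennreal (enn2real (J G x) powr (1 / (b - \<tau>))) \<partial>lborel) \<le> ennreal C"
    using Hardy_Littlewood_Sobolev[OF t, where 'a = 'a] unfolding J_def by blast
  \<comment> \<open>The homogeneity of the kernel gives the exponent
    \<open>- (n * (\<tau> - 1))\<close> of \<open>\<bar>c\<bar>\<close>, the Jacobian another
    \<open>- n\<close>.\<close>
  define L where "L = \<bar>c\<bar> powr (- (real DIM('a) * \<tau>))"
  have L: "0 < L" using c by (simp add: L_def)
  have le: "bop (riesz \<tau>) (\<lambda>y. y) (\<lambda>y. c *\<^sub>R y) (\<lambda>x. F x powr 0) (\<lambda>x. G x powr b) x \<le> ennreal L * J G x"
    if "tame G" for F G x
  proof -
    have [measurable]: "G \<in> borel_measurable borel" using that by (auto dest: tame_measurable)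
    have "bop (riesz \<tau>) (\<lambda>y. y) (\<lambda>y. c *\<^sub>R y) (\<lambda>x. F x powr 0) (\<lambda>x. G x powr b) x
       \<le> (\<integral>\<^sup>+y. ennreal (norm y powr (real DIM('a) * (\<tau> - 1))) * ennreal (G (x - c *\<^sub>R y) powr b) \<partial>lborel)"
      unfolding bop_def riesz_def by (intro nn_integral_mono mult_left_mono ennreal_leI) auto
    also have "\<dots> = (\<integral>\<^sup>+y. ennreal (\<bar>c\<bar> powr (- (real DIM('a) * (\<tau> - 1)))) *
        (ennreal (norm (0 + c *\<^sub>R y) powr (real DIM('a) * (\<tau> - 1))) * ennreal (G (x - (0 + c *\<^sub>R y)) powr b)) \<partial>lborel)"
    proof (rule nn_integral_cong)
      fix y :: 'a
      have "norm y powr (real DIM('a) * (\<tau> - 1)) = \<bar>c\<bar> powr (- (real DIM('a) * (\<tau> - 1))) * norm (0 + c *\<^sub>R y) powr (real DIM('a) * (\<tau> - 1))"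
        using c by (simp add: powr_mult powr_minus)
      then show "ennreal (norm y powr (real DIM('a) * (\<tau> - 1))) * ennreal (G (x - c *\<^sub>R y) powr b) =
        ennreal (\<bar>c\<bar> powr (- (real DIM('a) * (\<tau> - 1)))) *
        (ennreal (norm (0 + c *\<^sub>R y) powr (real DIM('a) * (\<tau> - 1))) * ennreal (G (x - (0 + c *\<^sub>R y)) powr b))"
        by (simp add: ennreal_mult mult.assoc)
    qed
    also have "\<dots> = ennreal (\<bar>c\<bar> powr (- (real DIM('a) * (\<tau> - 1)))) *
       (\<integral>\<^sup>+y. ennreal (norm (0 + c *\<^sub>R y) powr (real DIM('a) * (\<tau> - 1))) * ennreal (G (x - (0 + c *\<^sub>R y)) powr b) \<partial>lborel)"
      by (rule nn_integral_cmult) measurable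
    also have "\<dots> = ennreal L * J G x"
    proof -
      have "J G x = ennreal (\<bar>c\<bar> ^ DIM('a)) *
        (\<integral>\<^sup>+y. ennreal (norm (0 + c *\<^sub>R y) powr (real DIM('a) * (\<tau> - 1))) * ennreal (G (x - (0 + c *\<^sub>R y)) powr b) \<partial>lborel)"
        unfolding J_def by (rule nn_integral_lborel_affine[OF _ c]) measurable
      moreover have "ennreal (\<bar>c\<bar> powr (- (real DIM('a) * (\<tau> - 1)))) = ennreal L * ennreal (\<bar>c\<bar> ^ DIM('a))"
      proof -
        have "\<bar>c\<bar> ^ DIM('a) = \<bar>c\<bar> powr real DIM('a)" using c by (simp add: powr_realpow)
        then have "L * \<bar>c\<bar> ^ DIM('a) = \<bar>c\<bar> powr (- (real DIM('a) * (\<tau> - 1)))"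
          by (simp add: L_def powr_add[symmetric] algebra_simps)
        then show ?thesis using L by (simp add: ennreal_mult[symmetric])
      qed
      ultimately show ?thesis by (simp add: mult.assoc)
    qed
    finally show ?thesis .
  qed
  show ?thesis
  proof (rule bop_boundedI)
    show "0 \<le> L powr (1 / (b - \<tau>)) * C" using C(1) by simp
    fix F G :: "'a \<Rightarrow> real"
    assume G: "tame G" "(\<integral>\<^sup>+x. ennreal (G x) \<partial>lborel) \<le> 1"
    have fin: "ennreal L * J G x < \<infinity>" for x using C(2)[OF G, of x] by (simp add: ennreal_mult_less_top)
    show "bop (riesz \<tau>) (\<lambda>y. y) (\<lambda>y. c *\<^sub>R y) (\<lambda>x. F x powr 0) (\<lambda>x. G x powr b) x < \<infinity>" for x
      using le[OF G(1)] fin by (rule order.strict_trans1)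
    have [measurable]: "G \<in> borel_measurable borel" using G by (auto dest: tame_measurable)
    have [measurable]: "J G \<in> borel_measurable borel"
    proof -
      have "(\<lambda>x. J G x) \<in> borel_measurable borel" unfolding J_def by measurable
      then show ?thesis by simp
    qed
    have "enn2real (bop (riesz \<tau>) (\<lambda>y. y) (\<lambda>y. c *\<^sub>R y) (\<lambda>x. F x powr 0) (\<lambda>x. G x powr b) x) powr (1 / (b - \<tau>))
       \<le> L powr (1 / (b - \<tau>)) * enn2real (J G x) powr (1 / (b - \<tau>))" for x
    proof -
      have "enn2real (bop (riesz \<tau>) (\<lambda>y. y) (\<lambda>y. c *\<^sub>R y) (\<lambda>x. F x powr 0) (\<lambda>x. G x powr b) x) \<le> L * enn2real (J G x)"
        using enn2real_mono[OF le[OF G(1), of F x]] fin[of x] L by (simp add: enn2real_mult)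
      then show ?thesis using t L by (subst powr_mult[symmetric]) (auto intro!: powr_mono2)
    qed
    then have "(\<integral>\<^sup>+x. ennreal (enn2real (bop (riesz \<tau>) (\<lambda>y. y) (\<lambda>y. c *\<^sub>R y) (\<lambda>x. F x powr 0) (\<lambda>x. G x powr b) x) powr (1 / (b - \<tau>))) \<partial>lborel)
      \<le> (\<integral>\<^sup>+x. ennreal (L powr (1 / (b - \<tau>))) * ennreal (enn2real (J G x) powr (1 / (b - \<tau>))) \<partial>lborel)"
      by (intro nn_integral_mono) (simp add: ennreal_mult[symmetric] ennreal_leI)
    also have "\<dots> = ennreal (L powr (1 / (b - \<tau>))) * (\<integral>\<^sup>+x. ennreal (enn2real (J G x) powr (1 / (b - \<tau>))) \<partial>lborel)"
      by (rule nn_integral_cmult) measurable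
    also have "\<dots> \<le> ennreal (L powr (1 / (b - \<tau>))) * ennreal C" by (intro mult_left_mono C(3)[OF G]) simp
    also have "\<dots> = ennreal (L powr (1 / (b - \<tau>)) * C)" using C(1) by (simp add: ennreal_mult)
    finally show "(\<integral>\<^sup>+x. ennreal (enn2real (bop (riesz \<tau>) (\<lambda>y. y) (\<lambda>y. c *\<^sub>R y) (\<lambda>x. F x powr 0) (\<lambda>x. G x powr b) x) powr (1 / (b - \<tau>))) \<partial>lborel) \<le> ennreal (L powr (1 / (b - \<tau>)) * C)" .
  qed
qed

lemma riesz_interpolate: "riesz (l * \<tau>1 + (1 - l) * \<tau>2) z = riesz \<tau>1 z powr l * riesz \<tau>2 z powr (1 - l)"
proof -
  have "(real DIM('a) * ((l * \<tau>1 + (1 - l) * \<tau>2) - 1)) = real DIM('a) * (\<tau>1 - 1) * l + real DIM('a) * (\<tau>2 - 1) * (1 - l)"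
    by (simp add: algebra_simps)
  then show ?thesis for z :: 'a unfolding riesz_def powr_powr powr_add[symmetric] by simp
qed

text \<open>Scaling forces \<open>r = \<alpha> + \<beta> - \<tau>\<close>, an affine function of the
  other parameters, so interpolation says that the bounded triples
  \<open>(\<alpha>, \<beta>, \<tau>)\<close> with \<open>\<tau> < \<alpha> + \<beta>\<close> are
  closed under convex combinations.\<close>

lemma riesz_bounded_interpolate:
  fixes c :: real
  assumes 1: "bop_bounded (riesz \<tau>1) (\<lambda>y. y :: 'a::euclidean_space) (\<lambda>y. c *\<^sub>R y) \<alpha>1 \<beta>1 (\<alpha>1 + \<beta>1 - \<tau>1)"
    and 2: "bop_bounded (riesz \<tau>2) (\<lambda>y. y :: 'a) (\<lambda>y. c *\<^sub>R y) \<alpha>2 \<beta>2 (\<alpha>2 + \<beta>2 - \<tau>2)"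
    and l: "0 < l" "l < 1" and r: "\<tau>1 < \<alpha>1 + \<beta>1" "\<tau>2 < \<alpha>2 + \<beta>2"
    and \<alpha>: "\<alpha> = l * \<alpha>1 + (1 - l) * \<alpha>2" and \<beta>: "\<beta> = l * \<beta>1 + (1 - l) * \<beta>2" and \<tau>: "\<tau> = l * \<tau>1 + (1 - l) * \<tau>2"
  shows "bop_bounded (riesz \<tau>) (\<lambda>y. y :: 'a) (\<lambda>y. c *\<^sub>R y) \<alpha> \<beta> (\<alpha> + \<beta> - \<tau>)"
proof (rule bop_bounded_interpolate[OF 1 2])
  show "riesz \<tau> z = riesz \<tau>1 z powr l * riesz \<tau>2 z powr (1 - l)" for z :: 'a
    unfolding \<tau> by (rule riesz_interpolate)
  show "\<alpha> + \<beta> - \<tau> = l * (\<alpha>1 + \<beta>1 - \<tau>1) + (1 - l) * (\<alpha>2 + \<beta>2 - \<tau>2)"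
    by (simp add: \<alpha> \<beta> \<tau> algebra_simps)
qed (use l r \<alpha> \<beta> riesz_nonneg in auto)

section \<open>The range q \<le> 1\<close>

lemma nn_integral_bdd_ball_finite:
  fixes h :: "'a::euclidean_space \<Rightarrow> real"
  assumes "\<And>y. h y \<le> B"
  shows "(\<integral>\<^sup>+y. ennreal (h y) * indicator (ball 0 r) y \<partial>lborel) < \<infinity>"
proof -
  have "(\<integral>\<^sup>+y. ennreal (h y) * indicator (ball 0 r) y \<partial>lborel) \<le> (\<integral>\<^sup>+y. ennreal B * indicator (ball (0::'a) r) y \<partial>lborel)"
    using assms by (intro nn_integral_mono mult_right_mono ennreal_leI) auto
  also have "\<dots> = ennreal B * emeasure lborel (ball (0::'a) r)"
    by (rule nn_integral_cmult_indicator) simp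
  also have "\<dots> < \<infinity>" using emeasure_lborel_ball_finite[of "0::'a" r] by (simp add: ennreal_mult_less_top)
  finally show ?thesis .
qed

lemma nn_integral_indicator_ball_minus':
  "(\<integral>\<^sup>+z. indicator (ball (0::'a::euclidean_space) r) (z - x) \<partial>lborel) = emeasure lborel (ball (0::'a) r)"
proof -
  have "indicator (ball (0::'a) r) (z - x) = (indicator (ball (0::'a) r) (x - z) :: ennreal)" for z
    by (auto simp: indicator_def norm_minus_commute)
  then show ?thesis by (simp add: nn_integral_indicator_ball_minus)
qed

text \<open>If x is within \<open>\<rho>\<close> of z and \<open>norm y < \<rho>\<close>, both
  \<open>x - y\<close> and \<open>x - c *\<^sub>R y\<close> lie within \<open>R\<close> of z. With w
  = x - y as new variable the second argument becomes
  \<open>c *\<^sub>R w + (1 - c) *\<^sub>R x\<close>; for fixed w it is an affine function of x,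
  invertible because \<open>c \<noteq> 1\<close>, so the double integral factors.\<close>

lemma bilinear_localized_L1:
  fixes u v :: "'a::euclidean_space \<Rightarrow> real"
  assumes [measurable]: "u \<in> borel_measurable borel" "v \<in> borel_measurable borel"
    and c: "c \<noteq> 1" and R: "2 * \<rho> \<le> R" "(1 + \<bar>c\<bar>) * \<rho> \<le> R"
  shows "(\<integral>\<^sup>+x. (\<integral>\<^sup>+y. ennreal (u (x - y)) * ennreal (v (x - c *\<^sub>R y)) * indicator (ball 0 \<rho>) y \<partial>lborel) * indicator (ball 0 \<rho>) (z - x) \<partial>lborel)
    \<le> ennreal (1 / \<bar>1 - c\<bar> ^ DIM('a)) * (\<integral>\<^sup>+y. ennreal (u y) * indicator (ball 0 R) (z - y) \<partial>lborel)
        * (\<integral>\<^sup>+y. ennreal (v y) * indicator (ball 0 R) (z - y) \<partial>lborel)"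
proof -
  define U where "U = (\<integral>\<^sup>+y. ennreal (u y) * indicator (ball 0 R) (z - y) \<partial>lborel)"
  define V where "V = (\<integral>\<^sup>+y. ennreal (v y) * indicator (ball 0 R) (z - y) \<partial>lborel)"
  have "(\<integral>\<^sup>+x. (\<integral>\<^sup>+y. ennreal (u (x - y)) * ennreal (v (x - c *\<^sub>R y)) * indicator (ball 0 \<rho>) y \<partial>lborel) * indicator (ball 0 \<rho>) (z - x) \<partial>lborel)
    \<le> (\<integral>\<^sup>+x. (\<integral>\<^sup>+w. ennreal (u w) * indicator (ball 0 R) (z - w) *
         (ennreal (v (c *\<^sub>R w + (1 - c) *\<^sub>R x)) * indicator (ball 0 R) (z - (c *\<^sub>R w + (1 - c) *\<^sub>R x))) \<partial>lborel) \<partial>lborel)"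
  proof (rule nn_integral_mono)
    fix x :: 'a
    show "(\<integral>\<^sup>+y. ennreal (u (x - y)) * ennreal (v (x - c *\<^sub>R y)) * indicator (ball 0 \<rho>) y \<partial>lborel) * indicator (ball 0 \<rho>) (z - x)
      \<le> (\<integral>\<^sup>+w. ennreal (u w) * indicator (ball 0 R) (z - w) *
         (ennreal (v (c *\<^sub>R w + (1 - c) *\<^sub>R x)) * indicator (ball 0 R) (z - (c *\<^sub>R w + (1 - c) *\<^sub>R x))) \<partial>lborel)"
    proof (cases "norm (z - x) < \<rho>")
      case True
      have "(\<integral>\<^sup>+y. ennreal (u (x - y)) * ennreal (v (x - c *\<^sub>R y)) * indicator (ball 0 \<rho>) y \<partial>lborel)
        = (\<integral>\<^sup>+w. ennreal (u (x - (x - w))) * ennreal (v (x - c *\<^sub>R (x - w))) * indicator (ball 0 \<rho>) (x - w) \<partial>lborel)"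
        by (rule nn_integral_lborel_minus[symmetric]) measurable
      also have "\<dots> \<le> (\<integral>\<^sup>+w. ennreal (u w) * indicator (ball 0 R) (z - w) *
         (ennreal (v (c *\<^sub>R w + (1 - c) *\<^sub>R x)) * indicator (ball 0 R) (z - (c *\<^sub>R w + (1 - c) *\<^sub>R x))) \<partial>lborel)"
      proof (rule nn_integral_mono)
        fix w :: 'a
        have eq: "x - c *\<^sub>R (x - w) = c *\<^sub>R w + (1 - c) *\<^sub>R x" by (simp add: algebra_simps)
        show "ennreal (u (x - (x - w))) * ennreal (v (x - c *\<^sub>R (x - w))) * indicator (ball 0 \<rho>) (x - w)
          \<le> ennreal (u w) * indicator (ball 0 R) (z - w) *
         (ennreal (v (c *\<^sub>R w + (1 - c) *\<^sub>R x)) * indicator (ball 0 R) (z - (c *\<^sub>R w + (1 - c) *\<^sub>R x)))"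
        proof (cases "norm (x - w) < \<rho>")
          case xw: True
          have "norm (z - w) \<le> norm (z - x) + norm (x - w)"
            using norm_triangle_ineq[of "z - x" "x - w"] by simp
          then have 1: "norm (z - w) < R" using xw True R(1) by linarith
          have eq2: "z - (x - c *\<^sub>R (x - w)) = (z - x) + c *\<^sub>R (x - w)" by (simp add: algebra_simps)
          have "norm (z - (x - c *\<^sub>R (x - w))) \<le> norm (z - x) + \<bar>c\<bar> * norm (x - w)"
            unfolding eq2 using norm_triangle_ineq[of "z - x" "c *\<^sub>R (x - w)"] by simp
          also have "\<dots> < \<rho> + \<bar>c\<bar> * \<rho>"
            using True xw by (intro add_less_le_mono mult_left_mono) auto
          also have "\<dots> \<le> R" using R(2) by (simp add: algebra_simps)
          finally have 2: "norm (z - (x - c *\<^sub>R (x - w))) < R" .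
          show ?thesis unfolding eq using 1 2[unfolded eq] xw by simp
        qed simp
      qed
      finally show ?thesis using True by simp
    qed simp
  qed
  also have "\<dots> = (\<integral>\<^sup>+w. (\<integral>\<^sup>+x. ennreal (u w) * indicator (ball 0 R) (z - w) *
         (ennreal (v (c *\<^sub>R w + (1 - c) *\<^sub>R x)) * indicator (ball 0 R) (z - (c *\<^sub>R w + (1 - c) *\<^sub>R x))) \<partial>lborel) \<partial>lborel)"
    by (rule lborel_pair.Fubini') measurable
  also have "\<dots> = (\<integral>\<^sup>+w. ennreal (u w) * indicator (ball 0 R) (z - w) * (ennreal (1 / \<bar>1 - c\<bar> ^ DIM('a)) * V) \<partial>lborel)"
  proof (rule nn_integral_cong)
    fix w :: 'a
    have "V = ennreal (\<bar>1 - c\<bar> ^ DIM('a)) *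
        (\<integral>\<^sup>+x. ennreal (v (c *\<^sub>R w + (1 - c) *\<^sub>R x)) * indicator (ball 0 R) (z - (c *\<^sub>R w + (1 - c) *\<^sub>R x)) \<partial>lborel)"
      unfolding V_def using c by (intro nn_integral_lborel_affine) auto
    moreover have "ennreal (1 / \<bar>1 - c\<bar> ^ DIM('a)) * ennreal (\<bar>1 - c\<bar> ^ DIM('a)) = 1"
      using c by (simp add: ennreal_mult[symmetric])
    ultimately have "(\<integral>\<^sup>+x. ennreal (v (c *\<^sub>R w + (1 - c) *\<^sub>R x)) * indicator (ball 0 R) (z - (c *\<^sub>R w + (1 - c) *\<^sub>R x)) \<partial>lborel)
        = ennreal (1 / \<bar>1 - c\<bar> ^ DIM('a)) * V"
      by (simp add: mult.assoc[symmetric])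
    then show "(\<integral>\<^sup>+x. ennreal (u w) * indicator (ball 0 R) (z - w) *
         (ennreal (v (c *\<^sub>R w + (1 - c) *\<^sub>R x)) * indicator (ball 0 R) (z - (c *\<^sub>R w + (1 - c) *\<^sub>R x))) \<partial>lborel)
       = ennreal (u w) * indicator (ball 0 R) (z - w) * (ennreal (1 / \<bar>1 - c\<bar> ^ DIM('a)) * V)"
      by (subst nn_integral_cmult) auto
  qed
  also have "\<dots> = U * (ennreal (1 / \<bar>1 - c\<bar> ^ DIM('a)) * V)"
    unfolding U_def by (rule nn_integral_multc) measurable
  finally show ?thesis unfolding U_def V_def by (simp add: mult_ac)
qed

text \<open>Hoelder on the ball of radius \<open>\<rho>\<close> around z turns the local L^1 bound
  into one for the q-th power, since \<open>q \<le> 1\<close>. Integrating over z counts every x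
  with the volume \<open>W\<close> of that ball, so a global estimate results from purely local
  ones. The scale \<open>k + m\<close> of the averages absorbs the enlargement of
  \<open>\<rho>\<close> to \<open>R\<close>.\<close>

lemma bilinear_localized_Lq:
  fixes u v :: "'a::euclidean_space \<Rightarrow> real" and k :: int and m :: nat
  assumes u: "bdd_borel u" and v: "bdd_borel v"
    and c: "c \<noteq> 1" and m: "(2::real) \<le> 2 ^ m" "1 + \<bar>c\<bar> \<le> 2 ^ m" and q: "0 < q" "q \<le> 1"
  defines "d \<equiv> \<lambda>x. enn2real (\<integral>\<^sup>+y. ennreal (u (x - y)) * ennreal (v (x - c *\<^sub>R y)) * indicator (ball 0 (2 powr real_of_int k)) y \<partial>lborel)"
  defines "n \<equiv> real DIM('a)"
  defines "K1 \<equiv> 2 powr (2 * real m * n) / (measure lborel (ball (0::'a) 1) * \<bar>1 - c\<bar> ^ DIM('a))"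
  shows "(\<integral>\<^sup>+x. ennreal (d x powr q) \<partial>lborel)
    \<le> (\<integral>\<^sup>+z. ennreal ((K1 * 2 powr (real_of_int k * n) * avg (k + int m) u z * avg (k + int m) v z) powr q) \<partial>lborel)"
    and "(\<integral>\<^sup>+y. ennreal (u (x - y)) * ennreal (v (x - c *\<^sub>R y)) * indicator (ball 0 (2 powr real_of_int k)) y \<partial>lborel) = ennreal (d x)"
    and "d \<in> borel_measurable borel"
proof -
  have [measurable]: "u \<in> borel_measurable borel" "v \<in> borel_measurable borel" using u v by (auto simp: bdd_borel_def)
  define w where "w = measure lborel (ball (0::'a) 1)"
  have w: "0 < w" using unit_vol_pos by (simp add: w_def)
  define \<rho> :: real where "\<rho> = 2 powr real_of_int k"
  define R :: real where "R = 2 powr real_of_int (k + int m)"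
  have \<rho>: "0 < \<rho>" by (simp add: \<rho>_def)
  have Rm: "R = 2 ^ m * \<rho>" by (simp add: R_def \<rho>_def powr_add powr_realpow mult.commute)
  have R: "2 * \<rho> \<le> R" "(1 + \<bar>c\<bar>) * \<rho> \<le> R" unfolding Rm using m \<rho> by (auto intro!: mult_right_mono)
  define D where "D x = (\<integral>\<^sup>+y. ennreal (u (x - y)) * ennreal (v (x - c *\<^sub>R y)) * indicator (ball 0 \<rho>) y \<partial>lborel)" for x
  have D_meas[measurable]: "D \<in> borel_measurable borel"
  proof -
    have "(\<lambda>x. D x) \<in> borel_measurable borel" unfolding D_def by measurable
    then show ?thesis by simp
  qed
  obtain B1 B2 where B: "\<And>x. u x \<le> B1" "\<And>x. v x \<le> B2" and uv0: "\<And>x. 0 \<le> u x" "\<And>x. 0 \<le> v x"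
    using u v by (auto simp: bdd_borel_def)
  have "D x < \<infinity>" for x
  proof -
    have B1: "0 \<le> B1" using B(1) uv0(1) order_trans by blast
    have "u (x - y) * v (x - c *\<^sub>R y) \<le> B1 * B2" for y using B uv0 B1 by (intro mult_mono) auto
    from nn_integral_bdd_ball_finite[of "\<lambda>y. u (x - y) * v (x - c *\<^sub>R y)", OF this]
    show ?thesis by (simp add: D_def ennreal_mult uv0)
  qed
  then have Dd: "D x = ennreal (d x)" for x by (simp add: D_def d_def \<rho>_def)
  then show "(\<integral>\<^sup>+y. ennreal (u (x - y)) * ennreal (v (x - c *\<^sub>R y)) * indicator (ball 0 (2 powr real_of_int k)) y \<partial>lborel) = ennreal (d x)"
    by (simp add: D_def \<rho>_def)
  have d0: "0 \<le> d x" for x by (simp add: d_def)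
  have "d = (\<lambda>x. enn2real (D x))" by (simp add: D_def d_def \<rho>_def)
  then show d_meas[measurable]: "d \<in> borel_measurable borel" by simp
  define S where "S z = 1 / \<bar>1 - c\<bar> ^ DIM('a) * (2 powr (real_of_int (k + int m) * n) * avg (k + int m) u z) * (2 powr (real_of_int (k + int m) * n) * avg (k + int m) v z)" for z
  have S0: "0 \<le> S z" for z by (simp add: S_def avg_nonneg)
  have S_meas[measurable]: "S \<in> borel_measurable borel" unfolding S_def[abs_def] by measurable
  have avgR: "(\<integral>\<^sup>+y. ennreal (f y) * indicator (ball 0 R) (z - y) \<partial>lborel) = ennreal (2 powr (real_of_int (k + int m) * n) * avg (k + int m) f z)"
    if f: "bdd_borel f" for f and z :: 'a
  proof -
    define J where "J = (\<integral>\<^sup>+y. ennreal (f y) * indicator (ball 0 R) (z - y) \<partial>lborel)"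
    have "ennreal (2 powr (real_of_int (k + int m) * n) * avg (k + int m) f z) = ennreal (2 powr (real_of_int (k + int m) * n)) * ball_avg (k + int m) f z"
      unfolding ball_avg_eq[OF f] by (simp add: ennreal_mult avg_nonneg)
    also have "\<dots> = (ennreal (2 powr (real_of_int (k + int m) * n)) * ennreal (2 powr (- (real_of_int (k + int m) * n)))) * J"
      by (simp add: ball_avg_def J_def R_def n_def mult.assoc)
    also have "ennreal (2 powr (real_of_int (k + int m) * n)) * ennreal (2 powr (- (real_of_int (k + int m) * n))) = 1"
      by (simp add: ennreal_mult[symmetric] powr_add[symmetric])
    finally show ?thesis by (simp add: J_def)
  qed
  have L1: "(\<integral>\<^sup>+x. ennreal (d x * indicator (ball 0 \<rho>) (z - x)) \<partial>lborel) \<le> ennreal (S z)" for z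
  proof -
    have "(\<integral>\<^sup>+x. ennreal (d x * indicator (ball 0 \<rho>) (z - x)) \<partial>lborel) = (\<integral>\<^sup>+x. D x * indicator (ball 0 \<rho>) (z - x) \<partial>lborel)"
      unfolding Dd by (intro nn_integral_cong) (auto simp: indicator_def)
    also have "\<dots> \<le> ennreal (1 / \<bar>1 - c\<bar> ^ DIM('a)) * (\<integral>\<^sup>+y. ennreal (u y) * indicator (ball 0 R) (z - y) \<partial>lborel)
        * (\<integral>\<^sup>+y. ennreal (v y) * indicator (ball 0 R) (z - y) \<partial>lborel)"
      unfolding D_def by (rule bilinear_localized_L1[OF _ _ c R]) measurable
    also have "\<dots> = ennreal (S z)"
      unfolding avgR[OF u] avgR[OF v] S_def
      by (simp add: ennreal_mult[symmetric] avg_nonneg)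
    finally show ?thesis .
  qed
  define g where "g z x = (indicator (ball 0 \<rho>) (z - x) :: real)" for z x :: 'a
  have g_ennreal: "ennreal (g z x) = indicator (ball 0 \<rho>) (z - x)" for z x by (auto simp: g_def indicator_def)
  have g_meas: "g z \<in> borel_measurable borel" for z
  proof -
    have "(\<lambda>x. indicator (ball 0 \<rho>) (z - x) :: real) \<in> borel_measurable borel"
      by (rule measurable_compose[of "\<lambda>y. z - y" borel borel, OF _ borel_measurable_indicator]) auto
    then show ?thesis by (simp add: g_def[abs_def])
  qed
  define W where "W = w * 2 powr (real_of_int k * n)"
  have W: "0 < W" using w by (simp add: W_def)
  have "\<rho> ^ DIM('a) = 2 powr (real_of_int k * n)" by (simp add: \<rho>_def n_def powr_powr powr_realpow[symmetric])
  then have ball_vol: "emeasure lborel (ball (0::'a) \<rho>) = ennreal W"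
    using \<rho> by (simp add: emeasure_lborel_ball W_def w_def mult.commute)
  have L2: "(\<integral>\<^sup>+x. ennreal (d x powr q) * indicator (ball 0 \<rho>) (z - x) \<partial>lborel) \<le> ennreal (S z powr q * W powr (1 - q))" for z
  proof -
    have "(\<integral>\<^sup>+x. ennreal (d x powr q) * indicator (ball 0 \<rho>) (z - x) \<partial>lborel)
      = (\<integral>\<^sup>+x. ennreal ((d x * g z x) powr q * g z x powr (1 - q)) \<partial>lborel)"
      by (intro nn_integral_cong) (auto simp: g_def indicator_def)
    also have "\<dots> \<le> ennreal (S z powr q * W powr (1 - q))"
    proof (rule nn_integral_Holder)
      show "(\<lambda>x. d x * g z x) \<in> borel_measurable lborel" "g z \<in> borel_measurable lborel"
        using g_meas[of z] d_meas by auto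
      show "(\<integral>\<^sup>+x. ennreal (d x * g z x) \<partial>lborel) \<le> ennreal (S z)"
        unfolding g_def by (rule L1)
      show "(\<integral>\<^sup>+x. ennreal (g z x) \<partial>lborel) \<le> ennreal W"
        unfolding g_ennreal nn_integral_indicator_ball_minus ball_vol by simp
    qed (use d0 q S0 W in \<open>auto simp: g_def\<close>)
    finally show ?thesis .
  qed
  \<comment> \<open>Integration over all centres z: by symmetry the centres that see a given x fill
    a ball of volume \<open>W\<close>.\<close>
  have "ennreal W * (\<integral>\<^sup>+x. ennreal (d x powr q) \<partial>lborel)
    = (\<integral>\<^sup>+x. (\<integral>\<^sup>+z. ennreal (d x powr q) * indicator (ball 0 \<rho>) (z - x) \<partial>lborel) \<partial>lborel)"
    by (subst nn_integral_cmult[symmetric], measurable)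
       (simp add: nn_integral_cmult nn_integral_indicator_ball_minus' ball_vol mult.commute)
  also have "\<dots> = (\<integral>\<^sup>+z. (\<integral>\<^sup>+x. ennreal (d x powr q) * indicator (ball 0 \<rho>) (z - x) \<partial>lborel) \<partial>lborel)"
    by (rule lborel_pair.Fubini'[symmetric]) measurable
  also have "\<dots> \<le> (\<integral>\<^sup>+z. ennreal (S z powr q * W powr (1 - q)) \<partial>lborel)"
    by (intro nn_integral_mono L2)
  finally have L3: "ennreal W * (\<integral>\<^sup>+x. ennreal (d x powr q) \<partial>lborel) \<le> (\<integral>\<^sup>+z. ennreal (S z powr q * W powr (1 - q)) \<partial>lborel)" .
  have "(\<integral>\<^sup>+x. ennreal (d x powr q) \<partial>lborel) = ennreal (1 / W) * (ennreal W * (\<integral>\<^sup>+x. ennreal (d x powr q) \<partial>lborel))"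
    using W by (simp add: mult.assoc[symmetric] ennreal_mult[symmetric])
  also have "\<dots> \<le> ennreal (1 / W) * (\<integral>\<^sup>+z. ennreal (S z powr q * W powr (1 - q)) \<partial>lborel)"
    by (rule mult_left_mono[OF L3]) simp
  also have "\<dots> = (\<integral>\<^sup>+z. ennreal (1 / W) * ennreal (S z powr q * W powr (1 - q)) \<partial>lborel)"
    by (rule nn_integral_cmult[symmetric]) measurable
  also have "\<dots> = (\<integral>\<^sup>+z. ennreal ((K1 * 2 powr (real_of_int k * n) * avg (k + int m) u z * avg (k + int m) v z) powr q) \<partial>lborel)"
  proof (rule nn_integral_cong)
    fix z
    \<comment> \<open>The two unnormalized averages carry \<open>2 powr (2 * (k + m) * n)\<close>;
      dividing by the ball volume removes one \<open>2 powr (k * n)\<close>, and \<open>K1\<close>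
      collects what does not depend on k.\<close>
    have "K1 * 2 powr (real_of_int k * n) = 1 / \<bar>1 - c\<bar> ^ DIM('a) * 2 powr (real_of_int (k + int m) * n) * 2 powr (real_of_int (k + int m) * n) / W"
    proof -
      have "2 powr (real_of_int (k + int m) * n) * 2 powr (real_of_int (k + int m) * n) = 2 powr (2 * real m * n) * (2 powr (real_of_int k * n) * 2 powr (real_of_int k * n))"
        unfolding powr_add[symmetric] by (simp add: algebra_simps)
      then show ?thesis using w by (simp add: K1_def W_def w_def[symmetric] field_simps)
    qed
    then have eq: "K1 * 2 powr (real_of_int k * n) * avg (k + int m) u z * avg (k + int m) v z = S z / W"
      by (simp add: S_def)
    have "1 / W * (S z powr q * W powr (1 - q)) = (S z / W) powr q"
      using W S0[of z] by (simp add: powr_divide powr_diff)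
    then show "ennreal (1 / W) * ennreal (S z powr q * W powr (1 - q)) = ennreal ((K1 * 2 powr (real_of_int k * n) * avg (k + int m) u z * avg (k + int m) v z) powr q)"
      unfolding eq using W by (subst ennreal_mult[symmetric]) auto
  qed
  finally show "(\<integral>\<^sup>+x. ennreal (d x powr q) \<partial>lborel)
    \<le> (\<integral>\<^sup>+z. ennreal ((K1 * 2 powr (real_of_int k * n) * avg (k + int m) u z * avg (k + int m) v z) powr q) \<partial>lborel)" .
qed

text \<open>Subadditivity of t^q for series. With S the sum of the q-th powers, every
  \<open>a j powr q\<close> is at most S, hence
  \<open>a j \<le> a j powr q * S powr ((1 - q) / q)\<close>, and summation gives S^(1/q).\<close>

lemma powr_le_suminf_powr:
  fixes a :: "nat \<Rightarrow> real"
  assumes a: "\<And>j. 0 \<le> a j" and b: "0 \<le> b" "ennreal b \<le> (\<Sum>j. ennreal (a j))" and q: "0 < q" "q \<le> 1"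
  shows "ennreal (b powr q) \<le> (\<Sum>j. ennreal (a j powr q))"
proof (cases "(\<Sum>j. ennreal (a j powr q)) = \<infinity>")
  case False
  then obtain S where S: "(\<Sum>j. ennreal (a j powr q)) = ennreal S" "0 \<le> S"
    by (metis ennreal_cases infinity_ennreal_def)
  have le: "a j powr q \<le> S" for j
    using term_le_suminf_ennreal[of "\<lambda>j. ennreal (a j powr q)" j] S by simp
  have "a j \<le> a j powr q * S powr ((1 - q) / q)" for j
  proof -
    have "a j = a j powr q * (a j powr q) powr ((1 - q) / q)"
      using a[of j] q by (simp add: powr_powr powr_add[symmetric])
    also have "\<dots> \<le> a j powr q * S powr ((1 - q) / q)"
      using q le[of j] by (intro mult_left_mono powr_mono2) auto
    finally show ?thesis .
  qed
  then have "(\<Sum>j. ennreal (a j)) \<le> (\<Sum>j. ennreal (a j powr q) * ennreal (S powr ((1 - q) / q)))"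
    by (intro suminf_le) (auto simp: ennreal_mult[symmetric] intro!: ennreal_leI)
  also have "\<dots> = ennreal S * ennreal (S powr ((1 - q) / q))"
    using S by simp
  also have "\<dots> = ennreal (S powr (1 / q))"
  proof -
    have "S * S powr ((1 - q) / q) = S powr (1 / q)"
    proof (cases "S = 0")
      case False
      then have "S * S powr ((1 - q) / q) = S powr (1 + (1 - q) / q)" using S(2) by (simp add: powr_add)
      also have "1 + (1 - q) / q = 1 / q" using q by (simp add: field_simps)
      finally show ?thesis .
    qed simp
    then show ?thesis using S(2) by (simp add: ennreal_mult[symmetric])
  qed
  finally have "ennreal b \<le> ennreal (S powr (1 / q))" using b(2) by (rule order_trans[rotated])
  then have "b \<le> S powr (1 / q)" by (subst (asm) ennreal_le_iff) auto
  then have "b powr q \<le> (S powr (1 / q)) powr q" using b q by (intro powr_mono2) auto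
  then show ?thesis using q S by (simp add: powr_powr ennreal_leI)
next
  case True
  then show ?thesis by simp
qed

text \<open>Near the origin the kernel is integrable and the functions are bounded; away from it the
  kernel is at most 1 and \<open>F powr a\<close> is integrable.\<close>

lemma bop_riesz_finite:
  fixes F G :: "'a::euclidean_space \<Rightarrow> real"
  assumes F: "tame F" and G: "tame G" and a: "0 < a" and b: "0 \<le> b" and t: "0 < \<tau>" "\<tau> < 1"
  shows "bop (riesz \<tau>) (\<lambda>y. y) (\<lambda>y. c *\<^sub>R y) (\<lambda>x. F x powr a) (\<lambda>x. G x powr b) x < \<infinity>"
proof -
  have [measurable]: "F \<in> borel_measurable borel" "G \<in> borel_measurable borel" using F G by (auto dest: tame_measurable)
  obtain B1 where B1: "0 \<le> B1" "\<And>x. F x powr a \<le> B1" using tame_powr_bounded[OF F, of a] a by auto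
  obtain B2 where B2: "0 \<le> B2" "\<And>x. G x powr b \<le> B2" using tame_powr_bounded[OF G b] by auto
  define e where "e = real DIM('a) * (\<tau> - 1)"
  have e: "- real DIM('a) < e" "e \<le> 0" using t by (auto simp: e_def algebra_simps mult_le_0_iff)
  obtain C where C: "(\<integral>\<^sup>+y. ennreal (norm (y::'a) powr e) * indicator (ball 0 1) y \<partial>lborel) \<le> ennreal (C * 1 powr (e + real DIM('a)))"
    using nn_integral_norm_powr_ball[OF e(1)] zero_less_one by metis
  have ind: "(\<lambda>y. indicator (ball (0::'a) 1) y :: ennreal) \<in> borel_measurable lborel"
    by (rule borel_measurable_indicator) simp
  have "bop (riesz \<tau>) (\<lambda>y. y) (\<lambda>y. c *\<^sub>R y) (\<lambda>x. F x powr a) (\<lambda>x. G x powr b) x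
    \<le> (\<integral>\<^sup>+y. ennreal (B1 * B2) * (ennreal (norm y powr e) * indicator (ball 0 1) y) + ennreal B2 * ennreal (F (x - y) powr a) \<partial>lborel)"
    unfolding bop_def riesz_def e_def[symmetric]
  proof (rule nn_integral_mono)
    fix y :: 'a
    show "ennreal (norm y powr e) * ennreal (F (x - y) powr a * G (x - c *\<^sub>R y) powr b)
      \<le> ennreal (B1 * B2) * (ennreal (norm y powr e) * indicator (ball 0 1) y) + ennreal B2 * ennreal (F (x - y) powr a)"
    proof (cases "norm y < 1")
      case True
      have "F (x - y) powr a * G (x - c *\<^sub>R y) powr b \<le> B1 * B2" using B1 B2 by (intro mult_mono) auto
      then have "ennreal (norm y powr e) * ennreal (F (x - y) powr a * G (x - c *\<^sub>R y) powr b) \<le> ennreal (norm y powr e) * ennreal (B1 * B2)"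
        by (intro mult_left_mono ennreal_leI) auto
      also have "\<dots> \<le> ennreal (B1 * B2) * (ennreal (norm y powr e) * indicator (ball 0 1) y) + ennreal B2 * ennreal (F (x - y) powr a)"
        using True by (simp add: mult.commute)
      finally show ?thesis .
    next
      case False
      then have "norm y powr e \<le> 1" using e powr_mono[of e 0 "norm y"] by (auto split: if_splits)
      moreover have "F (x - y) powr a * G (x - c *\<^sub>R y) powr b \<le> B2 * F (x - y) powr a"
        using B2(2)[of "x - c *\<^sub>R y"] mult_left_mono[of "G (x - c *\<^sub>R y) powr b" B2 "F (x - y) powr a"] by (simp add: mult.commute)
      ultimately have "norm y powr e * (F (x - y) powr a * G (x - c *\<^sub>R y) powr b) \<le> 1 * (B2 * F (x - y) powr a)"
        by (rule mult_mono) auto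
      then have "ennreal (norm y powr e) * ennreal (F (x - y) powr a * G (x - c *\<^sub>R y) powr b) \<le> ennreal B2 * ennreal (F (x - y) powr a)"
        using B2(1) by (simp add: ennreal_mult[symmetric] ennreal_leI)
      then show ?thesis using False by simp
    qed
  qed
  also have "\<dots> = ennreal (B1 * B2) * (\<integral>\<^sup>+y. ennreal (norm (y::'a) powr e) * indicator (ball 0 1) y \<partial>lborel) + ennreal B2 * (\<integral>\<^sup>+y. ennreal (F (x - y) powr a) \<partial>lborel)"
  proof -
    have m1: "(\<lambda>y. ennreal (norm (y::'a) powr e) * indicator (ball 0 1) y) \<in> borel_measurable lborel"
      by (intro borel_measurable_times_ennreal ind) measurable
    show ?thesis
      by (subst nn_integral_add)
         (use m1 in \<open>auto simp: nn_integral_cmult intro!: borel_measurable_times_ennreal\<close>)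
  qed
  also have "(\<integral>\<^sup>+y. ennreal (F (x - y) powr a) \<partial>lborel) = (\<integral>\<^sup>+y. ennreal (F y powr a) \<partial>lborel)"
    by (rule nn_integral_lborel_minus) measurable
  also have "ennreal (B1 * B2) * (\<integral>\<^sup>+y. ennreal (norm (y::'a) powr e) * indicator (ball 0 1) y \<partial>lborel) + ennreal B2 * \<dots> < \<infinity>"
    using F a C by (auto simp: tame_def ennreal_mult_less_top intro: order.strict_trans1)
  finally show ?thesis .
qed

text \<open>The q-th power of the dyadic sum is at most the sum of the q-th powers, so each scale
  can be localized on its own. The weight \<open>2 powr (k * (n * \<tau>))\<close> is then shared
  between the two averages, and each factor is summed by the crossing argument.\<close>

lemma bop_bounded_quasi:
  fixes c :: real
  assumes a: "0 < a" "a < 1" and b: "0 < b" "b < 1" and t: "0 < \<tau>" "\<tau> < 1" and r: "1 \<le> a + b - \<tau>"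
    and c: "c \<noteq> 1"
  shows "bop_bounded (riesz \<tau>) (\<lambda>y. y :: 'a::euclidean_space) (\<lambda>y. c *\<^sub>R y) a b (a + b - \<tau>)"
proof -
  define q where "q = 1 / (a + b - \<tau>)"
  have q: "0 < q" "q \<le> 1" using r by (auto simp: q_def)
  define n where "n = real DIM('a)"
  have n: "0 < n" by (simp add: n_def)
  define e where "e = n * (\<tau> - 1)"
  define w where "w = measure lborel (ball (0::'a) 1)"
  have w: "0 < w" using unit_vol_pos by (simp add: w_def)
  obtain m :: nat where m: "max 2 (1 + \<bar>c\<bar>) < (2::real) ^ m" using real_arch_pow[of 2 "max 2 (1 + \<bar>c\<bar>)"] by auto
  then have m': "(2::real) \<le> 2 ^ m" "1 + \<bar>c\<bar> \<le> 2 ^ m" by auto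
  \<comment> \<open>Splitting \<open>\<tau>\<close> in the proportion of \<open>a\<close> to
    \<open>b\<close> yields both \<open>\<tau>1 < a\<close> and \<open>\<tau>2 < b\<close> from
    \<open>\<tau> < a + b\<close>.\<close>
  define \<tau>1 where "\<tau>1 = \<tau> * (a / (a + b))"
  define \<tau>2 where "\<tau>2 = \<tau> * (b / (a + b))"
  have "\<tau>1 + \<tau>2 = \<tau> * ((a + b) / (a + b))" by (simp only: \<tau>1_def \<tau>2_def add_divide_distrib distrib_left)
  then have tt: "\<tau> = \<tau>1 + \<tau>2" "0 < \<tau>1" "0 < \<tau>2" using a b t by (auto simp: \<tau>1_def \<tau>2_def)
  have \<kappa>: "\<tau> / (a + b) < 1" using a b r by simp
  have t12: "\<tau>1 < a" "\<tau>2 < b"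
    using mult_strict_right_mono[OF \<kappa> a(1)] mult_strict_right_mono[OF \<kappa> b(1)] by (auto simp: \<tau>1_def \<tau>2_def)
  \<comment> \<open>The Hoelder weights of the last step; that they add up to 1,
    \<open>q * (a - \<tau>1) + q * (b - \<tau>2) = 1\<close>, is the scaling relation.\<close>
  define l where "l = q * (a - \<tau>1)"
  have l: "0 \<le> l" "l \<le> 1" "1 - l = q * (b - \<tau>2)"
  proof -
    have *: "q * (a - \<tau>1) + q * (b - \<tau>2) = 1"
      using r tt(1) by (simp add: q_def add_divide_distrib[symmetric])
    show "0 \<le> l" using t12 q by (simp add: l_def)
    have "0 \<le> q * (b - \<tau>2)" using t12 q by simp
    then show "l \<le> 1" "1 - l = q * (b - \<tau>2)" using * by (auto simp: l_def)
  qed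
  define K1 where "K1 = 2 powr (2 * real m * n) / (w * \<bar>1 - c\<bar> ^ DIM('a))"
  have K1: "0 < K1" using w c by (simp add: K1_def)
  \<comment> \<open>The averages are taken at scale \<open>k + m\<close>; the shift only improves
    the decay, so \<open>m\<close> does not enter the constant.\<close>
  have dyadic: "\<exists>C\<ge>0. \<forall>F::'a \<Rightarrow> real. tame F \<and> (\<integral>\<^sup>+x. ennreal (F x) \<partial>lborel) \<le> 1 \<longrightarrow> (\<forall>z.
     (\<Sum>j. ennreal ((2 powr (real_of_int (int_decode j) * (n * \<sigma>)) * avg (int_decode j + int m) (\<lambda>x. F x powr \<alpha>) z) powr q))
       \<le> ennreal (C * mx (\<lambda>x. F x powr \<alpha>) z powr (q * ((\<alpha> - \<sigma>) / \<alpha>))))"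
    if \<sigma>: "0 < \<sigma>" "\<sigma> < \<alpha>" "\<alpha> < 1" for \<sigma> \<alpha>
  proof -
    define D where "D = max 1 (w powr (1 - \<alpha>))"
    have D: "1 \<le> D" by (simp add: D_def)
    have "0 < n * \<sigma> * q" "0 < n * (\<alpha> - \<sigma>) * q" "0 \<le> D powr q" using n \<sigma> q by auto
    from suminf_dyadic_crossing[OF this] obtain C where C: "0 \<le> C" "\<And>M e. 0 \<le> M \<Longrightarrow>
      (\<And>k. 0 \<le> e k \<and> e k \<le> D powr q * M * 2 powr (real_of_int k * (n * \<sigma> * q)) \<and> e k \<le> D powr q * 2 powr (- (real_of_int k * (n * (\<alpha> - \<sigma>) * q))))
      \<Longrightarrow> (\<Sum>j. ennreal (e (int_decode j))) \<le> ennreal (C * M powr (n * (\<alpha> - \<sigma>) * q / (n * \<sigma> * q + n * (\<alpha> - \<sigma>) * q)))"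
      by blast
    have th: "n * (\<alpha> - \<sigma>) * q / (n * \<sigma> * q + n * (\<alpha> - \<sigma>) * q) = (\<alpha> - \<sigma>) / \<alpha>"
    proof -
      have 1: "n * \<sigma> * q + n * (\<alpha> - \<sigma>) * q = \<alpha> * (n * q)" and 2: "n * (\<alpha> - \<sigma>) * q = (\<alpha> - \<sigma>) * (n * q)"
        by (simp_all add: algebra_simps)
      show ?thesis unfolding 1 unfolding 2 using n q by simp
    qed
    have "(\<Sum>j. ennreal ((2 powr (real_of_int (int_decode j) * (n * \<sigma>)) * avg (int_decode j + int m) (\<lambda>x. F x powr \<alpha>) z) powr q))
       \<le> ennreal (C * mx (\<lambda>x. F x powr \<alpha>) z powr (q * ((\<alpha> - \<sigma>) / \<alpha>)))"
      if F: "tame F" "(\<integral>\<^sup>+x. ennreal (F x) \<partial>lborel) \<le> 1" for F :: "'a \<Rightarrow> real" and z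
    proof -
      define u where "u x = F x powr \<alpha>" for x
      have bu: "bdd_borel u" unfolding u_def by (rule tame_powr_bdd_borel) (use F \<sigma> in auto)
      define E where "E k = (2 powr (real_of_int k * (n * \<sigma>)) * avg (k + int m) u z)" for k
      have E0: "0 \<le> E k" for k by (simp add: E_def avg_nonneg)
      have bound: "0 \<le> E k powr q \<and> E k powr q \<le> D powr q * (mx u z powr q) * 2 powr (real_of_int k * (n * \<sigma> * q))
          \<and> E k powr q \<le> D powr q * 2 powr (- (real_of_int k * (n * (\<alpha> - \<sigma>) * q)))" for k
      proof (intro conjI)
        have "avg (k + int m) u z \<le> D * mx u z"
          using avg_le_mx[OF bu, of "k + int m" z] mult_right_mono[OF D mx_nonneg[of u z]] by simp
        then have "2 powr (real_of_int k * (n * \<sigma>)) * avg (k + int m) u z \<le> 2 powr (real_of_int k * (n * \<sigma>)) * (D * mx u z)"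
          by (rule mult_left_mono) simp
        then have "E k powr q \<le> (D * mx u z * 2 powr (real_of_int k * (n * \<sigma>))) powr q"
          using E0[of k] q by (intro powr_mono2) (auto simp: E_def mult_ac)
        also have "\<dots> = D powr q * (mx u z powr q) * 2 powr (real_of_int k * (n * \<sigma> * q))"
          by (simp add: powr_mult powr_powr mult.assoc)
        finally show "E k powr q \<le> D powr q * (mx u z powr q) * 2 powr (real_of_int k * (n * \<sigma> * q))" .
        have "avg (k + int m) u z \<le> w powr (1 - \<alpha>) * 2 powr (- (real_of_int (k + int m) * (n * \<alpha>)))"
          unfolding u_def n_def w_def by (rule avg_powr_le) (use F \<sigma> in auto)
        also have "\<dots> \<le> D * 2 powr (- (real_of_int k * (n * \<alpha>)))"
        proof (rule mult_mono)
          have "real_of_int k * (n * \<alpha>) \<le> real_of_int (k + int m) * (n * \<alpha>)"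
            using n \<sigma> by (intro mult_right_mono) auto
          then show "2 powr (- (real_of_int (k + int m) * (n * \<alpha>))) \<le> 2 powr (- (real_of_int k * (n * \<alpha>)))"
            by (intro powr_mono) auto
        qed (auto simp: D_def)
        finally have "E k \<le> 2 powr (real_of_int k * (n * \<sigma>)) * (D * 2 powr (- (real_of_int k * (n * \<alpha>))))"
          unfolding E_def by (rule mult_left_mono) simp
        also have "\<dots> = D * (2 powr (real_of_int k * (n * \<sigma>)) * 2 powr (- (real_of_int k * (n * \<alpha>))))" by simp
        also have "\<dots> = D * 2 powr (- (real_of_int k * (n * (\<alpha> - \<sigma>))))"
          unfolding powr_add[symmetric] by (simp add: algebra_simps)
        finally have "E k powr q \<le> (D * 2 powr (- (real_of_int k * (n * (\<alpha> - \<sigma>))))) powr q"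
          using E0[of k] q by (intro powr_mono2) auto
        also have "\<dots> = D powr q * 2 powr (- (real_of_int k * (n * (\<alpha> - \<sigma>) * q)))"
          by (simp add: powr_mult powr_powr mult.assoc)
        finally show "E k powr q \<le> D powr q * 2 powr (- (real_of_int k * (n * (\<alpha> - \<sigma>) * q)))" .
      qed simp
      have "(\<Sum>j. ennreal (E (int_decode j) powr q)) \<le> ennreal (C * (mx u z powr q) powr (n * (\<alpha> - \<sigma>) * q / (n * \<sigma> * q + n * (\<alpha> - \<sigma>) * q)))"
        by (rule C(2)) (simp, rule bound)
      then show ?thesis unfolding th powr_powr E_def u_def[abs_def] .
    qed
    with C(1) show ?thesis by blast
  qed
  obtain C1 where C1: "0 \<le> C1" "\<And>F z. tame F \<Longrightarrow> (\<integral>\<^sup>+x. ennreal (F (x::'a)) \<partial>lborel) \<le> 1 \<Longrightarrow>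
     (\<Sum>j. ennreal ((2 powr (real_of_int (int_decode j) * (n * \<tau>1)) * avg (int_decode j + int m) (\<lambda>x. F x powr a) z) powr q))
       \<le> ennreal (C1 * mx (\<lambda>x. F x powr a) z powr (q * ((a - \<tau>1) / a)))"
    using dyadic[OF tt(2) t12(1) a(2)] by blast
  obtain C2 where C2: "0 \<le> C2" "\<And>F z. tame F \<Longrightarrow> (\<integral>\<^sup>+x. ennreal (F (x::'a)) \<partial>lborel) \<le> 1 \<Longrightarrow>
     (\<Sum>j. ennreal ((2 powr (real_of_int (int_decode j) * (n * \<tau>2)) * avg (int_decode j + int m) (\<lambda>x. F x powr b) z) powr q))
       \<le> ennreal (C2 * mx (\<lambda>x. F x powr b) z powr (q * ((b - \<tau>2) / b)))"
    using dyadic[OF tt(3) t12(2) b(2)] by blast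
  obtain M1 where M1: "0 \<le> M1" "\<And>F. tame F \<Longrightarrow> (\<integral>\<^sup>+x. ennreal (F (x::'a)) \<partial>lborel) \<le> 1 \<Longrightarrow>
    (\<integral>\<^sup>+x. ennreal (mx (\<lambda>x. F x powr a) x powr (1 / a)) \<partial>lborel) \<le> ennreal M1"
    using mx_powr_integral[OF a, where 'a = 'a] by blast
  obtain M2 where M2: "0 \<le> M2" "\<And>F. tame F \<Longrightarrow> (\<integral>\<^sup>+x. ennreal (F (x::'a)) \<partial>lborel) \<le> 1 \<Longrightarrow>
    (\<integral>\<^sup>+x. ennreal (mx (\<lambda>x. F x powr b) x powr (1 / b)) \<partial>lborel) \<le> ennreal M2"
    using mx_powr_integral[OF b, where 'a = 'a] by blast
  define K2 where "K2 = 2 powr \<bar>e\<bar> * K1"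
  have K2: "0 < K2" using K1 by (simp add: K2_def)
  show ?thesis
  proof (rule bop_boundedI)
    show "0 \<le> K2 powr q * (C1 * C2) * (M1 powr l * M2 powr (1 - l))" using C1 C2 M1 M2 by simp
    fix F G :: "'a \<Rightarrow> real"
    assume F: "tame F" and G: "tame G" and F1: "(\<integral>\<^sup>+x. ennreal (F x) \<partial>lborel) \<le> 1" and G1: "(\<integral>\<^sup>+x. ennreal (G x) \<partial>lborel) \<le> 1"
    show fin: "bop (riesz \<tau>) (\<lambda>y. y) (\<lambda>y. c *\<^sub>R y) (\<lambda>x. F x powr a) (\<lambda>x. G x powr b) x < \<infinity>" for x
      by (rule bop_riesz_finite[OF F G]) (use a b t in auto)
    have FG[measurable]: "F \<in> borel_measurable borel" "G \<in> borel_measurable borel" using F G by (auto dest: tame_measurable)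
    define u where "u x = F x powr a" for x
    define v where "v x = G x powr b" for x
    have bu: "bdd_borel u" unfolding u_def by (rule tame_powr_bdd_borel[OF F a(1)])
    have bv: "bdd_borel v" unfolding v_def by (rule tame_powr_bdd_borel[OF G b(1)])
    have uvm[measurable]: "u \<in> borel_measurable borel" "v \<in> borel_measurable borel" using bu bv by (auto simp: bdd_borel_def)
    define d where "d k x = enn2real (\<integral>\<^sup>+y. ennreal (u (x - y)) * ennreal (v (x - c *\<^sub>R y)) * indicator (ball 0 (2 powr real_of_int k)) y \<partial>lborel)" for k x
    have dm: "d k \<in> borel_measurable borel" for k
      using bilinear_localized_Lq(3)[OF bu bv c m' q, of k] unfolding d_def[abs_def] .
    have deq: "(\<integral>\<^sup>+y. ennreal (u (x - y)) * ennreal (v (x - c *\<^sub>R y)) * indicator (ball 0 (2 powr real_of_int k)) y \<partial>lborel) = ennreal (d k x)" for k x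
      unfolding d_def by (rule bilinear_localized_Lq(2)[OF bu bv c m' q])
    have dLq: "(\<integral>\<^sup>+x. ennreal (d k x powr q) \<partial>lborel)
      \<le> (\<integral>\<^sup>+z. ennreal ((K1 * 2 powr (real_of_int k * n) * avg (k + int m) u z * avg (k + int m) v z) powr q) \<partial>lborel)" for k
      unfolding d_def K1_def w_def n_def by (rule bilinear_localized_Lq(1)[OF bu bv c m' q])
    define B where "B x = enn2real (bop (riesz \<tau>) (\<lambda>y. y) (\<lambda>y. c *\<^sub>R y) u v x)" for x
    define s where "s k x = 2 powr \<bar>e\<bar> * 2 powr (real_of_int k * e) * d k x" for k x
    have s0: "0 \<le> s k x" for k x by (simp add: s_def d_def)
    have Bs: "ennreal (B x) \<le> (\<Sum>j. ennreal (s (int_decode j) x))" for x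
    proof -
      have "ennreal (B x) = bop (riesz \<tau>) (\<lambda>y. y) (\<lambda>y. c *\<^sub>R y) u v x"
        using fin[of x] by (simp add: B_def u_def[abs_def] v_def[abs_def])
      also have "\<dots> = (\<integral>\<^sup>+y. ennreal (norm y powr e) * (ennreal (u (x - y)) * ennreal (v (x - c *\<^sub>R y))) \<partial>lborel)"
        unfolding bop_def riesz_def e_def n_def by (simp add: ennreal_mult u_def v_def)
      also have "\<dots> \<le> (\<Sum>j. ennreal (2 powr \<bar>e\<bar> * 2 powr (real_of_int (int_decode j) * e)) *
        (\<integral>\<^sup>+y. ennreal (u (x - y)) * ennreal (v (x - c *\<^sub>R y)) * indicator (ball 0 (2 powr real_of_int (int_decode j))) y \<partial>lborel))"
        by (rule nn_integral_dyadic_kernel_le) measurable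
      also have "\<dots> = (\<Sum>j. ennreal (s (int_decode j) x))"
        unfolding deq s_def by (intro suminf_cong ennreal_mult[symmetric]) (auto simp: d_def)
      finally show ?thesis .
    qed
    define h1 where "h1 k z = 2 powr (real_of_int k * (n * \<tau>1)) * avg (k + int m) u z" for k z
    define h2 where "h2 k z = 2 powr (real_of_int k * (n * \<tau>2)) * avg (k + int m) v z" for k z
    have h0: "0 \<le> h1 k z" "0 \<le> h2 k z" for k z by (auto simp: h1_def h2_def avg_nonneg)
    have hm: "h1 k \<in> borel_measurable borel" "h2 k \<in> borel_measurable borel" for k
      unfolding h1_def[abs_def] h2_def[abs_def] by measurable
    have sLq: "(\<integral>\<^sup>+x. ennreal (s k x powr q) \<partial>lborel) \<le> ennreal (K2 powr q) * (\<integral>\<^sup>+z. ennreal (h1 k z powr q * h2 k z powr q) \<partial>lborel)" for k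
    proof -
      define L where "L = 2 powr \<bar>e\<bar> * 2 powr (real_of_int k * e)"
      have L: "0 < L" by (simp add: L_def)
      have "(\<integral>\<^sup>+x. ennreal (s k x powr q) \<partial>lborel) = (\<integral>\<^sup>+x. ennreal (L powr q) * ennreal (d k x powr q) \<partial>lborel)"
        unfolding s_def L_def[symmetric] by (simp add: powr_mult ennreal_mult)
      also have "\<dots> = ennreal (L powr q) * (\<integral>\<^sup>+x. ennreal (d k x powr q) \<partial>lborel)"
        using dm[of k] by (intro nn_integral_cmult) simp
      also have "\<dots> \<le> ennreal (L powr q) * (\<integral>\<^sup>+z. ennreal ((K1 * 2 powr (real_of_int k * n) * avg (k + int m) u z * avg (k + int m) v z) powr q) \<partial>lborel)"
        by (intro mult_left_mono dLq) simp
      also have "\<dots> = (\<integral>\<^sup>+z. ennreal (L powr q) * ennreal ((K1 * 2 powr (real_of_int k * n) * avg (k + int m) u z * avg (k + int m) v z) powr q) \<partial>lborel)"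
        by (rule nn_integral_cmult[symmetric]) measurable
      also have "\<dots> = (\<integral>\<^sup>+z. ennreal (K2 powr q) * ennreal (h1 k z powr q * h2 k z powr q) \<partial>lborel)"
      proof (rule nn_integral_cong)
        fix z
        have "L * (K1 * 2 powr (real_of_int k * n) * avg (k + int m) u z * avg (k + int m) v z) = K2 * (h1 k z * h2 k z)"
        proof -
          have "2 powr (real_of_int k * e) * 2 powr (real_of_int k * n) = 2 powr (real_of_int k * (n * \<tau>1)) * 2 powr (real_of_int k * (n * \<tau>2))"
            unfolding powr_add[symmetric] by (simp add: e_def tt(1) algebra_simps)
          then have "(2 powr (real_of_int k * e) * 2 powr (real_of_int k * n)) * (2 powr \<bar>e\<bar> * K1 * (avg (k + int m) u z * avg (k + int m) v z))
            = (2 powr (real_of_int k * (n * \<tau>1)) * 2 powr (real_of_int k * (n * \<tau>2))) * (2 powr \<bar>e\<bar> * K1 * (avg (k + int m) u z * avg (k + int m) v z))" by simp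
          then show ?thesis by (simp add: L_def K2_def h1_def h2_def mult_ac)
        qed
        then have "L powr q * (K1 * 2 powr (real_of_int k * n) * avg (k + int m) u z * avg (k + int m) v z) powr q = K2 powr q * (h1 k z powr q * h2 k z powr q)"
          by (metis powr_mult)
        then show "ennreal (L powr q) * ennreal ((K1 * 2 powr (real_of_int k * n) * avg (k + int m) u z * avg (k + int m) v z) powr q)
          = ennreal (K2 powr q) * ennreal (h1 k z powr q * h2 k z powr q)"
          by (simp add: ennreal_mult[symmetric])
      qed
      also have "\<dots> = ennreal (K2 powr q) * (\<integral>\<^sup>+z. ennreal (h1 k z powr q * h2 k z powr q) \<partial>lborel)"
        using hm[of k] by (intro nn_integral_cmult) simp
      finally show ?thesis .
    qed
    \<comment> \<open>The second factor is bounded by the whole of its own series, uniformly in the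
      scale, and the first factor is summed.\<close>
    have hsum: "(\<Sum>j. ennreal (h1 (int_decode j) z powr q * h2 (int_decode j) z powr q))
      \<le> ennreal (C1 * C2 * ((mx u z powr (1 / a)) powr l * (mx v z powr (1 / b)) powr (1 - l)))" for z
    proof -
      define X where "X = C1 * mx u z powr (q * ((a - \<tau>1) / a))"
      define Y where "Y = C2 * mx v z powr (q * ((b - \<tau>2) / b))"
      have X: "(\<Sum>j. ennreal (h1 (int_decode j) z powr q)) \<le> ennreal X"
        unfolding h1_def X_def u_def by (rule C1(2)[OF F F1])
      have Y: "(\<Sum>j. ennreal (h2 (int_decode j) z powr q)) \<le> ennreal Y"
        unfolding h2_def Y_def v_def by (rule C2(2)[OF G G1])
      have Yj: "ennreal (h2 (int_decode j) z powr q) \<le> ennreal Y" for j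
        using term_le_suminf_ennreal[of "\<lambda>j. ennreal (h2 (int_decode j) z powr q)" j] Y by (rule order_trans)
      have "(\<Sum>j. ennreal (h1 (int_decode j) z powr q * h2 (int_decode j) z powr q)) \<le> (\<Sum>j. ennreal (h1 (int_decode j) z powr q) * ennreal Y)"
        using Yj by (intro suminf_le) (auto simp: ennreal_mult intro: mult_left_mono)
      also have "\<dots> = (\<Sum>j. ennreal (h1 (int_decode j) z powr q)) * ennreal Y" by simp
      also have "\<dots> \<le> ennreal X * ennreal Y" by (rule mult_right_mono[OF X]) simp
      also have "\<dots> = ennreal (X * Y)" using C1 C2 by (simp add: ennreal_mult X_def Y_def)
      also have "X * Y = C1 * C2 * ((mx u z powr (1 / a)) powr l * (mx v z powr (1 / b)) powr (1 - l))"
        unfolding l(3) X_def Y_def unfolding l_def by (simp add: powr_powr)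
      finally show ?thesis .
    qed
    \<comment> \<open>Subadditivity separates the scales, each is localized, and the sum is then
      taken back inside the integral, where it is estimated pointwise.\<close>
    have "(\<integral>\<^sup>+x. ennreal (B x powr q) \<partial>lborel) \<le> (\<integral>\<^sup>+x. (\<Sum>j. ennreal (s (int_decode j) x powr q)) \<partial>lborel)"
      by (intro nn_integral_mono powr_le_suminf_powr s0 Bs q) (simp add: B_def)
    also have "\<dots> = (\<Sum>j. \<integral>\<^sup>+x. ennreal (s (int_decode j) x powr q) \<partial>lborel)"
    proof (rule nn_integral_suminf)
      fix j
      have "s (int_decode j) \<in> borel_measurable borel" unfolding s_def[abs_def] using dm by simp
      then show "(\<lambda>x. ennreal (s (int_decode j) x powr q)) \<in> borel_measurable lborel" by simp
    qed
    also have "\<dots> \<le> (\<Sum>j. ennreal (K2 powr q) * (\<integral>\<^sup>+z. ennreal (h1 (int_decode j) z powr q * h2 (int_decode j) z powr q) \<partial>lborel))"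
      by (intro suminf_le sLq) auto
    also have "\<dots> = ennreal (K2 powr q) * (\<integral>\<^sup>+z. (\<Sum>j. ennreal (h1 (int_decode j) z powr q * h2 (int_decode j) z powr q)) \<partial>lborel)"
    proof -
      have "(\<integral>\<^sup>+z. (\<Sum>j. ennreal (h1 (int_decode j) z powr q * h2 (int_decode j) z powr q)) \<partial>lborel)
        = (\<Sum>j. \<integral>\<^sup>+z. ennreal (h1 (int_decode j) z powr q * h2 (int_decode j) z powr q) \<partial>lborel)"
        using hm by (intro nn_integral_suminf) simp
      then show ?thesis by simp
    qed
    also have "\<dots> \<le> ennreal (K2 powr q) * (\<integral>\<^sup>+z. ennreal (C1 * C2) * ennreal ((mx u z powr (1 / a)) powr l * (mx v z powr (1 / b)) powr (1 - l)) \<partial>lborel)"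
    proof (intro mult_left_mono nn_integral_mono)
      fix z
      have "ennreal (C1 * C2 * ((mx u z powr (1 / a)) powr l * (mx v z powr (1 / b)) powr (1 - l)))
        = ennreal (C1 * C2) * ennreal ((mx u z powr (1 / a)) powr l * (mx v z powr (1 / b)) powr (1 - l))"
        using C1(1) C2(1) by (intro ennreal_mult) auto
      then show "(\<Sum>j. ennreal (h1 (int_decode j) z powr q * h2 (int_decode j) z powr q))
        \<le> ennreal (C1 * C2) * ennreal ((mx u z powr (1 / a)) powr l * (mx v z powr (1 / b)) powr (1 - l))"
        using hsum[of z] by simp
    qed simp
    also have "\<dots> = ennreal (K2 powr q) * (ennreal (C1 * C2) * (\<integral>\<^sup>+z. ennreal ((mx u z powr (1 / a)) powr l * (mx v z powr (1 / b)) powr (1 - l)) \<partial>lborel))"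
    proof -
      have "(\<lambda>z. ennreal ((mx u z powr (1 / a)) powr l * (mx v z powr (1 / b)) powr (1 - l))) \<in> borel_measurable lborel"
        by measurable
      then show ?thesis by (simp add: nn_integral_cmult)
    qed
    also have "\<dots> \<le> ennreal (K2 powr q) * (ennreal (C1 * C2) * ennreal (M1 powr l * M2 powr (1 - l)))"
    proof (intro mult_left_mono nn_integral_Holder)
      show "(\<lambda>x. mx u x powr (1 / a)) \<in> borel_measurable lborel" "(\<lambda>x. mx v x powr (1 / b)) \<in> borel_measurable lborel" by measurable
      show "(\<integral>\<^sup>+x. ennreal (mx u x powr (1 / a)) \<partial>lborel) \<le> ennreal M1"
        unfolding u_def by (rule M1(2)[OF F F1])
      show "(\<integral>\<^sup>+x. ennreal (mx v x powr (1 / b)) \<partial>lborel) \<le> ennreal M2"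
        unfolding v_def by (rule M2(2)[OF G G1])
    qed (use l M1 M2 in auto)
    also have "\<dots> = ennreal (K2 powr q * (C1 * C2) * (M1 powr l * M2 powr (1 - l)))"
      using C1 C2 by (simp add: ennreal_mult[symmetric] mult.assoc)
    finally show "(\<integral>\<^sup>+x. ennreal (enn2real (bop (riesz \<tau>) (\<lambda>y. y) (\<lambda>y. c *\<^sub>R y) (\<lambda>x. F x powr a) (\<lambda>x. G x powr b) x)
        powr (1 / (a + b - \<tau>))) \<partial>lborel) \<le> ennreal (K2 powr q * (C1 * C2) * (M1 powr l * M2 powr (1 - l)))"
      unfolding B_def u_def[abs_def] v_def[abs_def] q_def .
  qed
qed

section \<open>The full range by interpolation\<close>

text \<open>The point \<open>(a, b, \<tau>)\<close> lies on the segment between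
  \<open>(a / l, 0, \<kappa> * (a / l))\<close> and
  \<open>(0, b / (1 - l), \<kappa> * (b / (1 - l)))\<close>, at each of which one function is merely
  bounded and the estimate is linear.\<close>

lemma bop_bounded_banach:
  fixes c :: real
  assumes a: "0 < a" and b: "0 < b" and ab: "a + b < 1" and t: "0 < \<tau>" "\<tau> < a + b" and c: "c \<noteq> 0"
  shows "bop_bounded (riesz \<tau>) (\<lambda>y. y :: 'a::euclidean_space) (\<lambda>y. c *\<^sub>R y) a b (a + b - \<tau>)"
proof -
  \<comment> \<open>The midpoint of \<open>a\<close> and \<open>1 - b\<close>, so that
    \<open>a / l\<close> and \<open>b / (1 - l)\<close> are both below 1.\<close>
  define l where "l = (a + 1 - b) / 2"
  have l: "a < l" "b < 1 - l" "0 < l" "l < 1" using a b ab by (auto simp: l_def field_simps)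
  \<comment> \<open>The common ratio keeps the kernel parameter below the exponent at both
    endpoints.\<close>
  define \<kappa> where "\<kappa> = \<tau> / (a + b)"
  have \<kappa>: "0 < \<kappa>" "\<kappa> < 1" using a b t by (auto simp: \<kappa>_def)
  have p1: "0 < a / l" "a / l < 1" "0 < b / (1 - l)" "b / (1 - l) < 1" using l a b by auto
  have p2: "\<kappa> * (a / l) < a / l" "\<kappa> * (b / (1 - l)) < b / (1 - l)"
    using mult_strict_right_mono[OF \<kappa>(2) p1(1)] mult_strict_right_mono[OF \<kappa>(2) p1(3)] by auto
  have p3: "0 < \<kappa> * (a / l)" "0 < \<kappa> * (b / (1 - l))" using mult_pos_pos[OF \<kappa>(1) p1(1)] mult_pos_pos[OF \<kappa>(1) p1(3)] by auto
  show ?thesis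
  proof (rule riesz_bounded_interpolate)
    show "bop_bounded (riesz (\<kappa> * (a / l))) (\<lambda>y. y :: 'a) (\<lambda>y. c *\<^sub>R y) (a / l) 0 (a / l + 0 - \<kappa> * (a / l))"
      using bop_bounded_left[OF p3(1) p2(1) p1(2)] by simp
    show "bop_bounded (riesz (\<kappa> * (b / (1 - l)))) (\<lambda>y. y :: 'a) (\<lambda>y. c *\<^sub>R y) 0 (b / (1 - l)) (0 + b / (1 - l) - \<kappa> * (b / (1 - l)))"
      using bop_bounded_right[OF p3(2) p2(2) p1(4) c] by simp
    have "\<kappa> * a + \<kappa> * b = \<kappa> * (a + b)" by (simp add: distrib_left)
    also have "\<dots> = \<tau>" using a b by (simp add: \<kappa>_def)
    finally have "\<kappa> * a + \<kappa> * b = \<tau>" .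
    then show "\<tau> = l * (\<kappa> * (a / l)) + (1 - l) * (\<kappa> * (b / (1 - l)))" using l by simp
  qed (use l p2 in auto)
qed

text \<open>The remaining triples \<open>(a, b, \<tau>)\<close> are convex combinations of one near \<open>(1, 1, 1)\<close>, where \<open>q \<le> 1\<close>,
  and one with \<open>a + b < 1\<close>.\<close>

theorem bilinear_fractional_integral:
  fixes c :: real
  assumes a: "0 < a" "a < 1" and b: "0 < b" "b < 1" and t: "0 < \<tau>" "\<tau> < 1" "\<tau> < a + b"
    and c: "c \<noteq> 0" "c \<noteq> 1"
  shows "bop_bounded (riesz \<tau>) (\<lambda>y. y :: 'a::euclidean_space) (\<lambda>y. c *\<^sub>R y) a b (a + b - \<tau>)"
proof -
  consider "1 \<le> a + b - \<tau>" | "a + b < 1" | "a + b - \<tau> < 1" "1 \<le> a + b" by linarith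
  then show ?thesis
  proof cases
    case 1
    then show ?thesis using bop_bounded_quasi[OF a b t(1,2) _ c(2)] by blast
  next
    case 2
    then show ?thesis using bop_bounded_banach[OF a(1) b(1) _ t(1,3) c(1)] by blast
  next
    case 3
    \<comment> \<open>\<open>l\<close> is the weight of the point near \<open>(1, 1, 1)\<close>.
      Above \<open>a + b - 1\<close> it leaves a remainder with \<open>a2 + b2 < 1\<close>; below
      \<open>a\<close>, \<open>b\<close> and \<open>\<tau>\<close> it leaves positive coordinates;
      below \<open>a + b - \<tau>\<close> it leaves \<open>t2 < a2 + b2\<close>.\<close>
    have "a + b - 1 < min (min a b) (min \<tau> (a + b - \<tau>))" using 3 a b t by auto
    then obtain l where l: "a + b - 1 < l" "l < min (min a b) (min \<tau> (a + b - \<tau>))" using dense by blast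
    have l0: "0 < l" "l < 1" using l 3 a by auto
    \<comment> \<open>The first point is
      \<open>(1 - \<epsilon>, 1 - \<epsilon>, 1 - 3 * \<epsilon>)\<close>, where
      \<open>r = 1 + \<epsilon>\<close>. The bound \<open>1 / 3\<close> keeps its third coordinate
      positive, the other two preserve the strict inequalities of the remainder.\<close>
    have "0 < min (1 / 3) (min ((1 + l - a - b) / 2) (a + b - \<tau> - l))" using l by auto
    then obtain \<epsilon> where \<epsilon>: "0 < \<epsilon>" "\<epsilon> < min (1 / 3) (min ((1 + l - a - b) / 2) (a + b - \<tau> - l))" using dense by blast
    have \<epsilon>3: "\<epsilon> < 1 / 3" "2 * \<epsilon> < 1 + l - a - b" "\<epsilon> < a + b - \<tau> - l" using \<epsilon> by auto
    have le: "l * \<epsilon> < \<epsilon>" using l0 \<epsilon> by simp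
    have le0: "0 < l * \<epsilon>" using l0 \<epsilon> by simp
    define a2 where "a2 = (a - l * (1 - \<epsilon>)) / (1 - l)"
    define b2 where "b2 = (b - l * (1 - \<epsilon>)) / (1 - l)"
    define t2 where "t2 = (\<tau> - l * (1 - 3 * \<epsilon>)) / (1 - l)"
    have pos: "0 < a2" "0 < b2" "0 < t2"
      using l l0 le0 by (auto simp: a2_def b2_def t2_def algebra_simps intro!: divide_pos_pos)
    have ab2: "a2 + b2 < 1"
      unfolding a2_def b2_def add_divide_distrib[symmetric] using l0 le \<epsilon>3 by (simp add: algebra_simps)
    have t2: "t2 < a2 + b2"
      unfolding a2_def b2_def t2_def add_divide_distrib[symmetric] using l0 le \<epsilon>3
      by (intro divide_strict_right_mono) (auto simp: algebra_simps)
    show ?thesis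
    proof (rule riesz_bounded_interpolate)
      show "bop_bounded (riesz (1 - 3 * \<epsilon>)) (\<lambda>y. y :: 'a) (\<lambda>y. c *\<^sub>R y) (1 - \<epsilon>) (1 - \<epsilon>) ((1 - \<epsilon>) + (1 - \<epsilon>) - (1 - 3 * \<epsilon>))"
        by (rule bop_bounded_quasi) (use \<epsilon>(1) \<epsilon>3(1) c in auto)
      show "bop_bounded (riesz t2) (\<lambda>y. y :: 'a) (\<lambda>y. c *\<^sub>R y) a2 b2 (a2 + b2 - t2)"
        by (rule bop_bounded_banach) (use pos ab2 t2 c in auto)
      show "a = l * (1 - \<epsilon>) + (1 - l) * a2" "b = l * (1 - \<epsilon>) + (1 - l) * b2" "\<tau> = l * (1 - 3 * \<epsilon>) + (1 - l) * t2"
        using l0 by (auto simp: a2_def b2_def t2_def)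
    qed (use l0 t2 \<epsilon>(1) \<epsilon>3(1) in auto)
  qed
qed

section \<open>The kernel on the product space\<close>

text \<open>The dimension in the exponent is that of one factor: for \<open>\<tau> = s/n\<close> the
  kernel is |z|^(s-2n) on a space of dimension 2n.\<close>

definition riesz2 :: "real \<Rightarrow> 'a::euclidean_space \<times> 'a \<Rightarrow> real"
  where "riesz2 \<tau> z = norm z powr (real DIM('a) * (\<tau> - 2))"

text \<open>Once the kernel is split, Hoelder's inequality in x combines the two linear potentials.
  It is applied to powers of nonnegative functions, so target exponents below 1 make no difference.
  Each potential needs its share of \<open>\<tau>\<close> below its own exponent, which the
  proportional splitting guarantees.\<close>

theorem product_fractional_integral:
  assumes a: "0 < a" "a < 1" and b: "0 < b" "b < 1" and t: "0 < \<tau>" "\<tau> < a + b"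
  shows "bop_bounded (riesz2 \<tau>) (fst :: 'a::euclidean_space \<times> 'a \<Rightarrow> 'a) snd a b (a + b - \<tau>)"
proof -
  define n where "n = real DIM('a)"
  have n: "0 < n" by (simp add: n_def)
  define \<kappa> where "\<kappa> = \<tau> / (a + b)"
  have \<kappa>: "0 < \<kappa>" "\<kappa> < 1" using a b t by (auto simp: \<kappa>_def)
  define \<tau>1 where "\<tau>1 = \<kappa> * a"
  define \<tau>2 where "\<tau>2 = \<kappa> * b"
  have tt: "0 < \<tau>1" "0 < \<tau>2" "\<tau>1 < a" "\<tau>2 < b"
    using \<kappa> a b mult_strict_right_mono[OF \<kappa>(2) a(1)] mult_strict_right_mono[OF \<kappa>(2) b(1)] by (auto simp: \<tau>1_def \<tau>2_def)
  have "\<tau>1 + \<tau>2 = \<kappa> * (a + b)" by (simp add: \<tau>1_def \<tau>2_def distrib_left)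
  also have "\<dots> = \<tau>" using a b by (simp add: \<kappa>_def)
  finally have tsum: "\<tau> = \<tau>1 + \<tau>2" by simp
  define r where "r = a + b - \<tau>"
  have r: "0 < r" using t by (simp add: r_def)
  \<comment> \<open>Chosen with
    \<open>l / (a - \<tau>1) = 1 / r = (1 - l) / (b - \<tau>2)\<close>.\<close>
  define l where "l = (a - \<tau>1) / r"
  have rsum: "r = (a - \<tau>1) + (b - \<tau>2)" by (simp add: r_def tsum)
  have l: "0 \<le> l" "l \<le> 1" "1 - l = (b - \<tau>2) / r"
    using tt r by (auto simp: l_def rsum field_simps)
  define I where "I \<sigma> \<alpha> F x = (\<integral>\<^sup>+y. ennreal (norm y powr (real DIM('a) * (\<sigma> - 1))) * ennreal (F ((x::'a) - y) powr \<alpha>) \<partial>lborel)" for \<sigma> \<alpha> F x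
  obtain C1 where C1: "0 \<le> C1" "\<And>F x. tame F \<Longrightarrow> (\<integral>\<^sup>+x. ennreal (F x) \<partial>lborel) \<le> 1 \<Longrightarrow> I \<tau>1 a F x < \<infinity>"
    "\<And>F. tame F \<Longrightarrow> (\<integral>\<^sup>+x. ennreal (F x) \<partial>lborel) \<le> 1 \<Longrightarrow>
    (\<integral>\<^sup>+x. ennreal (enn2real (I \<tau>1 a F x) powr (1 / (a - \<tau>1))) \<partial>lborel) \<le> ennreal C1"
    using Hardy_Littlewood_Sobolev[OF tt(1,3) a(2), where 'a = 'a] unfolding I_def by blast
  obtain C2 where C2: "0 \<le> C2" "\<And>G x. tame G \<Longrightarrow> (\<integral>\<^sup>+x. ennreal (G x) \<partial>lborel) \<le> 1 \<Longrightarrow> I \<tau>2 b G x < \<infinity>"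
    "\<And>G. tame G \<Longrightarrow> (\<integral>\<^sup>+x. ennreal (G x) \<partial>lborel) \<le> 1 \<Longrightarrow>
    (\<integral>\<^sup>+x. ennreal (enn2real (I \<tau>2 b G x) powr (1 / (b - \<tau>2))) \<partial>lborel) \<le> ennreal C2"
    using Hardy_Littlewood_Sobolev[OF tt(2,4) b(2), where 'a = 'a] unfolding I_def by blast
  have kernel: "norm (y, z) powr (n * (\<tau> - 2)) \<le> norm y powr (n * (\<tau>1 - 1)) * norm z powr (n * (\<tau>2 - 1))"
    if "y \<noteq> 0" "z \<noteq> 0" for y z :: 'a
  proof -
    have e: "n * (\<tau>1 - 1) \<le> 0" "n * (\<tau>2 - 1) \<le> 0" using n tt a b by (auto simp: mult_le_0_iff)
    have "norm (y, z) powr (n * (\<tau> - 2)) = norm (y, z) powr (n * (\<tau>1 - 1)) * norm (y, z) powr (n * (\<tau>2 - 1))"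
      unfolding powr_add[symmetric] by (simp add: tsum algebra_simps)
    also have "\<dots> \<le> norm y powr (n * (\<tau>1 - 1)) * norm z powr (n * (\<tau>2 - 1))"
      using that e by (intro mult_mono powr_mono2') (auto intro: norm_fst_le norm_snd_le)
    finally show ?thesis .
  qed
  have main: "bop (riesz2 \<tau>) fst snd (\<lambda>x. F x powr a) (\<lambda>x. G x powr b) x \<le> I \<tau>1 a F x * I \<tau>2 b G x"
    if F: "tame F" and G: "tame G" for F G and x :: 'a
  proof -
    have [measurable]: "F \<in> borel_measurable borel" "G \<in> borel_measurable borel" using F G by (auto dest: tame_measurable)
    define f where "f y = ennreal (norm y powr (n * (\<tau>1 - 1))) * ennreal (F (x - y) powr a)" for y
    define g where "g y = ennreal (norm y powr (n * (\<tau>2 - 1))) * ennreal (G (x - y) powr b)" for y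
    have [measurable]: "f \<in> borel_measurable borel" "g \<in> borel_measurable borel" unfolding f_def[abs_def] g_def[abs_def] by measurable
    \<comment> \<open>Where one component vanishes, \<open>powr\<close> gives 0 on the right and the
      kernel inequality can fail; this set is null.\<close>
    have "AE z in lborel. fst z \<noteq> (0::'a) \<and> snd z \<noteq> (0::'a)"
    proof -
      have 1: "AE p in (lborel \<Otimes>\<^sub>M lborel :: ('a \<times> 'a) measure). fst p \<noteq> 0 \<and> snd p \<noteq> 0"
      proof (rule lborel_pair.AE_pair_measure)
        show "{p \<in> space (lborel \<Otimes>\<^sub>M lborel). fst p \<noteq> (0::'a) \<and> snd p \<noteq> (0::'a)} \<in> sets (lborel \<Otimes>\<^sub>M lborel)" by measurable
        show "AE y in lborel. AE z in lborel. fst (y, z) \<noteq> (0::'a) \<and> snd (y, z) \<noteq> (0::'a)"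
          using AE_lborel_singleton[of "0::'a"]
        proof eventually_elim
          case (elim y)
          show ?case using AE_lborel_singleton[of "0::'a"] by eventually_elim (use elim in auto)
        qed
      qed
      then show ?thesis unfolding lborel_prod .
    qed
    then have "bop (riesz2 \<tau>) fst snd (\<lambda>x. F x powr a) (\<lambda>x. G x powr b) x \<le> (\<integral>\<^sup>+z. f (fst z) * g (snd z) \<partial>lborel)"
      unfolding bop_def
    proof (intro nn_integral_mono_AE, eventually_elim)
      case (elim z)
      have "riesz2 \<tau> z * (F (x - fst z) powr a * G (x - snd z) powr b)
        \<le> (norm (fst z) powr (n * (\<tau>1 - 1)) * norm (snd z) powr (n * (\<tau>2 - 1))) * (F (x - fst z) powr a * G (x - snd z) powr b)"
        using kernel[of "fst z" "snd z"] elim by (intro mult_right_mono) (auto simp: riesz2_def n_def)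
      also have "\<dots> = (norm (fst z) powr (n * (\<tau>1 - 1)) * F (x - fst z) powr a) * (norm (snd z) powr (n * (\<tau>2 - 1)) * G (x - snd z) powr b)"
        by (simp only: mult_ac)
      finally have "ennreal (riesz2 \<tau> z * (F (x - fst z) powr a * G (x - snd z) powr b)) \<le>
         ennreal ((norm (fst z) powr (n * (\<tau>1 - 1)) * F (x - fst z) powr a) * (norm (snd z) powr (n * (\<tau>2 - 1)) * G (x - snd z) powr b))"
        by (rule ennreal_leI)
      then show ?case by (simp add: f_def g_def ennreal_mult riesz2_def)
    qed
    also have "\<dots> = (\<integral>\<^sup>+y. \<integral>\<^sup>+z. f y * g z \<partial>lborel \<partial>lborel)"
      by (subst lborel_prod[symmetric], subst lborel.nn_integral_fst[symmetric]) simp_all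
    also have "\<dots> = (\<integral>\<^sup>+y. f y * (\<integral>\<^sup>+z. g z \<partial>lborel) \<partial>lborel)"
      by (intro nn_integral_cong nn_integral_cmult) simp
    also have "\<dots> = (\<integral>\<^sup>+y. f y \<partial>lborel) * (\<integral>\<^sup>+z. g z \<partial>lborel)"
      by (rule nn_integral_multc) simp
    finally show ?thesis by (simp add: I_def f_def g_def n_def)
  qed
  show ?thesis
  proof (rule bop_boundedI)
    show "0 \<le> C1 powr l * C2 powr (1 - l)" by simp
    fix F G :: "'a \<Rightarrow> real"
    assume F: "tame F" and G: "tame G" and F1: "(\<integral>\<^sup>+x. ennreal (F x) \<partial>lborel) \<le> 1" and G1: "(\<integral>\<^sup>+x. ennreal (G x) \<partial>lborel) \<le> 1"
    have fin: "I \<tau>1 a F x * I \<tau>2 b G x < \<infinity>" for x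
      using C1(2)[OF F F1, of x] C2(2)[OF G G1, of x] by (simp add: ennreal_mult_less_top)
    show "bop (riesz2 \<tau>) fst snd (\<lambda>x. F x powr a) (\<lambda>x. G x powr b) x < \<infinity>" for x
      using main[OF F G] fin by (rule order.strict_trans1)
    have [measurable]: "F \<in> borel_measurable borel" "G \<in> borel_measurable borel" using F G by (auto dest: tame_measurable)
    define i1 where "i1 x = enn2real (I \<tau>1 a F x)" for x
    define i2 where "i2 x = enn2real (I \<tau>2 b G x)" for x
    have [measurable]: "i1 \<in> borel_measurable borel" "i2 \<in> borel_measurable borel"
      unfolding i1_def[abs_def] i2_def[abs_def] I_def by measurable
    have "enn2real (bop (riesz2 \<tau>) fst snd (\<lambda>x. F x powr a) (\<lambda>x. G x powr b) x) powr (1 / r)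
       \<le> (i1 x powr (1 / (a - \<tau>1))) powr l * (i2 x powr (1 / (b - \<tau>2))) powr (1 - l)" for x
    proof -
      have "enn2real (bop (riesz2 \<tau>) fst snd (\<lambda>x. F x powr a) (\<lambda>x. G x powr b) x) \<le> i1 x * i2 x"
        using enn2real_mono[OF main[OF F G, of x]] fin[of x] by (simp add: enn2real_mult i1_def i2_def)
      then have "enn2real (bop (riesz2 \<tau>) fst snd (\<lambda>x. F x powr a) (\<lambda>x. G x powr b) x) powr (1 / r) \<le> (i1 x * i2 x) powr (1 / r)"
        using r by (intro powr_mono2) auto
      also have "\<dots> = (i1 x powr (1 / (a - \<tau>1))) powr l * (i2 x powr (1 / (b - \<tau>2))) powr (1 - l)"
        unfolding l(3) unfolding l_def using tt by (simp add: powr_mult powr_powr)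
      finally show ?thesis .
    qed
    then have "(\<integral>\<^sup>+x. ennreal (enn2real (bop (riesz2 \<tau>) fst snd (\<lambda>x. F x powr a) (\<lambda>x. G x powr b) x) powr (1 / r)) \<partial>lborel)
      \<le> (\<integral>\<^sup>+x. ennreal ((i1 x powr (1 / (a - \<tau>1))) powr l * (i2 x powr (1 / (b - \<tau>2))) powr (1 - l)) \<partial>lborel)"
      by (intro nn_integral_mono ennreal_leI)
    also have "\<dots> \<le> ennreal (C1 powr l * C2 powr (1 - l))"
    proof (rule nn_integral_Holder)
      show "(\<lambda>x. i1 x powr (1 / (a - \<tau>1))) \<in> borel_measurable lborel" "(\<lambda>x. i2 x powr (1 / (b - \<tau>2))) \<in> borel_measurable lborel" by measurable
      show "(\<integral>\<^sup>+x. ennreal (i1 x powr (1 / (a - \<tau>1))) \<partial>lborel) \<le> ennreal C1" unfolding i1_def by (rule C1(3)[OF F F1])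
      show "(\<integral>\<^sup>+x. ennreal (i2 x powr (1 / (b - \<tau>2))) \<partial>lborel) \<le> ennreal C2" unfolding i2_def by (rule C2(3)[OF G G1])
    qed (use l C1 C2 in auto)
    finally show "(\<integral>\<^sup>+x. ennreal (enn2real (bop (riesz2 \<tau>) fst snd (\<lambda>x. F x powr a) (\<lambda>x. G x powr b) x) powr (1 / (a + b - \<tau>))) \<partial>lborel)
      \<le> ennreal (C1 powr l * C2 powr (1 - l))" by (simp add: r_def)
  qed
qed

section \<open>From unit balls to arbitrary norms\<close>

lemma tame_normalize:
  assumes f: "tame f" and p: "0 < p" and A: "0 < A"
    and I: "(\<integral>\<^sup>+x. ennreal (f x powr p) \<partial>lborel) \<le> ennreal (A powr p)"
  shows "tame (\<lambda>x. (f x / A) powr p)" "(\<integral>\<^sup>+x. ennreal ((f x / A) powr p) \<partial>lborel) \<le> 1"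
proof -
  have [measurable]: "f \<in> borel_measurable borel" using f by (rule tame_measurable)
  have eq: "ennreal ((f x / A) powr e) = ennreal (A powr (- e)) * ennreal (f x powr e)" for x e
    using A tame_nonneg[OF f, of x] by (simp add: powr_divide powr_minus field_simps ennreal_mult[symmetric])
  have int: "(\<integral>\<^sup>+x. ennreal ((f x / A) powr e) \<partial>lborel) = ennreal (A powr (- e)) * (\<integral>\<^sup>+x. ennreal (f x powr e) \<partial>lborel)" for e
    unfolding eq by (rule nn_integral_cmult) measurable
  show "(\<integral>\<^sup>+x. ennreal ((f x / A) powr p) \<partial>lborel) \<le> 1"
  proof -
    have "(\<integral>\<^sup>+x. ennreal ((f x / A) powr p) \<partial>lborel) \<le> ennreal (A powr (- p)) * ennreal (A powr p)"
      unfolding int by (intro mult_left_mono I) simp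
    also have "\<dots> = 1" using A by (simp add: ennreal_mult[symmetric] powr_minus)
    finally show ?thesis .
  qed
  show "tame (\<lambda>x. (f x / A) powr p)"
    unfolding tame_def bdd_borel_def
  proof (intro conjI allI impI)
    obtain B where B: "\<And>x. f x powr p \<le> B" using tame_powr_bounded[OF f, of p] p by auto
    have "(f x / A) powr p \<le> B / A powr p" for x
      using A B[of x] tame_nonneg[OF f, of x] by (simp add: powr_divide divide_right_mono)
    then show "\<exists>B. \<forall>x. (f x / A) powr p \<le> B" by blast
    fix e :: real assume e: "0 < e"
    have "(\<integral>\<^sup>+x. ennreal ((f x / A) powr (p * e)) \<partial>lborel) < \<infinity>"
      unfolding int using f p e by (simp add: tame_def ennreal_mult_less_top)
    then show "(\<integral>\<^sup>+x. ennreal (((f x / A) powr p) powr e) \<partial>lborel) < \<infinity>" by (simp add: powr_powr)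
  qed simp_all
qed

text \<open>Positive upper bounds \<open>A1\<close>, \<open>A2\<close> take the place of the norms
  because the functions are divided by them; a vanishing norm is reached later as a limit. The given
  constant bounds an integral of powers \<open>1 / r\<close>, hence \<open>C powr r\<close> as bound
  for the operator.\<close>

lemma bop_bounded_apply:
  fixes K :: "'b::euclidean_space \<Rightarrow> real" and \<pi>1 \<pi>2 :: "'b \<Rightarrow> 'a::euclidean_space"
  assumes bb: "bop_bounded K \<pi>1 \<pi>2 (1 / p1) (1 / p2) r" and p: "0 < p1" "0 < p2" and r: "0 < r"
    and [measurable]: "K \<in> borel_measurable borel" "\<pi>1 \<in> borel_measurable borel" "\<pi>2 \<in> borel_measurable borel"
    and K0: "\<And>z. 0 \<le> K z"
  shows "\<exists>C\<ge>0. \<forall>f g A1 A2. tame f \<and> tame g \<and> 0 < A1 \<and> 0 < A2 \<and>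
    (\<integral>\<^sup>+x. ennreal (f x powr p1) \<partial>lborel) \<le> ennreal (A1 powr p1) \<and> (\<integral>\<^sup>+x. ennreal (g x powr p2) \<partial>lborel) \<le> ennreal (A2 powr p2) \<longrightarrow>
    (\<forall>x. bop K \<pi>1 \<pi>2 f g x < \<infinity>) \<and>
    (\<integral>\<^sup>+x. ennreal (enn2real (bop K \<pi>1 \<pi>2 f g x) powr (1 / r)) \<partial>lborel) \<le> ennreal ((C * A1 * A2) powr (1 / r))"
proof -
  obtain C where C: "0 \<le> C" "\<And>F G x. tame F \<Longrightarrow> tame G \<Longrightarrow> (\<integral>\<^sup>+x. ennreal (F x) \<partial>lborel) \<le> 1 \<Longrightarrow>
      (\<integral>\<^sup>+x. ennreal (G x) \<partial>lborel) \<le> 1 \<Longrightarrow> bop K \<pi>1 \<pi>2 (\<lambda>x. F x powr (1 / p1)) (\<lambda>x. G x powr (1 / p2)) x < \<infinity>"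
    "\<And>F G. tame F \<Longrightarrow> tame G \<Longrightarrow> (\<integral>\<^sup>+x. ennreal (F x) \<partial>lborel) \<le> 1 \<Longrightarrow> (\<integral>\<^sup>+x. ennreal (G x) \<partial>lborel) \<le> 1 \<Longrightarrow>
      (\<integral>\<^sup>+x. ennreal (enn2real (bop K \<pi>1 \<pi>2 (\<lambda>x. F x powr (1 / p1)) (\<lambda>x. G x powr (1 / p2)) x) powr (1 / r)) \<partial>lborel) \<le> ennreal C"
    using bop_boundedE[OF bb] by blast
  show ?thesis
  proof (rule exI[of _ "C powr r"], intro conjI allI impI; (elim conjE)?)
    show "0 \<le> C powr r" by simp
    fix f g :: "'a \<Rightarrow> real" and A1 A2 :: real
    assume f: "tame f" and g: "tame g" and A: "0 < A1" "0 < A2"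
      and If: "(\<integral>\<^sup>+x. ennreal (f x powr p1) \<partial>lborel) \<le> ennreal (A1 powr p1)"
      and Ig: "(\<integral>\<^sup>+x. ennreal (g x powr p2) \<partial>lborel) \<le> ennreal (A2 powr p2)"
    have [measurable]: "f \<in> borel_measurable borel" "g \<in> borel_measurable borel" using f g by (auto dest: tame_measurable)
    note F = tame_normalize[OF f p(1) A(1) If] and G = tame_normalize[OF g p(2) A(2) Ig]
    define N where "N x = bop K \<pi>1 \<pi>2 (\<lambda>x. ((f x / A1) powr p1) powr (1 / p1)) (\<lambda>x. ((g x / A2) powr p2) powr (1 / p2)) x" for x
    have N_fin: "N x < \<infinity>" for x unfolding N_def by (rule C(2)[OF F(1) G(1) F(2) G(2)])
    have "((f x / A1) powr p1) powr (1 / p1) = f x / A1" "((g x / A2) powr p2) powr (1 / p2) = g x / A2" for x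
      using p A tame_nonneg[OF f, of x] tame_nonneg[OF g, of x] by (simp_all add: powr_powr)
    then have N_eq: "N x = bop K \<pi>1 \<pi>2 (\<lambda>x. f x / A1) (\<lambda>x. g x / A2) x" for x by (simp add: N_def)
    have bop_eq: "bop K \<pi>1 \<pi>2 f g x = ennreal (A1 * A2) * N x" for x
    proof -
      have "ennreal (A1 * A2) * N x = (\<integral>\<^sup>+z. ennreal (A1 * A2) * (ennreal (K z) * ennreal (f (x - \<pi>1 z) / A1 * (g (x - \<pi>2 z) / A2))) \<partial>lborel)"
        unfolding N_eq bop_def by (rule nn_integral_cmult[symmetric]) measurable
      also have "\<dots> = bop K \<pi>1 \<pi>2 f g x"
        unfolding bop_def
      proof (rule nn_integral_cong)
        fix z
        have "A1 * A2 * (K z * (f (x - \<pi>1 z) / A1 * (g (x - \<pi>2 z) / A2))) = K z * (f (x - \<pi>1 z) * g (x - \<pi>2 z))"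
          using A by simp
        then show "ennreal (A1 * A2) * (ennreal (K z) * ennreal (f (x - \<pi>1 z) / A1 * (g (x - \<pi>2 z) / A2))) = ennreal (K z) * ennreal (f (x - \<pi>1 z) * g (x - \<pi>2 z))"
          using A K0[of z] tame_nonneg[OF f] tame_nonneg[OF g] by (simp add: ennreal_mult[symmetric])
      qed
      finally show ?thesis ..
    qed
    show "bop K \<pi>1 \<pi>2 f g x < \<infinity>" for x
      unfolding bop_eq using N_fin[of x] by (simp add: ennreal_mult_less_top)
    have Nm[measurable]: "(\<lambda>x. enn2real (N x)) \<in> borel_measurable borel"
      unfolding N_eq by (intro measurable_compose[OF bop_measurable borel_measurable_enn2real]) measurable
    have "(\<integral>\<^sup>+x. ennreal (enn2real (bop K \<pi>1 \<pi>2 f g x) powr (1 / r)) \<partial>lborel)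
       = (\<integral>\<^sup>+x. ennreal ((A1 * A2) powr (1 / r)) * ennreal (enn2real (N x) powr (1 / r)) \<partial>lborel)"
      unfolding bop_eq using A by (intro nn_integral_cong) (simp add: enn2real_mult powr_mult ennreal_mult[symmetric])
    also have "\<dots> = ennreal ((A1 * A2) powr (1 / r)) * (\<integral>\<^sup>+x. ennreal (enn2real (N x) powr (1 / r)) \<partial>lborel)"
      by (rule nn_integral_cmult) measurable
    also have "\<dots> \<le> ennreal ((A1 * A2) powr (1 / r)) * ennreal C"
      unfolding N_def by (intro mult_left_mono C(3) F G) simp
    also have "\<dots> = ennreal ((C powr r * A1 * A2) powr (1 / r))"
    proof -
      have "(C powr r * A1 * A2) powr (1 / r) = C * (A1 * A2) powr (1 / r)"
        using C(1) r by (simp add: powr_mult powr_powr mult.assoc)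
      then show ?thesis using C(1) by (simp add: ennreal_mult[symmetric] mult.commute)
    qed
    finally show "(\<integral>\<^sup>+x. ennreal (enn2real (bop K \<pi>1 \<pi>2 f g x) powr (1 / r)) \<partial>lborel) \<le> ennreal ((C powr r * A1 * A2) powr (1 / r))" .
  qed
qed

subsection \<open>Finite differences and symbol estimates\<close>

definition fd :: "'a::real_normed_vector \<Rightarrow> ('a \<Rightarrow> complex) \<Rightarrow> 'a \<Rightarrow> complex"
  where "fd h F x = F (x + h) - F x"

lemma fd_pow_Suc: "(fd h ^^ Suc k) F x = (fd h ^^ k) F (x + h) - (fd h ^^ k) F x"
  unfolding funpow.simps comp_apply by (rule fd_def)

text \<open>\<open>F\<close> can be differentiated \<open>k\<close> times in direction \<open>b\<close> away from the origin, the \<open>j\<close>-th derivative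
  being \<open>O(|x|\<^bsup>c-j\<^esup>)\<close>. The recursive form makes the Leibniz rule an induction without binomial sums.\<close>

primrec dir_symbol :: "nat \<Rightarrow> 'a::euclidean_space \<Rightarrow> ('a \<Rightarrow> complex) \<Rightarrow> real \<Rightarrow> real \<Rightarrow> bool"
  where
    "dir_symbol 0 b F c A \<longleftrightarrow> (\<forall>x. x \<noteq> 0 \<longrightarrow> norm (F x) \<le> A * norm x powr c)"
  | "dir_symbol (Suc k) b F c A \<longleftrightarrow> (\<forall>x. x \<noteq> 0 \<longrightarrow> norm (F x) \<le> A * norm x powr c) \<and>
      (\<exists>F'. (\<forall>x. x \<noteq> 0 \<longrightarrow> ((\<lambda>t. F (x + t *\<^sub>R b)) has_vector_derivative F' x) (at 0)) \<and> dir_symbol k b F' (c - 1) A)"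

lemma dir_symbol_bound: "dir_symbol k b F c A \<Longrightarrow> x \<noteq> 0 \<Longrightarrow> norm (F x) \<le> A * norm x powr c"
  by (cases k) auto

lemma dir_symbol_Suc_D: "dir_symbol (Suc k) b F c A \<Longrightarrow> dir_symbol k b F c A"
proof (induction k arbitrary: F c)
  case (Suc k)
  then obtain F' where F': "\<forall>x. x \<noteq> 0 \<longrightarrow> ((\<lambda>t. F (x + t *\<^sub>R b)) has_vector_derivative F' x) (at 0)"
    "dir_symbol (Suc k) b F' (c - 1) A" by auto
  have "dir_symbol k b F' (c - 1) A" by (rule Suc.IH[OF F'(2)])
  with F' Suc.prems show ?case by auto
qed auto

lemma dir_symbol_mono: "dir_symbol k b F c A \<Longrightarrow> A \<le> B \<Longrightarrow> dir_symbol k b F c B"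
proof (induction k arbitrary: F c)
  case 0
  then show ?case by (auto intro: order_trans mult_right_mono)
next
  case (Suc k)
  then show ?case by (auto intro: order_trans mult_right_mono)
qed

lemma dir_symbol_add:
  "dir_symbol k b F c A \<Longrightarrow> dir_symbol k b G c B \<Longrightarrow> dir_symbol k b (\<lambda>x. F x + G x) c (A + B)"
proof (induction k arbitrary: F G c)
  case 0
  then show ?case by (auto simp: distrib_right intro: norm_triangle_le add_mono)
next
  case (Suc k)
  then obtain F' G' where F': "\<forall>x. x \<noteq> 0 \<longrightarrow> ((\<lambda>t. F (x + t *\<^sub>R b)) has_vector_derivative F' x) (at 0)"
    "dir_symbol k b F' (c - 1) A" and G': "\<forall>x. x \<noteq> 0 \<longrightarrow> ((\<lambda>t. G (x + t *\<^sub>R b)) has_vector_derivative G' x) (at 0)"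
    "dir_symbol k b G' (c - 1) B" by auto
  have "dir_symbol k b (\<lambda>x. F' x + G' x) (c - 1) (A + B)" using Suc.IH F' G' by blast
  moreover have "\<forall>x. x \<noteq> 0 \<longrightarrow> ((\<lambda>t. F (x + t *\<^sub>R b) + G (x + t *\<^sub>R b)) has_vector_derivative F' x + G' x) (at 0)"
    using F' G' by (auto intro: has_vector_derivative_add)
  moreover have "norm (F x + G x) \<le> (A + B) * norm x powr c" if "x \<noteq> 0" for x
    using dir_symbol_bound[OF Suc.prems(1) that] dir_symbol_bound[OF Suc.prems(2) that]
    by (auto simp: distrib_right intro: norm_triangle_le)
  ultimately show ?case by auto
qed

text \<open>The product rule gives two terms of the same form, hence a factor 2 per
  derivative.\<close>

lemma dir_symbol_mult:
  assumes "0 \<le> A" "0 \<le> B"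
  shows "dir_symbol k b F c A \<Longrightarrow> dir_symbol k b G d B \<Longrightarrow> dir_symbol k b (\<lambda>x. F x * G x) (c + d) (2 ^ k * (A * B))"
proof (induction k arbitrary: F G c d)
  case 0
  have "norm (F x * G x) \<le> (A * norm x powr c) * (B * norm x powr d)" if "x \<noteq> 0" for x
    using 0 that assms unfolding norm_mult by (intro mult_mono) auto
  then show ?case by (simp add: powr_add mult_ac)
next
  case (Suc k)
  from Suc.prems obtain F' G' where F': "\<forall>x. x \<noteq> 0 \<longrightarrow> ((\<lambda>t. F (x + t *\<^sub>R b)) has_vector_derivative F' x) (at 0)"
    "dir_symbol k b F' (c - 1) A" and G': "\<forall>x. x \<noteq> 0 \<longrightarrow> ((\<lambda>t. G (x + t *\<^sub>R b)) has_vector_derivative G' x) (at 0)"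
    "dir_symbol k b G' (d - 1) B" by auto
  have FG: "dir_symbol k b F c A" "dir_symbol k b G d B" using Suc.prems dir_symbol_Suc_D by blast+
  have "dir_symbol k b (\<lambda>x. F x * G' x) (c + (d - 1)) (2 ^ k * (A * B))" by (rule Suc.IH[OF FG(1) G'(2)])
  moreover have "dir_symbol k b (\<lambda>x. F' x * G x) ((c - 1) + d) (2 ^ k * (A * B))" by (rule Suc.IH[OF F'(2) FG(2)])
  ultimately have "dir_symbol k b (\<lambda>x. F x * G' x + F' x * G x) (c + d - 1) (2 ^ Suc k * (A * B))"
    using dir_symbol_add[of k b "\<lambda>x. F x * G' x" "c + d - 1" "2 ^ k * (A * B)" "\<lambda>x. F' x * G x" "2 ^ k * (A * B)"]
    by (simp add: algebra_simps)
  moreover have "((\<lambda>t. F (x + t *\<^sub>R b) * G (x + t *\<^sub>R b)) has_vector_derivative F x * G' x + F' x * G x) (at 0)" if "x \<noteq> 0" for x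
    using has_vector_derivative_mult[of "\<lambda>t. F (x + t *\<^sub>R b)" "F' x" 0 UNIV "\<lambda>t. G (x + t *\<^sub>R b)" "G' x"] F' G' that by simp
  moreover have "norm (F x * G x) \<le> 2 ^ Suc k * (A * B) * norm x powr (c + d)" if "x \<noteq> 0" for x
  proof -
    have "norm (F x * G x) \<le> (A * norm x powr c) * (B * norm x powr d)"
      using dir_symbol_bound[OF FG(1) that] dir_symbol_bound[OF FG(2) that] assms
      unfolding norm_mult by (intro mult_mono) auto
    also have "\<dots> = 1 * (A * B * norm x powr (c + d))" by (simp add: powr_add mult_ac)
    also have "\<dots> \<le> 2 ^ Suc k * (A * B * norm x powr (c + d))"
      using assms by (intro mult_right_mono one_le_power) auto
    finally show ?thesis by (simp add: mult_ac)
  qed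
  ultimately show ?case
    unfolding dir_symbol.simps by (intro conjI exI[of _ "\<lambda>x. F x * G' x + F' x * G x"]) auto
qed

section \<open>Differences as discrete derivatives\<close>

text \<open>Differencing commutes with differentiation as long as all sampled points
  \<open>x + real j *\<^sub>R h\<close> stay in the domain.\<close>

lemma has_vector_derivative_fd_pow:
  assumes "\<And>x. x \<in> S \<Longrightarrow> ((\<lambda>t. F (x + t *\<^sub>R b)) has_vector_derivative F' x) (at 0)"
    and "\<And>j. j \<le> k \<Longrightarrow> x + real j *\<^sub>R h \<in> S"
  shows "((\<lambda>t. (fd h ^^ k) F (x + t *\<^sub>R b)) has_vector_derivative (fd h ^^ k) F' x) (at 0)"
  using assms(2)
proof (induction k arbitrary: x)
  case 0
  then show ?case using assms(1)[of x] by simp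
next
  case (Suc k)
  have "((\<lambda>t. (fd h ^^ k) F (x + t *\<^sub>R b)) has_vector_derivative (fd h ^^ k) F' x) (at 0)"
    by (rule Suc.IH) (use Suc.prems in auto)
  moreover have "((\<lambda>t. (fd h ^^ k) F ((x + h) + t *\<^sub>R b)) has_vector_derivative (fd h ^^ k) F' (x + h)) (at 0)"
  proof (rule Suc.IH)
    fix j assume "j \<le> k"
    then show "x + h + real j *\<^sub>R h \<in> S" using Suc.prems[of "Suc j"] by (simp add: algebra_simps)
  qed
  ultimately have "((\<lambda>t. (fd h ^^ k) F ((x + h) + t *\<^sub>R b) - (fd h ^^ k) F (x + t *\<^sub>R b)) has_vector_derivative
      (fd h ^^ k) F' (x + h) - (fd h ^^ k) F' x) (at 0)"
    by (intro has_vector_derivative_diff)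
  moreover have "x + h + t *\<^sub>R b = x + t *\<^sub>R b + h" for t by simp
  ultimately show ?case unfolding fd_pow_Suc by simp
qed

text \<open>The mean value inequality on a segment. The derivative is known only at parameter 0 of
  the line through each point, so it is transported to the parameter u by the chain rule.\<close>

lemma norm_diff_le_line_derivative:
  fixes F F' :: "'a::real_normed_vector \<Rightarrow> complex"
  assumes d: "\<And>u. 0 \<le> u \<Longrightarrow> u \<le> 1 \<Longrightarrow> ((\<lambda>t. F (x + (u * \<tau>) *\<^sub>R b + t *\<^sub>R b)) has_vector_derivative F' (x + (u * \<tau>) *\<^sub>R b)) (at 0)"
    and B: "\<And>u. 0 \<le> u \<Longrightarrow> u \<le> 1 \<Longrightarrow> norm (F' (x + (u * \<tau>) *\<^sub>R b)) \<le> B"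
  shows "norm (F (x + \<tau> *\<^sub>R b) - F x) \<le> \<bar>\<tau>\<bar> * B"
proof -
  define f where "f u = F (x + (u * \<tau>) *\<^sub>R b)" for u
  have "(f has_vector_derivative \<tau> *\<^sub>R F' (x + (u * \<tau>) *\<^sub>R b)) (at u within {0..1})" if "u \<in> {0..1}" for u
  proof -
    define g where "g t = F (x + (u * \<tau>) *\<^sub>R b + t *\<^sub>R b)" for t
    have g: "(g has_vector_derivative F' (x + (u * \<tau>) *\<^sub>R b)) (at ((u - u) * \<tau>))"
      using d[of u] that by (simp add: g_def[abs_def])
    have "((\<lambda>v. (v - u) * \<tau>) has_vector_derivative \<tau>) (at u within {0..1})"
      unfolding has_real_derivative_iff_has_vector_derivative[symmetric] by (auto intro!: derivative_eq_intros)
    from vector_diff_chain_within[OF this has_vector_derivative_at_within[OF g]]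
    have "((g \<circ> (\<lambda>v. (v - u) * \<tau>)) has_vector_derivative \<tau> *\<^sub>R F' (x + (u * \<tau>) *\<^sub>R b)) (at u within {0..1})" .
    moreover have "g \<circ> (\<lambda>v. (v - u) * \<tau>) = f" by (auto simp: g_def f_def fun_eq_iff algebra_simps)
    ultimately show ?thesis by simp
  qed
  moreover have "onorm (\<lambda>t. t *\<^sub>R (\<tau> *\<^sub>R F' (x + (u * \<tau>) *\<^sub>R b))) \<le> \<bar>\<tau>\<bar> * B" if "u \<in> {0..1}" for u
  proof (rule onorm_le)
    fix t
    have "\<bar>\<tau>\<bar> * norm (F' (x + (u * \<tau>) *\<^sub>R b)) \<le> \<bar>\<tau>\<bar> * B" using B[of u] that by (intro mult_left_mono) auto
    from mult_right_mono[OF this, of "\<bar>t\<bar>"]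
    show "norm (t *\<^sub>R (\<tau> *\<^sub>R F' (x + (u * \<tau>) *\<^sub>R b))) \<le> \<bar>\<tau>\<bar> * B * norm t" by (simp add: abs_mult mult_ac)
  qed
  ultimately have "norm (f 1 - f 0) \<le> (\<bar>\<tau>\<bar> * B) * norm (1 - 0 :: real)"
    by (intro differentiable_bound[where S = "{0..1}" and f' = "\<lambda>u t. t *\<^sub>R (\<tau> *\<^sub>R F' (x + (u * \<tau>) *\<^sub>R b))"])
      (auto simp: has_vector_derivative_def)
  then show ?thesis by (simp add: f_def)
qed

text \<open>A difference is an increment of a lower difference, hence at most
  \<open>\<bar>\<tau>\<bar>\<close> times the same lower difference of the derivative. Since
  \<open>c \<le> 0\<close>, the bound is worst closest to the origin, and \<open>\<rho>\<close>
  bounds that distance from below along all k steps.\<close>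

lemma norm_fd_pow_le:
  assumes "dir_symbol k b F c A" "0 \<le> A" "c \<le> 0" "0 < \<rho>"
    and "\<And>u. 0 \<le> u \<Longrightarrow> u \<le> real k \<Longrightarrow> \<rho> \<le> norm (x + (u * \<tau>) *\<^sub>R b)"
  shows "norm ((fd (\<tau> *\<^sub>R b) ^^ k) F x) \<le> \<bar>\<tau>\<bar> ^ k * (A * \<rho> powr (c - real k))"
  using assms(1,3,5)
proof (induction k arbitrary: F c x)
  case 0
  have \<rho>: "\<rho> \<le> norm x" using 0(3)[of 0] by simp
  then have "x \<noteq> 0" using assms(4) by auto
  then have "norm (F x) \<le> A * norm x powr c" by (rule dir_symbol_bound[OF 0(1)])
  also have "\<dots> \<le> A * \<rho> powr c" using \<rho> assms(2,4) 0(2) by (intro mult_left_mono powr_mono2') auto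
  finally show ?case by simp
next
  case (Suc k)
  from Suc.prems(1) obtain F' where F': "\<forall>x. x \<noteq> 0 \<longrightarrow> ((\<lambda>t. F (x + t *\<^sub>R b)) has_vector_derivative F' x) (at 0)"
    "dir_symbol k b F' (c - 1) A" by auto
  have nz: "x + (u * \<tau>) *\<^sub>R b \<noteq> 0" if "0 \<le> u" "u \<le> real (Suc k)" for u
    using Suc.prems(3)[OF that] assms(4) by auto
  have "norm ((fd (\<tau> *\<^sub>R b) ^^ k) F (x + \<tau> *\<^sub>R b) - (fd (\<tau> *\<^sub>R b) ^^ k) F x) \<le> \<bar>\<tau>\<bar> * (\<bar>\<tau>\<bar> ^ k * (A * \<rho> powr ((c - 1) - real k)))"
  proof (rule norm_diff_le_line_derivative)
    fix u :: real assume u: "0 \<le> u" "u \<le> 1"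
    show "((\<lambda>t. (fd (\<tau> *\<^sub>R b) ^^ k) F (x + (u * \<tau>) *\<^sub>R b + t *\<^sub>R b)) has_vector_derivative (fd (\<tau> *\<^sub>R b) ^^ k) F' (x + (u * \<tau>) *\<^sub>R b)) (at 0)"
    proof (rule has_vector_derivative_fd_pow[where S = "- {0}"])
      fix j assume "j \<le> k"
      then show "x + (u * \<tau>) *\<^sub>R b + real j *\<^sub>R \<tau> *\<^sub>R b \<in> - {0}"
        using nz[of "u + real j"] u by (simp add: algebra_simps)
    qed (use F' in auto)
    show "norm ((fd (\<tau> *\<^sub>R b) ^^ k) F' (x + (u * \<tau>) *\<^sub>R b)) \<le> \<bar>\<tau>\<bar> ^ k * (A * \<rho> powr ((c - 1) - real k))"
    proof (rule Suc.IH[OF F'(2)])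
      fix v assume "0 \<le> v" "v \<le> real k"
      then show "\<rho> \<le> norm (x + (u * \<tau>) *\<^sub>R b + (v * \<tau>) *\<^sub>R b)"
        using Suc.prems(3)[of "u + v"] u by (simp add: algebra_simps)
    qed (use Suc.prems in auto)
  qed
  moreover have "c - 1 - real k = c - real (Suc k)" by simp
  ultimately show ?case unfolding fd_pow_Suc by (simp add: mult.assoc)
qed

lemma fd_pow_measurable:
  assumes "F \<in> borel_measurable borel"
  shows "(fd h ^^ k) (F :: 'a::euclidean_space \<Rightarrow> complex) \<in> borel_measurable borel"
proof (induction k)
  case (Suc k)
  then have [measurable]: "(fd h ^^ k) F \<in> borel_measurable borel" .
  have "(\<lambda>x. (fd h ^^ Suc k) F x) \<in> borel_measurable borel" unfolding fd_pow_Suc by measurable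
  then show ?case .
qed (use assms in simp)

lemma fd_pow_integrable:
  assumes "integrable lborel (F :: 'a::euclidean_space \<Rightarrow> complex)"
  shows "integrable lborel ((fd h ^^ k) F)"
proof (induction k)
  case (Suc k)
  have "integrable lborel (\<lambda>x. (fd h ^^ k) F (h + 1 *\<^sub>R x))"
    by (rule integrable_lborel_affine[OF Suc]) simp
  then have "integrable lborel (\<lambda>x. (fd h ^^ Suc k) F x)"
    unfolding fd_pow_Suc using Suc by (intro Bochner_Integration.integrable_diff) (auto simp: add.commute)
  then show ?case .
qed (use assms in simp)

lemma integrable_mult_cis:
  assumes "integrable lborel (F :: 'a::euclidean_space \<Rightarrow> complex)"
  shows "integrable lborel (\<lambda>x. F x * cis (y \<bullet> x))"
proof (rule Bochner_Integration.integrable_bound[OF assms])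
  have [measurable]: "F \<in> borel_measurable borel" using assms by (auto dest: borel_measurable_integrable)
  have "(\<lambda>x. cis (y \<bullet> x)) \<in> borel_measurable borel"
    by (intro borel_measurable_continuous_onI continuous_intros)
  then show "(\<lambda>x. F x * cis (y \<bullet> x)) \<in> borel_measurable lborel" by simp
qed (simp add: norm_mult)

text \<open>Summation by parts: translating the function by \<open>h\<close> multiplies its Fourier
  integral by \<open>cis (- (y \<bullet> h))\<close>.\<close>

lemma integral_fd_pow_cis:
  assumes "integrable lborel (F :: 'a::euclidean_space \<Rightarrow> complex)"
  shows "(\<integral>x. (fd h ^^ k) F x * cis (y \<bullet> x) \<partial>lborel) = (cis (- (y \<bullet> h)) - 1) ^ k * (\<integral>x. F x * cis (y \<bullet> x) \<partial>lborel)"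
proof (induction k)
  case (Suc k)
  define G where "G = (fd h ^^ k) F"
  have G: "integrable lborel G" unfolding G_def by (rule fd_pow_integrable[OF assms])
  then have Gm: "(\<lambda>x. G x * cis (y \<bullet> x)) \<in> borel_measurable borel"
    using integrable_mult_cis[OF G, of y] by (auto dest: borel_measurable_integrable)
  have shift: "(\<integral>x. G (x + h) * cis (y \<bullet> (x + h)) \<partial>lborel) = (\<integral>x. G x * cis (y \<bullet> x) \<partial>lborel)"
    using integral_lborel_affine[OF Gm, of 1 h] by (simp add: add.commute)
  have int_shift: "integrable lborel (\<lambda>x. G (x + h) * cis (y \<bullet> x))"
    using integrable_mult_cis[OF integrable_lborel_affine[OF G, of 1 h], of y] by (simp add: add.commute)
  have "(\<integral>x. (fd h ^^ Suc k) F x * cis (y \<bullet> x) \<partial>lborel) = (\<integral>x. G (x + h) * cis (y \<bullet> x) - G x * cis (y \<bullet> x) \<partial>lborel)"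
    unfolding fd_pow_Suc G_def[symmetric] by (simp add: left_diff_distrib)
  also have "\<dots> = (\<integral>x. G (x + h) * cis (y \<bullet> x) \<partial>lborel) - (\<integral>x. G x * cis (y \<bullet> x) \<partial>lborel)"
    by (rule Bochner_Integration.integral_diff[OF int_shift integrable_mult_cis[OF G]])
  also have "(\<integral>x. G (x + h) * cis (y \<bullet> x) \<partial>lborel) = (\<integral>x. cis (- (y \<bullet> h)) * (G (x + h) * cis (y \<bullet> (x + h))) \<partial>lborel)"
    by (intro Bochner_Integration.integral_cong) (simp_all add: inner_add_right cis_mult mult.left_commute)
  also have "\<dots> = cis (- (y \<bullet> h)) * (\<integral>x. G (x + h) * cis (y \<bullet> (x + h)) \<partial>lborel)"
    by (rule integral_mult_right_zero)
  also have "\<dots> - (\<integral>x. G x * cis (y \<bullet> x) \<partial>lborel) = (cis (- (y \<bullet> h)) - 1) * (\<integral>x. G x * cis (y \<bullet> x) \<partial>lborel)"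
    unfolding shift by (simp add: algebra_simps)
  finally show ?case using Suc by (simp add: G_def)
qed simp

text \<open>A bound without cancellation: each difference at most doubles the mass and enlarges the
  ball by the step.\<close>

lemma nn_integral_fd_pow_ball_le:
  fixes F :: "'a::euclidean_space \<Rightarrow> complex"
  assumes Fm: "F \<in> borel_measurable borel"
  shows "(\<integral>\<^sup>+x. ennreal (norm ((fd h ^^ k) F x)) * indicator (ball 0 R) x \<partial>lborel)
    \<le> 2 ^ k * (\<integral>\<^sup>+x. ennreal (norm (F x)) * indicator (ball 0 (R + real k * norm h)) x \<partial>lborel)"
proof (induction k arbitrary: R)
  case (Suc k)
  have ind: "(\<lambda>x. indicator (ball (0::'a) r) x :: ennreal) \<in> borel_measurable borel" for r
    by (rule borel_measurable_indicator) simp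
  define G where "G = (fd h ^^ k) F"
  have Gm[measurable]: "G \<in> borel_measurable borel" unfolding G_def by (rule fd_pow_measurable[OF Fm])
  define J where "J r = (\<integral>\<^sup>+x. ennreal (norm (G x)) * indicator (ball 0 r) x \<partial>lborel)" for r
  have Jm: "(\<lambda>x. ennreal (norm (G x)) * indicator (ball 0 r) x) \<in> borel_measurable borel" for r
    by (intro borel_measurable_times_ennreal ind) measurable
  have Jm': "(\<lambda>x. ennreal (norm (G (h + x))) * indicator (ball 0 r) (h + x)) \<in> borel_measurable borel" for r
    by (rule measurable_compose[OF _ Jm]) measurable
  have "(\<integral>\<^sup>+x. ennreal (norm ((fd h ^^ Suc k) F x)) * indicator (ball 0 R) x \<partial>lborel)
    \<le> (\<integral>\<^sup>+x. ennreal (norm (G (h + x))) * indicator (ball 0 (R + norm h)) (h + x) + ennreal (norm (G x)) * indicator (ball 0 (R + norm h)) x \<partial>lborel)"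
  proof (rule nn_integral_mono)
    fix x
    show "ennreal (norm ((fd h ^^ Suc k) F x)) * indicator (ball 0 R) x \<le>
      ennreal (norm (G (h + x))) * indicator (ball 0 (R + norm h)) (h + x) + ennreal (norm (G x)) * indicator (ball 0 (R + norm h)) x"
    proof (cases "norm x < R")
      case True
      have "norm (h + x) < R + norm h" using True norm_triangle_ineq[of h x] by linarith
      moreover have "norm x < R + norm h" using True norm_ge_zero[of h] by linarith
      moreover have "norm ((fd h ^^ Suc k) F x) \<le> norm (G (h + x)) + norm (G x)"
        unfolding fd_pow_Suc G_def[symmetric] using norm_triangle_ineq4[of "G (h + x)" "G x"] by (simp only: add.commute)
      ultimately show ?thesis using True by (simp add: ennreal_plus[symmetric] ennreal_leI del: ennreal_plus)
    qed simp
  qed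
  also have "\<dots> = (\<integral>\<^sup>+x. ennreal (norm (G (h + x))) * indicator (ball 0 (R + norm h)) (h + x) \<partial>lborel) + J (R + norm h)"
    unfolding J_def using Jm Jm' by (intro nn_integral_add) auto
  also have "(\<integral>\<^sup>+x. ennreal (norm (G (h + x))) * indicator (ball 0 (R + norm h)) (h + x) \<partial>lborel) = J (R + norm h)"
    unfolding J_def using nn_integral_lborel_shift[OF Jm] by simp
  also have "J (R + norm h) + J (R + norm h) = 2 * J (R + norm h)" by (simp add: mult_2)
  also have "\<dots> \<le> 2 * (2 ^ k * (\<integral>\<^sup>+x. ennreal (norm (F x)) * indicator (ball 0 (R + norm h + real k * norm h)) x \<partial>lborel))"
    unfolding J_def G_def by (intro mult_left_mono Suc.IH) simp
  finally show ?case by (simp add: algebra_simps)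
qed simp

subsection \<open>Kernels of singular multipliers\<close>

text \<open>This is \<open>1 + \<i> * \<epsilon> * (x \<bullet> b)\<close>: zero-free and affine in
  one coordinate, so the derivatives of its negative powers are multiples of negative
  powers.\<close>

definition cutoff_factor :: "real \<Rightarrow> 'a::euclidean_space \<Rightarrow> 'a \<Rightarrow> complex"
  where "cutoff_factor \<epsilon> b x = Complex 1 (\<epsilon> * (x \<bullet> b))"

text \<open>A smooth cutoff which is explicit enough for all its derivatives along coordinate directions to be read off.\<close>

definition cutoff :: "nat \<Rightarrow> real \<Rightarrow> 'a::euclidean_space \<Rightarrow> complex"
  where "cutoff M \<epsilon> x = (\<Prod>b\<in>Basis. inverse (cutoff_factor \<epsilon> b x) ^ M)"

lemma cutoff_factor_nz: "cutoff_factor \<epsilon> b x \<noteq> 0"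
  by (simp add: cutoff_factor_def complex_eq_iff)

lemma norm_cutoff_factor: "norm (cutoff_factor \<epsilon> b x) ^ 2 = 1 + (\<epsilon> * (x \<bullet> b)) ^ 2"
  by (simp add: cutoff_factor_def cmod_def)

lemma norm_cutoff_factor_ge_1: "1 \<le> norm (cutoff_factor \<epsilon> b x)"
proof -
  have "1 ^ 2 \<le> norm (cutoff_factor \<epsilon> b x) ^ 2" unfolding norm_cutoff_factor by simp
  then show ?thesis by (rule power2_le_imp_le) simp
qed

lemma one_plus_sum_le_prod:
  fixes f :: "'b \<Rightarrow> real"
  assumes "finite S" "\<And>b. b \<in> S \<Longrightarrow> 0 \<le> f b"
  shows "1 + sum f S \<le> (\<Prod>b\<in>S. 1 + f b)"
  using assms
proof (induction S rule: finite_induct)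
  case (insert x S)
  have "1 + sum f S \<le> (\<Prod>b\<in>S. 1 + f b)" "0 \<le> f x" "0 \<le> sum f S" using insert by (auto intro: sum_nonneg)
  then have "(1 + f x) * (1 + sum f S) \<le> (1 + f x) * (\<Prod>b\<in>S. 1 + f b)" by (intro mult_left_mono) auto
  moreover have "1 + (f x + sum f S) \<le> (1 + f x) * (1 + sum f S)"
    using \<open>0 \<le> f x\<close> \<open>0 \<le> sum f S\<close> by (simp add: algebra_simps)
  ultimately show ?case using insert by simp
qed simp

text \<open>Expanding the product of \<open>1 + (\<epsilon> * (x \<bullet> b)) ^ 2\<close> over the
  coordinates leaves at least \<open>1 + (\<epsilon> * norm x) ^ 2\<close>, so the coordinatewise
  cutoff decays in all directions.\<close>

lemma norm_cutoff_le:
  fixes x :: "'a::euclidean_space"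
  shows "norm (cutoff M \<epsilon> x) \<le> inverse (sqrt (1 + (\<epsilon> * norm x) ^ 2)) ^ M"
proof -
  have "norm x ^ 2 = (\<Sum>b\<in>Basis. (x \<bullet> b) ^ 2)"
    unfolding power2_norm_eq_inner by (subst euclidean_inner) (simp only: power2_eq_square)
  then have "1 + (\<epsilon> * norm x) ^ 2 = 1 + (\<Sum>b\<in>Basis. (\<epsilon> * (x \<bullet> b)) ^ 2)"
    unfolding power_mult_distrib sum_distrib_left[symmetric] by simp
  also have "\<dots> \<le> (\<Prod>b\<in>Basis. 1 + (\<epsilon> * (x \<bullet> b)) ^ 2)"
    by (rule one_plus_sum_le_prod) auto
  also have "\<dots> = (\<Prod>b\<in>Basis. norm (cutoff_factor \<epsilon> b x)) ^ 2"
    by (simp add: norm_cutoff_factor prod_power_distrib)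
  finally have "sqrt (1 + (\<epsilon> * norm x) ^ 2) \<le> (\<Prod>b\<in>Basis. norm (cutoff_factor \<epsilon> b x))"
    by (rule real_le_lsqrt[rotated]) (auto intro: prod_nonneg)
  moreover have "0 < sqrt (1 + (\<epsilon> * norm x) ^ 2)" by (simp add: add_pos_nonneg)
  ultimately have "inverse (\<Prod>b\<in>Basis. norm (cutoff_factor \<epsilon> b x)) \<le> inverse (sqrt (1 + (\<epsilon> * norm x) ^ 2))"
    by (rule le_imp_inverse_le)
  then have "inverse (\<Prod>b\<in>Basis. norm (cutoff_factor \<epsilon> b x)) ^ M \<le> inverse (sqrt (1 + (\<epsilon> * norm x) ^ 2)) ^ M"
    by (rule power_mono) (auto intro: prod_nonneg)
  moreover have "norm (cutoff M \<epsilon> x) = inverse (\<Prod>b\<in>Basis. norm (cutoff_factor \<epsilon> b x)) ^ M"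
    unfolding cutoff_def prod_norm[symmetric] norm_power norm_inverse prod_power_distrib[symmetric]
    using prod_inversef[of "\<lambda>b. norm (cutoff_factor \<epsilon> b x)" Basis] by (simp add: o_def)
  ultimately show ?thesis by simp
qed

lemma norm_cutoff_le_1: "norm (cutoff M \<epsilon> x) \<le> 1"
proof -
  have "inverse (sqrt (1 + (\<epsilon> * norm x) ^ 2)) \<le> 1" by (rule inverse_le_1_iff[THEN iffD2]) auto
  then have "inverse (sqrt (1 + (\<epsilon> * norm x) ^ 2)) ^ M \<le> 1" by (intro power_le_one) auto
  with norm_cutoff_le[of M \<epsilon> x] show ?thesis by linarith
qed

text \<open>Decay in scale-invariant form: the powers of \<epsilon> produced by derivatives are
  traded for powers of 1/|x|, with a constant free of \<epsilon>.\<close>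

lemma cutoff_decay:
  assumes "j \<le> M" "0 < \<epsilon>"
  shows "(\<epsilon> * norm x) ^ j * norm (cutoff M \<epsilon> x) \<le> 1"
proof -
  define s where "s = sqrt (1 + (\<epsilon> * norm x) ^ 2)"
  have s: "\<epsilon> * norm x \<le> s" "1 \<le> s" by (auto simp: s_def real_le_rsqrt)
  have "(\<epsilon> * norm x) ^ j * norm (cutoff M \<epsilon> x) \<le> s ^ j * inverse s ^ M"
    using assms s norm_cutoff_le[of M \<epsilon> x] unfolding s_def[symmetric] by (intro mult_mono power_mono) auto
  also have "\<dots> \<le> s ^ M * inverse s ^ M"
    using assms s by (intro mult_right_mono power_increasing) auto
  also have "\<dots> = 1" using s by (simp add: power_mult_distrib[symmetric])
  finally show ?thesis .
qed

lemma cutoff_measurable [measurable]: "cutoff M \<epsilon> \<in> borel_measurable borel"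
proof -
  have "continuous_on UNIV (cutoff M \<epsilon> :: 'a \<Rightarrow> complex)"
    unfolding cutoff_def[abs_def] cutoff_factor_def Complex_eq
    by (intro continuous_intros) (auto simp: complex_eq_iff)
  then show ?thesis by (rule borel_measurable_continuous_onI)
qed

lemma cutoff_tendsto: "(\<lambda>j. cutoff M (1 / real (Suc j)) x) \<longlonglongrightarrow> 1"
proof -
  have "(\<lambda>j. \<Prod>b\<in>Basis. inverse (Complex 1 (1 / real (Suc j) * (x \<bullet> b))) ^ M) \<longlonglongrightarrow> (\<Prod>b\<in>(Basis::'a set). inverse (Complex 1 (0 * (x \<bullet> b))) ^ M)"
    unfolding Complex_eq
    by (intro tendsto_intros LIMSEQ_Suc[OF lim_1_over_n]) (auto simp: complex_eq_iff)
  then show ?thesis unfolding cutoff_def cutoff_factor_def by (simp add: complex_eq_iff[of "Complex 1 0" 1] del: of_nat_Suc flip: one_complex.code)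
qed

text \<open>Products of the cutoff with powers of one inverse factor are closed under
  differentiation in that coordinate; each derivative adds one power and a coefficient of modulus
  \<open>(M + j) * \<bar>\<epsilon>\<bar>\<close>.\<close>

lemma has_vector_derivative_cutoff:
  fixes x b :: "'a::euclidean_space"
  assumes b: "b \<in> Basis"
  shows "((\<lambda>t. cutoff M \<epsilon> (x + t *\<^sub>R b) * inverse (cutoff_factor \<epsilon> b (x + t *\<^sub>R b)) ^ j) has_vector_derivative
     - (of_nat (M + j) * \<i> * of_real \<epsilon>) * (cutoff M \<epsilon> x * inverse (cutoff_factor \<epsilon> b x) ^ Suc j)) (at 0)"
proof -
  define P where "P = (\<Prod>b'\<in>Basis - {b}. inverse (cutoff_factor \<epsilon> b' x) ^ M)"
  have cf: "cutoff_factor \<epsilon> b (x + t *\<^sub>R b) = 1 + \<i> * of_real (\<epsilon> * (x \<bullet> b)) + of_real t * (\<i> * of_real \<epsilon>)" for t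
    using b by (simp add: cutoff_factor_def complex_eq_iff inner_add_left algebra_simps)
  have split: "cutoff M \<epsilon> (x + t *\<^sub>R b) = P * inverse (cutoff_factor \<epsilon> b (x + t *\<^sub>R b)) ^ M" for t
  proof -
    have "cutoff M \<epsilon> (x + t *\<^sub>R b) = inverse (cutoff_factor \<epsilon> b (x + t *\<^sub>R b)) ^ M * (\<Prod>b'\<in>Basis - {b}. inverse (cutoff_factor \<epsilon> b' (x + t *\<^sub>R b)) ^ M)"
      unfolding cutoff_def using b by (simp add: prod.remove)
    also have "(\<Prod>b'\<in>Basis - {b}. inverse (cutoff_factor \<epsilon> b' (x + t *\<^sub>R b)) ^ M) = P"
      unfolding P_def using b by (intro prod.cong) (auto simp: cutoff_factor_def inner_add_left inner_not_same_Basis)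
    finally show ?thesis by (simp add: mult.commute)
  qed
  define z where "z = 1 + \<i> * of_real (\<epsilon> * (x \<bullet> b))"
  have z: "z = cutoff_factor \<epsilon> b x" using cf[of 0] by (simp add: z_def)
  have z0: "z \<noteq> 0" unfolding z by (rule cutoff_factor_nz)
  have "((\<lambda>w. P * inverse (z + w * (\<i> * of_real \<epsilon>)) ^ (M + j)) has_field_derivative
      - (of_nat (M + j) * \<i> * of_real \<epsilon>) * (P * inverse z ^ Suc (M + j))) (at (of_real 0))"
  proof (cases "M + j")
    case (Suc k)
    show ?thesis unfolding Suc
      by (rule derivative_eq_intros refl | use z0 in simp)+
  qed auto
  from has_vector_derivative_real_field[OF this]
  have "((\<lambda>t. P * inverse (z + of_real t * (\<i> * of_real \<epsilon>)) ^ (M + j)) has_vector_derivative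
      - (of_nat (M + j) * \<i> * of_real \<epsilon>) * (P * inverse z ^ Suc (M + j))) (at 0)" .
  moreover have "P * inverse (z + of_real t * (\<i> * of_real \<epsilon>)) ^ (M + j) = cutoff M \<epsilon> (x + t *\<^sub>R b) * inverse (cutoff_factor \<epsilon> b (x + t *\<^sub>R b)) ^ j" for t
    unfolding split cf z_def by (simp add: power_add mult.assoc)
  moreover have "P * inverse z ^ Suc (M + j) = cutoff M \<epsilon> x * inverse (cutoff_factor \<epsilon> b x) ^ Suc j"
    using split[of 0] by (simp add: z power_add mult_ac)
  ultimately show ?thesis by simp
qed

text \<open>The coefficient \<open>w\<close> collects the factors \<epsilon> of the derivatives
  already taken, and the decay of the cutoff converts \<open>\<epsilon> ^ j\<close> into |x|^(-j).
  As \<open>j \<le> M\<close>, a new derivative costs at most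
  \<open>M + j \<le> 2 * M + 1\<close>.\<close>

lemma dir_symbol_cutoff_aux:
  fixes b :: "'a::euclidean_space"
  assumes b: "b \<in> Basis" and \<epsilon>: "0 < \<epsilon>"
  shows "j + k \<le> M \<Longrightarrow> norm w \<le> B * \<epsilon> ^ j \<Longrightarrow> 0 \<le> B \<Longrightarrow>
    dir_symbol k b (\<lambda>x. w * (cutoff M \<epsilon> x * inverse (cutoff_factor \<epsilon> b x) ^ j)) (- real j) (B * (2 * real M + 1) ^ k)"
proof (induction k arbitrary: j w B)
  case (0 j w B)
  have "norm (w * (cutoff M \<epsilon> x * inverse (cutoff_factor \<epsilon> b x) ^ j)) \<le> B * norm x powr (- real j)" if x: "x \<noteq> 0" for x
  proof -
    have "norm (inverse (cutoff_factor \<epsilon> b x) ^ j) \<le> 1"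
      using norm_cutoff_factor_ge_1[of \<epsilon> b x] by (auto simp: norm_power norm_inverse intro!: power_le_one inverse_le_1_iff[THEN iffD2])
    then have "norm w * (norm (cutoff M \<epsilon> x) * norm (inverse (cutoff_factor \<epsilon> b x) ^ j)) \<le> (B * \<epsilon> ^ j) * (norm (cutoff M \<epsilon> x) * 1)"
      using 0 \<epsilon> by (intro mult_mono) auto
    also have "\<dots> = B * norm x powr (- real j) * ((\<epsilon> * norm x) ^ j * norm (cutoff M \<epsilon> x))"
      using x by (simp add: powr_minus powr_realpow power_mult_distrib field_simps)
    also have "\<dots> \<le> B * norm x powr (- real j) * 1"
      using 0 \<epsilon> by (intro mult_left_mono cutoff_decay) auto
    finally show ?thesis by (simp add: norm_mult)
  qed
  then show ?case by simp
next
  case (Suc k j w B)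
  define w' where "w' = w * (- (of_nat (M + j) * \<i> * of_real \<epsilon>))"
  have "norm w' = norm w * (real (M + j) * \<epsilon>)" using \<epsilon> by (simp add: w'_def norm_mult del: of_nat_add)
  also have "\<dots> \<le> (B * \<epsilon> ^ j) * ((2 * real M + 1) * \<epsilon>)"
    using Suc.prems \<epsilon> by (intro mult_mono) auto
  also have "\<dots> = (B * (2 * real M + 1)) * \<epsilon> ^ Suc j" by simp
  finally have w': "norm w' \<le> (B * (2 * real M + 1)) * \<epsilon> ^ Suc j" .
  have "dir_symbol k b (\<lambda>x. w' * (cutoff M \<epsilon> x * inverse (cutoff_factor \<epsilon> b x) ^ Suc j)) (- real (Suc j)) (B * (2 * real M + 1) * (2 * real M + 1) ^ k)"
    by (rule Suc.IH) (use Suc.prems w' in auto)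
  moreover have "- real (Suc j) = - real j - 1" "B * (2 * real M + 1) * (2 * real M + 1) ^ k = B * (2 * real M + 1) ^ Suc k"
    by simp_all
  ultimately have 1: "dir_symbol k b (\<lambda>x. w' * (cutoff M \<epsilon> x * inverse (cutoff_factor \<epsilon> b x) ^ Suc j)) (- real j - 1) (B * (2 * real M + 1) ^ Suc k)"
    by (simp only:)
  have 2: "((\<lambda>t. w * (cutoff M \<epsilon> (x + t *\<^sub>R b) * inverse (cutoff_factor \<epsilon> b (x + t *\<^sub>R b)) ^ j)) has_vector_derivative
      w' * (cutoff M \<epsilon> x * inverse (cutoff_factor \<epsilon> b x) ^ Suc j)) (at 0)" for x
    using has_vector_derivative_mult_right[OF has_vector_derivative_cutoff[OF b, of M \<epsilon> x j], of w]
    unfolding w'_def mult.assoc .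
  have 3: "dir_symbol k b (\<lambda>x. w * (cutoff M \<epsilon> x * inverse (cutoff_factor \<epsilon> b x) ^ j)) (- real j) (B * (2 * real M + 1) ^ k)"
    by (rule Suc.IH) (use Suc.prems in auto)
  have "B * (2 * real M + 1) ^ k \<le> B * (2 * real M + 1) ^ Suc k"
    using Suc.prems by (intro mult_left_mono power_increasing) auto
  then have "dir_symbol k b (\<lambda>x. w * (cutoff M \<epsilon> x * inverse (cutoff_factor \<epsilon> b x) ^ j)) (- real j) (B * (2 * real M + 1) ^ Suc k)"
    by (rule dir_symbol_mono[OF 3])
  then have "\<forall>x. x \<noteq> 0 \<longrightarrow> norm (w * (cutoff M \<epsilon> x * inverse (cutoff_factor \<epsilon> b x) ^ j)) \<le> B * (2 * real M + 1) ^ Suc k * norm x powr (- real j)"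
    by (intro allI impI) (rule dir_symbol_bound)
  with 1 2 show ?case
    unfolding dir_symbol.simps
    by (intro conjI exI[of _ "\<lambda>x. w' * (cutoff M \<epsilon> x * inverse (cutoff_factor \<epsilon> b x) ^ Suc j)"]) blast+
qed

lemma dir_symbol_cutoff:
  fixes b :: "'a::euclidean_space"
  assumes "b \<in> Basis" "0 < \<epsilon>" "k \<le> M"
  shows "dir_symbol k b (cutoff M \<epsilon>) 0 ((2 * real M + 1) ^ k)"
  using dir_symbol_cutoff_aux[of b \<epsilon> 0 k M 1 1] assms by simp

section \<open>The kernel estimate\<close>

text \<open>Selects the coordinate direction in which to take differences; the dimension is the
  price for using no other directions.\<close>

lemma exists_large_coordinate:
  fixes y :: "'a::euclidean_space"
  shows "\<exists>b\<in>Basis. norm y \<le> real DIM('a) * \<bar>y \<bullet> b\<bar>"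
proof (rule ccontr)
  assume "\<not> ?thesis"
  then have *: "\<bar>y \<bullet> b\<bar> < norm y / real DIM('a)" if "b \<in> Basis" for b
    using that by (auto simp: not_le field_simps)
  have "norm y \<le> (\<Sum>b\<in>Basis. \<bar>y \<bullet> b\<bar>)" by (rule norm_le_l1)
  also have "\<dots> < (\<Sum>b\<in>(Basis::'a set). norm y / real DIM('a))"
    by (rule sum_strict_mono) (use * in auto)
  also have "\<dots> = norm y" by simp
  finally show False by simp
qed

text \<open>The finite difference with step \<open>h\<close>, \<open>y \<bullet> h = \<pi>\<close>, multiplies the Fourier integral at \<open>y\<close> by \<open>(-2)\<^sup>N\<close>; near the
  origin its cancellation is not needed, far away it gains \<open>(|h|/|\<zeta>|)\<^sup>N\<close>.\<close>

lemma kernel_bound: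
  assumes s: "0 < s" "s < real DIM('a::euclidean_space)" and A: "0 \<le> A"
  shows "\<exists>C\<ge>0. \<forall>(F::'a \<Rightarrow> complex) y. integrable lborel F \<longrightarrow> y \<noteq> 0 \<longrightarrow>
    (\<forall>b\<in>Basis. dir_symbol DIM('a) b F (- s) A) \<longrightarrow>
    norm (\<integral>x. F x * cis (y \<bullet> x) \<partial>lborel) \<le> C * norm y powr (s - real DIM('a))"
proof -
  \<comment> \<open>As many differences as dimensions suffice: |x|^(-s) is integrable at the origin
    by s < N, and N differences give |x|^(-s-N), integrable at infinity by s > 0.\<close>
  define N where "N = DIM('a)"
  have N: "0 < N" by (simp add: N_def)
  obtain C1 where C1: "0 \<le> C1" "\<And>R. 0 < R \<Longrightarrow> (\<integral>\<^sup>+x. ennreal (norm (x::'a) powr (- s)) * indicator (ball 0 R) x \<partial>lborel) \<le> ennreal (C1 * R powr (- s + real N))"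
    using nn_integral_norm_powr_ball[of "- s", where 'a = 'a] s unfolding N_def by auto
  obtain C2 where C2: "0 \<le> C2" "\<And>R. 0 < R \<Longrightarrow> (\<integral>\<^sup>+x. ennreal (norm (x::'a) powr (- s - real N)) * indicator (- ball 0 R) x \<partial>lborel) \<le> ennreal (C2 * R powr (- s - real N + real N))"
    using nn_integral_norm_powr_tail[of "- s - real N", where 'a = 'a] s unfolding N_def by auto
  \<comment> \<open>\<open>a1\<close> belongs to the ball of radius
    \<open>2 * N * \<bar>\<tau>\<bar>\<close>, enlarged by N steps to
    \<open>3 * N * \<bar>\<tau>\<bar>\<close>; \<open>a2\<close> to its complement, with a power of
    2 from halving the distance to the origin.\<close>
  define a1 where "a1 = 2 ^ N * (A * (C1 * (3 * real N) powr (real N - s)))"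
  define a2 where "a2 = A * 2 powr (s + real N) * (C2 * (2 * real N) powr (- s))"
  have a: "0 \<le> a1" "0 \<le> a2" using A C1 C2 by (auto simp: a1_def a2_def)
  define C where "C = (a1 + a2) * (pi * real N) powr (real N - s)"
  have "norm (\<integral>x. F x * cis (y \<bullet> x) \<partial>lborel) \<le> C * norm y powr (s - real N)"
    if F: "integrable lborel F" and y: "y \<noteq> 0" and D: "\<And>b. b \<in> Basis \<Longrightarrow> dir_symbol N b F (- s) A" for F :: "'a \<Rightarrow> complex" and y
  proof -
    have Fm[measurable]: "F \<in> borel_measurable borel" using F by (auto dest: borel_measurable_integrable)
    obtain b where b: "b \<in> Basis" "norm y \<le> real N * \<bar>y \<bullet> b\<bar>" using exists_large_coordinate[of y] unfolding N_def by blast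
    have yb: "y \<bullet> b \<noteq> 0" using b y by auto
    define \<tau> where "\<tau> = pi / (y \<bullet> b)"
    define h where "h = \<tau> *\<^sub>R b"
    have nh: "norm h = \<bar>\<tau>\<bar>" using b by (simp add: h_def)
    have \<tau>0: "0 < \<bar>\<tau>\<bar>" using yb by (simp add: \<tau>_def)
    have yh: "y \<bullet> h = pi" using yb by (simp add: h_def \<tau>_def)
    define G where "G = (fd h ^^ N) F"
    have Gm: "G \<in> borel_measurable borel" unfolding G_def by (rule fd_pow_measurable[OF Fm])
    have G: "integrable lborel G" unfolding G_def by (rule fd_pow_integrable[OF F])
    have "(\<integral>x. G x * cis (y \<bullet> x) \<partial>lborel) = (cis (- pi) - 1) ^ N * (\<integral>x. F x * cis (y \<bullet> x) \<partial>lborel)"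
      unfolding G_def integral_fd_pow_cis[OF F] yh ..
    moreover have "norm ((cis (- pi) - 1) ^ N) = 2 ^ N"
    proof -
      have "cis (- pi) - 1 = - 2" by (simp add: complex_eq_iff)
      then show ?thesis by (simp only: norm_power norm_minus_cancel norm_numeral)
    qed
    ultimately have "2 ^ N * norm (\<integral>x. F x * cis (y \<bullet> x) \<partial>lborel) = norm (\<integral>x. G x * cis (y \<bullet> x) \<partial>lborel)"
      by (simp add: norm_mult)
    \<comment> \<open>Of the factor \<open>2 ^ N\<close> only that it is at least 1 is kept.\<close>
    moreover have "norm (\<integral>x. F x * cis (y \<bullet> x) \<partial>lborel) \<le> 2 ^ N * norm (\<integral>x. F x * cis (y \<bullet> x) \<partial>lborel)"
      using mult_right_mono[of 1 "2 ^ N :: real" "norm (\<integral>x. F x * cis (y \<bullet> x) \<partial>lborel)"] by simp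
    ultimately have "ennreal (norm (\<integral>x. F x * cis (y \<bullet> x) \<partial>lborel)) \<le> ennreal (norm (\<integral>x. G x * cis (y \<bullet> x) \<partial>lborel))"
      by (simp add: ennreal_leI)
    also have "\<dots> \<le> (\<integral>\<^sup>+x. ennreal (norm (G x * cis (y \<bullet> x))) \<partial>lborel)"
      by (rule integral_norm_bound_ennreal[OF integrable_mult_cis[OF G]])
    also have "\<dots> = (\<integral>\<^sup>+x. ennreal (norm (G x)) \<partial>lborel)" by (simp add: norm_mult)
    also have "\<dots> = (\<integral>\<^sup>+x. ennreal (norm (G x)) * indicator (ball 0 (2 * real N * \<bar>\<tau>\<bar>)) x + ennreal (norm (G x)) * indicator (- ball 0 (2 * real N * \<bar>\<tau>\<bar>)) x \<partial>lborel)"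
      by (intro nn_integral_cong) (auto simp: indicator_def)
    also have "\<dots> = (\<integral>\<^sup>+x. ennreal (norm (G x)) * indicator (ball 0 (2 * real N * \<bar>\<tau>\<bar>)) x \<partial>lborel) + (\<integral>\<^sup>+x. ennreal (norm (G x)) * indicator (- ball 0 (2 * real N * \<bar>\<tau>\<bar>)) x \<partial>lborel)"
    proof (rule nn_integral_add)
      have "(\<lambda>x. ennreal (norm (G x))) \<in> borel_measurable lborel" using Gm by simp
      moreover have "ball 0 r \<in> sets lborel" for r :: real by simp
      ultimately show "(\<lambda>x. ennreal (norm (G x)) * indicator (ball 0 (2 * real N * \<bar>\<tau>\<bar>)) x) \<in> borel_measurable lborel"
        "(\<lambda>x. ennreal (norm (G x)) * indicator (- ball 0 (2 * real N * \<bar>\<tau>\<bar>)) x) \<in> borel_measurable lborel"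
        by (intro borel_measurable_times_ennreal borel_measurable_indicator; simp)+
    qed
    also have "\<dots> \<le> ennreal (a1 * \<bar>\<tau>\<bar> powr (real N - s)) + ennreal (a2 * \<bar>\<tau>\<bar> powr (real N - s))"
    proof (rule add_mono)
      have "(\<integral>\<^sup>+x. ennreal (norm (G x)) * indicator (ball 0 (2 * real N * \<bar>\<tau>\<bar>)) x \<partial>lborel)
        \<le> 2 ^ N * (\<integral>\<^sup>+x. ennreal (norm (F x)) * indicator (ball 0 (2 * real N * \<bar>\<tau>\<bar> + real N * norm h)) x \<partial>lborel)"
        unfolding G_def by (rule nn_integral_fd_pow_ball_le[OF Fm])
      also have "(\<integral>\<^sup>+x. ennreal (norm (F x)) * indicator (ball 0 (2 * real N * \<bar>\<tau>\<bar> + real N * norm h)) x \<partial>lborel)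
        \<le> (\<integral>\<^sup>+x. ennreal A * (ennreal (norm (x::'a) powr (- s)) * indicator (ball 0 (3 * real N * \<bar>\<tau>\<bar>)) x) \<partial>lborel)"
      proof (rule nn_integral_mono_AE)
        have r: "2 * real N * \<bar>\<tau>\<bar> + real N * norm h = 3 * real N * \<bar>\<tau>\<bar>" by (simp add: nh)
        show "AE x in lborel. ennreal (norm (F x)) * indicator (ball 0 (2 * real N * \<bar>\<tau>\<bar> + real N * norm h)) x
          \<le> ennreal A * (ennreal (norm x powr (- s)) * indicator (ball 0 (3 * real N * \<bar>\<tau>\<bar>)) x)"
          unfolding r using AE_lborel_singleton[of "0::'a"]
        proof eventually_elim
          case (elim x)
          have "ennreal (norm (F x)) \<le> ennreal A * ennreal (norm x powr (- s))"
            using dir_symbol_bound[OF D[OF b(1)] elim] A by (simp add: ennreal_mult[symmetric] ennreal_leI)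
          then show ?case by (auto simp: indicator_def)
        qed
      qed
      also have "\<dots> = ennreal A * (\<integral>\<^sup>+x. ennreal (norm (x::'a) powr (- s)) * indicator (ball 0 (3 * real N * \<bar>\<tau>\<bar>)) x \<partial>lborel)"
      proof (rule nn_integral_cmult)
        have "ball (0::'a) r \<in> sets lborel" for r :: real by simp
        then show "(\<lambda>x. ennreal (norm (x::'a) powr (- s)) * indicator (ball 0 (3 * real N * \<bar>\<tau>\<bar>)) x) \<in> borel_measurable lborel"
          by (intro borel_measurable_times_ennreal borel_measurable_indicator) auto
      qed
      also have "\<dots> \<le> ennreal A * ennreal (C1 * (3 * real N * \<bar>\<tau>\<bar>) powr (- s + real N))"
        using \<tau>0 N by (intro mult_left_mono C1(2)) auto
      also have "\<dots> = ennreal (A * (C1 * (3 * real N) powr (real N - s)) * \<bar>\<tau>\<bar> powr (real N - s))"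
      proof -
        have "(3 * real N * \<bar>\<tau>\<bar>) powr (- s + real N) = (3 * real N) powr (real N - s) * \<bar>\<tau>\<bar> powr (real N - s)"
          by (simp add: powr_mult)
        then show ?thesis using A C1(1) by (simp add: ennreal_mult[symmetric] mult.assoc)
      qed
      finally have "(\<integral>\<^sup>+x. ennreal (norm (G x)) * indicator (ball 0 (2 * real N * \<bar>\<tau>\<bar>)) x \<partial>lborel)
         \<le> 2 ^ N * ennreal (A * (C1 * (3 * real N) powr (real N - s)) * \<bar>\<tau>\<bar> powr (real N - s))"
        by (simp add: mult_left_mono)
      also have "\<dots> = ennreal (a1 * \<bar>\<tau>\<bar> powr (real N - s))"
      proof -
        have "(2::ennreal) ^ N = ennreal (2 ^ N)" by (simp flip: ennreal_power ennreal_numeral)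
        then show ?thesis using A C1(1) by (simp add: a1_def ennreal_mult[symmetric] mult.assoc)
      qed
      finally show "(\<integral>\<^sup>+x. ennreal (norm (G x)) * indicator (ball 0 (2 * real N * \<bar>\<tau>\<bar>)) x \<partial>lborel) \<le> ennreal (a1 * \<bar>\<tau>\<bar> powr (real N - s))" .
      have "(\<integral>\<^sup>+x. ennreal (norm (G x)) * indicator (- ball 0 (2 * real N * \<bar>\<tau>\<bar>)) x \<partial>lborel)
        \<le> (\<integral>\<^sup>+x. ennreal (\<bar>\<tau>\<bar> ^ N * (A * 2 powr (s + real N))) * (ennreal (norm (x::'a) powr (- s - real N)) * indicator (- ball 0 (2 * real N * \<bar>\<tau>\<bar>)) x) \<partial>lborel)"
      proof (rule nn_integral_mono)
        fix x :: 'a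
        show "ennreal (norm (G x)) * indicator (- ball 0 (2 * real N * \<bar>\<tau>\<bar>)) x
          \<le> ennreal (\<bar>\<tau>\<bar> ^ N * (A * 2 powr (s + real N))) * (ennreal (norm x powr (- s - real N)) * indicator (- ball 0 (2 * real N * \<bar>\<tau>\<bar>)) x)"
        proof (cases "2 * real N * \<bar>\<tau>\<bar> \<le> norm x")
          case True
          then have x0: "0 < norm x" using \<tau>0 N by (smt (verit) mult_pos_pos of_nat_0_less_iff)
          \<comment> \<open>N steps of length \<open>\<bar>\<tau>\<bar>\<close> use up at most half
            of \<open>norm x\<close>, so all sampled segments stay at distance
            \<open>norm x / 2\<close> from the origin.\<close>
          have "norm (G x) \<le> \<bar>\<tau>\<bar> ^ N * (A * (norm x / 2) powr (- s - real N))"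
            unfolding G_def h_def
          proof (rule norm_fd_pow_le[OF D[OF b(1)] A])
            fix u :: real assume u: "0 \<le> u" "u \<le> real N"
            have "norm ((u * \<tau>) *\<^sub>R b) = u * \<bar>\<tau>\<bar>" using b u by (simp add: abs_mult)
            also have "\<dots> \<le> real N * \<bar>\<tau>\<bar>" using u by (intro mult_right_mono) auto
            also have "\<dots> \<le> norm x / 2" using True by simp
            finally show "norm x / 2 \<le> norm (x + (u * \<tau>) *\<^sub>R b)"
              using norm_triangle_ineq2[of x "- ((u * \<tau>) *\<^sub>R b)"] by simp
          qed (use s x0 in auto)
          also have "(norm x / 2) powr (- s - real N) = norm x powr (- s - real N) * 2 powr (s + real N)"
          proof -
            have "2 powr (- s - real N) = inverse (2 powr (s + real N))" by (simp flip: powr_minus)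
            then show ?thesis using x0 by (simp add: powr_divide field_simps)
          qed
          finally have "norm (G x) \<le> (\<bar>\<tau>\<bar> ^ N * (A * 2 powr (s + real N))) * norm x powr (- s - real N)" by (simp add: mult_ac)
          then have "ennreal (norm (G x)) \<le> ennreal ((\<bar>\<tau>\<bar> ^ N * (A * 2 powr (s + real N))) * norm x powr (- s - real N))"
            by (rule ennreal_leI)
          then show ?thesis using A True by (simp add: ennreal_mult)
        qed simp
      qed
      also have "\<dots> = ennreal (\<bar>\<tau>\<bar> ^ N * (A * 2 powr (s + real N))) * (\<integral>\<^sup>+x. ennreal (norm (x::'a) powr (- s - real N)) * indicator (- ball 0 (2 * real N * \<bar>\<tau>\<bar>)) x \<partial>lborel)"
      proof (rule nn_integral_cmult)
        have "- ball (0::'a) r \<in> sets lborel" for r :: real by simp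
        then show "(\<lambda>x. ennreal (norm (x::'a) powr (- s - real N)) * indicator (- ball 0 (2 * real N * \<bar>\<tau>\<bar>)) x) \<in> borel_measurable lborel"
          by (intro borel_measurable_times_ennreal borel_measurable_indicator) auto
      qed
      also have "\<dots> \<le> ennreal (\<bar>\<tau>\<bar> ^ N * (A * 2 powr (s + real N))) * ennreal (C2 * (2 * real N * \<bar>\<tau>\<bar>) powr (- s - real N + real N))"
        using \<tau>0 N by (intro mult_left_mono C2(2)) auto
      also have "\<dots> = ennreal (a2 * \<bar>\<tau>\<bar> powr (real N - s))"
      proof -
        have "\<bar>\<tau>\<bar> ^ N * (2 * real N * \<bar>\<tau>\<bar>) powr (- s - real N + real N) = (2 * real N) powr (- s) * \<bar>\<tau>\<bar> powr (real N - s)"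
        proof -
          have "\<bar>\<tau>\<bar> ^ N = \<bar>\<tau>\<bar> powr real N" using \<tau>0 by (simp add: powr_realpow)
          then have "\<bar>\<tau>\<bar> ^ N * \<bar>\<tau>\<bar> powr (- s) = \<bar>\<tau>\<bar> powr (real N - s)" by (simp add: powr_add[symmetric])
          then show ?thesis by (simp add: powr_mult)
        qed
        then have "\<bar>\<tau>\<bar> ^ N * (A * 2 powr (s + real N)) * (C2 * (2 * real N * \<bar>\<tau>\<bar>) powr (- s - real N + real N)) = a2 * \<bar>\<tau>\<bar> powr (real N - s)"
          by (simp add: a2_def mult_ac)
        then show ?thesis using A C2(1) by (subst ennreal_mult[symmetric]) auto
      qed
      finally show "(\<integral>\<^sup>+x. ennreal (norm (G x)) * indicator (- ball 0 (2 * real N * \<bar>\<tau>\<bar>)) x \<partial>lborel) \<le> ennreal (a2 * \<bar>\<tau>\<bar> powr (real N - s))" .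
    qed
    also have "\<dots> = ennreal ((a1 + a2) * \<bar>\<tau>\<bar> powr (real N - s))"
      using a by (simp add: ennreal_plus[symmetric] distrib_right del: ennreal_plus)
    finally have "norm (\<integral>x. F x * cis (y \<bullet> x) \<partial>lborel) \<le> (a1 + a2) * \<bar>\<tau>\<bar> powr (real N - s)"
      using a by (subst (asm) ennreal_le_iff) auto
    \<comment> \<open>The chosen coordinate of y is at least \<open>norm y / N\<close> in modulus,
      and the exponent is positive as s < N.\<close>
    also have "\<dots> \<le> (a1 + a2) * (pi * real N / norm y) powr (real N - s)"
    proof (intro mult_left_mono powr_mono2)
      show "\<bar>\<tau>\<bar> \<le> pi * real N / norm y"
        using b(2) yb y by (simp add: \<tau>_def field_simps)
    qed (use s a N_def in auto)
    also have "\<dots> = C * norm y powr (s - real N)"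
    proof -
      have "norm y powr (s - real N) = inverse (norm y powr (real N - s))" by (simp flip: powr_minus)
      then show ?thesis unfolding C_def powr_divide by (simp only: divide_inverse mult.assoc)
    qed
    finally show ?thesis .
  qed
  moreover have "0 \<le> C" using a by (simp add: C_def)
  ultimately show ?thesis unfolding N_def by blast
qed

section \<open>Pairing a multiplier with a Fourier integral\<close>

lemma integrable_pair_mult:
  fixes f :: "'a::euclidean_space \<Rightarrow> complex" and g :: "'b::euclidean_space \<Rightarrow> complex"
  assumes f: "integrable lborel f" and g: "integrable lborel g"
    and h[measurable]: "h \<in> borel_measurable (lborel \<Otimes>\<^sub>M lborel)" and h1: "\<And>p. norm (h p) \<le> 1"
  shows "integrable (lborel \<Otimes>\<^sub>M lborel) (\<lambda>(x, y). f x * g y * h (x, y) :: complex)"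
proof (rule integrableI_bounded)
  have [measurable]: "f \<in> borel_measurable borel" "g \<in> borel_measurable borel"
    using f g by (auto dest: borel_measurable_integrable)
  show "(\<lambda>(x, y). f x * g y * h (x, y)) \<in> borel_measurable (lborel \<Otimes>\<^sub>M lborel)" by measurable
  have "(\<integral>\<^sup>+p. ennreal (norm (case p of (x, y) \<Rightarrow> f x * g y * h (x, y))) \<partial>(lborel \<Otimes>\<^sub>M lborel))
    \<le> (\<integral>\<^sup>+p. ennreal (norm (f (fst p))) * ennreal (norm (g (snd p))) \<partial>(lborel \<Otimes>\<^sub>M lborel))"
  proof (rule nn_integral_mono)
    fix p :: "'a \<times> 'b"
    have "norm (f (fst p)) * norm (g (snd p)) * norm (h p) \<le> norm (f (fst p)) * norm (g (snd p)) * 1"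
      by (intro mult_left_mono h1) auto
    then show "ennreal (norm (case p of (x, y) \<Rightarrow> f x * g y * h (x, y))) \<le> ennreal (norm (f (fst p))) * ennreal (norm (g (snd p)))"
      by (simp add: split_beta norm_mult ennreal_mult[symmetric] ennreal_leI)
  qed
  also have "\<dots> = (\<integral>\<^sup>+x. \<integral>\<^sup>+y. ennreal (norm (f x)) * ennreal (norm (g y)) \<partial>lborel \<partial>lborel)"
    by (subst lborel.nn_integral_fst[symmetric]) simp_all
  also have "\<dots> = (\<integral>\<^sup>+x. ennreal (norm (f x)) * (\<integral>\<^sup>+y. ennreal (norm (g y)) \<partial>lborel) \<partial>lborel)"
    by (intro nn_integral_cong nn_integral_cmult) simp
  also have "\<dots> = (\<integral>\<^sup>+x. ennreal (norm (f x)) \<partial>lborel) * (\<integral>\<^sup>+y. ennreal (norm (g y)) \<partial>lborel)"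
    by (rule nn_integral_multc) simp
  also have "\<dots> < \<infinity>"
    using f g by (simp add: integrable_iff_bounded ennreal_mult_less_top)
  finally show "(\<integral>\<^sup>+p. ennreal (norm (case p of (x, y) \<Rightarrow> f x * g y * h (x, y))) \<partial>(lborel \<Otimes>\<^sub>M lborel)) < \<infinity>" .
qed

lemma measurable_cis_inner [measurable (raw)]:
  fixes f g :: "_ \<Rightarrow> 'b::euclidean_space"
  assumes "f \<in> borel_measurable M" "g \<in> borel_measurable M"
  shows "(\<lambda>x. cis (f x \<bullet> g x)) \<in> borel_measurable M"
proof -
  have "cis \<in> borel_measurable borel"
    by (intro borel_measurable_continuous_onI continuous_intros)
  from measurable_compose[OF borel_measurable_inner[OF assms] this] show ?thesis .
qed

text \<open>The multiplication formula, which moves the Fourier integral from one factor to the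
  other; the double integral converges absolutely because the exponential has modulus 1.\<close>

lemma integral_swap_cis:
  fixes F \<psi> :: "'a::euclidean_space \<Rightarrow> complex"
  assumes F: "integrable lborel F" and \<psi>: "integrable lborel \<psi>"
  shows "(\<integral>\<zeta>. F \<zeta> * (\<integral>y. \<psi> y * cis (y \<bullet> \<zeta>) \<partial>lborel) \<partial>lborel) = (\<integral>y. \<psi> y * (\<integral>\<zeta>. F \<zeta> * cis (y \<bullet> \<zeta>) \<partial>lborel) \<partial>lborel)"
proof -
  have "integrable (lborel \<Otimes>\<^sub>M lborel) (\<lambda>(\<zeta>, y). F \<zeta> * \<psi> y * (\<lambda>p. cis (snd p \<bullet> fst p)) (\<zeta>, y))"
  proof (rule integrable_pair_mult[OF F \<psi>])
    have "(\<lambda>p. snd p) \<in> borel_measurable (lborel \<Otimes>\<^sub>M lborel)" "(\<lambda>p. fst p) \<in> borel_measurable (lborel \<Otimes>\<^sub>M lborel)"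
      by measurable
    then show "(\<lambda>p. cis (snd p \<bullet> fst p)) \<in> borel_measurable (lborel \<Otimes>\<^sub>M (lborel :: 'a measure))"
      by (rule measurable_cis_inner)
  qed simp
  then have int: "integrable (lborel \<Otimes>\<^sub>M lborel) (\<lambda>(\<zeta>, y). F \<zeta> * \<psi> y * cis (y \<bullet> \<zeta>))" by simp
  have "(\<integral>y. (\<integral>\<zeta>. F \<zeta> * \<psi> y * cis (y \<bullet> \<zeta>) \<partial>lborel) \<partial>lborel) = (\<integral>\<zeta>. (\<integral>y. F \<zeta> * \<psi> y * cis (y \<bullet> \<zeta>) \<partial>lborel) \<partial>lborel)"
    by (rule lborel_pair.Fubini_integral[OF int])
  moreover have "(\<integral>\<zeta>. F \<zeta> * \<psi> y * cis (y \<bullet> \<zeta>) \<partial>lborel) = \<psi> y * (\<integral>\<zeta>. F \<zeta> * cis (y \<bullet> \<zeta>) \<partial>lborel)" for y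
    by (subst integral_mult_right_zero[symmetric]) (simp add: mult_ac)
  moreover have "(\<integral>y. F \<zeta> * \<psi> y * cis (y \<bullet> \<zeta>) \<partial>lborel) = F \<zeta> * (\<integral>y. \<psi> y * cis (y \<bullet> \<zeta>) \<partial>lborel)" for \<zeta>
    by (subst integral_mult_right_zero[symmetric]) (simp add: mult_ac)
  ultimately show ?thesis by simp
qed

text \<open>A cutoff of order dimension plus one is integrable at infinity, where the symbol is
  bounded by \<open>A\<close>; near the origin |x|^(-s) is integrable.\<close>

lemma symbol_cutoff_integrable:
  fixes m :: "'a::euclidean_space \<Rightarrow> complex"
  assumes m[measurable]: "m \<in> borel_measurable borel" and b: "\<And>x. x \<noteq> 0 \<Longrightarrow> norm (m x) \<le> A * norm x powr (- s)"
    and s: "0 < s" "s < real DIM('a)" and A: "0 \<le> A" and \<epsilon>: "0 < \<epsilon>"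
  shows "integrable lborel (\<lambda>x. m x * cutoff (DIM('a) + 1) \<epsilon> x)"
proof (rule integrableI_bounded)
  define M where "M = DIM('a) + 1"
  show "(\<lambda>x. m x * cutoff (DIM('a) + 1) \<epsilon> x) \<in> borel_measurable lborel" by measurable
  obtain C1 where C1: "\<And>R. 0 < R \<Longrightarrow> (\<integral>\<^sup>+x. ennreal (norm (x::'a) powr (- s)) * indicator (ball 0 R) x \<partial>lborel) \<le> ennreal (C1 * R powr (- s + real DIM('a)))"
    using nn_integral_norm_powr_ball[of "- s", where 'a = 'a] s by auto
  obtain C2 where C2: "\<And>R. 0 < R \<Longrightarrow> (\<integral>\<^sup>+x. ennreal (norm (x::'a) powr (- real M)) * indicator (- ball 0 R) x \<partial>lborel) \<le> ennreal (C2 * R powr (- real M + real DIM('a)))"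
    using nn_integral_norm_powr_tail[of "- real M", where 'a = 'a] by (auto simp: M_def)
  have m1: "(\<lambda>x. ennreal (norm (x::'a) powr (- s)) * indicator (ball 0 1) x) \<in> borel_measurable lborel"
    "(\<lambda>x. ennreal (norm (x::'a) powr (- real M)) * indicator (- ball 0 1) x) \<in> borel_measurable lborel"
  proof -
    have "ball (0::'a) 1 \<in> sets lborel" "- ball (0::'a) 1 \<in> sets lborel" by simp_all
    then show "(\<lambda>x. ennreal (norm (x::'a) powr (- s)) * indicator (ball 0 1) x) \<in> borel_measurable lborel"
      "(\<lambda>x. ennreal (norm (x::'a) powr (- real M)) * indicator (- ball 0 1) x) \<in> borel_measurable lborel"
      by (intro borel_measurable_times_ennreal borel_measurable_indicator; simp)+
  qed
  have "(\<integral>\<^sup>+x. ennreal (norm (m x * cutoff M \<epsilon> x)) \<partial>lborel)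
    \<le> (\<integral>\<^sup>+x. ennreal A * (ennreal (norm (x::'a) powr (- s)) * indicator (ball 0 1) x) + ennreal (A * (1 / \<epsilon>) ^ M) * (ennreal (norm x powr (- real M)) * indicator (- ball 0 1) x) \<partial>lborel)"
  proof (rule nn_integral_mono_AE)
    show "AE x in lborel. ennreal (norm (m x * cutoff M \<epsilon> x)) \<le> ennreal A * (ennreal (norm (x::'a) powr (- s)) * indicator (ball 0 1) x) + ennreal (A * (1 / \<epsilon>) ^ M) * (ennreal (norm x powr (- real M)) * indicator (- ball 0 1) x)"
      using AE_lborel_singleton[of "0::'a"]
    proof eventually_elim
      case (elim x)
      show ?case
      proof (cases "norm x < 1")
        case True
        have "norm (m x * cutoff M \<epsilon> x) \<le> A * norm x powr (- s) * 1"
          unfolding norm_mult using b[OF elim] norm_cutoff_le_1[of M \<epsilon> x] A by (intro mult_mono) auto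
        then have "ennreal (norm (m x * cutoff M \<epsilon> x)) \<le> ennreal A * ennreal (norm x powr (- s))"
          using A by (simp add: ennreal_mult[symmetric] ennreal_leI)
        then show ?thesis using True by simp
      next
        case False
        have "norm x powr (- s) \<le> norm x powr 0" using False s by (intro powr_mono) auto
        also have "\<dots> = 1" using False by auto
        finally have "A * norm x powr (- s) \<le> A * 1" using A by (intro mult_left_mono)
        then have 1: "norm (m x) \<le> A" using b[OF elim] by simp
        have "(\<epsilon> * norm x) ^ M * norm (cutoff M \<epsilon> x) \<le> 1" by (rule cutoff_decay[OF order_refl \<epsilon>])
        then have 2: "norm (cutoff M \<epsilon> x) \<le> (1 / \<epsilon>) ^ M * norm x powr (- real M)"
          using False \<epsilon> elim by (simp add: powr_minus powr_realpow power_mult_distrib field_simps)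
        have "norm (m x * cutoff M \<epsilon> x) \<le> A * ((1 / \<epsilon>) ^ M * norm x powr (- real M))"
          unfolding norm_mult using 1 2 A by (intro mult_mono) auto
        then have "ennreal (norm (m x * cutoff M \<epsilon> x)) \<le> ennreal (A * (1 / \<epsilon>) ^ M) * ennreal (norm x powr (- real M))"
          using A \<epsilon> by (simp add: ennreal_mult[symmetric] ennreal_leI mult.assoc)
        then show ?thesis using False by simp
      qed
    qed
  qed
  also have "\<dots> = ennreal A * (\<integral>\<^sup>+x. ennreal (norm (x::'a) powr (- s)) * indicator (ball 0 1) x \<partial>lborel)
     + ennreal (A * (1 / \<epsilon>) ^ M) * (\<integral>\<^sup>+x. ennreal (norm (x::'a) powr (- real M)) * indicator (- ball 0 1) x \<partial>lborel)"
    using m1 by (subst nn_integral_add) (auto simp: nn_integral_cmult intro!: borel_measurable_times_ennreal)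
  also have "\<dots> < \<infinity>"
    using C1[of 1] C2[of 1] by (auto simp: ennreal_mult_less_top intro: order.strict_trans1)
  finally show "(\<integral>\<^sup>+x. ennreal (norm (m x * cutoff (DIM('a) + 1) \<epsilon> x)) \<partial>lborel) < \<infinity>" by (simp add: M_def)
qed

text \<open>The pairing replaces a kernel that need not be given by a convergent integral. Cut-off
  symbols satisfy the same estimates with one constant for all \<epsilon>, the integrals may be
  exchanged for them, and integrability of the full pairing lets \<epsilon> tend to 0.\<close>

theorem multiplier_pairing_bound:
  assumes s: "0 < s" "s < real DIM('a::euclidean_space)" and A: "0 \<le> A"
  shows "\<exists>C\<ge>0. \<forall>(m::'a \<Rightarrow> complex) \<psi>. m \<in> borel_measurable borel \<longrightarrow>
    (\<forall>b\<in>Basis. dir_symbol DIM('a) b m (- s) A) \<longrightarrow> integrable lborel \<psi> \<longrightarrow>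
    integrable lborel (\<lambda>\<zeta>. m \<zeta> * (\<integral>y. \<psi> y * cis (y \<bullet> \<zeta>) \<partial>lborel)) \<longrightarrow>
    ennreal (norm (\<integral>\<zeta>. m \<zeta> * (\<integral>y. \<psi> y * cis (y \<bullet> \<zeta>) \<partial>lborel) \<partial>lborel))
      \<le> ennreal C * (\<integral>\<^sup>+y. ennreal (norm y powr (s - real DIM('a))) * ennreal (norm (\<psi> y)) \<partial>lborel)"
proof -
  define N where "N = DIM('a)"
  define M where "M = N + 1"
  \<comment> \<open>\<open>2 ^ N\<close> from the product rule, \<open>(2 * M + 1) ^ N\<close> from
    the cutoff; \<epsilon> does not occur.\<close>
  define A' where "A' = 2 ^ N * (A * (2 * real M + 1) ^ N)"
  have A': "0 \<le> A'" using A by (simp add: A'_def)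
  obtain C where C0: "0 \<le> C" "\<forall>(F::'a \<Rightarrow> complex) y. integrable lborel F \<longrightarrow> y \<noteq> 0 \<longrightarrow>
    (\<forall>b\<in>Basis. dir_symbol DIM('a) b F (- s) A') \<longrightarrow> norm (\<integral>x. F x * cis (y \<bullet> x) \<partial>lborel) \<le> C * norm y powr (s - real DIM('a))"
    using kernel_bound[OF s A'] by (elim exE conjE)
  have C: "0 \<le> C" "norm (\<integral>x. F x * cis (y \<bullet> x) \<partial>lborel) \<le> C * norm y powr (s - real N)"
    if "integrable lborel F" "y \<noteq> 0" "\<And>b. b \<in> Basis \<Longrightarrow> dir_symbol N b F (- s) A'" for F :: "'a \<Rightarrow> complex" and y
    using C0 that unfolding N_def by simp_all
  have "ennreal (norm (\<integral>\<zeta>. m \<zeta> * (\<integral>y. \<psi> y * cis (y \<bullet> \<zeta>) \<partial>lborel) \<partial>lborel))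
      \<le> ennreal C * (\<integral>\<^sup>+y. ennreal (norm y powr (s - real N)) * ennreal (norm (\<psi> y)) \<partial>lborel)"
    if m: "m \<in> borel_measurable borel" and D: "\<And>b. b \<in> Basis \<Longrightarrow> dir_symbol N b m (- s) A" and \<psi>: "integrable lborel \<psi>"
      and int: "integrable lborel (\<lambda>\<zeta>. m \<zeta> * (\<integral>y. \<psi> y * cis (y \<bullet> \<zeta>) \<partial>lborel))" for m \<psi> :: "'a \<Rightarrow> complex"
  proof -
    note m[measurable]
    have [measurable]: "\<psi> \<in> borel_measurable borel" using \<psi> by (auto dest: borel_measurable_integrable)
    define \<Psi> where "\<Psi> \<zeta> = (\<integral>y. \<psi> y * cis (y \<bullet> \<zeta>) \<partial>lborel)" for \<zeta>
    define I where "I = (\<integral>\<^sup>+y. ennreal (norm y powr (s - real N)) * ennreal (norm (\<psi> y)) \<partial>lborel)"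
    have bound: "ennreal (norm (\<integral>\<zeta>. m \<zeta> * cutoff M \<epsilon> \<zeta> * \<Psi> \<zeta> \<partial>lborel)) \<le> ennreal C * I" if \<epsilon>: "0 < \<epsilon>" for \<epsilon>
    proof -
      define F where "F \<zeta> = m \<zeta> * cutoff M \<epsilon> \<zeta>" for \<zeta>
      have F: "integrable lborel F" unfolding F_def[abs_def] M_def N_def
        by (rule symbol_cutoff_integrable[OF m _ s A \<epsilon>]) (rule dir_symbol_bound[OF D[OF SOME_Basis]])
      have FD: "dir_symbol N b F (- s) A'" if "b \<in> Basis" for b
        using dir_symbol_mult[OF A _ D[OF that] dir_symbol_cutoff[OF that \<epsilon>, of N M]] unfolding F_def[abs_def] A'_def M_def by simp
      define k where "k y = (\<integral>\<zeta>. F \<zeta> * cis (y \<bullet> \<zeta>) \<partial>lborel)" for y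
      have Fm[measurable]: "F \<in> borel_measurable borel" using F by (auto dest: borel_measurable_integrable)
      have "(\<lambda>y. k y) \<in> borel_measurable borel"
        unfolding k_def by measurable
      then have [measurable]: "k \<in> borel_measurable borel" by simp
      have "(\<integral>\<zeta>. F \<zeta> * \<Psi> \<zeta> \<partial>lborel) = (\<integral>y. \<psi> y * k y \<partial>lborel)"
        unfolding \<Psi>_def k_def by (rule integral_swap_cis[OF F \<psi>])
      then have "ennreal (norm (\<integral>\<zeta>. F \<zeta> * \<Psi> \<zeta> \<partial>lborel)) = ennreal (norm (\<integral>y. \<psi> y * k y \<partial>lborel))" by simp
      \<comment> \<open>A non-integrable function has Bochner integral 0, so the inequality persists
        in that case.\<close>
      also have "\<dots> \<le> (\<integral>\<^sup>+y. ennreal (norm (\<psi> y * k y)) \<partial>lborel)"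
      proof (cases "integrable lborel (\<lambda>y. \<psi> y * k y)")
        case True
        then show ?thesis by (rule integral_norm_bound_ennreal)
      qed (simp add: not_integrable_integral_eq)
      also have "\<dots> \<le> (\<integral>\<^sup>+y. ennreal C * (ennreal (norm y powr (s - real N)) * ennreal (norm (\<psi> y))) \<partial>lborel)"
      proof (rule nn_integral_mono_AE)
        show "AE y in lborel. ennreal (norm (\<psi> y * k y)) \<le> ennreal C * (ennreal (norm y powr (s - real N)) * ennreal (norm (\<psi> y)))"
          using AE_lborel_singleton[of "0::'a"]
        proof eventually_elim
          case (elim y)
          have "norm (\<psi> y * k y) \<le> norm (\<psi> y) * (C * norm y powr (s - real N))"
            unfolding norm_mult k_def by (intro mult_left_mono C(2)[OF F elim FD]) auto
          then show ?case using C0(1) by (simp add: ennreal_mult[symmetric] ennreal_leI mult_ac)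
        qed
      qed
      also have "\<dots> = ennreal C * I" unfolding I_def by (rule nn_integral_cmult) measurable
      finally show ?thesis by (simp add: F_def)
    qed
    have "(\<lambda>j. \<integral>\<zeta>. m \<zeta> * cutoff M (1 / real (Suc j)) \<zeta> * \<Psi> \<zeta> \<partial>lborel) \<longlonglongrightarrow> (\<integral>\<zeta>. m \<zeta> * \<Psi> \<zeta> \<partial>lborel)"
    proof (rule integral_dominated_convergence)
      have "(\<lambda>\<zeta>. \<Psi> \<zeta>) \<in> borel_measurable borel" unfolding \<Psi>_def by measurable
      then have [measurable]: "\<Psi> \<in> borel_measurable borel" by simp
      show "(\<lambda>\<zeta>. m \<zeta> * \<Psi> \<zeta>) \<in> borel_measurable lborel" "(\<lambda>\<zeta>. m \<zeta> * cutoff M (1 / real (Suc j)) \<zeta> * \<Psi> \<zeta>) \<in> borel_measurable lborel" for j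
        by measurable
      show "integrable lborel (\<lambda>\<zeta>. norm (m \<zeta> * \<Psi> \<zeta>))" using int unfolding \<Psi>_def by (rule integrable_norm)
      show "AE \<zeta> in lborel. (\<lambda>j. m \<zeta> * cutoff M (1 / real (Suc j)) \<zeta> * \<Psi> \<zeta>) \<longlonglongrightarrow> m \<zeta> * \<Psi> \<zeta>"
      proof (rule AE_I2)
        fix \<zeta>
        have "(\<lambda>j. m \<zeta> * cutoff M (1 / real (Suc j)) \<zeta> * \<Psi> \<zeta>) \<longlonglongrightarrow> m \<zeta> * 1 * \<Psi> \<zeta>"
          by (intro tendsto_intros cutoff_tendsto)
        then show "(\<lambda>j. m \<zeta> * cutoff M (1 / real (Suc j)) \<zeta> * \<Psi> \<zeta>) \<longlonglongrightarrow> m \<zeta> * \<Psi> \<zeta>" by simp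
      qed
      show "AE \<zeta> in lborel. norm (m \<zeta> * cutoff M (1 / real (Suc j)) \<zeta> * \<Psi> \<zeta>) \<le> norm (m \<zeta> * \<Psi> \<zeta>)" for j
      proof (rule AE_I2)
        fix \<zeta>
        have "norm (m \<zeta>) * norm (\<Psi> \<zeta>) * norm (cutoff M (1 / real (Suc j)) \<zeta>) \<le> norm (m \<zeta>) * norm (\<Psi> \<zeta>) * 1"
          by (intro mult_left_mono norm_cutoff_le_1) auto
        then show "norm (m \<zeta> * cutoff M (1 / real (Suc j)) \<zeta> * \<Psi> \<zeta>) \<le> norm (m \<zeta> * \<Psi> \<zeta>)" by (simp add: norm_mult mult_ac)
      qed
    qed
    then have "(\<lambda>j. ennreal (norm (\<integral>\<zeta>. m \<zeta> * cutoff M (1 / real (Suc j)) \<zeta> * \<Psi> \<zeta> \<partial>lborel))) \<longlonglongrightarrow> ennreal (norm (\<integral>\<zeta>. m \<zeta> * \<Psi> \<zeta> \<partial>lborel))"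
      by (intro tendsto_ennrealI tendsto_norm)
    then have "ennreal (norm (\<integral>\<zeta>. m \<zeta> * \<Psi> \<zeta> \<partial>lborel)) \<le> ennreal C * I"
      by (rule LIMSEQ_le_const2) (intro exI allI impI bound, simp)
    then show ?thesis by (simp add: \<Psi>_def I_def)
  qed
  with C0(1) show ?thesis unfolding N_def by blast
qed

subsection \<open>Schwartz functions\<close>

lemma integrable_one_plus_norm:
  "integrable lborel (\<lambda>x. 1 / (1 + norm (x::'a::euclidean_space)) ^ (DIM('a) + 1))"
proof (rule integrableI_bounded)
  define M where "M = DIM('a) + 1"
  obtain C where C: "\<And>R. 0 < R \<Longrightarrow> (\<integral>\<^sup>+x. ennreal (norm (x::'a) powr (- real M)) * indicator (- ball 0 R) x \<partial>lborel) \<le> ennreal (C * R powr (- real M + real DIM('a)))"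
    using nn_integral_norm_powr_tail[of "- real M", where 'a = 'a] by (auto simp: M_def)
  have sets: "ball (0::'a) 1 \<in> sets lborel" "- ball (0::'a) 1 \<in> sets lborel" by simp_all
  have "(\<integral>\<^sup>+x. ennreal (norm (1 / (1 + norm (x::'a)) ^ M)) \<partial>lborel)
    \<le> (\<integral>\<^sup>+x. indicator (ball 0 1) x + ennreal (norm (x::'a) powr (- real M)) * indicator (- ball 0 1) x \<partial>lborel)"
  proof (rule nn_integral_mono)
    fix x :: 'a
    show "ennreal (norm (1 / (1 + norm x) ^ M)) \<le> indicator (ball 0 1) x + ennreal (norm x powr (- real M)) * indicator (- ball 0 1) x"
    proof (cases "norm x < 1")
      case True
      have "1 \<le> (1 + norm x) ^ M" by (rule one_le_power) simp
      moreover have "0 < (1 + norm x) ^ M" by (rule zero_less_power) (simp add: add_pos_nonneg)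
      ultimately have "1 / (1 + norm x) ^ M \<le> 1" by (subst divide_le_eq_1_pos)
      then have "norm (1 / (1 + norm x) ^ M) \<le> 1" by (simp add: norm_divide norm_power)
      then show ?thesis using True by simp
    next
      case False
      have "1 / (1 + norm x) ^ M \<le> 1 / norm x ^ M"
        using False by (intro divide_left_mono power_mono mult_pos_pos zero_less_power) auto
      also have "\<dots> = norm x powr (- real M)"
      proof -
        have "0 < norm x" using False by linarith
        then show ?thesis by (simp add: powr_minus powr_realpow inverse_eq_divide)
      qed
      finally show ?thesis using False by (simp add: norm_divide norm_power ennreal_leI)
    qed
  qed
  also have "\<dots> = emeasure lborel (ball (0::'a) 1) + (\<integral>\<^sup>+x. ennreal (norm (x::'a) powr (- real M)) * indicator (- ball 0 1) x \<partial>lborel)"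
    using sets by (subst nn_integral_add) (auto intro!: borel_measurable_times_ennreal borel_measurable_indicator)
  also have "\<dots> < \<infinity>"
    using C[of 1] emeasure_lborel_ball_finite[of "0::'a" 1] by (auto intro: order.strict_trans1)
  finally show "(\<integral>\<^sup>+x. ennreal (norm (1 / (1 + norm (x::'a)) ^ (DIM('a) + 1))) \<partial>lborel) < \<infinity>" by (simp add: M_def)
qed measurable

text \<open>Decay without derivatives; it is applied to each iterated coordinate derivative of a
  Schwartz function.\<close>

definition rapid :: "('a::euclidean_space \<Rightarrow> complex) \<Rightarrow> bool"
  where "rapid f \<longleftrightarrow> continuous_on UNIV f \<and> (\<forall>M. \<exists>C. \<forall>x. norm (f x) * (1 + norm x) ^ M \<le> C)"

lemma rapidE:
  assumes "rapid f"
  obtains C where "0 \<le> C" "\<And>x. norm (f x) \<le> C / (1 + norm x) ^ M"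
proof -
  obtain C where C: "\<And>x. norm (f x) * (1 + norm x) ^ M \<le> C" using assms by (auto simp: rapid_def)
  have "0 \<le> norm (f 0) * (1 + norm (0::'a)) ^ M" by simp
  then have "0 \<le> C" using C[of 0] by linarith
  moreover have "norm (f x) \<le> C / (1 + norm x) ^ M" for x
  proof -
    have "0 < (1 + norm x) ^ M" by (simp add: add_pos_nonneg)
    then show ?thesis using C[of x] by (simp add: pos_le_divide_eq)
  qed
  ultimately show thesis by (rule that)
qed

lemma rapid_measurable: "rapid f \<Longrightarrow> f \<in> borel_measurable borel"
  unfolding rapid_def by (auto intro: borel_measurable_continuous_onI)

lemma rapid_integrable:
  assumes "rapid (f :: 'a::euclidean_space \<Rightarrow> complex)"
  shows "integrable lborel f"
proof -
  obtain C where C: "0 \<le> C" "\<And>x. norm (f x) \<le> C / (1 + norm x) ^ (DIM('a) + 1)" using rapidE[OF assms] by blast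
  show ?thesis
  proof (rule Bochner_Integration.integrable_bound)
    show "integrable lborel (\<lambda>x. C * (1 / (1 + norm (x::'a)) ^ (DIM('a) + 1)))"
      by (intro integrable_mult_right integrable_one_plus_norm)
    show "AE x in lborel. norm (f x) \<le> norm (C * (1 / (1 + norm (x::'a)) ^ (DIM('a) + 1)))"
      using C by (intro AE_I2) (simp add: norm_mult norm_divide norm_power)
  qed (use rapid_measurable[OF assms] in simp)
qed

section \<open>Coordinate derivatives of Schwartz functions\<close>

lemma foldr_dir_deriv_replicate: "foldr dir_deriv (replicate k b) f = (dir_deriv b ^^ k) f"
  by (induction k) auto

lemma smooth_on_dir_deriv:
  assumes "smooth_on S f" "b \<in> Basis"
  shows "continuous_on S ((dir_deriv b ^^ k) f)"
    and "x \<in> S \<Longrightarrow> ((\<lambda>t. (dir_deriv b ^^ k) f (x + t *\<^sub>R b)) has_vector_derivative (dir_deriv b ^^ Suc k) f x) (at 0)"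
proof -
  have "replicate k b \<in> lists Basis" using assms(2) by auto
  then have *: "continuous_on S (foldr dir_deriv (replicate k b) f)"
    "\<And>x. x \<in> S \<Longrightarrow> (\<lambda>t::real. foldr dir_deriv (replicate k b) f (x + t *\<^sub>R b)) differentiable (at 0)"
    using assms unfolding smooth_on_def by blast+
  show "continuous_on S ((dir_deriv b ^^ k) f)" using *(1) by (simp only: foldr_dir_deriv_replicate)
  show "((\<lambda>t. (dir_deriv b ^^ k) f (x + t *\<^sub>R b)) has_vector_derivative (dir_deriv b ^^ Suc k) f x) (at 0)" if "x \<in> S"
  proof -
    have "(\<lambda>t. (dir_deriv b ^^ k) f (x + t *\<^sub>R b)) differentiable (at 0)"
      using *(2)[OF that] by (simp only: foldr_dir_deriv_replicate)
    then show ?thesis unfolding funpow.simps comp_apply dir_deriv_def[of b "(dir_deriv b ^^ k) f"]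
      by (rule vector_derivative_works[THEN iffD1])
  qed
qed

lemma mi_deriv_zero [simp]: "mi_deriv e (\<lambda>_. 0) f = f"
proof -
  have "foldr (\<lambda>i. dir_deriv (e i) ^^ 0) xs f = f" for xs by (induction xs) auto
  then show ?thesis by (simp add: mi_deriv_def)
qed

text \<open>Pure powers in one coordinate are the derivatives that the difference method consumes;
  for them the enumeration of the coordinates is immaterial.\<close>

lemma mi_deriv_single: "mi_deriv e (\<lambda>i. if i = j then k else 0) f = (dir_deriv (e j) ^^ k) f"
proof -
  have "distinct xs \<Longrightarrow> foldr (\<lambda>i. dir_deriv (e i) ^^ (if i = j then k else 0)) xs f
      = (if j \<in> set xs then (dir_deriv (e j) ^^ k) f else f)" for xs
    by (induction xs) auto
  from this[OF coord_list(1)] show ?thesis by (simp add: mi_deriv_def coord_list(2))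
qed

lemma mi_size_single [simp]: "mi_size (\<lambda>i. if i = j then k else 0) = k"
  by (simp add: mi_size_def)

lemma mi_size_zero [simp]: "mi_size (\<lambda>_. 0) = 0"
  by (simp add: mi_size_def)

text \<open>Powers of single coordinates suffice as weights, because some coordinate has size at
  least |x| over the dimension; the constants are summed over the coordinates as that coordinate
  depends on x.\<close>

lemma schwartz_decay:
  fixes f :: "(real^'n) \<Rightarrow> complex"
  assumes f: "f \<in> schwartz"
  shows "\<exists>C. \<forall>x. norm ((dir_deriv (axis j 1) ^^ k) f x) * (1 + norm x) ^ M \<le> C"
proof -
  define D where "D = (dir_deriv (axis j 1) ^^ k) f"
  have bd: "\<exists>C. \<forall>x. \<bar>x $ i\<bar> ^ L * norm (D x) \<le> C" for i and L :: nat
  proof -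
    have "bounded (range (\<lambda>x. (\<Prod>l\<in>UNIV. (x $ l) ^ \<alpha> l) *\<^sub>R mi_deriv (\<lambda>i. axis i 1) \<beta> f x))" for \<alpha> \<beta>
      using f by (simp add: schwartz_def)
    from this[of "\<lambda>l. if l = i then L else 0" "\<lambda>i. if i = j then k else 0"]
    obtain C where "\<And>x. norm ((\<Prod>l\<in>UNIV. (x $ l) ^ (if l = i then L else 0)) *\<^sub>R D x) \<le> C"
      unfolding mi_deriv_single D_def bounded_iff by auto
    moreover have "(\<Prod>l\<in>UNIV. (x $ l) ^ (if l = i then L else 0)) = (x $ i) ^ L" for x :: "real^'n"
    proof -
      have "(\<Prod>l\<in>UNIV. (x $ l) ^ (if l = i then L else 0)) = (\<Prod>l\<in>UNIV. if l = i then (x $ l) ^ L else 1)"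
        by (intro prod.cong) auto
      then show ?thesis by simp
    qed
    ultimately show ?thesis by (auto simp: power_abs)
  qed
  have "\<forall>i. \<exists>C. \<forall>x. \<bar>x $ i\<bar> ^ M * norm (D x) \<le> C" using bd by blast
  then obtain c where c: "\<And>i x. \<bar>x $ i\<bar> ^ M * norm (D x) \<le> c i" by metis
  obtain c0 where c0: "\<And>x. norm (D x) \<le> c0" using bd[of undefined 0] by auto
  have c_nn: "0 \<le> c i" for i using c[of 0 i] by (rule order_trans[rotated]) simp
  have "norm (D x) * (1 + norm x) ^ M \<le> 2 ^ M * (c0 + real CARD('n) ^ M * (\<Sum>i\<in>UNIV. c i))" for x
  proof -
    obtain b where b: "b \<in> Basis" "norm x \<le> real DIM(real^'n) * \<bar>x \<bullet> b\<bar>" using exists_large_coordinate by blast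
    then obtain i where i: "b = axis i 1" by (auto simp: Basis_vec_def)
    have xi: "norm x \<le> real CARD('n) * \<bar>x $ i\<bar>" using b(2) by (simp add: i inner_axis)
    then have "norm x ^ M \<le> (real CARD('n) * \<bar>x $ i\<bar>) ^ M" by (intro power_mono) auto
    then have "norm x ^ M * norm (D x) \<le> real CARD('n) ^ M * (\<bar>x $ i\<bar> ^ M * norm (D x))"
      by (simp add: power_mult_distrib mult_right_mono flip: mult.assoc)
    also have "\<dots> \<le> real CARD('n) ^ M * (\<Sum>i\<in>UNIV. c i)"
      using c[of x i] member_le_sum[of i UNIV c] c_nn by (intro mult_left_mono) auto
    finally have 1: "norm x ^ M * norm (D x) \<le> real CARD('n) ^ M * (\<Sum>i\<in>UNIV. c i)" .
    have "(1 + norm x) ^ M \<le> (2 * max 1 (norm x)) ^ M" by (intro power_mono) auto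
    also have "\<dots> = 2 ^ M * max 1 (norm x) ^ M" by (rule power_mult_distrib)
    also have "\<dots> \<le> 2 ^ M * (1 + norm x ^ M)" by (intro mult_left_mono) (auto simp: max_def)
    finally have "norm (D x) * (1 + norm x) ^ M \<le> norm (D x) * (2 ^ M * (1 + norm x ^ M))" by (rule mult_left_mono) simp
    also have "\<dots> = 2 ^ M * (norm (D x) + norm x ^ M * norm (D x))" by (simp add: algebra_simps)
    also have "\<dots> \<le> 2 ^ M * (c0 + real CARD('n) ^ M * (\<Sum>i\<in>UNIV. c i))" using 1 c0[of x] by (intro mult_left_mono add_mono) auto
    finally show ?thesis .
  qed
  then show ?thesis unfolding D_def by blast
qed

lemma schwartz_smooth: "f \<in> schwartz \<Longrightarrow> smooth_on UNIV f"
  by (simp add: schwartz_def)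

lemma axis_Basis: "axis i (1::real) \<in> (Basis :: (real^'n) set)"
  by (simp add: axis_in_Basis_iff)

lemma schwartz_rapid:
  fixes f :: "(real^'n) \<Rightarrow> complex"
  assumes f: "f \<in> schwartz"
  shows "rapid ((dir_deriv (axis j 1) ^^ k) f)"
  unfolding rapid_def
proof (intro conjI allI)
  show "continuous_on UNIV ((dir_deriv (axis j 1) ^^ k) f)"
    by (rule smooth_on_dir_deriv(1)[OF schwartz_smooth[OF f] axis_Basis])
qed (rule schwartz_decay[OF f])

text \<open>The counterpart without a singularity: derivatives exist everywhere, so only the last
  one has to be bounded along the segment.\<close>

lemma norm_fd_pow_chain_le:
  assumes "\<And>j x. ((\<lambda>t. D j (x + t *\<^sub>R b)) has_vector_derivative D (Suc j) x) (at 0)"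
    and "\<And>u. 0 \<le> u \<Longrightarrow> u \<le> real k \<Longrightarrow> norm (D k (x + (u * \<tau>) *\<^sub>R b)) \<le> B"
  shows "norm ((fd (\<tau> *\<^sub>R b) ^^ k) (D 0) x) \<le> \<bar>\<tau>\<bar> ^ k * B"
  using assms
proof (induction k arbitrary: D x)
  case 0
  then show ?case using 0(2)[of 0] by simp
next
  case (Suc k)
  have "norm ((fd (\<tau> *\<^sub>R b) ^^ k) (D 0) (x + \<tau> *\<^sub>R b) - (fd (\<tau> *\<^sub>R b) ^^ k) (D 0) x) \<le> \<bar>\<tau>\<bar> * (\<bar>\<tau>\<bar> ^ k * B)"
  proof (rule norm_diff_le_line_derivative)
    fix u :: real assume u: "0 \<le> u" "u \<le> 1"
    show "((\<lambda>t. (fd (\<tau> *\<^sub>R b) ^^ k) (D 0) (x + (u * \<tau>) *\<^sub>R b + t *\<^sub>R b)) has_vector_derivative (fd (\<tau> *\<^sub>R b) ^^ k) (D (Suc 0)) (x + (u * \<tau>) *\<^sub>R b)) (at 0)"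
      by (rule has_vector_derivative_fd_pow[where S = UNIV]) (use Suc.prems in auto)
    show "norm ((fd (\<tau> *\<^sub>R b) ^^ k) (D (Suc 0)) (x + (u * \<tau>) *\<^sub>R b)) \<le> \<bar>\<tau>\<bar> ^ k * B"
    proof (rule Suc.IH[of "\<lambda>j. D (Suc j)"])
      show "norm (D (Suc k) (x + (u * \<tau>) *\<^sub>R b + (v * \<tau>) *\<^sub>R b)) \<le> B" if "0 \<le> v" "v \<le> real k" for v
        using Suc.prems(2)[of "u + v"] u that by (simp add: algebra_simps)
    qed (rule Suc.prems(1))
  qed
  then show ?case unfolding fd_pow_Suc by simp
qed

section \<open>Decay of the Fourier transform\<close>

lemma divide_le_rescale:
  fixes P Q R c :: real
  assumes "0 < P" "0 < Q" "0 \<le> c" "P \<le> R * Q"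
  shows "c / Q \<le> c * R / P"
  using assms mult_left_mono[of P "R * Q" c] by (simp add: field_simps)

text \<open>Unnormalized and with the positive sign of the kernel integrals;
  \<open>fourier f \<xi>\<close> is a multiple of \<open>ft f (- \<xi>)\<close>.\<close>

definition ft :: "('a::euclidean_space \<Rightarrow> complex) \<Rightarrow> 'a \<Rightarrow> complex"
  where "ft f y = (\<integral>x. f x * cis (y \<bullet> x) \<partial>lborel)"

lemma ft_measurable [measurable]:
  assumes [measurable]: "f \<in> borel_measurable borel"
  shows "ft f \<in> borel_measurable borel"
proof -
  have "(\<lambda>y. ft f y) \<in> borel_measurable borel" unfolding ft_def by measurable
  then show ?thesis by simp
qed

lemma norm_integral_mult_cis_le:
  assumes "integrable lborel (f :: 'a::euclidean_space \<Rightarrow> complex)"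
  shows "norm (\<integral>x. f x * cis (y \<bullet> x) \<partial>lborel) \<le> (\<integral>x. norm (f x) \<partial>lborel)"
proof -
  have "norm (\<integral>x. f x * cis (y \<bullet> x) \<partial>lborel) \<le> (\<integral>x. norm (f x * cis (y \<bullet> x)) \<partial>lborel)" by (rule integral_norm_bound)
  then show ?thesis by (simp add: norm_mult)
qed

text \<open>The step is chosen with \<open>y \<bullet> h = pi\<close>, as for singular kernels: k
  differences multiply the transform by a factor of modulus \<open>2 ^ k\<close> and gain
  \<open>\<bar>\<tau>\<bar> ^ k\<close>, of order |y|^(-k). For |y| \<le> 1 the integral of |f| is
  enough.\<close>

lemma ft_decay:
  fixes f :: "(real^'n) \<Rightarrow> complex"
  assumes f: "f \<in> schwartz"
  shows "\<exists>C. \<forall>y. norm (ft f y) * (1 + norm y) ^ k \<le> C"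
proof -
  define N where "N = DIM(real^'n)"
  have fi: "integrable lborel f" using rapid_integrable[OF schwartz_rapid[OF f, where k = 0]] by simp
  have "\<forall>j. \<exists>c. 0 \<le> c \<and> (\<forall>x. norm ((dir_deriv (axis j 1) ^^ k) f x) \<le> c / (1 + norm x) ^ (N + 1))"
    using rapidE[OF schwartz_rapid[OF f]] by metis
  then obtain c where c: "\<And>j. 0 \<le> c j" "\<And>j x. norm ((dir_deriv (axis j 1) ^^ k) f x) \<le> c j / (1 + norm x) ^ (N + 1)" by metis
  \<comment> \<open>For \<open>1 \<le> norm y\<close> the k steps move a point by at most
    \<open>r\<close>, so \<open>1 + norm\<close> changes by a factor of at most
    \<open>1 + r\<close>.\<close>
  define r where "r = real k * (pi * real N)"
  have r: "0 \<le> r" by (simp add: r_def)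
  define J where "J = (\<integral>x. 1 / (1 + norm (x::real^'n)) ^ (N + 1) \<partial>lborel)"
  have J: "0 \<le> J" unfolding J_def by (rule integral_nonneg_AE) simp
  \<comment> \<open>The sum over all coordinates accounts for the direction depending on y.\<close>
  define K1 where "K1 = (pi * real N) ^ k * ((\<Sum>j\<in>UNIV. c j) * (1 + r) ^ (N + 1) * J)"
  have sc: "0 \<le> (\<Sum>j\<in>UNIV. c j)" using c(1) by (auto intro: sum_nonneg)
  have K1: "0 \<le> K1" using J r sc by (simp add: K1_def)
  have big: "norm (ft f y) * norm y ^ k \<le> K1" if y: "1 \<le> norm y" for y
  proof -
    obtain b where b: "b \<in> Basis" "norm y \<le> real N * \<bar>y \<bullet> b\<bar>" using exists_large_coordinate unfolding N_def by blast
    then obtain j where j: "b = axis j 1" by (auto simp: Basis_vec_def)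
    have yb: "y \<bullet> b \<noteq> 0" using b y by auto
    define \<tau> where "\<tau> = pi / (y \<bullet> b)"
    have \<tau>: "\<bar>\<tau>\<bar> * norm y \<le> pi * real N" using b(2) yb by (simp add: \<tau>_def field_simps)
    then have \<tau>1: "\<bar>\<tau>\<bar> \<le> pi * real N" using y mult_left_mono[OF y, of "\<bar>\<tau>\<bar>"] by simp
    define h where "h = \<tau> *\<^sub>R b"
    have yh: "y \<bullet> h = pi" using yb by (simp add: h_def \<tau>_def)
    define G where "G = (fd h ^^ k) f"
    have G: "integrable lborel G" unfolding G_def by (rule fd_pow_integrable[OF fi])
    have Gb: "norm (G x) \<le> (\<bar>\<tau>\<bar> ^ k * (c j * (1 + r) ^ (N + 1))) * (1 / (1 + norm x) ^ (N + 1))" for x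
    proof -
      have "norm ((fd (\<tau> *\<^sub>R b) ^^ k) ((dir_deriv b ^^ 0) f) x) \<le> \<bar>\<tau>\<bar> ^ k * (c j * (1 + r) ^ (N + 1) / (1 + norm x) ^ (N + 1))"
      proof (rule norm_fd_pow_chain_le[where D = "\<lambda>i. (dir_deriv b ^^ i) f"])
        show "((\<lambda>t. (dir_deriv b ^^ i) f (x + t *\<^sub>R b)) has_vector_derivative (dir_deriv b ^^ Suc i) f x) (at 0)" for i x
          by (rule smooth_on_dir_deriv(2)[OF schwartz_smooth[OF f] b(1)]) simp
        fix u :: real assume u: "0 \<le> u" "u \<le> real k"
        define x' where "x' = x + (u * \<tau>) *\<^sub>R b"
        have "norm ((u * \<tau>) *\<^sub>R b) = u * \<bar>\<tau>\<bar>" using b u by (simp add: abs_mult)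
        also have "\<dots> \<le> r" unfolding r_def using u \<tau>1 by (intro mult_mono) auto
        finally have "norm x \<le> norm x' + r" using norm_triangle_ineq4[of x' "(u * \<tau>) *\<^sub>R b"] by (simp add: x'_def)
        moreover have "0 \<le> r * norm x'" using r by (rule mult_nonneg_nonneg) simp
        moreover have "(1 + r) * (1 + norm x') = 1 + norm x' + r + r * norm x'" by (simp add: algebra_simps)
        ultimately have "1 + norm x \<le> (1 + r) * (1 + norm x')" by linarith
        then have "(1 + norm x) ^ (N + 1) \<le> ((1 + r) * (1 + norm x')) ^ (N + 1)" by (intro power_mono) auto
        then have le: "(1 + norm x) ^ (N + 1) \<le> (1 + r) ^ (N + 1) * (1 + norm x') ^ (N + 1)" by (simp only: power_mult_distrib)
        have p: "0 < (1 + norm x) ^ (N + 1)" "0 < (1 + norm x') ^ (N + 1)" by (simp_all add: add_pos_nonneg)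
        have "norm ((dir_deriv b ^^ k) f x') \<le> c j / (1 + norm x') ^ (N + 1)" unfolding j by (rule c(2))
        also have "\<dots> \<le> c j * (1 + r) ^ (N + 1) / (1 + norm x) ^ (N + 1)"
          by (rule divide_le_rescale[OF p c(1) le])
        finally show "norm ((dir_deriv b ^^ k) f (x + (u * \<tau>) *\<^sub>R b)) \<le> c j * (1 + r) ^ (N + 1) / (1 + norm x) ^ (N + 1)"
          by (simp add: x'_def)
      qed
      then show ?thesis by (simp add: G_def h_def)
    qed
    have "(\<integral>x. G x * cis (y \<bullet> x) \<partial>lborel) = (cis (- pi) - 1) ^ k * ft f y"
      unfolding G_def ft_def integral_fd_pow_cis[OF fi] yh ..
    moreover have "norm ((cis (- pi) - 1) ^ k) = 2 ^ k"
    proof -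
      have "cis (- pi) - 1 = - 2" by (simp add: complex_eq_iff)
      then show ?thesis by (simp only: norm_power norm_minus_cancel norm_numeral)
    qed
    ultimately have "2 ^ k * norm (ft f y) = norm (\<integral>x. G x * cis (y \<bullet> x) \<partial>lborel)"
      by (simp add: norm_mult)
    moreover have "norm (ft f y) \<le> 2 ^ k * norm (ft f y)"
      using mult_right_mono[of 1 "2 ^ k :: real" "norm (ft f y)"] by simp
    ultimately have "norm (ft f y) \<le> (\<integral>x. norm (G x) \<partial>lborel)"
      using norm_integral_mult_cis_le[OF G, of y] by linarith
    also have "\<dots> \<le> (\<integral>x. (\<bar>\<tau>\<bar> ^ k * (c j * (1 + r) ^ (N + 1))) * (1 / (1 + norm (x::real^'n)) ^ (N + 1)) \<partial>lborel)"
      by (intro integral_mono integrable_norm G integrable_mult_right Gb) (unfold N_def, rule integrable_one_plus_norm)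
    also have "\<dots> = (\<bar>\<tau>\<bar> ^ k * (c j * (1 + r) ^ (N + 1))) * J" unfolding J_def by (rule integral_mult_right_zero)
    finally have "norm (ft f y) * norm y ^ k \<le> ((\<bar>\<tau>\<bar> ^ k * (c j * (1 + r) ^ (N + 1))) * J) * norm y ^ k" by (rule mult_right_mono) simp
    also have "\<dots> = (\<bar>\<tau>\<bar> * norm y) ^ k * (c j * (1 + r) ^ (N + 1) * J)" by (simp add: power_mult_distrib mult_ac)
    also have "\<dots> \<le> K1"
      unfolding K1_def
    proof (rule mult_mono)
      show "(\<bar>\<tau>\<bar> * norm y) ^ k \<le> (pi * real N) ^ k" using \<tau> by (intro power_mono) auto
      have "c j \<le> (\<Sum>j\<in>UNIV. c j)" using c(1) by (intro member_le_sum) auto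
      then show "c j * (1 + r) ^ (N + 1) * J \<le> (\<Sum>j\<in>UNIV. c j) * (1 + r) ^ (N + 1) * J"
        using r J by (intro mult_right_mono) auto
      show "0 \<le> c j * (1 + r) ^ (N + 1) * J" using c(1) r J by simp
    qed simp
    finally show ?thesis .
  qed
  define K0 where "K0 = (\<integral>x. norm (f x) \<partial>lborel)"
  have "norm (ft f y) * (1 + norm y) ^ k \<le> 2 ^ k * max K0 K1" for y
  proof (cases "norm y \<le> 1")
    case True
    have K0: "norm (ft f y) \<le> K0" unfolding ft_def K0_def by (rule norm_integral_mult_cis_le[OF fi])
    have "norm (ft f y) * (1 + norm y) ^ k \<le> K0 * 2 ^ k" using True K0 by (intro mult_mono power_mono) (auto intro: order_trans[OF norm_ge_zero])
    also have "\<dots> \<le> 2 ^ k * max K0 K1" by (simp add: mult.commute)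
    finally show ?thesis .
  next
    case False
    have "norm (ft f y) * (1 + norm y) ^ k \<le> norm (ft f y) * (2 * norm y) ^ k" using False by (intro mult_left_mono power_mono) auto
    also have "\<dots> = 2 ^ k * (norm (ft f y) * norm y ^ k)" by (simp add: power_mult_distrib)
    also have "\<dots> \<le> 2 ^ k * max K0 K1" using big[of y] False by (intro mult_left_mono) auto
    finally show ?thesis .
  qed
  then show ?thesis by blast
qed

subsection \<open>Fourier inversion\<close>

text \<open>\<open>lborel\<close> is the image of a product measure indexed by the basis, so tensor
  products integrate factor by factor.\<close>

lemma lborel_integral_prod_Basis:
  fixes \<phi> :: "'a::euclidean_space \<Rightarrow> real \<Rightarrow> complex"
  assumes "\<And>b. b \<in> Basis \<Longrightarrow> integrable lborel (\<phi> b)"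
  shows "integrable lborel (\<lambda>x. \<Prod>b\<in>Basis. \<phi> b (x \<bullet> b))"
    and "(\<integral>x. (\<Prod>b\<in>Basis. \<phi> b (x \<bullet> b)) \<partial>lborel) = (\<Prod>b\<in>Basis. (\<integral>t. \<phi> b t \<partial>lborel))"
proof -
  interpret product_sigma_finite "\<lambda>_::'a. lborel :: real measure" ..
  have [measurable]: "\<phi> b \<in> borel_measurable borel" if "b \<in> Basis" for b
    using assms[OF that] by (auto dest: borel_measurable_integrable)
  have meas: "(\<lambda>x. \<Prod>b\<in>Basis. \<phi> b (x \<bullet> b)) \<in> borel_measurable borel" by measurable
  have T: "(\<lambda>f. \<Sum>b\<in>Basis. f b *\<^sub>R b) \<in> (\<Pi>\<^sub>M b\<in>(Basis::'a set). lborel) \<rightarrow>\<^sub>M borel" by measurable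
  have eq: "(\<Prod>b\<in>Basis. \<phi> b ((\<Sum>b\<in>Basis. f b *\<^sub>R b) \<bullet> b)) = (\<Prod>b\<in>Basis. \<phi> b (f b))" for f
    by (intro prod.cong) auto
  have "integrable (\<Pi>\<^sub>M b\<in>(Basis::'a set). lborel) (\<lambda>f. \<Prod>b\<in>Basis. \<phi> b (f b))"
    by (rule product_integrable_prod) (use assms in auto)
  then show "integrable lborel (\<lambda>x. \<Prod>b\<in>Basis. \<phi> b (x \<bullet> b))"
    by (subst lborel_eq, subst integrable_distr_eq[OF T meas]) (simp only: eq)
  have "(\<integral>x. (\<Prod>b\<in>Basis. \<phi> b (x \<bullet> b)) \<partial>lborel) = (\<integral>f. (\<Prod>b\<in>Basis. \<phi> b (f b)) \<partial>(\<Pi>\<^sub>M b\<in>(Basis::'a set). lborel))"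
    by (subst lborel_eq, subst integral_distr[OF T meas]) (simp only: eq)
  also have "\<dots> = (\<Prod>b\<in>Basis. (\<integral>t. \<phi> b t \<partial>lborel))"
    by (rule product_integral_prod) (use assms in auto)
  finally show "(\<integral>x. (\<Prod>b\<in>Basis. \<phi> b (x \<bullet> b)) \<partial>lborel) = (\<Prod>b\<in>Basis. (\<integral>t. \<phi> b t \<partial>lborel))" .
qed

text \<open>The characteristic function of the standard normal distribution, freed of its
  normalization.\<close>

lemma gaussian_1d:
  fixes v :: real
  shows "integrable lborel (\<lambda>t. complex_of_real (exp (- (t ^ 2) / 2)) * cis (v * t))"
    and "(\<integral>t. complex_of_real (exp (- (t ^ 2) / 2)) * cis (v * t) \<partial>lborel) = complex_of_real (sqrt (2 * pi) * exp (- (v ^ 2) / 2))"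
proof -
  have eq: "complex_of_real (exp (- (t ^ 2) / 2)) * cis (v * t) = complex_of_real (sqrt (2 * pi)) * (std_normal_density t *\<^sub>R iexp (v * t))" for t
    by (simp add: std_normal_density_def cis_conv_exp scaleR_conv_of_real)
  have "integrable lborel std_normal_density"
    using integrable_normal_moment[where k = 0 and \<sigma> = 1 and \<mu> = 0] by simp
  then have "integrable lborel (\<lambda>t. std_normal_density t *\<^sub>R iexp (v * t))"
    by (rule Bochner_Integration.integrable_bound) (auto simp: normal_density_nonneg)
  then show "integrable lborel (\<lambda>t. complex_of_real (exp (- (t ^ 2) / 2)) * cis (v * t))"
    unfolding eq by (rule integrable_mult_right)
  have "(\<integral>t. std_normal_density t *\<^sub>R iexp (v * t) \<partial>lborel) = char std_normal_distribution v"
    unfolding char_def by (subst integral_density) (auto simp: normal_density_nonneg)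
  also have "\<dots> = complex_of_real (exp (- (v ^ 2) / 2))" by (simp add: char_std_normal_distribution)
  finally show "(\<integral>t. complex_of_real (exp (- (t ^ 2) / 2)) * cis (v * t) \<partial>lborel) = complex_of_real (sqrt (2 * pi) * exp (- (v ^ 2) / 2))"
    unfolding eq by (subst integral_mult_right_zero) simp
qed

definition gauss :: "'a::euclidean_space \<Rightarrow> complex"
  where "gauss x = complex_of_real (exp (- (norm x ^ 2) / 2))"

lemma gauss_measurable [measurable]: "gauss \<in> borel_measurable borel"
  unfolding gauss_def[abs_def] by measurable

lemma gauss_fourier:
  fixes v :: "'a::euclidean_space"
  shows "integrable lborel (gauss :: 'a \<Rightarrow> complex)"
    and "(\<integral>x. gauss x * cis (v \<bullet> x) \<partial>lborel) = complex_of_real (sqrt (2 * pi) ^ DIM('a)) * gauss v"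
proof -
  have nrm: "norm x ^ 2 = (\<Sum>b\<in>Basis. (x \<bullet> b) ^ 2)" for x :: 'a
    unfolding power2_norm_eq_inner by (subst euclidean_inner) (simp only: power2_eq_square)
  have cis_sum: "cis (sum f S) = (\<Prod>b\<in>S. cis (f b))" if "finite S" for f and S :: "'a set"
    using that by (induction S rule: finite_induct) (auto simp: cis_mult[symmetric])
  have exp_eq: "exp (- (norm x ^ 2) / 2) = (\<Prod>b\<in>Basis. exp (- ((x \<bullet> b) ^ 2) / 2))" for x :: 'a
    unfolding nrm by (simp add: exp_sum[symmetric] sum_negf sum_divide_distrib[symmetric])
  have eq: "gauss x * cis (w \<bullet> x) = (\<Prod>b\<in>Basis. complex_of_real (exp (- ((x \<bullet> b) ^ 2) / 2)) * cis ((w \<bullet> b) * (x \<bullet> b)))" for x w :: 'a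
    unfolding gauss_def exp_eq of_real_prod prod.distrib by (subst euclidean_inner) (simp add: cis_sum)
  have "integrable lborel (\<lambda>x. gauss x * cis ((0::'a) \<bullet> x))"
    unfolding eq by (rule lborel_integral_prod_Basis(1)) (rule gaussian_1d(1))
  then show "integrable lborel (gauss :: 'a \<Rightarrow> complex)" by simp
  have "(\<integral>x. gauss x * cis (v \<bullet> x) \<partial>lborel) = (\<Prod>b\<in>Basis. complex_of_real (sqrt (2 * pi) * exp (- ((v \<bullet> b) ^ 2) / 2)))"
    unfolding eq by (subst lborel_integral_prod_Basis(2)[OF gaussian_1d(1)]) (simp only: gaussian_1d(2))
  also have "\<dots> = complex_of_real (sqrt (2 * pi) ^ DIM('a)) * gauss v"
    unfolding gauss_def exp_eq of_real_prod[symmetric] prod.distrib by simp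
  finally show "(\<integral>x. gauss x * cis (v \<bullet> x) \<partial>lborel) = complex_of_real (sqrt (2 * pi) ^ DIM('a)) * gauss v" .
qed

text \<open>Inserting \<open>gauss (\<epsilon> *\<^sub>R \<xi>)\<close> makes the double integral
  absolutely convergent, and exchanging the integrals turns the left side into an average of
  \<open>f\<close> around x with a rescaled Gaussian. As \<epsilon> tends to 0, the left side
  converges by integrability of \<open>ft f\<close>, the right side by boundedness and continuity of
  \<open>f\<close>.\<close>

theorem fourier_inversion:
  fixes f :: "'a::euclidean_space \<Rightarrow> complex"
  assumes cont: "continuous_on UNIV f" and B: "\<And>x. norm (f x) \<le> B" and f: "integrable lborel f" and ftf: "integrable lborel (ft f)"
  shows "(\<integral>\<xi>. ft f \<xi> * cis (- (x \<bullet> \<xi>)) \<partial>lborel) = complex_of_real ((2 * pi) ^ DIM('a)) * f x"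
proof -
  \<comment> \<open>It appears once as the constant in the transform of the Gaussian and once as its
    total mass, so that \<open>K * K\<close> is the constant of the inversion formula.\<close>
  define K where "K = complex_of_real (sqrt (2 * pi) ^ DIM('a))"
  have fm[measurable]: "f \<in> borel_measurable borel" using cont by (rule borel_measurable_continuous_onI)
  have g_int: "integrable lborel (gauss :: 'a \<Rightarrow> complex)" by (rule gauss_fourier(1))
  have smoothed: "(\<integral>\<xi>. gauss (\<epsilon> *\<^sub>R \<xi>) * cis (- (x \<bullet> \<xi>)) * ft f \<xi> \<partial>lborel) = K * (\<integral>w. f (x + \<epsilon> *\<^sub>R w) * gauss w \<partial>lborel)"
    if \<epsilon>: "0 < \<epsilon>" for \<epsilon>
  proof -
    define F where "F \<xi> = gauss (\<epsilon> *\<^sub>R \<xi>) * cis ((- x) \<bullet> \<xi>)" for \<xi>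
    have "integrable lborel (\<lambda>\<xi>::'a. gauss (0 + \<epsilon> *\<^sub>R \<xi>))" using \<epsilon> by (intro integrable_lborel_affine g_int) auto
    then have F: "integrable lborel F" unfolding F_def[abs_def] by (intro integrable_mult_cis) simp
    have inner: "(\<integral>\<xi>. F \<xi> * cis (u \<bullet> \<xi>) \<partial>lborel) = K * gauss ((u - x) /\<^sub>R \<epsilon>) / of_real (\<epsilon> ^ DIM('a))" for u
    proof -
      have "(\<integral>\<xi>. gauss \<xi> * cis (((u - x) /\<^sub>R \<epsilon>) \<bullet> \<xi>) \<partial>lborel)
        = (\<bar>\<epsilon>\<bar> ^ DIM('a)) *\<^sub>R (\<integral>\<xi>. gauss (0 + \<epsilon> *\<^sub>R \<xi>) * cis (((u - x) /\<^sub>R \<epsilon>) \<bullet> (0 + \<epsilon> *\<^sub>R \<xi>)) \<partial>lborel)"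
      proof (rule integral_lborel_affine)
        show "(\<lambda>\<xi>. gauss \<xi> * cis (((u - x) /\<^sub>R \<epsilon>) \<bullet> \<xi>)) \<in> borel_measurable borel"
          by (intro borel_measurable_times gauss_measurable measurable_cis_inner) simp_all
      qed (use \<epsilon> in auto)
      moreover have "gauss (0 + \<epsilon> *\<^sub>R \<xi>) * cis (((u - x) /\<^sub>R \<epsilon>) \<bullet> (0 + \<epsilon> *\<^sub>R \<xi>)) = F \<xi> * cis (u \<bullet> \<xi>)" for \<xi>
      proof -
        have "((u - x) /\<^sub>R \<epsilon>) \<bullet> (0 + \<epsilon> *\<^sub>R \<xi>) = (\<epsilon> * inverse \<epsilon>) * ((u - x) \<bullet> \<xi>)" by simp
        also have "\<dots> = (- x) \<bullet> \<xi> + u \<bullet> \<xi>" using \<epsilon> by (simp add: inner_diff_left)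
        finally have "cis (((u - x) /\<^sub>R \<epsilon>) \<bullet> (0 + \<epsilon> *\<^sub>R \<xi>)) = cis ((- x) \<bullet> \<xi>) * cis (u \<bullet> \<xi>)" by (simp only: cis_mult)
        then show ?thesis by (simp only: F_def add_0 mult.assoc)
      qed
      ultimately have "K * gauss ((u - x) /\<^sub>R \<epsilon>) = of_real (\<epsilon> ^ DIM('a)) * (\<integral>\<xi>. F \<xi> * cis (u \<bullet> \<xi>) \<partial>lborel)"
        unfolding gauss_fourier(2) K_def using \<epsilon> by (simp add: scaleR_conv_of_real)
      then show ?thesis using \<epsilon> by simp
    qed
    have "(\<integral>\<xi>. gauss (\<epsilon> *\<^sub>R \<xi>) * cis (- (x \<bullet> \<xi>)) * ft f \<xi> \<partial>lborel) = (\<integral>\<xi>. F \<xi> * (\<integral>u. f u * cis (u \<bullet> \<xi>) \<partial>lborel) \<partial>lborel)"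
      by (simp add: F_def ft_def inner_commute)
    also have "\<dots> = (\<integral>u. f u * (\<integral>\<xi>. F \<xi> * cis (u \<bullet> \<xi>) \<partial>lborel) \<partial>lborel)"
      by (rule integral_swap_cis[OF F f])
    also have "\<dots> = (\<integral>u. f u * (K * gauss ((u - x) /\<^sub>R \<epsilon>) / of_real (\<epsilon> ^ DIM('a))) \<partial>lborel)"
      unfolding inner ..
    also have "\<dots> = (\<bar>\<epsilon>\<bar> ^ DIM('a)) *\<^sub>R (\<integral>w. f (x + \<epsilon> *\<^sub>R w) * (K * gauss ((x + \<epsilon> *\<^sub>R w - x) /\<^sub>R \<epsilon>) / of_real (\<epsilon> ^ DIM('a))) \<partial>lborel)"
      by (rule integral_lborel_affine) (use \<epsilon> in auto)
    also have "\<dots> = (\<integral>w. K * (f (x + \<epsilon> *\<^sub>R w) * gauss w) \<partial>lborel)"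
      using \<epsilon> by (subst integral_scaleR_right[symmetric]) (simp add: scaleR_conv_of_real mult_ac)
    also have "\<dots> = K * (\<integral>w. f (x + \<epsilon> *\<^sub>R w) * gauss w \<partial>lborel)" by (rule integral_mult_right_zero)
    finally show ?thesis .
  qed
  define e where "e j = 1 / real (Suc j)" for j
  have e: "0 < e j" for j by (simp add: e_def)
  have e0: "e \<longlonglongrightarrow> 0" unfolding e_def[abs_def] by (rule LIMSEQ_Suc[OF lim_1_over_n])
  have gauss_lim: "(\<lambda>j. gauss (e j *\<^sub>R \<xi>)) \<longlonglongrightarrow> 1" for \<xi> :: 'a
  proof -
    have "(\<lambda>j. complex_of_real (exp (- (norm (e j *\<^sub>R \<xi>) ^ 2) / 2))) \<longlonglongrightarrow> complex_of_real (exp (- (norm (0 *\<^sub>R \<xi>) ^ 2) / 2))"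
      by (intro tendsto_intros e0) auto
    then show ?thesis by (simp add: gauss_def)
  qed
  have "(\<lambda>j. \<integral>\<xi>. gauss (e j *\<^sub>R \<xi>) * cis (- (x \<bullet> \<xi>)) * ft f \<xi> \<partial>lborel) \<longlonglongrightarrow> (\<integral>\<xi>. ft f \<xi> * cis (- (x \<bullet> \<xi>)) \<partial>lborel)"
  proof (rule integral_dominated_convergence)
    have c: "(\<lambda>\<xi>. cis (- (x \<bullet> \<xi>))) \<in> borel_measurable borel"
    proof -
      have "(\<lambda>\<xi>. cis ((- x) \<bullet> \<xi>)) \<in> borel_measurable borel" by (rule measurable_cis_inner) simp_all
      then show ?thesis by (simp only: inner_minus_left)
    qed
    have g: "(\<lambda>\<xi>::'a. gauss (e j *\<^sub>R \<xi>)) \<in> borel_measurable borel" for j by measurable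
    have t: "(\<lambda>\<xi>. ft f \<xi>) \<in> borel_measurable borel" using ft_measurable[OF fm] by simp
    show "(\<lambda>\<xi>. ft f \<xi> * cis (- (x \<bullet> \<xi>))) \<in> borel_measurable lborel"
      "(\<lambda>\<xi>. gauss (e j *\<^sub>R \<xi>) * cis (- (x \<bullet> \<xi>)) * ft f \<xi>) \<in> borel_measurable lborel" for j
      unfolding measurable_lborel1 measurable_lborel2 by (intro borel_measurable_times c g t)+
    show "integrable lborel (\<lambda>\<xi>. norm (ft f \<xi>))" using ftf by (rule integrable_norm)
    show "AE \<xi> in lborel. (\<lambda>j. gauss (e j *\<^sub>R \<xi>) * cis (- (x \<bullet> \<xi>)) * ft f \<xi>) \<longlonglongrightarrow> ft f \<xi> * cis (- (x \<bullet> \<xi>))"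
    proof (rule AE_I2)
      fix \<xi>
      have "(\<lambda>j. gauss (e j *\<^sub>R \<xi>) * cis (- (x \<bullet> \<xi>)) * ft f \<xi>) \<longlonglongrightarrow> 1 * cis (- (x \<bullet> \<xi>)) * ft f \<xi>"
        by (intro tendsto_intros gauss_lim)
      then show "(\<lambda>j. gauss (e j *\<^sub>R \<xi>) * cis (- (x \<bullet> \<xi>)) * ft f \<xi>) \<longlonglongrightarrow> ft f \<xi> * cis (- (x \<bullet> \<xi>))" by (simp add: mult.commute)
    qed
    show "AE \<xi> in lborel. norm (gauss (e j *\<^sub>R \<xi>) * cis (- (x \<bullet> \<xi>)) * ft f \<xi>) \<le> norm (ft f \<xi>)" for j
      by (rule AE_I2) (auto simp: gauss_def norm_mult intro!: mult_left_le_one_le)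
  qed
  moreover have "(\<lambda>j. \<integral>w. f (x + e j *\<^sub>R w) * gauss w \<partial>lborel) \<longlonglongrightarrow> (\<integral>w. f x * gauss (w::'a) \<partial>lborel)"
  proof (rule integral_dominated_convergence)
    show "(\<lambda>w::'a. f x * gauss w) \<in> borel_measurable lborel" "(\<lambda>w. f (x + e j *\<^sub>R w) * gauss w) \<in> borel_measurable lborel" for j by measurable
    show "integrable lborel (\<lambda>w::'a. B * norm (gauss w :: complex))" by (intro integrable_mult_right integrable_norm g_int)
    show "AE w in lborel. (\<lambda>j. f (x + e j *\<^sub>R w) * gauss w) \<longlonglongrightarrow> f x * gauss w"
    proof (rule AE_I2)
      fix w :: 'a
      have "(\<lambda>j. x + e j *\<^sub>R w) \<longlonglongrightarrow> x + 0 *\<^sub>R w" by (intro tendsto_intros e0)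
      then have "(\<lambda>j. x + e j *\<^sub>R w) \<longlonglongrightarrow> x" by simp
      moreover have "isCont f x" using cont by (simp add: continuous_on_eq_continuous_at)
      ultimately have "(\<lambda>j. f (x + e j *\<^sub>R w)) \<longlonglongrightarrow> f x" by (rule isCont_tendsto_compose[rotated])
      then show "(\<lambda>j. f (x + e j *\<^sub>R w) * gauss w) \<longlonglongrightarrow> f x * gauss w" by (intro tendsto_intros)
    qed
    show "AE w in lborel. norm (f (x + e j *\<^sub>R w) * gauss w) \<le> B * norm (gauss w)" for j
      by (rule AE_I2) (simp add: norm_mult mult_right_mono B)
  qed
  then have "(\<lambda>j. K * (\<integral>w. f (x + e j *\<^sub>R w) * gauss w \<partial>lborel)) \<longlonglongrightarrow> K * (\<integral>w. f x * gauss (w::'a) \<partial>lborel)"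
    by (rule tendsto_mult_left)
  ultimately have "(\<integral>\<xi>. ft f \<xi> * cis (- (x \<bullet> \<xi>)) \<partial>lborel) = K * (\<integral>w. f x * gauss (w::'a) \<partial>lborel)"
    unfolding smoothed[OF e] by (rule LIMSEQ_unique)
  also have "(\<integral>w. f x * gauss (w::'a) \<partial>lborel) = f x * (\<integral>w. gauss (w::'a) \<partial>lborel)" by (rule integral_mult_right_zero)
  also have "(\<integral>w. gauss (w::'a) \<partial>lborel) = K"
    using gauss_fourier(2)[of "0::'a"] by (simp add: K_def gauss_def)
  also have "K * (f x * K) = complex_of_real ((2 * pi) ^ DIM('a)) * f x"
  proof -
    have "sqrt (2 * pi) ^ DIM('a) * sqrt (2 * pi) ^ DIM('a) = (2 * pi) ^ DIM('a)"
      unfolding power_mult_distrib[symmetric] by simp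
    then have "K * K = complex_of_real ((2 * pi) ^ DIM('a))" unfolding K_def of_real_mult[symmetric] by simp
    moreover have "K * (f x * K) = (K * K) * f x" by (simp only: mult_ac)
    ultimately show ?thesis by (simp only:)
  qed
  finally show ?thesis .
qed

section \<open>Schwartz functions and the normalized transform\<close>

lemma schwartz_basic:
  fixes f :: "(real^'n) \<Rightarrow> complex"
  assumes "f \<in> schwartz"
  shows "rapid f" "integrable lborel f" "f \<in> borel_measurable borel"
proof -
  show "rapid f" using schwartz_rapid[OF assms, where k = 0] by simp
  then show "integrable lborel f" "f \<in> borel_measurable borel" by (rule rapid_integrable, rule rapid_measurable)
qed

lemma fourier_eq_ft:
  fixes f :: "(real^'n) \<Rightarrow> complex"
  assumes "f \<in> borel_measurable borel"
  shows "fourier f \<xi> = of_real (1 / (2 * pi) ^ CARD('n)) * ft f (- \<xi>)"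
proof -
  have "(\<lambda>x. cis ((- \<xi>) \<bullet> x) * f x) \<in> borel_measurable lborel"
    using assms by (intro borel_measurable_times measurable_cis_inner) simp_all
  then have "(\<integral>x. cis (- (x \<bullet> \<xi>)) * f x \<partial>lebesgue) = (\<integral>x. cis (- (x \<bullet> \<xi>)) * f x \<partial>lborel)"
    by (intro integral_completion) (simp add: inner_commute)
  also have "\<dots> = ft f (- \<xi>)" unfolding ft_def by (intro Bochner_Integration.integral_cong) (simp_all add: inner_commute mult.commute)
  finally show ?thesis by (simp add: fourier_def)
qed

lemma fourier_measurable:
  fixes f :: "(real^'n) \<Rightarrow> complex"
  assumes [measurable]: "f \<in> borel_measurable borel"
  shows "fourier f \<in> borel_measurable borel"
proof -
  have "(\<lambda>\<xi>. of_real (1 / (2 * pi) ^ CARD('n)) * ft f (- \<xi>)) \<in> borel_measurable borel" by measurable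
  then show ?thesis unfolding fourier_eq_ft[OF assms, symmetric] by simp
qed

lemma fourier_decay:
  fixes f :: "(real^'n) \<Rightarrow> complex"
  assumes f: "f \<in> schwartz"
  shows "\<exists>C\<ge>0. \<forall>\<xi>. norm (fourier f \<xi>) \<le> C / (1 + norm \<xi>) ^ k"
proof -
  obtain C where C: "\<And>y. norm (ft f y) * (1 + norm y) ^ k \<le> C" using ft_decay[OF f] by blast
  define c where "c = 1 / (2 * pi) ^ CARD('n)"
  have c: "0 \<le> c" by (simp add: c_def)
  have "0 \<le> norm (ft f 0) * (1 + norm (0::real^'n)) ^ k" by simp
  then have C0: "0 \<le> C" using C[of 0] by linarith
  have "norm (fourier f \<xi>) \<le> (c * C) / (1 + norm \<xi>) ^ k" for \<xi>
  proof -
    have p: "0 < (1 + norm \<xi>) ^ k" by (simp add: add_pos_nonneg)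
    have "norm (fourier f \<xi>) * (1 + norm \<xi>) ^ k = c * (norm (ft f (- \<xi>)) * (1 + norm (- \<xi>)) ^ k)"
      unfolding fourier_eq_ft[OF schwartz_basic(3)[OF f]] c_def[symmetric] norm_mult using c by simp
    also have "\<dots> \<le> c * C" by (intro mult_left_mono C c)
    finally show ?thesis using p by (simp add: pos_le_divide_eq)
  qed
  then show ?thesis using c C0 by (intro exI[of _ "c * C"]) auto
qed

lemma fourier_integrable:
  fixes f :: "(real^'n) \<Rightarrow> complex"
  assumes f: "f \<in> schwartz"
  shows "integrable lborel (fourier f)"
proof -
  obtain C where C: "0 \<le> C" "\<And>\<xi>. norm (fourier f \<xi>) \<le> C / (1 + norm \<xi>) ^ (DIM(real^'n) + 1)" using fourier_decay[OF f] by blast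
  show ?thesis
  proof (rule Bochner_Integration.integrable_bound)
    show "integrable lborel (\<lambda>x. C * (1 / (1 + norm (x::real^'n)) ^ (DIM(real^'n) + 1)))"
      by (intro integrable_mult_right integrable_one_plus_norm)
    show "AE x in lborel. norm (fourier f x) \<le> norm (C * (1 / (1 + norm x) ^ (DIM(real^'n) + 1)))"
      using C by (intro AE_I2) (simp add: norm_mult norm_divide norm_power)
  qed (use fourier_measurable[OF schwartz_basic(3)[OF f]] in simp)
qed

lemma schwartz_fourier_inversion:
  fixes f :: "(real^'n) \<Rightarrow> complex"
  assumes f: "f \<in> schwartz"
  shows "(\<integral>\<xi>. fourier f \<xi> * cis (x \<bullet> \<xi>) \<partial>lborel) = f x"
proof -
  define c where "c = complex_of_real (1 / (2 * pi) ^ CARD('n))"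
  have c: "c \<noteq> 0" by (simp add: c_def)
  note fm = schwartz_basic(3)[OF f]
  have ft_eq: "ft f \<xi> = (1 / c) * fourier f (- \<xi>)" for \<xi> using fourier_eq_ft[OF fm, of "- \<xi>", folded c_def] c by simp
  have "integrable lborel (\<lambda>\<xi>. fourier f (0 + (-1) *\<^sub>R \<xi>))" by (intro integrable_lborel_affine fourier_integrable f) simp
  then have ftf: "integrable lborel (ft f)" unfolding ft_eq[abs_def] by (intro integrable_mult_right) simp
  obtain B where B: "\<And>x. norm (f x) \<le> B" using rapidE[OF schwartz_basic(1)[OF f], of 0] by auto
  \<comment> \<open>\<open>fourier\<close> and \<open>ft\<close> differ by a reflection, undone by
    substituting \<open>- \<xi>\<close>.\<close>
  have "(\<integral>\<xi>. fourier f \<xi> * cis (x \<bullet> \<xi>) \<partial>lborel) = \<bar>-1\<bar> ^ DIM(real^'n) *\<^sub>R (\<integral>\<xi>. fourier f (0 + (-1) *\<^sub>R \<xi>) * cis (x \<bullet> (0 + (-1) *\<^sub>R \<xi>)) \<partial>lborel)"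
    by (rule integral_lborel_affine) (intro borel_measurable_times measurable_cis_inner fourier_measurable[OF fm], simp_all)
  also have "\<dots> = (\<integral>\<xi>. c * (ft f \<xi> * cis (- (x \<bullet> \<xi>))) \<partial>lborel)"
    using c by (simp add: ft_eq)
  also have "\<dots> = c * (\<integral>\<xi>. ft f \<xi> * cis (- (x \<bullet> \<xi>)) \<partial>lborel)" by (rule integral_mult_right_zero)
  also have "(\<integral>\<xi>. ft f \<xi> * cis (- (x \<bullet> \<xi>)) \<partial>lborel) = complex_of_real ((2 * pi) ^ DIM(real^'n)) * f x"
    by (rule fourier_inversion[OF _ B schwartz_basic(2)[OF f] ftf]) (use schwartz_basic(1)[OF f] in \<open>simp add: rapid_def\<close>)
  also have "c * (complex_of_real ((2 * pi) ^ DIM(real^'n)) * f x) = f x" by (simp add: c_def)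
  finally show ?thesis .
qed

subsection \<open>Bilinear pseudodifferential operators\<close>

text \<open>Small powers \<open>a\<close> are covered because the decay of \<open>f\<close> has
  arbitrarily high order \<open>M\<close>, so that \<open>M * a\<close> can be made to exceed the
  dimension.\<close>

lemma schwartz_tame:
  fixes f :: "(real^'n) \<Rightarrow> complex"
  assumes f: "f \<in> schwartz"
  shows "tame (\<lambda>x. norm (f x))"
  unfolding tame_def bdd_borel_def
proof (intro conjI allI impI)
  note fm[measurable] = schwartz_basic(3)[OF f]
  show "(\<lambda>x. norm (f x)) \<in> borel_measurable borel" by measurable
  show "\<exists>B. \<forall>x. norm (f x) \<le> B" using rapidE[OF schwartz_basic(1)[OF f], of 0] by auto
  fix a :: real assume a: "0 < a"
  define N where "N = DIM(real^'n) + 1"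
  obtain M :: nat where M: "real N / a \<le> real M" using real_arch_simple by blast
  then have Ma: "real N \<le> real M * a" using a by (simp add: field_simps)
  obtain C where C: "0 \<le> C" "\<And>x. norm (f x) \<le> C / (1 + norm x) ^ M" using rapidE[OF schwartz_basic(1)[OF f]] by blast
  have "(\<integral>\<^sup>+x. ennreal (norm (f x) powr a) \<partial>lborel) \<le> (\<integral>\<^sup>+x. ennreal (norm (C powr a * (1 / (1 + norm (x::real^'n)) ^ N))) \<partial>lborel)"
  proof (intro nn_integral_mono ennreal_leI)
    fix x :: "real^'n"
    have p: "0 < 1 + norm x" by (simp add: add_pos_nonneg)
    have "norm (f x) powr a \<le> (C / (1 + norm x) ^ M) powr a" using a C(2)[of x] by (intro powr_mono2) auto
    also have "\<dots> = C powr a / (1 + norm x) powr (real M * a)"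
      using p by (simp add: powr_divide powr_powr flip: powr_realpow)
    also have "\<dots> \<le> C powr a / (1 + norm x) powr real N"
      using p Ma by (intro divide_left_mono powr_mono mult_pos_pos) auto
    also have "(1 + norm x) powr real N = (1 + norm x) ^ N" using p by (simp add: powr_realpow)
    also have "C powr a / (1 + norm x) ^ N = norm (C powr a * (1 / (1 + norm x) ^ N))"
      using p by simp
    finally show "norm (f x) powr a \<le> norm (C powr a * (1 / (1 + norm x) ^ N))" .
  qed
  also have "\<dots> < \<infinity>"
  proof -
    have "integrable lborel (\<lambda>x. C powr a * (1 / (1 + norm (x::real^'n)) ^ N))"
      unfolding N_def by (intro integrable_mult_right integrable_one_plus_norm)
    then show ?thesis by (simp add: integrable_iff_bounded)
  qed
  finally show "(\<integral>\<^sup>+x. ennreal (norm (f x) powr a) \<partial>lborel) < \<infinity>" .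
qed simp

lemma Lq_norm_schwartz:
  fixes f :: "(real^'n) \<Rightarrow> complex"
  assumes f: "f \<in> schwartz" and p: "0 < p"
  shows "(\<integral>\<^sup>+x. ennreal (norm (f x) powr p) \<partial>lborel) = ennreal (Lq_norm p f powr p)"
proof -
  note fm[measurable] = schwartz_basic(3)[OF f]
  define I where "I = (\<integral>\<^sup>+x. ennreal (norm (f x) powr p) \<partial>lborel)"
  have fin: "I < \<infinity>" using schwartz_tame[OF f] p by (simp add: tame_def I_def)
  have "(\<integral>x. norm (f x) powr p \<partial>lebesgue) = (\<integral>x. norm (f x) powr p \<partial>lborel)"
    by (intro integral_completion) measurable
  also have "\<dots> = enn2real I" unfolding I_def by (intro integral_eq_nn_integral) auto
  finally have "Lq_norm p f powr p = enn2real I"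
    using p by (simp add: Lq_norm_def powr_powr)
  then show ?thesis using fin by (simp add: I_def)
qed

section \<open>From pointwise domination to boundedness\<close>

text \<open>The analysis is contained in the pointwise bound and in \<open>bop_bounded\<close>. The
  norms are enlarged by \<epsilon> because the normalization divides by them; letting \<epsilon>
  tend to 0 also covers vanishing functions.\<close>

lemma bil_boundedI:
  fixes \<sigma> :: "((real^'n) \<times> (real^'n) \<times> (real^'n)) \<Rightarrow> complex"
    and K :: "'b::euclidean_space \<Rightarrow> real" and \<pi>1 \<pi>2 :: "'b \<Rightarrow> real^'n"
  assumes int: "\<And>f g x. f \<in> schwartz \<Longrightarrow> g \<in> schwartz \<Longrightarrow> integrable lebesgue (bil_integrand \<sigma> f g x)"
    and meas: "\<And>f g. f \<in> schwartz \<Longrightarrow> g \<in> schwartz \<Longrightarrow> bil_op \<sigma> f g \<in> borel_measurable borel"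
    and C0: "0 \<le> C0" "\<And>f g x. f \<in> schwartz \<Longrightarrow> g \<in> schwartz \<Longrightarrow>
      ennreal (norm (bil_op \<sigma> f g x)) \<le> ennreal C0 * bop K \<pi>1 \<pi>2 (\<lambda>x. norm (f x)) (\<lambda>x. norm (g x)) x"
    and bb: "bop_bounded K \<pi>1 \<pi>2 (1 / p1) (1 / p2) r" and p: "0 < p1" "0 < p2" and r: "0 < r" "r = 1 / q"
    and Km: "K \<in> borel_measurable borel" "\<pi>1 \<in> borel_measurable borel" "\<pi>2 \<in> borel_measurable borel"
    and K0: "\<And>z. 0 \<le> K z"
  shows "bil_bounded \<sigma> p1 p2 q"
proof -
  have q: "0 < q" "1 / r = q" using r by auto
  obtain C where C: "0 \<le> C" "\<And>f g A1 A2 x. tame f \<Longrightarrow> tame g \<Longrightarrow> 0 < A1 \<Longrightarrow> 0 < A2 \<Longrightarrow>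
    (\<integral>\<^sup>+x. ennreal (f x powr p1) \<partial>lborel) \<le> ennreal (A1 powr p1) \<Longrightarrow> (\<integral>\<^sup>+x. ennreal (g x powr p2) \<partial>lborel) \<le> ennreal (A2 powr p2) \<Longrightarrow>
    bop K \<pi>1 \<pi>2 f g x < \<infinity>"
    "\<And>f g A1 A2. tame f \<Longrightarrow> tame g \<Longrightarrow> 0 < A1 \<Longrightarrow> 0 < A2 \<Longrightarrow>
    (\<integral>\<^sup>+x. ennreal (f x powr p1) \<partial>lborel) \<le> ennreal (A1 powr p1) \<Longrightarrow> (\<integral>\<^sup>+x. ennreal (g x powr p2) \<partial>lborel) \<le> ennreal (A2 powr p2) \<Longrightarrow>
    (\<integral>\<^sup>+x. ennreal (enn2real (bop K \<pi>1 \<pi>2 f g x) powr q) \<partial>lborel) \<le> ennreal ((C * A1 * A2) powr q)"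
    using bop_bounded_apply[OF bb p r(1) Km K0] unfolding q(2) by blast
  have main: "in_Lq q (bil_op \<sigma> f g) \<and> Lq_norm q (bil_op \<sigma> f g) \<le> C0 * C * Lq_norm p1 f * Lq_norm p2 g"
    if f: "f \<in> schwartz" and g: "g \<in> schwartz" for f g
  proof -
    define T where "T = bil_op \<sigma> f g"
    have Tm[measurable]: "T \<in> borel_measurable borel" unfolding T_def by (rule meas[OF f g])
    define N1 where "N1 = Lq_norm p1 f"
    define N2 where "N2 = Lq_norm p2 g"
    have N: "0 \<le> N1" "0 \<le> N2" by (auto simp: N1_def N2_def Lq_norm_def)
    define I where "I = (\<integral>\<^sup>+x. ennreal (norm (T x) powr q) \<partial>lborel)"
    have bound: "I \<le> ennreal ((C0 * C * (N1 + \<epsilon>) * (N2 + \<epsilon>)) powr q)" if \<epsilon>: "0 < \<epsilon>" for \<epsilon>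
    proof -
      define b where "b x = bop K \<pi>1 \<pi>2 (\<lambda>x. norm (f x)) (\<lambda>x. norm (g x)) x" for x
      have A: "0 < N1 + \<epsilon>" "0 < N2 + \<epsilon>" using N \<epsilon> by auto
      have I1: "(\<integral>\<^sup>+x. ennreal (norm (f x) powr p1) \<partial>lborel) \<le> ennreal ((N1 + \<epsilon>) powr p1)"
        unfolding Lq_norm_schwartz[OF f p(1)] N1_def[symmetric] using N p \<epsilon> by (intro ennreal_leI powr_mono2) auto
      have I2: "(\<integral>\<^sup>+x. ennreal (norm (g x) powr p2) \<partial>lborel) \<le> ennreal ((N2 + \<epsilon>) powr p2)"
        unfolding Lq_norm_schwartz[OF g p(2)] N2_def[symmetric] using N p \<epsilon> by (intro ennreal_leI powr_mono2) auto
      have fin: "b x < \<infinity>" for x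
        unfolding b_def by (rule C(2)[OF schwartz_tame[OF f] schwartz_tame[OF g] A I1 I2])
      have bm[measurable]: "(\<lambda>x. enn2real (b x)) \<in> borel_measurable borel"
        unfolding b_def using schwartz_basic(3)[OF f] schwartz_basic(3)[OF g]
        by (intro measurable_compose[OF bop_measurable borel_measurable_enn2real] Km) auto
      have "norm (T x) powr q \<le> C0 powr q * enn2real (b x) powr q" for x
      proof -
        have "ennreal (norm (T x)) \<le> ennreal (C0 * enn2real (b x))"
          using C0(2)[OF f g, of x] C0(1) fin[of x] by (simp add: T_def b_def ennreal_mult)
        then have "norm (T x) \<le> C0 * enn2real (b x)" using C0(1) by (subst (asm) ennreal_le_iff) auto
        then have "norm (T x) powr q \<le> (C0 * enn2real (b x)) powr q" using q by (intro powr_mono2) auto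
        then show ?thesis by (simp add: powr_mult)
      qed
      then have "I \<le> (\<integral>\<^sup>+x. ennreal (C0 powr q) * ennreal (enn2real (b x) powr q) \<partial>lborel)"
        unfolding I_def by (intro nn_integral_mono) (simp add: ennreal_mult[symmetric] ennreal_leI)
      also have "\<dots> = ennreal (C0 powr q) * (\<integral>\<^sup>+x. ennreal (enn2real (b x) powr q) \<partial>lborel)"
        by (rule nn_integral_cmult) measurable
      also have "\<dots> \<le> ennreal (C0 powr q) * ennreal ((C * (N1 + \<epsilon>) * (N2 + \<epsilon>)) powr q)"
        unfolding b_def by (intro mult_left_mono C(3)[OF schwartz_tame[OF f] schwartz_tame[OF g] A I1 I2]) simp
      also have "\<dots> = ennreal ((C0 * C * (N1 + \<epsilon>) * (N2 + \<epsilon>)) powr q)"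
        by (simp add: ennreal_mult[symmetric] powr_mult mult.assoc)
      finally show ?thesis .
    qed
    \<comment> \<open>A single \<epsilon>, here 1, proves membership in L^q; the sharp norm bound
      needs all of them.\<close>
    have "I \<le> ennreal ((C0 * C * (N1 + 1) * (N2 + 1)) powr q)" by (rule bound) simp
    then have I_fin: "I < \<infinity>" by (rule order.strict_trans1) simp
    have Tint: "integrable lborel (\<lambda>x. norm (T x) powr q)"
      using I_fin unfolding I_def by (intro integrableI_bounded) auto
    then have "in_Lq q T"
      unfolding in_Lq_def using integrable_completion[of "\<lambda>x. norm (T x) powr q" lborel]
      by (auto intro: measurable_completion)
    have Leq: "Lq_norm q T = enn2real I powr (1 / q)"
    proof -
      have "(\<integral>x. norm (T x) powr q \<partial>lebesgue) = (\<integral>x. norm (T x) powr q \<partial>lborel)"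
        by (intro integral_completion) measurable
      also have "\<dots> = enn2real I" unfolding I_def by (intro integral_eq_nn_integral) auto
      finally show ?thesis by (simp add: Lq_norm_def)
    qed
    have "Lq_norm q T \<le> C0 * C * (N1 + \<epsilon>) * (N2 + \<epsilon>)" if \<epsilon>: "0 < \<epsilon>" for \<epsilon>
    proof -
      have nn: "0 \<le> C0 * C * (N1 + \<epsilon>) * (N2 + \<epsilon>)" using C0(1) C(1) N \<epsilon> by simp
      have "enn2real I \<le> (C0 * C * (N1 + \<epsilon>) * (N2 + \<epsilon>)) powr q"
        using bound[OF \<epsilon>] by (intro enn2real_leI) auto
      then have "enn2real I powr (1 / q) \<le> ((C0 * C * (N1 + \<epsilon>) * (N2 + \<epsilon>)) powr q) powr (1 / q)"
        using q by (intro powr_mono2) auto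
      also have "\<dots> = C0 * C * (N1 + \<epsilon>) * (N2 + \<epsilon>)" using q nn by (simp add: powr_powr)
      finally show ?thesis unfolding Leq .
    qed
    then have le: "Lq_norm q T \<le> C0 * C * (N1 + 1 / real (Suc j)) * (N2 + 1 / real (Suc j))" for j by simp
    have "(\<lambda>j. C0 * C * (N1 + 1 / real (Suc j)) * (N2 + 1 / real (Suc j))) \<longlonglongrightarrow> C0 * C * (N1 + 0) * (N2 + 0)"
      by (intro tendsto_intros LIMSEQ_Suc[OF lim_1_over_n])
    then have "Lq_norm q T \<le> C0 * C * (N1 + 0) * (N2 + 0)"
      by (rule LIMSEQ_le_const) (use le in blast)
    with \<open>in_Lq q T\<close> show ?thesis by (simp add: T_def N1_def N2_def)
  qed
  show ?thesis unfolding bil_bounded_def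
    by (rule exI[of _ "C0 * C"]) (use main int in blast)
qed

section \<open>Symbol estimates uniform in x\<close>

text \<open>The complement of the origin is open, so agreement there passes to the
  derivatives.\<close>

lemma dir_symbol_cong:
  assumes "dir_symbol k b F c A" and eq: "\<And>x. x \<noteq> 0 \<Longrightarrow> F x = G x"
  shows "dir_symbol k b G c A"
proof (cases k)
  case (Suc k')
  then obtain F' where F': "\<And>x. x \<noteq> 0 \<Longrightarrow> ((\<lambda>t. F (x + t *\<^sub>R b)) has_vector_derivative F' x) (at 0)" "dir_symbol k' b F' (c - 1) A"
    using assms(1) by auto
  have "((\<lambda>t. G (x + t *\<^sub>R b)) has_vector_derivative F' x) (at 0)" if x: "x \<noteq> 0" for x
  proof (rule has_vector_derivative_transform_within_open[OF F'(1)[OF x]])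
    show "open ((\<lambda>t. x + t *\<^sub>R b) -` (- {0}))"
      by (intro open_vimage continuous_intros)
  qed (use x eq in auto)
  then show ?thesis using Suc assms F'(2) by auto
qed (use assms in auto)

lemma dir_symbol_chain:
  assumes "\<And>j x. j < k \<Longrightarrow> x \<noteq> 0 \<Longrightarrow> ((\<lambda>t. D j (x + t *\<^sub>R b)) has_vector_derivative D (Suc j) x) (at 0)"
    and "\<And>j x. j \<le> k \<Longrightarrow> x \<noteq> 0 \<Longrightarrow> norm (D j x) \<le> A * norm x powr (c - real j)"
  shows "dir_symbol k b (D 0) c A"
  using assms
proof (induction k arbitrary: D c)
  case (Suc k)
  have "dir_symbol k b (D (Suc 0)) (c - 1) A"
  proof (rule Suc.IH[of "\<lambda>j. D (Suc j)"])
    show "((\<lambda>t. D (Suc j) (x + t *\<^sub>R b)) has_vector_derivative D (Suc (Suc j)) x) (at 0)" if "j < k" "x \<noteq> 0" for j x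
      using Suc.prems(1)[of "Suc j" x] that by simp
    show "norm (D (Suc j) x) \<le> A * norm x powr (c - 1 - real j)" if "j \<le> k" "x \<noteq> 0" for j x
      using Suc.prems(2)[of "Suc j" x] that by (simp add: algebra_simps)
  qed
  moreover have "norm (D 0 x) \<le> A * norm x powr c" if "x \<noteq> 0" for x using Suc.prems(2)[of 0 x] that by simp
  moreover have "((\<lambda>t. D 0 (x + t *\<^sub>R b)) has_vector_derivative D (Suc 0) x) (at 0)" if "x \<noteq> 0" for x
    using Suc.prems(1)[of 0 x] that by simp
  ultimately show ?case by auto
qed auto

text \<open>The kernel bound depends on the symbol only through \<open>A\<close>, so one constant
  must serve all x, all directions and all orders up to \<open>N\<close>; it is the sum of finitely
  many.\<close>

lemma uniform_dir_symbol:
  fixes \<sigma> :: "'x::euclidean_space \<times> 'b::euclidean_space \<Rightarrow> complex"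
  assumes sm: "smooth_on S \<sigma>" and S: "\<And>x \<zeta>. \<zeta> \<noteq> 0 \<Longrightarrow> (x, \<zeta>) \<in> S"
    and est: "\<And>b k. b \<in> Basis \<Longrightarrow> \<exists>C. \<forall>x \<zeta>. \<zeta> \<noteq> 0 \<longrightarrow> norm ((dir_deriv (0, b) ^^ k) \<sigma> (x, \<zeta>)) \<le> C * norm \<zeta> powr (c - real k)"
  shows "\<exists>A\<ge>0. \<forall>x. \<forall>b\<in>Basis. dir_symbol N b (\<lambda>\<zeta>. \<sigma> (x, \<zeta>)) c A"
proof -
  have "\<forall>b k. \<exists>C. b \<in> Basis \<longrightarrow> (\<forall>x \<zeta>. \<zeta> \<noteq> 0 \<longrightarrow> norm ((dir_deriv (0, b) ^^ k) \<sigma> (x, \<zeta>)) \<le> C * norm \<zeta> powr (c - real k))"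
    using est by blast
  then obtain C where C: "\<And>b k x \<zeta>. b \<in> Basis \<Longrightarrow> \<zeta> \<noteq> 0 \<Longrightarrow> norm ((dir_deriv (0, b) ^^ k) \<sigma> (x, \<zeta>)) \<le> C b k * norm \<zeta> powr (c - real k)"
    by metis
  define A where "A = (\<Sum>b\<in>Basis. \<Sum>k\<le>N. \<bar>C b k\<bar>)"
  have A0: "0 \<le> A" by (auto simp: A_def intro!: sum_nonneg)
  have CA: "C b k \<le> A" if "b \<in> Basis" "k \<le> N" for b k
  proof -
    have "C b k \<le> \<bar>C b k\<bar>" by simp
    also have "\<dots> \<le> (\<Sum>k\<le>N. \<bar>C b k\<bar>)" using that by (intro member_le_sum) auto
    also have "\<dots> \<le> A" unfolding A_def using that by (intro member_le_sum[where f = "\<lambda>b. \<Sum>k\<le>N. \<bar>C b k\<bar>"]) (auto intro!: sum_nonneg)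
    finally show ?thesis .
  qed
  have "dir_symbol N b (\<lambda>\<zeta>. \<sigma> (x, \<zeta>)) c A" if b: "b \<in> Basis" for x b
  proof -
    have B: "(0, b) \<in> (Basis :: ('x \<times> 'b) set)" using b by (auto simp: Basis_prod_def)
    have "dir_symbol N b ((\<lambda>j \<zeta>. (dir_deriv (0, b) ^^ j) \<sigma> (x, \<zeta>)) 0) c A"
    proof (rule dir_symbol_chain)
      fix j \<zeta> assume z: "\<zeta> \<noteq> (0::'b)"
      show "((\<lambda>t. (dir_deriv (0, b) ^^ j) \<sigma> (x, \<zeta> + t *\<^sub>R b)) has_vector_derivative (dir_deriv (0, b) ^^ Suc j) \<sigma> (x, \<zeta>)) (at 0)"
        using smooth_on_dir_deriv(2)[OF sm B S[OF z], of j x] by simp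
      assume j: "j \<le> N"
      have "C b j * norm \<zeta> powr (c - real j) \<le> A * norm \<zeta> powr (c - real j)" by (intro mult_right_mono CA b j) simp
      then show "norm ((dir_deriv (0, b) ^^ j) \<sigma> (x, \<zeta>)) \<le> A * norm \<zeta> powr (c - real j)" using C[OF b z, of j x] by linarith
    qed
    then show ?thesis by simp
  qed
  with A0 show ?thesis by blast
qed

section \<open>Symbols given off a null set\<close>

text \<open>The values of a homogeneous symbol on the singular set are arbitrary and might spoil
  Borel measurability; they are reset to 0.\<close>

definition restrict_symbol :: "('x \<times> 'b \<Rightarrow> complex) \<Rightarrow> 'b set \<Rightarrow> 'x \<times> 'b \<Rightarrow> complex"
  where "restrict_symbol \<sigma> P p = (if snd p \<in> P then \<sigma> p else 0)"

lemma restrict_symbol_measurable: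
  fixes \<sigma> :: "'x::euclidean_space \<times> 'b::euclidean_space \<Rightarrow> complex"
  assumes "continuous_on (UNIV \<times> P) \<sigma>" "open P"
  shows "restrict_symbol \<sigma> P \<in> borel_measurable borel"
proof -
  have "UNIV \<times> P \<in> sets borel" using assms(2) by (intro borel_open open_Times) auto
  then have "(\<lambda>p. if p \<in> UNIV \<times> P then \<sigma> p else 0) \<in> borel_measurable borel"
    using assms(1) by (intro borel_measurable_continuous_on_if continuous_intros) auto
  moreover have "(\<lambda>p. if p \<in> UNIV \<times> P then \<sigma> p else 0) = restrict_symbol \<sigma> P"
    by (auto simp: restrict_symbol_def fun_eq_iff)
  ultimately show ?thesis by simp
qed

lemma bil_integrand_measurable:
  fixes \<sigma> :: "((real^'n) \<times> (real^'n) \<times> (real^'n)) \<Rightarrow> complex"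
  assumes [measurable]: "\<sigma> \<in> borel_measurable borel" and f: "f \<in> schwartz" and g: "g \<in> schwartz"
  shows "(\<lambda>p. bil_integrand \<sigma> f g (fst p) (snd p)) \<in> borel_measurable borel"
    and "bil_integrand \<sigma> f g x \<in> borel_measurable borel"
proof -
  have [measurable]: "fourier f \<in> borel_measurable borel" "fourier g \<in> borel_measurable borel"
    by (rule fourier_measurable[OF schwartz_basic(3)[OF f]], rule fourier_measurable[OF schwartz_basic(3)[OF g]])
  have [measurable]: "(\<lambda>p :: (real^'n) \<times> (real^'n) \<times> (real^'n). fst p) \<in> borel_measurable borel"
    "(\<lambda>p :: (real^'n) \<times> (real^'n) \<times> (real^'n). fst (snd p)) \<in> borel_measurable borel"
    "(\<lambda>p :: (real^'n) \<times> (real^'n) \<times> (real^'n). snd (snd p)) \<in> borel_measurable borel"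
    by (intro borel_measurable_continuous_onI continuous_intros)+
  have "(\<lambda>p :: (real^'n) \<times> (real^'n) \<times> (real^'n). cis (fst p \<bullet> (fst (snd p) + snd (snd p))) * \<sigma> p * fourier f (fst (snd p)) * fourier g (snd (snd p))) \<in> borel_measurable borel"
    by (intro borel_measurable_times measurable_cis_inner borel_measurable_add; measurable)
  then show 1: "(\<lambda>p. bil_integrand \<sigma> f g (fst p) (snd p)) \<in> borel_measurable borel"
    by (simp add: bil_integrand_def split_beta)
  have "(\<lambda>z :: (real^'n) \<times> (real^'n). (x, z)) \<in> borel_measurable borel"
    by (intro borel_measurable_continuous_onI continuous_intros)
  from measurable_compose[OF this 1] show "bil_integrand \<sigma> f g x \<in> borel_measurable borel" by simp
qed

text \<open>The completed measure ignores the null set, so the operator is unchanged when the symbol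
  is replaced by a Borel function; from then on all integrals are over \<open>lborel\<close>, where
  products of measures are at hand.\<close>

lemma bil_op_restrict:
  fixes \<sigma> :: "((real^'n) \<times> (real^'n) \<times> (real^'n)) \<Rightarrow> complex"
  assumes cont: "continuous_on (UNIV \<times> P) \<sigma>" and P: "open P" "AE z in lborel. z \<in> P"
    and f: "f \<in> schwartz" and g: "g \<in> schwartz"
  defines "\<sigma>' \<equiv> restrict_symbol \<sigma> P"
  shows "integrable lborel (bil_integrand \<sigma>' f g x) \<Longrightarrow> integrable lebesgue (bil_integrand \<sigma> f g x)"
    and "bil_op \<sigma> f g x = (\<integral>z. bil_integrand \<sigma>' f g x z \<partial>lborel)"
    and "bil_op \<sigma> f g \<in> borel_measurable borel"
proof -
  have \<sigma>'m: "\<sigma>' \<in> borel_measurable borel" unfolding \<sigma>'_def by (rule restrict_symbol_measurable[OF cont P(1)])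
  note m = bil_integrand_measurable[OF \<sigma>'m f g]
  have ae: "AE z in lebesgue. bil_integrand \<sigma>' f g x z = bil_integrand \<sigma> f g x z" for x
  proof (rule AE_completion)
    show "AE z in lborel. bil_integrand \<sigma>' f g x z = bil_integrand \<sigma> f g x z"
      using P(2) by eventually_elim (simp add: bil_integrand_def \<sigma>'_def restrict_symbol_def split_beta)
  qed
  have m': "bil_integrand \<sigma>' f g x \<in> borel_measurable lebesgue" for x using m(2)[of x] by (intro measurable_completion) simp
  have m'': "bil_integrand \<sigma> f g x \<in> borel_measurable lebesgue" for x by (rule borel_measurable_AE[OF m' ae])
  show "integrable lebesgue (bil_integrand \<sigma> f g x)" if "integrable lborel (bil_integrand \<sigma>' f g x)"
  proof (rule integrable_cong_AE_imp[OF _ m'' ae])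
    show "integrable lebesgue (bil_integrand \<sigma>' f g x)" using that m(2)[of x] by (simp add: integrable_completion)
  qed
  show eq: "bil_op \<sigma> f g x = (\<integral>z. bil_integrand \<sigma>' f g x z \<partial>lborel)" for x
  proof -
    have "bil_op \<sigma> f g x = (\<integral>z. bil_integrand \<sigma>' f g x z \<partial>lebesgue)"
      unfolding bil_op_def
    proof (rule integral_cong_AE[OF m'' m'])
      show "AE z in lebesgue. bil_integrand \<sigma> f g x z = bil_integrand \<sigma>' f g x z" using ae[of x] by eventually_elim simp
    qed
    also have "\<dots> = (\<integral>z. bil_integrand \<sigma>' f g x z \<partial>lborel)" using m(2)[of x] by (intro integral_completion) simp
    finally show ?thesis .
  qed
  have "(\<lambda>x. \<integral>z. bil_integrand \<sigma>' f g x z \<partial>lborel) \<in> borel_measurable borel"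
  proof (rule lborel.borel_measurable_lebesgue_integral)
    have "(\<lambda>p. bil_integrand \<sigma>' f g (fst p) (snd p)) \<in> borel_measurable (borel \<Otimes>\<^sub>M borel)"
      using m(1) unfolding borel_prod .
    then have "(\<lambda>(x, z). bil_integrand \<sigma>' f g x z) \<in> borel_measurable (borel \<Otimes>\<^sub>M borel)" by (simp add: split_beta)
    then show "(\<lambda>(x, z). bil_integrand \<sigma>' f g x z) \<in> borel_measurable (borel \<Otimes>\<^sub>M lborel)" by simp
  qed
  then show "bil_op \<sigma> f g \<in> borel_measurable borel" by (simp add: eq[abs_def])
qed

text \<open>Inside the unit ball the symbol is integrable and \<open>G\<close> bounded, outside the
  symbol is at most \<open>A\<close>. \<open>L\<close> does not depend on \<open>G\<close>, so that
  all translates of a function share one bound.\<close>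

lemma nn_integral_symbol_mult:
  fixes m :: "'b::euclidean_space \<Rightarrow> complex"
  assumes m[measurable]: "m \<in> borel_measurable borel" and mb: "\<And>x. x \<noteq> 0 \<Longrightarrow> norm (m x) \<le> A * norm x powr (- s)"
    and s: "0 < s" "s < real DIM('b)" and A: "0 \<le> A"
  obtains L where "0 \<le> L" "\<And>G B. G \<in> borel_measurable borel \<Longrightarrow> (\<And>x. norm (G x :: complex) \<le> B) \<Longrightarrow>
    (\<integral>\<^sup>+x. ennreal (norm (m x)) * ennreal (norm (G x)) \<partial>lborel) \<le> ennreal (L * B) + ennreal A * (\<integral>\<^sup>+x. ennreal (norm (G x)) \<partial>lborel)"
proof -
  obtain C where C: "0 \<le> C" "\<And>R. 0 < R \<Longrightarrow> (\<integral>\<^sup>+x. ennreal (norm (x::'b) powr (- s)) * indicator (ball 0 R) x \<partial>lborel) \<le> ennreal (C * R powr (- s + real DIM('b)))"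
    using nn_integral_norm_powr_ball[of "- s", where 'a = 'b] s by auto
  have "ball (0::'b) 1 \<in> sets lborel" by simp
  then have m1: "(\<lambda>x. ennreal (norm (x::'b) powr (- s)) * indicator (ball 0 1) x) \<in> borel_measurable lborel"
    by (intro borel_measurable_times_ennreal borel_measurable_indicator) simp_all
  have "(\<integral>\<^sup>+x. ennreal (norm (m x)) * ennreal (norm (G x)) \<partial>lborel) \<le> ennreal (A * C * B) + ennreal A * (\<integral>\<^sup>+x. ennreal (norm (G x)) \<partial>lborel)"
    if G[measurable]: "G \<in> borel_measurable borel" and GB: "\<And>x. norm (G x :: complex) \<le> B" for G B
  proof -
    have B: "0 \<le> B" using GB[of 0] norm_ge_zero order_trans by blast
    have "(\<integral>\<^sup>+x. ennreal (norm (m x)) * ennreal (norm (G x)) \<partial>lborel)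
      \<le> (\<integral>\<^sup>+x. ennreal (A * B) * (ennreal (norm (x::'b) powr (- s)) * indicator (ball 0 1) x) + ennreal A * ennreal (norm (G x)) \<partial>lborel)"
    proof (rule nn_integral_mono_AE)
      show "AE x in lborel. ennreal (norm (m x)) * ennreal (norm (G x)) \<le> ennreal (A * B) * (ennreal (norm (x::'b) powr (- s)) * indicator (ball 0 1) x) + ennreal A * ennreal (norm (G x))"
        using AE_lborel_singleton[of "0::'b"]
      proof eventually_elim
        case (elim x)
        show ?case
        proof (cases "norm x < 1")
          case True
          have "norm (m x) * norm (G x) \<le> (A * norm x powr (- s)) * B" using mb[OF elim] GB[of x] A by (intro mult_mono) auto
          then have "ennreal (norm (m x)) * ennreal (norm (G x)) \<le> ennreal (A * B) * ennreal (norm x powr (- s))"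
            using A B by (simp add: ennreal_mult[symmetric] ennreal_leI mult_ac)
          then show ?thesis using True by (simp add: add_increasing2)
        next
          case False
          have "norm x powr (- s) \<le> norm x powr 0" using False s by (intro powr_mono) auto
          also have "\<dots> = 1" using False by auto
          finally have "A * norm x powr (- s) \<le> A * 1" using A by (intro mult_left_mono)
          then have "norm (m x) \<le> A" using mb[OF elim] by simp
          then have "ennreal (norm (m x)) * ennreal (norm (G x)) \<le> ennreal A * ennreal (norm (G x))" by (intro mult_right_mono ennreal_leI) auto
          then show ?thesis by (simp add: add_increasing)
        qed
      qed
    qed
    also have "\<dots> = ennreal (A * B) * (\<integral>\<^sup>+x. ennreal (norm (x::'b) powr (- s)) * indicator (ball 0 1) x \<partial>lborel) + ennreal A * (\<integral>\<^sup>+x. ennreal (norm (G x)) \<partial>lborel)"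
      using m1 by (subst nn_integral_add) (simp_all add: nn_integral_cmult borel_measurable_times_ennreal)
    also have "\<dots> \<le> ennreal (A * B) * ennreal C + ennreal A * (\<integral>\<^sup>+x. ennreal (norm (G x)) \<partial>lborel)"
      using C(2)[of 1] by (intro add_right_mono mult_left_mono) auto
    also have "ennreal (A * B) * ennreal C = ennreal (A * C * B)" using A B C by (simp add: ennreal_mult[symmetric] mult_ac)
    finally show ?thesis .
  qed
  then show thesis using A C(1) by (intro that[of "A * C"]) auto
qed

text \<open>The phase \<open>cis (x \<bullet> \<xi>)\<close> of the operator is produced by
  translating the function to x; the reflection provides the sign that the pairing requires.\<close>

lemma ft_reflect_shift:
  fixes f :: "(real^'n) \<Rightarrow> complex"
  assumes f: "f \<in> schwartz"
  shows "integrable lborel (\<lambda>y. f (x - y) * cis (y \<bullet> \<xi>))"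
    and "(\<integral>y. f (x - y) * cis (y \<bullet> \<xi>) \<partial>lborel) = of_real ((2 * pi) ^ CARD('n)) * (cis (x \<bullet> \<xi>) * fourier f \<xi>)"
proof -
  note fm[measurable] = schwartz_basic(3)[OF f]
  have "integrable lborel (\<lambda>y. f (x + (-1) *\<^sub>R y))" by (intro integrable_lborel_affine schwartz_basic(2)[OF f]) simp
  then have "integrable lborel (\<lambda>y. f (x - y))" by simp
  from integrable_mult_cis[OF this, of \<xi>] show "integrable lborel (\<lambda>y. f (x - y) * cis (y \<bullet> \<xi>))" by (simp add: inner_commute)
  have "(\<integral>u. f u * cis ((x - u) \<bullet> \<xi>) \<partial>lborel) = \<bar>-1\<bar> ^ DIM(real^'n) *\<^sub>R (\<integral>y. f (x + (-1) *\<^sub>R y) * cis ((x - (x + (-1) *\<^sub>R y)) \<bullet> \<xi>) \<partial>lborel)"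
    by (rule integral_lborel_affine) (intro borel_measurable_times measurable_cis_inner fm, simp_all)
  then have "(\<integral>y. f (x - y) * cis (y \<bullet> \<xi>) \<partial>lborel) = (\<integral>u. f u * cis ((x - u) \<bullet> \<xi>) \<partial>lborel)" by simp
  also have "\<dots> = (\<integral>u. cis (x \<bullet> \<xi>) * (f u * cis ((- \<xi>) \<bullet> u)) \<partial>lborel)"
  proof (intro Bochner_Integration.integral_cong refl)
    fix u
    have "(x - u) \<bullet> \<xi> = x \<bullet> \<xi> + (- \<xi>) \<bullet> u" by (simp add: inner_diff_left inner_commute[of \<xi> u])
    then have "cis ((x - u) \<bullet> \<xi>) = cis (x \<bullet> \<xi>) * cis ((- \<xi>) \<bullet> u)" by (simp only: cis_mult)
    then show "f u * cis ((x - u) \<bullet> \<xi>) = cis (x \<bullet> \<xi>) * (f u * cis ((- \<xi>) \<bullet> u))" by (simp only: mult_ac)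
  qed
  also have "\<dots> = cis (x \<bullet> \<xi>) * ft f (- \<xi>)" unfolding ft_def by (rule integral_mult_right_zero)
  also have "ft f (- \<xi>) = of_real ((2 * pi) ^ CARD('n)) * fourier f \<xi>"
    unfolding fourier_eq_ft[OF fm] by simp
  finally show "(\<integral>y. f (x - y) * cis (y \<bullet> \<xi>) \<partial>lborel) = of_real ((2 * pi) ^ CARD('n)) * (cis (x \<bullet> \<xi>) * fourier f \<xi>)"
    by (simp add: mult.left_commute)
qed

lemma fourier_bounded:
  fixes f :: "(real^'n) \<Rightarrow> complex"
  assumes f: "f \<in> schwartz"
  obtains B where "0 \<le> B" "\<And>\<xi>. norm (fourier f \<xi>) \<le> B"
  using fourier_decay[OF f, of 0] by auto

lemma lborel_integral_pair_mult:
  fixes f :: "'a::euclidean_space \<Rightarrow> complex" and g :: "'b::euclidean_space \<Rightarrow> complex"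
  assumes f: "integrable lborel f" and g: "integrable lborel g"
  shows "integrable lborel (\<lambda>z. f (fst z) * g (snd z))"
    and "(\<integral>z. f (fst z) * g (snd z) \<partial>lborel) = (\<integral>x. f x \<partial>lborel) * (\<integral>y. g y \<partial>lborel)"
proof -
  have int: "integrable (lborel \<Otimes>\<^sub>M lborel) (\<lambda>z. f (fst z) * g (snd z))"
    using integrable_pair_mult[OF f g, of "\<lambda>_. 1"] by (simp add: case_prod_beta')
  then show "integrable lborel (\<lambda>z. f (fst z) * g (snd z))" unfolding lborel_prod .
  have "(\<integral>z. f (fst z) * g (snd z) \<partial>lborel) = (\<integral>x. \<integral>y. f x * g y \<partial>lborel \<partial>lborel)"
    unfolding lborel_prod[symmetric] using lborel_pair.integral_fst'[OF int] by simp
  then show "(\<integral>z. f (fst z) * g (snd z) \<partial>lborel) = (\<integral>x. f x \<partial>lborel) * (\<integral>y. g y \<partial>lborel)" by simp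
qed

section \<open>Symbols singular at the origin\<close>

text \<open>For fixed x the operator is the pairing of the symbol with the transform of the tensor
  product of f(x - y) and g(x - z), so the multiplier bound in dimension 2n applies.\<close>

lemma bil_bounded_isotropic:
  fixes \<sigma> :: "((real^'n) \<times> (real^'n) \<times> (real^'n)) \<Rightarrow> complex"
  assumes p: "1 < p1" "1 < p2" and q: "0 < q" and s: "0 < s" "s < 2 * real CARD('n)"
    and scale: "1 / q = 1 / p1 + 1 / p2 - s / real CARD('n)"
    and cont: "continuous_on (UNIV \<times> - {0}) \<sigma>"
    and A: "0 \<le> A" and sym: "\<And>x b. b \<in> Basis \<Longrightarrow> dir_symbol DIM((real^'n) \<times> (real^'n)) b (\<lambda>\<zeta>. \<sigma> (x, \<zeta>)) (- s) A"
  shows "bil_bounded \<sigma> p1 p2 q"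
proof -
  define n where "n = real CARD('n)"
  have n: "0 < n" by (simp add: n_def)
  have dim: "real DIM((real^'n) \<times> (real^'n)) = 2 * n" by (simp add: n_def)
  define \<sigma>' where "\<sigma>' = restrict_symbol \<sigma> (- {0})"
  have op: "open (- {0::(real^'n) \<times> (real^'n)})" by auto
  have ae: "AE z in lborel. z \<in> - {0::(real^'n) \<times> (real^'n)}" using AE_lborel_singleton[of "0::(real^'n) \<times> (real^'n)"] by simp
  have s': "s < real DIM((real^'n) \<times> (real^'n))" using s by simp
  define m where "m x \<zeta> = \<sigma>' (x, \<zeta>)" for x \<zeta>
  have \<sigma>'m: "\<sigma>' \<in> borel_measurable borel" unfolding \<sigma>'_def by (rule restrict_symbol_measurable[OF cont op])
  have mm: "m x \<in> borel_measurable borel" for x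
  proof -
    have "(\<lambda>\<zeta> :: (real^'n) \<times> (real^'n). (x, \<zeta>)) \<in> borel_measurable borel"
      by (intro borel_measurable_continuous_onI continuous_intros)
    from measurable_compose[OF this \<sigma>'m] show ?thesis by (simp add: m_def[abs_def])
  qed
  have msym: "dir_symbol DIM((real^'n) \<times> (real^'n)) b (m x) (- s) A" if "b \<in> Basis" for x b
    by (rule dir_symbol_cong[OF sym[OF that, of x]]) (simp add: m_def \<sigma>'_def restrict_symbol_def)
  have mb: "norm (m x \<zeta>) \<le> A * norm \<zeta> powr (- s)" if "\<zeta> \<noteq> 0" for x \<zeta>
    by (rule dir_symbol_bound[OF msym[OF SOME_Basis] that])
  \<comment> \<open>\<open>fourier\<close> carries the reciprocal of this factor, so f and g each
    bring one \<open>c\<close> into the pairing.\<close>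
  define c where "c = complex_of_real ((2 * pi) ^ CARD('n))"
  have c: "c \<noteq> 0" by (simp add: c_def)
  have int: "integrable lborel (bil_integrand \<sigma>' f g x)" if f: "f \<in> schwartz" and g: "g \<in> schwartz" for f g x
  proof -
    obtain B1 where B1: "0 \<le> B1" "\<And>\<xi>. norm (fourier f \<xi>) \<le> B1" using fourier_bounded[OF f] by blast
    obtain B2 where B2: "0 \<le> B2" "\<And>\<xi>. norm (fourier g \<xi>) \<le> B2" using fourier_bounded[OF g] by blast
    define G where "G \<zeta> = fourier f (fst \<zeta>) * fourier g (snd \<zeta>)" for \<zeta>
    have G: "integrable lborel G" unfolding G_def[abs_def]
      by (rule lborel_integral_pair_mult(1)[OF fourier_integrable[OF f] fourier_integrable[OF g]])
    then have Gm: "G \<in> borel_measurable borel" by (auto dest: borel_measurable_integrable)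
    have GB: "norm (G \<zeta>) \<le> B1 * B2" for \<zeta> unfolding G_def norm_mult using B1 B2 by (intro mult_mono) auto
    obtain L where L: "(\<integral>\<^sup>+\<zeta>. ennreal (norm (m x \<zeta>)) * ennreal (norm (G \<zeta>)) \<partial>lborel) \<le> ennreal (L * (B1 * B2)) + ennreal A * (\<integral>\<^sup>+\<zeta>. ennreal (norm (G \<zeta>)) \<partial>lborel)"
    proof (rule nn_integral_symbol_mult[OF mm mb s(1) s' A, of x])
      fix L assume "\<And>G B. G \<in> borel_measurable borel \<Longrightarrow> (\<And>x. norm (G x :: complex) \<le> B) \<Longrightarrow>
        (\<integral>\<^sup>+\<zeta>. ennreal (norm (m x \<zeta>)) * ennreal (norm (G \<zeta>)) \<partial>lborel) \<le> ennreal (L * B) + ennreal A * (\<integral>\<^sup>+\<zeta>. ennreal (norm (G \<zeta>)) \<partial>lborel)"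
      from this[OF Gm GB] show thesis by (rule that)
    qed
    show ?thesis
    proof (rule integrableI_bounded)
      show "bil_integrand \<sigma>' f g x \<in> borel_measurable lborel" using bil_integrand_measurable(2)[OF \<sigma>'m f g] by simp
      have "(\<integral>\<^sup>+\<zeta>. ennreal (norm (bil_integrand \<sigma>' f g x \<zeta>)) \<partial>lborel) = (\<integral>\<^sup>+\<zeta>. ennreal (norm (m x \<zeta>)) * ennreal (norm (G \<zeta>)) \<partial>lborel)"
        by (intro nn_integral_cong) (simp add: bil_integrand_def split_beta norm_mult m_def G_def ennreal_mult mult.assoc)
      also have "\<dots> \<le> ennreal (L * (B1 * B2)) + ennreal A * (\<integral>\<^sup>+\<zeta>. ennreal (norm (G \<zeta>)) \<partial>lborel)" by (rule L)
      also have "\<dots> < \<infinity>" using G by (simp add: integrable_iff_bounded ennreal_mult_less_top)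
      finally show "(\<integral>\<^sup>+\<zeta>. ennreal (norm (bil_integrand \<sigma>' f g x \<zeta>)) \<partial>lborel) < \<infinity>" .
    qed
  qed
  obtain C where C: "0 \<le> C" "\<forall>(m::(real^'n) \<times> (real^'n) \<Rightarrow> complex) \<psi>. m \<in> borel_measurable borel \<longrightarrow>
    (\<forall>b\<in>Basis. dir_symbol DIM((real^'n) \<times> (real^'n)) b m (- s) A) \<longrightarrow> integrable lborel \<psi> \<longrightarrow>
    integrable lborel (\<lambda>\<zeta>. m \<zeta> * (\<integral>y. \<psi> y * cis (y \<bullet> \<zeta>) \<partial>lborel)) \<longrightarrow>
    ennreal (norm (\<integral>\<zeta>. m \<zeta> * (\<integral>y. \<psi> y * cis (y \<bullet> \<zeta>) \<partial>lborel) \<partial>lborel))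
      \<le> ennreal C * (\<integral>\<^sup>+y. ennreal (norm y powr (s - real DIM((real^'n) \<times> (real^'n)))) * ennreal (norm (\<psi> y)) \<partial>lborel)"
    using multiplier_pairing_bound[OF s(1) s' A] by (elim exE conjE)
  have pointwise: "ennreal (norm (bil_op \<sigma> f g x)) \<le> ennreal (C / norm (c * c)) * bop (riesz2 (s / n)) fst snd (\<lambda>x. norm (f x)) (\<lambda>x. norm (g x)) x"
    if f: "f \<in> schwartz" and g: "g \<in> schwartz" for f g x
  proof -
    define \<psi> where "\<psi> z = f (x - fst z) * g (x - snd z)" for z
    have "integrable lborel (\<lambda>y. f (x - y))" "integrable lborel (\<lambda>y. g (x - y))"
      using ft_reflect_shift(1)[OF f, of x 0] ft_reflect_shift(1)[OF g, of x 0] by simp_all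
    then have \<psi>: "integrable lborel \<psi>" unfolding \<psi>_def[abs_def] by (rule lborel_integral_pair_mult(1))
    have \<Psi>: "m x \<zeta> * (\<integral>y. \<psi> y * cis (y \<bullet> \<zeta>) \<partial>lborel) = c * c * bil_integrand \<sigma>' f g x \<zeta>" for \<zeta>
    proof -
      have "(\<integral>y. \<psi> y * cis (y \<bullet> \<zeta>) \<partial>lborel) = (\<integral>z. (f (x - fst z) * cis (fst z \<bullet> fst \<zeta>)) * (g (x - snd z) * cis (snd z \<bullet> snd \<zeta>)) \<partial>lborel)"
      proof (intro Bochner_Integration.integral_cong refl)
        fix z
        have "cis (z \<bullet> \<zeta>) = cis (fst z \<bullet> fst \<zeta>) * cis (snd z \<bullet> snd \<zeta>)" unfolding cis_mult by (simp add: inner_prod_def)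
        then show "\<psi> z * cis (z \<bullet> \<zeta>) = (f (x - fst z) * cis (fst z \<bullet> fst \<zeta>)) * (g (x - snd z) * cis (snd z \<bullet> snd \<zeta>))"
          by (simp only: \<psi>_def mult_ac)
      qed
      also have "\<dots> = (c * (cis (x \<bullet> fst \<zeta>) * fourier f (fst \<zeta>))) * (c * (cis (x \<bullet> snd \<zeta>) * fourier g (snd \<zeta>)))"
        unfolding lborel_integral_pair_mult(2)[OF ft_reflect_shift(1)[OF f] ft_reflect_shift(1)[OF g]] ft_reflect_shift(2)[OF f] ft_reflect_shift(2)[OF g] c_def ..
      also have "\<dots> = c * c * (cis (x \<bullet> (fst \<zeta> + snd \<zeta>)) * fourier f (fst \<zeta>) * fourier g (snd \<zeta>))"
        by (simp add: inner_add_right cis_mult[symmetric] mult_ac)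
      finally show ?thesis by (simp add: bil_integrand_def split_beta m_def mult_ac)
    qed
    have int': "integrable lborel (\<lambda>\<zeta>. m x \<zeta> * (\<integral>y. \<psi> y * cis (y \<bullet> \<zeta>) \<partial>lborel))"
      unfolding \<Psi> by (intro integrable_mult_right int f g)
    have "c * c * bil_op \<sigma> f g x = (\<integral>\<zeta>. m x \<zeta> * (\<integral>y. \<psi> y * cis (y \<bullet> \<zeta>) \<partial>lborel) \<partial>lborel)"
      unfolding \<Psi> bil_op_restrict(2)[OF cont op ae f g] \<sigma>'_def by (rule integral_mult_right_zero[symmetric])
    then have "ennreal (norm (c * c * bil_op \<sigma> f g x)) \<le> ennreal C * (\<integral>\<^sup>+y. ennreal (norm y powr (s - real DIM((real^'n) \<times> (real^'n)))) * ennreal (norm (\<psi> y)) \<partial>lborel)"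
      using C(2)[rule_format, OF mm msym \<psi> int'] by (simp only:)
    also have "(\<integral>\<^sup>+y. ennreal (norm y powr (s - real DIM((real^'n) \<times> (real^'n)))) * ennreal (norm (\<psi> y)) \<partial>lborel) = bop (riesz2 (s / n)) fst snd (\<lambda>x. norm (f x)) (\<lambda>x. norm (g x)) x"
    proof -
      have "real DIM(real^'n) * (s / n - 2) = s - 2 * n" using n by (simp add: n_def field_simps)
      then show ?thesis unfolding bop_def riesz2_def dim \<psi>_def norm_mult by simp
    qed
    finally have le: "ennreal (norm (c * c * bil_op \<sigma> f g x)) \<le> ennreal C * bop (riesz2 (s / n)) fst snd (\<lambda>x. norm (f x)) (\<lambda>x. norm (g x)) x" .
    have cc: "0 < norm (c * c)" using c by simp
    have "ennreal (norm (bil_op \<sigma> f g x)) = ennreal (1 / norm (c * c)) * ennreal (norm (c * c * bil_op \<sigma> f g x))"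
      using cc by (subst ennreal_mult[symmetric]) (auto simp: norm_mult)
    also have "\<dots> \<le> ennreal (1 / norm (c * c)) * (ennreal C * bop (riesz2 (s / n)) fst snd (\<lambda>x. norm (f x)) (\<lambda>x. norm (g x)) x)"
      by (rule mult_left_mono[OF le]) simp
    also have "\<dots> = ennreal (C / norm (c * c)) * bop (riesz2 (s / n)) fst snd (\<lambda>x. norm (f x)) (\<lambda>x. norm (g x)) x"
      using C(1) cc by (simp add: mult.assoc[symmetric] ennreal_mult[symmetric])
    finally show ?thesis .
  qed
  have ab: "0 < 1 / p1" "1 / p1 < 1" "0 < 1 / p2" "1 / p2 < 1" using p by auto
  \<comment> \<open>\<open>1 / q > 0\<close> in the scaling relation is the condition on
    \<open>s / n\<close> in the fractional integral.\<close>
  have \<tau>: "0 < s / n" "s / n < 1 / p1 + 1 / p2" using s n q scale by (auto simp: n_def) (smt (verit) zero_less_divide_1_iff)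
  show ?thesis
  proof (rule bil_boundedI)
    show "integrable lebesgue (bil_integrand \<sigma> f g x)" if f: "f \<in> schwartz" and g: "g \<in> schwartz" for f g x
      by (rule bil_op_restrict(1)[OF cont op ae f g]) (fold \<sigma>'_def, rule int[OF f g])
    show "bil_op \<sigma> f g \<in> borel_measurable borel" if f: "f \<in> schwartz" and g: "g \<in> schwartz" for f g
      by (rule bil_op_restrict(3)[OF cont op ae f g])
    show "ennreal (norm (bil_op \<sigma> f g x)) \<le> ennreal (C / norm (c * c)) * bop (riesz2 (s / n)) fst snd (\<lambda>x. norm (f x)) (\<lambda>x. norm (g x)) x"
      if "f \<in> schwartz" "g \<in> schwartz" for f g x by (rule pointwise[OF that])
    show "bop_bounded (riesz2 (s / n)) (fst :: (real^'n) \<times> (real^'n) \<Rightarrow> real^'n) snd (1 / p1) (1 / p2) (1 / p1 + 1 / p2 - s / n)"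
      by (rule product_fractional_integral[OF ab \<tau>])
    show "riesz2 (s / n) \<in> borel_measurable (borel :: ((real^'n) \<times> (real^'n)) measure)" unfolding riesz2_def[abs_def] by measurable
    show "(fst :: (real^'n) \<times> (real^'n) \<Rightarrow> real^'n) \<in> borel_measurable borel" "(snd :: (real^'n) \<times> (real^'n) \<Rightarrow> real^'n) \<in> borel_measurable borel"
      by (intro borel_measurable_continuous_onI continuous_on_fst continuous_on_snd continuous_on_id)+
    show "0 < 1 / p1 + 1 / p2 - s / n" "1 / p1 + 1 / p2 - s / n = 1 / q" using \<tau> scale by (auto simp: n_def)
  qed (use C(1) p in \<open>auto simp: riesz2_def\<close>)
qed

section \<open>Symbols singular along a plane\<close>

lemma measurable_shear:
  fixes t :: real
  shows "(\<lambda>z :: 'a::euclidean_space \<times> 'a. (fst z + t *\<^sub>R snd z, snd z)) \<in> borel_measurable borel"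
  by (intro borel_measurable_continuous_onI continuous_intros)

lemma nn_integral_shear:
  fixes E :: "'a::euclidean_space \<times> 'a \<Rightarrow> ennreal"
  assumes E: "E \<in> borel_measurable borel"
  shows "(\<integral>\<^sup>+z. E z \<partial>lborel) = (\<integral>\<^sup>+\<eta>. \<integral>\<^sup>+\<zeta>. E (\<zeta> + t *\<^sub>R \<eta>, \<eta>) \<partial>lborel \<partial>lborel)"
proof -
  have Em: "E \<in> borel_measurable (lborel \<Otimes>\<^sub>M lborel)" unfolding lborel_prod using E by simp
  have sec: "(\<lambda>\<xi>. E (\<xi>, \<eta>)) \<in> borel_measurable borel" for \<eta>
    using measurable_compose[OF _ E, of "\<lambda>\<xi>. (\<xi>, \<eta>)" borel] by (simp add: borel_measurable_continuous_onI continuous_intros)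
  have "(\<integral>\<^sup>+z. E z \<partial>lborel) = (\<integral>\<^sup>+\<eta>. \<integral>\<^sup>+\<xi>. E (\<xi>, \<eta>) \<partial>lborel \<partial>lborel)"
    unfolding lborel_prod[symmetric] by (rule lborel_pair.nn_integral_snd[OF Em, symmetric])
  also have "\<dots> = (\<integral>\<^sup>+\<eta>. \<integral>\<^sup>+\<zeta>. E (\<zeta> + t *\<^sub>R \<eta>, \<eta>) \<partial>lborel \<partial>lborel)"
  proof (rule nn_integral_cong)
    fix \<eta> :: 'a
    show "(\<integral>\<^sup>+\<xi>. E (\<xi>, \<eta>) \<partial>lborel) = (\<integral>\<^sup>+\<zeta>. E (\<zeta> + t *\<^sub>R \<eta>, \<eta>) \<partial>lborel)"
      using nn_integral_lborel_shift[OF sec, of "t *\<^sub>R \<eta>" \<eta>] by (simp add: add.commute)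
  qed
  finally show ?thesis .
qed

text \<open>For fixed \<eta> the substitution is a translation in the first variable. Absolute
  integrability of the sheared function is obtained first, from the nonnegative version, because the
  final exchange of integrals rests on it.\<close>

lemma integral_shear:
  fixes E :: "'a::euclidean_space \<times> 'a \<Rightarrow> complex"
  assumes E: "integrable lborel E"
  shows "integrable lborel (\<lambda>\<zeta>. \<integral>\<eta>. E (\<zeta> + t *\<^sub>R \<eta>, \<eta>) \<partial>lborel)"
    and "(\<integral>z. E z \<partial>lborel) = (\<integral>\<zeta>. \<integral>\<eta>. E (\<zeta> + t *\<^sub>R \<eta>, \<eta>) \<partial>lborel \<partial>lborel)"
proof -
  define H where "H z = E (fst z + t *\<^sub>R snd z, snd z)" for z
  have Em: "E \<in> borel_measurable borel" using E by (auto dest: borel_measurable_integrable)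
  have Hm: "H \<in> borel_measurable borel" unfolding H_def[abs_def] by (rule measurable_compose[OF measurable_shear Em])
  have sec: "(\<lambda>\<xi>. E (\<xi>, \<eta>)) \<in> borel_measurable borel" for \<eta>
    using measurable_compose[OF _ Em, of "\<lambda>\<xi>. (\<xi>, \<eta>)" borel] by (simp add: borel_measurable_continuous_onI continuous_intros)
  have H: "integrable lborel H"
  proof (rule integrableI_bounded)
    show "H \<in> borel_measurable lborel" using Hm by simp
    \<comment> \<open>Shearing by 0 is plain Tonelli; the shear by \<open>t\<close> is then undone
      for the norm of \<open>E\<close>.\<close>
    have "(\<integral>\<^sup>+z. ennreal (norm (H z)) \<partial>lborel) = (\<integral>\<^sup>+\<eta>. \<integral>\<^sup>+\<zeta>. ennreal (norm (H (\<zeta> + 0 *\<^sub>R \<eta>, \<eta>))) \<partial>lborel \<partial>lborel)"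
      using Hm by (intro nn_integral_shear) measurable
    also have "\<dots> = (\<integral>\<^sup>+\<eta>. \<integral>\<^sup>+\<zeta>. ennreal (norm (E (\<zeta> + t *\<^sub>R \<eta>, \<eta>))) \<partial>lborel \<partial>lborel)" by (simp add: H_def)
    also have "\<dots> = (\<integral>\<^sup>+z. ennreal (norm (E z)) \<partial>lborel)"
      using Em by (intro nn_integral_shear[symmetric]) measurable
    also have "\<dots> < \<infinity>" using E by (simp add: integrable_iff_bounded)
    finally show "(\<integral>\<^sup>+z. ennreal (norm (H z)) \<partial>lborel) < \<infinity>" .
  qed
  have E2: "integrable (lborel \<Otimes>\<^sub>M lborel) (\<lambda>(\<xi>, \<eta>). E (\<xi>, \<eta>))" using E unfolding lborel_prod by simp
  have H2: "integrable (lborel \<Otimes>\<^sub>M lborel) (\<lambda>(\<zeta>, \<eta>). E (\<zeta> + t *\<^sub>R \<eta>, \<eta>))"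
    using H unfolding lborel_prod H_def[abs_def] by (simp add: case_prod_beta')
  show "integrable lborel (\<lambda>\<zeta>. \<integral>\<eta>. E (\<zeta> + t *\<^sub>R \<eta>, \<eta>) \<partial>lborel)"
    using lborel_pair.integrable_fst[OF H2] .
  have "(\<integral>z. E z \<partial>lborel) = (\<integral>\<eta>. \<integral>\<xi>. E (\<xi>, \<eta>) \<partial>lborel \<partial>lborel)"
    using lborel_pair.integral_snd[OF E2] unfolding lborel_prod by simp
  also have "\<dots> = (\<integral>\<eta>. \<integral>\<zeta>. E (\<zeta> + t *\<^sub>R \<eta>, \<eta>) \<partial>lborel \<partial>lborel)"
  proof (rule Bochner_Integration.integral_cong[OF refl])
    fix \<eta> :: 'a
    show "(\<integral>\<xi>. E (\<xi>, \<eta>) \<partial>lborel) = (\<integral>\<zeta>. E (\<zeta> + t *\<^sub>R \<eta>, \<eta>) \<partial>lborel)"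
      using integral_lborel_affine[OF sec, of 1 \<eta> "t *\<^sub>R \<eta>"] by (simp add: add.commute)
  qed
  also have "\<dots> = (\<integral>\<zeta>. \<integral>\<eta>. E (\<zeta> + t *\<^sub>R \<eta>, \<eta>) \<partial>lborel \<partial>lborel)"
    by (rule lborel_pair.Fubini_integral[OF H2])
  finally show "(\<integral>z. E z \<partial>lborel) = (\<integral>\<zeta>. \<integral>\<eta>. E (\<zeta> + t *\<^sub>R \<eta>, \<eta>) \<partial>lborel \<partial>lborel)" .
qed

text \<open>Along the line \<open>\<xi> = \<zeta> + t \<eta>\<close> Fourier inversion for \<open>g\<close> turns the \<open>\<eta>\<close>-integral into the
  Fourier transform of a product of two translates.\<close>

lemma fourier_line_integral:
  fixes f g :: "(real^'n) \<Rightarrow> complex"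
  assumes f: "f \<in> schwartz" and g: "g \<in> schwartz"
  shows "integrable lborel (\<lambda>y. f (x - y) * g (x + t *\<^sub>R y))"
    and "(\<integral>y. f (x - y) * g (x + t *\<^sub>R y) * cis (y \<bullet> \<zeta>) \<partial>lborel)
      = of_real ((2 * pi) ^ CARD('n)) *
        (\<integral>\<eta>. cis (x \<bullet> (\<zeta> + t *\<^sub>R \<eta> + \<eta>)) * fourier f (\<zeta> + t *\<^sub>R \<eta>) * fourier g \<eta> \<partial>lborel)"
proof -
  define c where "c = complex_of_real ((2 * pi) ^ CARD('n))"
  note [measurable] = schwartz_basic(3)[OF f] schwartz_basic(3)[OF g]
  have f0: "integrable lborel (\<lambda>y. f (x - y))" using ft_reflect_shift(1)[OF f, of x 0] by simp
  obtain B where B: "\<And>y. norm (g y) \<le> B" using rapidE[OF schwartz_basic(1)[OF g], of 0] by auto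
  have fB: "integrable lborel (\<lambda>y. complex_of_real B * f (x - y))" using f0 by (rule integrable_mult_right)
  show "integrable lborel (\<lambda>y. f (x - y) * g (x + t *\<^sub>R y))"
  proof (rule Bochner_Integration.integrable_bound[OF fB])
    show "(\<lambda>y. f (x - y) * g (x + t *\<^sub>R y)) \<in> borel_measurable lborel" by measurable
    show "AE y in lborel. norm (f (x - y) * g (x + t *\<^sub>R y)) \<le> norm (complex_of_real B * f (x - y))"
    proof (rule AE_I2)
      fix y
      have "norm (g (x + t *\<^sub>R y)) \<le> norm (complex_of_real B)" using B[of "x + t *\<^sub>R y"] by simp
      then have "norm (f (x - y)) * norm (g (x + t *\<^sub>R y)) \<le> norm (f (x - y)) * norm (complex_of_real B)" by (rule mult_left_mono) simp
      then show "norm (f (x - y) * g (x + t *\<^sub>R y)) \<le> norm (complex_of_real B * f (x - y))" by (simp only: norm_mult mult.commute)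
    qed
  qed
  have f1: "integrable lborel (\<lambda>y. f (x - y) * cis (y \<bullet> \<zeta>))" by (rule ft_reflect_shift(1)[OF f])
  have g1: "integrable lborel (\<lambda>\<eta>. fourier g \<eta> * cis (x \<bullet> \<eta>))" by (rule integrable_mult_cis[OF fourier_integrable[OF g]])
  have "integrable (lborel \<Otimes>\<^sub>M lborel) (\<lambda>(y, \<eta>). f (x - y) * cis (y \<bullet> \<zeta>) * (fourier g \<eta> * cis (x \<bullet> \<eta>)) * (\<lambda>p. cis ((t *\<^sub>R fst p) \<bullet> snd p)) (y, \<eta>))"
  proof (rule integrable_pair_mult[OF f1 g1])
    have "(\<lambda>p. t *\<^sub>R fst p) \<in> borel_measurable (lborel \<Otimes>\<^sub>M (lborel :: (real^'n) measure))" "(\<lambda>p. snd p) \<in> borel_measurable ((lborel :: (real^'n) measure) \<Otimes>\<^sub>M lborel)"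
      by measurable
    then show "(\<lambda>p. cis ((t *\<^sub>R fst p) \<bullet> snd p)) \<in> borel_measurable (lborel \<Otimes>\<^sub>M (lborel :: (real^'n) measure))"
      by (rule measurable_cis_inner)
  qed simp
  then have int: "integrable (lborel \<Otimes>\<^sub>M lborel) (\<lambda>(y, \<eta>). f (x - y) * cis (y \<bullet> \<zeta>) * (fourier g \<eta> * cis (x \<bullet> \<eta>)) * cis ((t *\<^sub>R y) \<bullet> \<eta>))"
    by simp
  \<comment> \<open>\<open>g (x + t *\<^sub>R y)\<close> is replaced by its inversion integral;
    after the exchange the y-integral is the transform of a translate of \<open>f\<close> at the
    frequency \<open>\<zeta> + t *\<^sub>R \<eta>\<close>.\<close>
  have "(\<integral>y. f (x - y) * g (x + t *\<^sub>R y) * cis (y \<bullet> \<zeta>) \<partial>lborel)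
    = (\<integral>y. \<integral>\<eta>. f (x - y) * cis (y \<bullet> \<zeta>) * (fourier g \<eta> * cis (x \<bullet> \<eta>)) * cis ((t *\<^sub>R y) \<bullet> \<eta>) \<partial>lborel \<partial>lborel)"
  proof (rule Bochner_Integration.integral_cong[OF refl])
    fix y
    have "(\<integral>\<eta>. f (x - y) * cis (y \<bullet> \<zeta>) * (fourier g \<eta> * cis (x \<bullet> \<eta>)) * cis ((t *\<^sub>R y) \<bullet> \<eta>) \<partial>lborel)
      = (\<integral>\<eta>. f (x - y) * cis (y \<bullet> \<zeta>) * (fourier g \<eta> * cis ((x + t *\<^sub>R y) \<bullet> \<eta>)) \<partial>lborel)"
      by (intro Bochner_Integration.integral_cong refl) (simp only: inner_add_left cis_mult[symmetric] mult_ac)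
    also have "\<dots> = f (x - y) * cis (y \<bullet> \<zeta>) * g (x + t *\<^sub>R y)"
      unfolding integral_mult_right_zero schwartz_fourier_inversion[OF g] ..
    finally show "f (x - y) * g (x + t *\<^sub>R y) * cis (y \<bullet> \<zeta>) = (\<integral>\<eta>. f (x - y) * cis (y \<bullet> \<zeta>) * (fourier g \<eta> * cis (x \<bullet> \<eta>)) * cis ((t *\<^sub>R y) \<bullet> \<eta>) \<partial>lborel)"
      by (simp only: mult_ac)
  qed
  also have "\<dots> = (\<integral>\<eta>. \<integral>y. f (x - y) * cis (y \<bullet> \<zeta>) * (fourier g \<eta> * cis (x \<bullet> \<eta>)) * cis ((t *\<^sub>R y) \<bullet> \<eta>) \<partial>lborel \<partial>lborel)"
    by (rule lborel_pair.Fubini_integral[OF int, symmetric])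
  also have "\<dots> = (\<integral>\<eta>. c * (cis (x \<bullet> (\<zeta> + t *\<^sub>R \<eta> + \<eta>)) * fourier f (\<zeta> + t *\<^sub>R \<eta>) * fourier g \<eta>) \<partial>lborel)"
  proof (rule Bochner_Integration.integral_cong[OF refl])
    fix \<eta>
    have "(\<integral>y. f (x - y) * cis (y \<bullet> \<zeta>) * (fourier g \<eta> * cis (x \<bullet> \<eta>)) * cis ((t *\<^sub>R y) \<bullet> \<eta>) \<partial>lborel)
      = (\<integral>y. (fourier g \<eta> * cis (x \<bullet> \<eta>)) * (f (x - y) * cis (y \<bullet> (\<zeta> + t *\<^sub>R \<eta>))) \<partial>lborel)"
    proof (intro Bochner_Integration.integral_cong refl)
      fix y
      have "cis (y \<bullet> (\<zeta> + t *\<^sub>R \<eta>)) = cis (y \<bullet> \<zeta>) * cis ((t *\<^sub>R y) \<bullet> \<eta>)" by (simp add: cis_mult inner_add_right)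
      then show "f (x - y) * cis (y \<bullet> \<zeta>) * (fourier g \<eta> * cis (x \<bullet> \<eta>)) * cis ((t *\<^sub>R y) \<bullet> \<eta>) = (fourier g \<eta> * cis (x \<bullet> \<eta>)) * (f (x - y) * cis (y \<bullet> (\<zeta> + t *\<^sub>R \<eta>)))"
        by (simp only: mult_ac)
    qed
    also have "\<dots> = (fourier g \<eta> * cis (x \<bullet> \<eta>)) * (c * (cis (x \<bullet> (\<zeta> + t *\<^sub>R \<eta>)) * fourier f (\<zeta> + t *\<^sub>R \<eta>)))"
      unfolding integral_mult_right_zero ft_reflect_shift(2)[OF f] c_def ..
    also have "\<dots> = c * (cis (x \<bullet> (\<zeta> + t *\<^sub>R \<eta> + \<eta>)) * fourier f (\<zeta> + t *\<^sub>R \<eta>) * fourier g \<eta>)"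
      unfolding inner_add_right[of x "\<zeta> + t *\<^sub>R \<eta>" \<eta>] cis_mult[symmetric] by (simp only: mult_ac)
    finally show "(\<integral>y. f (x - y) * cis (y \<bullet> \<zeta>) * (fourier g \<eta> * cis (x \<bullet> \<eta>)) * cis ((t *\<^sub>R y) \<bullet> \<eta>) \<partial>lborel) = c * (cis (x \<bullet> (\<zeta> + t *\<^sub>R \<eta> + \<eta>)) * fourier f (\<zeta> + t *\<^sub>R \<eta>) * fourier g \<eta>)" .
  qed
  finally show "(\<integral>y. f (x - y) * g (x + t *\<^sub>R y) * cis (y \<bullet> \<zeta>) \<partial>lborel)
      = of_real ((2 * pi) ^ CARD('n)) *
        (\<integral>\<eta>. cis (x \<bullet> (\<zeta> + t *\<^sub>R \<eta> + \<eta>)) * fourier f (\<zeta> + t *\<^sub>R \<eta>) * fourier g \<eta> \<partial>lborel)"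
    unfolding integral_mult_right_zero c_def .
qed

text \<open>In \<zeta> = \<xi> - t \<eta> the symbol is a multiplier of n variables only, paired
  with a product of two translates that depend on the same y. Hence the range s < n instead of s <
  2n, and a bilinear integral along a line instead of a product of potentials.\<close>

lemma bil_bounded_directional:
  fixes \<sigma> :: "((real^'n) \<times> (real^'n) \<times> (real^'n)) \<Rightarrow> complex"
  assumes p: "1 < p1" "1 < p2" and q: "0 < q" and s: "0 < s" "s < real CARD('n)"
    and scale: "1 / q = 1 / p1 + 1 / p2 - s / real CARD('n)"
    and t: "t \<noteq> 0" "t \<noteq> - 1"
    and cont: "continuous_on (UNIV \<times> - {0}) \<sigma>0"
    and eq: "\<And>x \<xi> \<eta>. \<xi> - t *\<^sub>R \<eta> \<noteq> 0 \<Longrightarrow> \<sigma> (x, \<xi>, \<eta>) = \<sigma>0 (x, \<xi> - t *\<^sub>R \<eta>)"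
    and A: "0 \<le> A" and sym: "\<And>x b. b \<in> Basis \<Longrightarrow> dir_symbol DIM(real^'n) b (\<lambda>\<zeta>. \<sigma>0 (x, \<zeta>)) (- s) A"
  shows "bil_bounded \<sigma> p1 p2 q"
proof -
  define n where "n = real CARD('n)"
  have n: "0 < n" by (simp add: n_def)
  define P where "P = {z :: (real^'n) \<times> (real^'n). fst z - t *\<^sub>R snd z \<noteq> 0}"
  have op: "open P" unfolding P_def by (intro open_Collect_neq continuous_intros)
  \<comment> \<open>For each \<xi> exactly one \<eta> is excluded, because
    \<open>t \<noteq> 0\<close>.\<close>
  have ae: "AE z in lborel. z \<in> P"
  proof -
    have Pm: "P \<in> sets (lborel \<Otimes>\<^sub>M lborel)" using op unfolding lborel_prod by simp
    have "AE z in lborel \<Otimes>\<^sub>M lborel. z \<in> P"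
    proof (rule lborel_pair.AE_pair_measure)
      have "{z \<in> space (lborel \<Otimes>\<^sub>M lborel). z \<in> P} = P" by (auto simp: space_pair_measure)
      then show "{z \<in> space (lborel \<Otimes>\<^sub>M lborel). z \<in> P} \<in> sets (lborel \<Otimes>\<^sub>M lborel)" using Pm by simp
      show "AE \<xi> in lborel. AE \<eta> in lborel. (\<xi>, \<eta>) \<in> P"
      proof (rule AE_I2)
        fix \<xi> :: "real^'n"
        show "AE \<eta> in lborel. (\<xi>, \<eta>) \<in> P"
          using AE_lborel_singleton[of "(1 / t) *\<^sub>R \<xi>"] by eventually_elim (use t(1) in \<open>auto simp: P_def\<close>)
      qed
    qed
    then show ?thesis unfolding lborel_prod .
  qed
  have cont\<sigma>: "continuous_on (UNIV \<times> P) \<sigma>"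
  proof -
    have "continuous_on (UNIV \<times> P) (\<lambda>p. \<sigma>0 (fst p, fst (snd p) - t *\<^sub>R snd (snd p)))"
      by (rule continuous_on_compose2[OF cont]) (auto intro!: continuous_intros simp: P_def)
    moreover have "\<sigma> p = \<sigma>0 (fst p, fst (snd p) - t *\<^sub>R snd (snd p))" if "p \<in> UNIV \<times> P" for p
      using that eq[of "fst (snd p)" "snd (snd p)" "fst p"] by (auto simp: P_def)
    ultimately show ?thesis using continuous_on_cong[OF refl, of "UNIV \<times> P" \<sigma>] by auto
  qed
  define \<sigma>' where "\<sigma>' = restrict_symbol \<sigma> P"
  have \<sigma>'m: "\<sigma>' \<in> borel_measurable borel" unfolding \<sigma>'_def by (rule restrict_symbol_measurable[OF cont\<sigma> op])
  define m where "m x \<zeta> = restrict_symbol \<sigma>0 (- {0}) (x, \<zeta>)" for x \<zeta>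
  \<comment> \<open>Both sides are 0 on the singular plane, so the identity holds
    everywhere.\<close>
  have \<sigma>'_eq: "\<sigma>' (x, \<xi>, \<eta>) = m x (\<xi> - t *\<^sub>R \<eta>)" for x \<xi> \<eta>
    using eq[of \<xi> \<eta> x] by (simp add: \<sigma>'_def m_def restrict_symbol_def P_def)
  have mm: "m x \<in> borel_measurable borel" for x
  proof -
    have "(\<lambda>\<zeta> :: real^'n. (x, \<zeta>)) \<in> borel_measurable borel"
      by (intro borel_measurable_continuous_onI continuous_intros)
    from measurable_compose[OF this restrict_symbol_measurable[OF cont]] show ?thesis by (simp add: m_def[abs_def] open_Compl)
  qed
  have msym: "dir_symbol DIM(real^'n) b (m x) (- s) A" if "b \<in> Basis" for x b
    by (rule dir_symbol_cong[OF sym[OF that, of x]]) (simp add: m_def restrict_symbol_def)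
  have mb: "norm (m x \<zeta>) \<le> A * norm \<zeta> powr (- s)" if "\<zeta> \<noteq> 0" for x \<zeta>
    by (rule dir_symbol_bound[OF msym[OF SOME_Basis] that])
  have s': "s < real DIM(real^'n)" using s by simp
  define c where "c = complex_of_real ((2 * pi) ^ CARD('n))"
  have c: "c \<noteq> 0" by (simp add: c_def)
  have int: "integrable lborel (bil_integrand \<sigma>' f g x)" if f: "f \<in> schwartz" and g: "g \<in> schwartz" for f g x
  proof (rule integrableI_bounded)
    show "bil_integrand \<sigma>' f g x \<in> borel_measurable lborel" using bil_integrand_measurable(2)[OF \<sigma>'m f g] by simp
    note fm = fourier_measurable[OF schwartz_basic(3)[OF f]] and gm = fourier_measurable[OF schwartz_basic(3)[OF g]]
    obtain B where B: "0 \<le> B" "\<And>\<xi>. norm (fourier f \<xi>) \<le> B" using fourier_bounded[OF f] by blast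
    define I where "I = (\<integral>\<^sup>+\<xi>. ennreal (norm (fourier f \<xi>)) \<partial>lborel)"
    \<comment> \<open>The bound is uniform in \<eta>: the translates of \<open>fourier f\<close>
      share their supremum and their integral.\<close>
    obtain L where L: "\<And>\<eta>. (\<integral>\<^sup>+\<zeta>. ennreal (norm (m x \<zeta>)) * ennreal (norm (fourier f (\<zeta> + t *\<^sub>R \<eta>))) \<partial>lborel) \<le> ennreal (L * B) + ennreal A * I"
    proof (rule nn_integral_symbol_mult[OF mm mb s(1) s' A, of x])
      fix L assume L: "\<And>G B. G \<in> borel_measurable borel \<Longrightarrow> (\<And>x. norm (G x :: complex) \<le> B) \<Longrightarrow>
        (\<integral>\<^sup>+\<zeta>. ennreal (norm (m x \<zeta>)) * ennreal (norm (G \<zeta>)) \<partial>lborel) \<le> ennreal (L * B) + ennreal A * (\<integral>\<^sup>+\<zeta>. ennreal (norm (G \<zeta>)) \<partial>lborel)"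
      have "(\<integral>\<^sup>+\<zeta>. ennreal (norm (m x \<zeta>)) * ennreal (norm (fourier f (\<zeta> + t *\<^sub>R \<eta>))) \<partial>lborel) \<le> ennreal (L * B) + ennreal A * I" for \<eta>
      proof -
        have "(\<integral>\<^sup>+\<zeta>. ennreal (norm (fourier f (\<zeta> + t *\<^sub>R \<eta>))) \<partial>lborel) = I"
          using nn_integral_lborel_shift[of "\<lambda>\<xi>. ennreal (norm (fourier f \<xi>))" "t *\<^sub>R \<eta>"] fm by (simp add: I_def add.commute)
        moreover have "(\<lambda>\<zeta>. fourier f (\<zeta> + t *\<^sub>R \<eta>)) \<in> borel_measurable borel" using fm by measurable
        ultimately show ?thesis using L[of "\<lambda>\<zeta>. fourier f (\<zeta> + t *\<^sub>R \<eta>)" B] B(2) by simp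
      qed
      then show thesis by (rule that)
    qed
    have "(\<integral>\<^sup>+z. ennreal (norm (bil_integrand \<sigma>' f g x z)) \<partial>lborel) = (\<integral>\<^sup>+\<eta>. \<integral>\<^sup>+\<zeta>. ennreal (norm (bil_integrand \<sigma>' f g x (\<zeta> + t *\<^sub>R \<eta>, \<eta>))) \<partial>lborel \<partial>lborel)"
      using bil_integrand_measurable(2)[OF \<sigma>'m f g, of x] by (intro nn_integral_shear) measurable
    also have "\<dots> = (\<integral>\<^sup>+\<eta>. (\<integral>\<^sup>+\<zeta>. ennreal (norm (m x \<zeta>)) * ennreal (norm (fourier f (\<zeta> + t *\<^sub>R \<eta>))) \<partial>lborel) * ennreal (norm (fourier g \<eta>)) \<partial>lborel)"
    proof (rule nn_integral_cong)
      fix \<eta>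
      have "(\<lambda>\<zeta>. fourier f (\<zeta> + t *\<^sub>R \<eta>)) \<in> borel_measurable borel" using fm by measurable
      then have "(\<lambda>\<zeta>. ennreal (norm (m x \<zeta>)) * ennreal (norm (fourier f (\<zeta> + t *\<^sub>R \<eta>)))) \<in> borel_measurable lborel"
        using mm[of x] by measurable
      from nn_integral_multc[OF this, of "ennreal (norm (fourier g \<eta>))"]
      show "(\<integral>\<^sup>+\<zeta>. ennreal (norm (bil_integrand \<sigma>' f g x (\<zeta> + t *\<^sub>R \<eta>, \<eta>))) \<partial>lborel) =
        (\<integral>\<^sup>+\<zeta>. ennreal (norm (m x \<zeta>)) * ennreal (norm (fourier f (\<zeta> + t *\<^sub>R \<eta>))) \<partial>lborel) * ennreal (norm (fourier g \<eta>))"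
        by (simp add: bil_integrand_def \<sigma>'_eq norm_mult ennreal_mult)
    qed
    also have "\<dots> \<le> (\<integral>\<^sup>+\<eta>. (ennreal (L * B) + ennreal A * I) * ennreal (norm (fourier g \<eta>)) \<partial>lborel)"
      by (intro nn_integral_mono mult_right_mono L) simp
    also have "\<dots> = (ennreal (L * B) + ennreal A * I) * (\<integral>\<^sup>+\<eta>. ennreal (norm (fourier g \<eta>)) \<partial>lborel)"
      using gm by (intro nn_integral_cmult) measurable
    also have "\<dots> < \<infinity>"
      using fourier_integrable[OF f] fourier_integrable[OF g] by (simp add: integrable_iff_bounded I_def ennreal_mult_less_top)
    finally show "(\<integral>\<^sup>+z. ennreal (norm (bil_integrand \<sigma>' f g x z)) \<partial>lborel) < \<infinity>" .
  qed
  obtain C where C: "0 \<le> C" "\<forall>(m::(real^'n) \<Rightarrow> complex) \<psi>. m \<in> borel_measurable borel \<longrightarrow>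
    (\<forall>b\<in>Basis. dir_symbol DIM(real^'n) b m (- s) A) \<longrightarrow> integrable lborel \<psi> \<longrightarrow>
    integrable lborel (\<lambda>\<zeta>. m \<zeta> * (\<integral>y. \<psi> y * cis (y \<bullet> \<zeta>) \<partial>lborel)) \<longrightarrow>
    ennreal (norm (\<integral>\<zeta>. m \<zeta> * (\<integral>y. \<psi> y * cis (y \<bullet> \<zeta>) \<partial>lborel) \<partial>lborel))
      \<le> ennreal C * (\<integral>\<^sup>+y. ennreal (norm y powr (s - real DIM(real^'n))) * ennreal (norm (\<psi> y)) \<partial>lborel)"
    using multiplier_pairing_bound[OF s(1) s' A] by (elim exE conjE)
  have pointwise: "ennreal (norm (bil_op \<sigma> f g x)) \<le> ennreal (C / norm c) * bop (riesz (s / n)) (\<lambda>y. y) (\<lambda>y. (- t) *\<^sub>R y) (\<lambda>x. norm (f x)) (\<lambda>x. norm (g x)) x"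
    if f: "f \<in> schwartz" and g: "g \<in> schwartz" for f g x
  proof -
    define \<psi> where "\<psi> y = f (x - y) * g (x + t *\<^sub>R y)" for y
    have \<psi>: "integrable lborel \<psi>" unfolding \<psi>_def[abs_def] by (rule fourier_line_integral(1)[OF f g])
    have \<Psi>: "m x \<zeta> * (\<integral>y. \<psi> y * cis (y \<bullet> \<zeta>) \<partial>lborel) = c * (\<integral>\<eta>. bil_integrand \<sigma>' f g x (\<zeta> + t *\<^sub>R \<eta>, \<eta>) \<partial>lborel)" for \<zeta>
    proof -
      have "(\<integral>\<eta>. bil_integrand \<sigma>' f g x (\<zeta> + t *\<^sub>R \<eta>, \<eta>) \<partial>lborel)
        = (\<integral>\<eta>. m x \<zeta> * (cis (x \<bullet> (\<zeta> + t *\<^sub>R \<eta> + \<eta>)) * fourier f (\<zeta> + t *\<^sub>R \<eta>) * fourier g \<eta>) \<partial>lborel)"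
        by (intro Bochner_Integration.integral_cong refl) (simp add: bil_integrand_def \<sigma>'_eq mult_ac)
      then show ?thesis unfolding \<psi>_def fourier_line_integral(2)[OF f g] integral_mult_right_zero c_def by (simp only: mult_ac)
    qed
    have int': "integrable lborel (\<lambda>\<zeta>. m x \<zeta> * (\<integral>y. \<psi> y * cis (y \<bullet> \<zeta>) \<partial>lborel))"
      unfolding \<Psi> by (intro integrable_mult_right integral_shear(1) int f g)
    have "c * bil_op \<sigma> f g x = (\<integral>\<zeta>. m x \<zeta> * (\<integral>y. \<psi> y * cis (y \<bullet> \<zeta>) \<partial>lborel) \<partial>lborel)"
      unfolding \<Psi> bil_op_restrict(2)[OF cont\<sigma> op ae f g] \<sigma>'_def[symmetric] integral_mult_right_zero
        integral_shear(2)[OF int[OF f g], of x t] ..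
    then have "ennreal (norm (c * bil_op \<sigma> f g x)) \<le> ennreal C * (\<integral>\<^sup>+y. ennreal (norm y powr (s - real DIM(real^'n))) * ennreal (norm (\<psi> y)) \<partial>lborel)"
      using C(2)[rule_format, OF mm msym \<psi> int'] by (simp only:)
    also have "(\<integral>\<^sup>+y. ennreal (norm y powr (s - real DIM(real^'n))) * ennreal (norm (\<psi> y)) \<partial>lborel) = bop (riesz (s / n)) (\<lambda>y. y) (\<lambda>y. (- t) *\<^sub>R y) (\<lambda>x. norm (f x)) (\<lambda>x. norm (g x)) x"
    proof -
      have "real DIM(real^'n) * (s / n - 1) = s - real DIM(real^'n)" using n by (simp add: n_def field_simps)
      then show ?thesis unfolding bop_def riesz_def \<psi>_def norm_mult by simp
    qed
    finally have le: "ennreal (norm (c * bil_op \<sigma> f g x)) \<le> ennreal C * bop (riesz (s / n)) (\<lambda>y. y) (\<lambda>y. (- t) *\<^sub>R y) (\<lambda>x. norm (f x)) (\<lambda>x. norm (g x)) x" .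
    have cc: "0 < norm c" using c by simp
    have "ennreal (norm (bil_op \<sigma> f g x)) = ennreal (1 / norm c) * ennreal (norm (c * bil_op \<sigma> f g x))"
      using cc by (subst ennreal_mult[symmetric]) (auto simp: norm_mult)
    also have "\<dots> \<le> ennreal (1 / norm c) * (ennreal C * bop (riesz (s / n)) (\<lambda>y. y) (\<lambda>y. (- t) *\<^sub>R y) (\<lambda>x. norm (f x)) (\<lambda>x. norm (g x)) x)"
      by (rule mult_left_mono[OF le]) simp
    also have "\<dots> = ennreal (C / norm c) * bop (riesz (s / n)) (\<lambda>y. y) (\<lambda>y. (- t) *\<^sub>R y) (\<lambda>x. norm (f x)) (\<lambda>x. norm (g x)) x"
      using C(1) cc by (simp add: mult.assoc[symmetric] ennreal_mult[symmetric])
    finally show ?thesis .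
  qed
  have ab: "0 < 1 / p1" "1 / p1 < 1" "0 < 1 / p2" "1 / p2 < 1" using p by auto
  have "0 < 1 / q" using q by simp
  then have \<tau>: "0 < s / n" "s / n < 1" "s / n < 1 / p1 + 1 / p2" using s n scale by (auto simp: n_def)
  \<comment> \<open>The fractional integral is used with \<open>c = - t\<close>, for which
    \<open>c \<noteq> 1\<close> reads \<open>t \<noteq> - 1\<close>.\<close>
  have ct: "- t \<noteq> 0" "- t \<noteq> 1" using t by auto
  show ?thesis
  proof (rule bil_boundedI)
    show "integrable lebesgue (bil_integrand \<sigma> f g x)" if f: "f \<in> schwartz" and g: "g \<in> schwartz" for f g x
      by (rule bil_op_restrict(1)[OF cont\<sigma> op ae f g]) (fold \<sigma>'_def, rule int[OF f g])
    show "bil_op \<sigma> f g \<in> borel_measurable borel" if f: "f \<in> schwartz" and g: "g \<in> schwartz" for f g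
      by (rule bil_op_restrict(3)[OF cont\<sigma> op ae f g])
    show "ennreal (norm (bil_op \<sigma> f g x)) \<le> ennreal (C / norm c) * bop (riesz (s / n)) (\<lambda>y. y) (\<lambda>y. (- t) *\<^sub>R y) (\<lambda>x. norm (f x)) (\<lambda>x. norm (g x)) x"
      if "f \<in> schwartz" "g \<in> schwartz" for f g x by (rule pointwise[OF that])
    show "bop_bounded (riesz (s / n)) (\<lambda>y :: real^'n. y) (\<lambda>y. (- t) *\<^sub>R y) (1 / p1) (1 / p2) (1 / p1 + 1 / p2 - s / n)"
      by (rule bilinear_fractional_integral[OF ab \<tau> ct])
    show "riesz (s / n) \<in> borel_measurable (borel :: (real^'n) measure)" by (rule riesz_measurable)
    show "(\<lambda>y :: real^'n. y) \<in> borel_measurable borel" "(\<lambda>y :: real^'n. (- t) *\<^sub>R y) \<in> borel_measurable borel"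
      by (intro borel_measurable_continuous_onI continuous_intros)+
    show "0 < 1 / p1 + 1 / p2 - s / n" "1 / p1 + 1 / p2 - s / n = 1 / q" using \<tau> scale by (auto simp: n_def)
    show "0 \<le> riesz (s / n) z" for z :: "real^'n" by (rule riesz_nonneg)
  qed (use C(1) p in auto)
qed

section \<open>The symbol classes\<close>

text \<open>For exponents at most 0 a weight larger than |\<zeta>| gives a stronger estimate, so
  inhomogeneous symbols satisfy the homogeneous bounds. The absolute value allows constants of
  either sign.\<close>

lemma weight_powr_mono:
  assumes "\<zeta> \<noteq> (0 :: 'b::real_normed_vector)" "norm \<zeta> \<le> w" "e \<le> 0"
  shows "C * w powr e \<le> \<bar>C\<bar> * norm \<zeta> powr e"
proof -
  have "w powr e \<le> norm \<zeta> powr e" using assms by (intro powr_mono2') auto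
  then have "\<bar>C\<bar> * w powr e \<le> \<bar>C\<bar> * norm \<zeta> powr e" by (intro mult_left_mono) auto
  moreover have "C * w powr e \<le> \<bar>C\<bar> * w powr e" by (intro mult_right_mono) auto
  ultimately show ?thesis by linarith
qed

lemma lin_symbols_uniform:
  fixes \<sigma> :: "(real^'n) \<times> (real^'n) \<Rightarrow> complex"
  assumes \<sigma>: "\<sigma> \<in> lin_symbols w (- s) \<delta>" and s: "0 < s" and w: "\<And>\<zeta>. norm \<zeta> \<le> w \<zeta>"
  shows "continuous_on (UNIV \<times> - {0}) \<sigma>"
    and "\<exists>A\<ge>0. \<forall>x. \<forall>b\<in>Basis. dir_symbol N b (\<lambda>\<zeta>. \<sigma> (x, \<zeta>)) (- s) A"
proof -
  define S where "S = {(x :: real^'n, \<xi> :: real^'n). w \<xi> \<noteq> 0}"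
  have sm: "smooth_on S \<sigma>" using \<sigma> by (simp add: lin_symbols_def S_def)
  have w0: "w \<zeta> \<noteq> 0" if "\<zeta> \<noteq> 0" for \<zeta> using w[of \<zeta>] that by (metis norm_le_zero_iff)
  have S: "(x, \<zeta>) \<in> S" if "\<zeta> \<noteq> 0" for x \<zeta> using w0[OF that] by (simp add: S_def)
  have "continuous_on S \<sigma>" using smooth_on_dir_deriv(1)[OF sm SOME_Basis, of 0] by simp
  then show "continuous_on (UNIV \<times> - {0}) \<sigma>" by (rule continuous_on_subset) (auto intro: S)
  show "\<exists>A\<ge>0. \<forall>x. \<forall>b\<in>Basis. dir_symbol N b (\<lambda>\<zeta>. \<sigma> (x, \<zeta>)) (- s) A"
  proof (rule uniform_dir_symbol[OF sm S])
    fix b :: "real^'n" and k assume "b \<in> Basis"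
    then obtain j where b: "b = axis j 1" by (auto simp: Basis_vec_def)
    have "\<forall>\<alpha> \<beta> :: 'n \<Rightarrow> nat. \<exists>C. \<forall>x \<xi>. w \<xi> \<noteq> 0 \<longrightarrow>
      norm (mi_deriv (\<lambda>i. (axis i 1, 0)) \<alpha> (mi_deriv (\<lambda>i. (0, axis i 1)) \<beta> \<sigma>) (x, \<xi>))
        \<le> C * w \<xi> powr (- s - real (mi_size \<beta>) + \<delta> * real (mi_size \<alpha>))"
      using \<sigma> by (simp add: lin_symbols_def)
    from this[THEN spec, THEN spec, of "\<lambda>_. 0" "\<lambda>i. if i = j then k else 0"]
    obtain C where C: "\<And>x \<xi>. w \<xi> \<noteq> 0 \<Longrightarrow> norm ((dir_deriv (0, b) ^^ k) \<sigma> (x, \<xi>)) \<le> C * w \<xi> powr (- s - real k)"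
      unfolding mi_deriv_zero mi_deriv_single mi_size_zero mi_size_single b by auto
    have "norm ((dir_deriv (0, b) ^^ k) \<sigma> (x, \<zeta>)) \<le> \<bar>C\<bar> * norm \<zeta> powr (- s - real k)" if "\<zeta> \<noteq> 0" for x \<zeta>
      using C[OF w0[OF that], of x] weight_powr_mono[OF that w, of "- s - real k" C] s by simp
    then show "\<exists>C. \<forall>x \<zeta>. \<zeta> \<noteq> 0 \<longrightarrow> norm ((dir_deriv (0, b) ^^ k) \<sigma> (x, \<zeta>)) \<le> C * norm \<zeta> powr (- s - real k)"
      by blast
  qed
qed

text \<open>The same reduction on the product space; each of its basis vectors lies in one of the
  two frequency blocks, so a pure derivative involves \<beta> or \<gamma> but not both.\<close>

lemma bil_symbols_uniform:
  fixes \<sigma> :: "(real^'n) \<times> (real^'n) \<times> (real^'n) \<Rightarrow> complex"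
  assumes \<sigma>: "\<sigma> \<in> bil_symbols w (- s) \<delta>" and s: "0 < s" and w: "\<And>\<xi> \<eta>. norm (\<xi>, \<eta>) \<le> w \<xi> \<eta>"
  shows "continuous_on (UNIV \<times> - {0}) \<sigma>"
    and "\<exists>A\<ge>0. \<forall>x. \<forall>b\<in>Basis. dir_symbol N b (\<lambda>\<zeta>. \<sigma> (x, \<zeta>)) (- s) A"
proof -
  define S where "S = {(x :: real^'n, \<xi> :: real^'n, \<eta> :: real^'n). w \<xi> \<eta> \<noteq> 0}"
  have sm: "smooth_on S \<sigma>" using \<sigma> by (simp add: bil_symbols_def S_def)
  have w0: "w (fst \<zeta>) (snd \<zeta>) \<noteq> 0" if "\<zeta> \<noteq> 0" for \<zeta>
    using w[of "fst \<zeta>" "snd \<zeta>"] that by (metis norm_le_zero_iff prod.collapse)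
  have S: "(x, \<zeta>) \<in> S" if "\<zeta> \<noteq> 0" for x \<zeta> using w0[OF that] by (simp add: S_def case_prod_beta)
  have "continuous_on S \<sigma>" using smooth_on_dir_deriv(1)[OF sm SOME_Basis, of 0] by simp
  then show "continuous_on (UNIV \<times> - {0}) \<sigma>" by (rule continuous_on_subset) (auto intro!: S)
  show "\<exists>A\<ge>0. \<forall>x. \<forall>b\<in>Basis. dir_symbol N b (\<lambda>\<zeta>. \<sigma> (x, \<zeta>)) (- s) A"
  proof (rule uniform_dir_symbol[OF sm S])
    fix b :: "(real^'n) \<times> (real^'n)" and k assume "b \<in> Basis"
    then obtain j where b: "b = (axis j 1, 0) \<or> b = (0, axis j 1)" by (auto simp: Basis_prod_def Basis_vec_def)
    have est: "\<forall>\<alpha> \<beta> \<gamma> :: 'n \<Rightarrow> nat. \<exists>C. \<forall>x \<xi> \<eta>. w \<xi> \<eta> \<noteq> 0 \<longrightarrow>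
      norm (mi_deriv (\<lambda>i. (axis i 1, 0, 0)) \<alpha>
             (mi_deriv (\<lambda>i. (0, axis i 1, 0)) \<beta>
               (mi_deriv (\<lambda>i. (0, 0, axis i 1)) \<gamma> \<sigma>)) (x, \<xi>, \<eta>))
        \<le> C * w \<xi> \<eta> powr (- s - real (mi_size \<beta> + mi_size \<gamma>) + \<delta> * real (mi_size \<alpha>))"
      using \<sigma> by (simp add: bil_symbols_def)
    have "\<exists>C. \<forall>x \<xi> \<eta>. w \<xi> \<eta> \<noteq> 0 \<longrightarrow> norm ((dir_deriv (0, b) ^^ k) \<sigma> (x, \<xi>, \<eta>)) \<le> C * w \<xi> \<eta> powr (- s - real k)"
      using b
    proof
      assume b: "b = (axis j 1, 0)"
      from est[THEN spec, THEN spec, THEN spec, of "\<lambda>_. 0" "\<lambda>i. if i = j then k else 0" "\<lambda>_. 0"]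
      show ?thesis unfolding mi_deriv_zero mi_deriv_single mi_size_zero mi_size_single b by simp
    next
      assume b: "b = (0, axis j 1)"
      from est[THEN spec, THEN spec, THEN spec, of "\<lambda>_. 0" "\<lambda>_. 0" "\<lambda>i. if i = j then k else 0"]
      show ?thesis unfolding mi_deriv_zero mi_deriv_single mi_size_zero mi_size_single b by simp
    qed
    then obtain C where C: "\<And>x \<xi> \<eta>. w \<xi> \<eta> \<noteq> 0 \<Longrightarrow> norm ((dir_deriv (0, b) ^^ k) \<sigma> (x, \<xi>, \<eta>)) \<le> C * w \<xi> \<eta> powr (- s - real k)"
      by blast
    have "norm ((dir_deriv (0, b) ^^ k) \<sigma> (x, \<zeta>)) \<le> \<bar>C\<bar> * norm \<zeta> powr (- s - real k)" if "\<zeta> \<noteq> 0" for x \<zeta>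
      using C[OF w0[OF that], of x] weight_powr_mono[OF that, of "w (fst \<zeta>) (snd \<zeta>)" "- s - real k" C] w[of "fst \<zeta>" "snd \<zeta>"] s by simp
    then show "\<exists>C. \<forall>x \<zeta>. \<zeta> \<noteq> 0 \<longrightarrow> norm ((dir_deriv (0, b) ^^ k) \<sigma> (x, \<zeta>)) \<le> C * norm \<zeta> powr (- s - real k)"
      by blast
  qed
qed

text \<open>sin \<theta> + cos \<theta> is a multiple of sin (\<theta> + \<pi>/4), and \<theta> +
  \<pi>/4 stays strictly between 0 and 2\<pi>, where \<pi> is the only zero of the sine.\<close>

lemma tan_ne_minus_one:
  assumes "0 < \<theta>" "\<theta> < pi" "\<theta> \<noteq> 3 * pi / 4"
  shows "tan \<theta> \<noteq> - 1"
proof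
  assume "tan \<theta> = - 1"
  then have "cos \<theta> \<noteq> 0" by (auto simp: tan_def)
  with \<open>tan \<theta> = - 1\<close> have "sin \<theta> = - cos \<theta>" by (simp add: tan_def divide_eq_eq)
  then have "sin (\<theta> + pi / 4) = 0" by (simp add: sin_add sin_45 cos_45)
  then obtain i :: int where i: "\<theta> + pi / 4 = of_int i * pi" unfolding sin_zero_iff_int2 by blast
  have "0 < of_int i * pi" "of_int i * pi < 2 * pi" using i assms pi_gt_zero by linarith+
  then have "0 < real_of_int i" "real_of_int i < 2" by (simp_all add: zero_less_mult_iff)
  then have "i = 1" by linarith
  then show False using i assms(3) by simp
qed

theorem theorem2:
  fixes p\<^sub>1 p\<^sub>2 q s :: real
  assumes "1 < p\<^sub>1" and "1 < p\<^sub>2" and "0 < q" and "0 < s"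
    and "1 / q = 1 / p\<^sub>1 + 1 / p\<^sub>2 - s / real CARD('n::finite)"
  shows "(\<forall>\<delta> (\<sigma> :: (real^'n) \<times> (real^'n) \<times> (real^'n) \<Rightarrow> complex).
            s < 2 * real CARD('n) \<and> 0 \<le> \<delta> \<and> \<delta> < 1 \<and>
            \<sigma> \<in> BS_class (- s) \<delta> \<union> BS_hom_class (- s) \<delta>
            \<longrightarrow> bil_bounded \<sigma> p\<^sub>1 p\<^sub>2 q)
       \<and> (\<forall>\<theta> \<delta> (\<sigma> :: (real^'n) \<times> (real^'n) \<times> (real^'n) \<Rightarrow> complex).
            s < real CARD('n) \<and> 0 < \<theta> \<and> \<theta> < pi \<and> \<theta> \<noteq> pi / 2 \<and> \<theta> \<noteq> 3 * pi / 4 \<and>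
            0 \<le> \<delta> \<and> \<delta> < 1 \<and>
            ((\<sigma> \<in> BS_theta_class \<theta> (- s) \<delta> \<and>
               (\<exists>\<sigma>\<^sub>0 \<in> S_class (- s) \<delta>. \<forall>x \<xi> \<eta>.
                  \<sigma> (x, \<xi>, \<eta>) = \<sigma>\<^sub>0 (x, \<xi> - tan \<theta> *\<^sub>R \<eta>))) \<or>
             (\<sigma> \<in> BS_theta_hom_class \<theta> (- s) \<delta> \<and>
               (\<exists>\<sigma>\<^sub>0 \<in> S_hom_class (- s) \<delta>. \<forall>x \<xi> \<eta>. \<xi> - tan \<theta> *\<^sub>R \<eta> \<noteq> 0 \<longrightarrow>
                  \<sigma> (x, \<xi>, \<eta>) = \<sigma>\<^sub>0 (x, \<xi> - tan \<theta> *\<^sub>R \<eta>))))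
            \<longrightarrow> bil_bounded \<sigma> p\<^sub>1 p\<^sub>2 q)"
proof (intro conjI allI impI; elim conjE)
  fix \<delta> and \<sigma> :: "(real^'n) \<times> (real^'n) \<times> (real^'n) \<Rightarrow> complex"
  assume s: "s < 2 * real CARD('n)" and "\<sigma> \<in> BS_class (- s) \<delta> \<union> BS_hom_class (- s) \<delta>"
  \<comment> \<open>\<open>w\<close> is either of the two weights; from here on only its lower bound
    is used.\<close>
  then obtain w where \<sigma>: "\<sigma> \<in> bil_symbols w (- s) \<delta>" and w: "\<And>\<xi> \<eta>. norm \<xi> + norm \<eta> \<le> w \<xi> \<eta>"
    unfolding BS_class_def BS_hom_class_def by auto
  have w': "norm (\<xi>, \<eta>) \<le> w \<xi> \<eta>" for \<xi> \<eta> using norm_Pair_le[of \<xi> \<eta>] w[of \<xi> \<eta>] by linarith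
  note sym = bil_symbols_uniform[OF \<sigma> assms(4) w']
  obtain A where "0 \<le> A" "\<And>x b. b \<in> Basis \<Longrightarrow> dir_symbol DIM((real^'n) \<times> (real^'n)) b (\<lambda>\<zeta>. \<sigma> (x, \<zeta>)) (- s) A"
    using sym(2) by blast
  with assms s sym(1) show "bil_bounded \<sigma> p\<^sub>1 p\<^sub>2 q" by (intro bil_bounded_isotropic)
next
  fix \<theta> \<delta> and \<sigma> :: "(real^'n) \<times> (real^'n) \<times> (real^'n) \<Rightarrow> complex"
  assume s: "s < real CARD('n)" and \<theta>: "0 < \<theta>" "\<theta> < pi" "\<theta> \<noteq> pi / 2" "\<theta> \<noteq> 3 * pi / 4"
    and "(\<sigma> \<in> BS_theta_class \<theta> (- s) \<delta> \<and>
               (\<exists>\<sigma>\<^sub>0 \<in> S_class (- s) \<delta>. \<forall>x \<xi> \<eta>.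
                  \<sigma> (x, \<xi>, \<eta>) = \<sigma>\<^sub>0 (x, \<xi> - tan \<theta> *\<^sub>R \<eta>))) \<or>
             (\<sigma> \<in> BS_theta_hom_class \<theta> (- s) \<delta> \<and>
               (\<exists>\<sigma>\<^sub>0 \<in> S_hom_class (- s) \<delta>. \<forall>x \<xi> \<eta>. \<xi> - tan \<theta> *\<^sub>R \<eta> \<noteq> 0 \<longrightarrow>
                  \<sigma> (x, \<xi>, \<eta>) = \<sigma>\<^sub>0 (x, \<xi> - tan \<theta> *\<^sub>R \<eta>)))"
  \<comment> \<open>In both alternatives the representation is needed off the singular plane
    only.\<close>
  then obtain \<sigma>\<^sub>0 where \<sigma>\<^sub>0: "\<sigma>\<^sub>0 \<in> S_class (- s) \<delta> \<union> S_hom_class (- s) \<delta>"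
    and eq: "\<And>x \<xi> \<eta>. \<xi> - tan \<theta> *\<^sub>R \<eta> \<noteq> 0 \<Longrightarrow> \<sigma> (x, \<xi>, \<eta>) = \<sigma>\<^sub>0 (x, \<xi> - tan \<theta> *\<^sub>R \<eta>)" by blast
  then obtain w where \<sigma>\<^sub>0: "\<sigma>\<^sub>0 \<in> lin_symbols w (- s) \<delta>" and w: "\<And>\<zeta>. norm \<zeta> \<le> w \<zeta>"
    unfolding S_class_def S_hom_class_def by auto
  note sym = lin_symbols_uniform[OF \<sigma>\<^sub>0 assms(4) w]
  obtain A where A: "0 \<le> A" "\<And>x b. b \<in> Basis \<Longrightarrow> dir_symbol DIM(real^'n) b (\<lambda>\<zeta>. \<sigma>\<^sub>0 (x, \<zeta>)) (- s) A"
    using sym(2) by blast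
  \<comment> \<open>The tangent is positive below \<pi>/2, and beyond it sine and cosine are both
    nonzero; at \<pi>/2 itself the quotient would be 0 by the convention on division.\<close>
  have "tan \<theta> \<noteq> 0"
  proof (cases "\<theta> < pi / 2")
    case True
    then show ?thesis using tan_gt_zero[of \<theta>] \<theta> by simp
  next
    case False
    have "0 < sin \<theta>" using \<theta> by (simp add: sin_gt_zero)
    moreover have "cos \<theta> \<noteq> 0" using False \<theta> cos_monotone_0_pi[of "pi / 2" \<theta>] by simp
    ultimately show ?thesis by (simp add: tan_def)
  qed
  moreover have "tan \<theta> \<noteq> - 1" by (rule tan_ne_minus_one) (use \<theta> in auto)
  ultimately show "bil_bounded \<sigma> p\<^sub>1 p\<^sub>2 q"
    by (rule bil_bounded_directional[OF assms(1-4) s assms(5) _ _ sym(1) eq A])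
qed

end
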